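(* Let $p$ be an odd prime, let $G$ be a finite group, and let $\mathcal{B}=\bigoplus_{g\in G}\mathcal{B}_g$ be a (faithful) $G$-crossed fusion category over $\Bbbk$ such that $\mathcal{B}_e$ is a non-degenerate pointed braided fusion category whose group of invertible objects $\operatorname{Inv}(\mathcal{B}_e)$ is an elementary abelian $p$-group. Then $G$ is a reflection group in $\operatorname{Pic}(\mathcal{B}_e)$ (that is, the homomorphism $G\to \operatorname{Pic}(\mathcal{B}_e)= O(A,Q)$, $g\mapsto[\mathcal{B}_g]$, is injective and its image is generated by reflections) if and only if $\mathcal{B}$ is a reflection fusion category.
   Context: $\Bbbk$ is an algebraically closed field of characteristic zero. A fusion category is a $\Bbbk$-linear semisimple rigid tensor category with finitely many simple objects up to isomorphism, finite-dimensional Hom spaces and simple unit. FPdim denotes Frobenius-Perron dimension; $\operatorname{Inv}(\mathcal{C})$ is the group of isomorphism classes of invertible objects; $\mathcal{C}$ is pointed if every simple object is invertible. A braided fusion category is non-degenerate if the only simple object $X$ with $c_{Y,X}c_{X,Y}=\mathrm{id}$ for all $Y$ is the unit. A (faithful) $G$-crossed fusion category is a fusion category $\mathcal{C}$ with: a monoidal action $g\mapsto g_*$ of $G$ on $\mathcal{C}$ by tensor autoequivalences; a grading $\mathcal{C}=\bigoplus_{g\in G}\mathcal{C}_g$ with $\mathcal{C}_g\otimes\mathcal{C}_h\subseteq\mathcal{C}_{gh}$ and all $\mathcal{C}_g\ne 0$; natural isomorphisms ($G$-braiding) $c_{X,Y}:X\otimes Y\to g_*(Y)\otimes X$ for $X\in\mathcal{C}_g$,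 $Y\in\mathcal{C}$; such that $g_*(\mathcal{C}_h)\subseteq\mathcal{C}_{ghg^{-1}}$, $c$ is compatible with the action ($g_*(c_{X,Z})$ corresponds to $c_{g_*X,g_*Z}$ under the canonical isomorphisms), and $c$ satisfies the two hexagon-type axioms expressing $c_{X,Y\otimes Z}$ through $c_{X,Y},c_{X,Z}$ and $c_{X\otimes Y,Z}$ through $c_{Y,Z}$, $c_{X,h_*(Z)}$ ($Y\in\mathcal C_h$), modulo canonical isomorphisms of the action. In particular $\mathcal{C}_e$ is braided. $\operatorname{Pic}(\mathcal{D})$, for a braided fusion category $\mathcal{D}$, is the group of equivalence classes of invertible $\mathcal{D}$-module categories under $\boxtimes_{\mathcal{D}}$; each $\mathcal{B}_g$ is an invertible $\mathcal{B}_e$-module category. A quadratic space over $\mathbb{F}_p$ is a finite-dimensional vector space with a non-degenerate quadratic form $Q$, $Q(v)=B(v,v)$ with $B$ symmetric bilinear. Fixing a primitive $p$-th root of unity $\zeta\in\Bbbk^\times$, non-degenerate pointed braided fusion categories with elementary abelian $p$-group $A$ of invertible objects correspond to quadratic spaces $(A,Q)$ over $\mathbb{F}_p$: $\mathrm{Vec}_{(A,Q)}$ is the category of $A$-graded vector spaces with trivial associator and braiding $\Bbbk_a\otimes\Bbbk_b\to\Bbbk_b\otimes\Bbbk_a$ given by $\zeta^{B(a,b)}$. One has $\operatorname{Pic}(\mathrm{Vec}_{(A,Q)})=\operatorname{Aut}^{br}_\otimes(\mathrm{Vec}_{(A,Q)})= O(A,Q)$, the group of linear isometries of $(A,Q)$.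 A reflection in $O(A,Q)$ is a map $r_a(v)=v-2\frac{B(v,a)}{B(a,a)}a$ with $B(a,a)\neq0$. Reflection fusion category: a $G$-crossed fusion category $\mathcal{B}$ such that $\mathcal{B}_e$ is a non-degenerate pointed braided fusion category with $\operatorname{Inv}(\mathcal{B}_e)$ an elementary abelian $p$-group and (1) $\operatorname{Inv}(\mathcal{B})=\operatorname{Inv}(\mathcal{B}_e)$; (2) $\mathcal{B}$ is tensor generated by $\operatorname{Inv}(\mathcal{B})$ and simple objects of Frobenius-Perron dimension $\sqrt p$. Here $\mathcal{C}$ is tensor generated by a set of objects $S$ if every simple $Y\in\mathcal{C}$ is a subobject of $X_1\otimes\cdots\otimes X_l$ for some $X_i\in S$ (repetitions allowed). *)

theory Defs
  imports
    "HOL-Algebra.Generated_Groups"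
    "HOL-Algebra.Bij"
    "HOL-Computational_Algebra.Polynomial"
    "HOL-Number_Theory.Modular_Inverse"
begin

section \<open>Linear categories\<close>

text \<open>Objects and arrows live in explicit carrier sets. Composition is written in the usual
  order, and its value on non-composable arrows is irrelevant.\<close>

record ('o, 'm, 'k) lincat =
  Obj :: "'o set"
  Arr :: "'m set"
  Dom :: "'m \<Rightarrow> 'o"
  Cod :: "'m \<Rightarrow> 'o"
  Id :: "'o \<Rightarrow> 'm"
  Comp :: "'m \<Rightarrow> 'm \<Rightarrow> 'm"  (infixl "\<cdot>\<index>" 70)
  Plus :: "'m \<Rightarrow> 'm \<Rightarrow> 'm"  (infixl "\<oplus>\<index>" 65)
  Null :: "'o \<Rightarrow> 'o \<Rightarrow> 'm"
  Scale :: "'k \<Rightarrow> 'm \<Rightarrow> 'm"  (infixr "\<star>\<index>" 75)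

definition Hom :: "('o, 'm, 'k, 'z) lincat_scheme \<Rightarrow> 'o \<Rightarrow> 'o \<Rightarrow> 'm set" where
  "Hom C x y = {f \<in> Arr C. Dom C f = x \<and> Cod C f = y}"

locale linear_category =
  fixes C :: "('o, 'm, 'k::field, 'z) lincat_scheme" (structure)
  assumes dom_cod: "f \<in> Arr C \<Longrightarrow> Dom C f \<in> Obj C \<and> Cod C f \<in> Obj C"
    and id_in_Hom: "x \<in> Obj C \<Longrightarrow> Id C x \<in> Hom C x x"
    and comp_in_Hom: "f \<in> Hom C x y \<Longrightarrow> g \<in> Hom C y z \<Longrightarrow> g \<cdot> f \<in> Hom C x z"
    and comp_assoc: "f \<in> Hom C x y \<Longrightarrow> g \<in> Hom C y z \<Longrightarrow> h \<in> Hom C z w \<Longrightarrow>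
      h \<cdot> (g \<cdot> f) = (h \<cdot> g) \<cdot> f"
    and id_comp: "f \<in> Hom C x y \<Longrightarrow> Id C y \<cdot> f = f"
    and comp_id: "f \<in> Hom C x y \<Longrightarrow> f \<cdot> Id C x = f"
    and null_in_Hom: "x \<in> Obj C \<Longrightarrow> y \<in> Obj C \<Longrightarrow> Null C x y \<in> Hom C x y"
    and plus_in_Hom: "f \<in> Hom C x y \<Longrightarrow> g \<in> Hom C x y \<Longrightarrow> f \<oplus> g \<in> Hom C x y"
    and scale_in_Hom: "f \<in> Hom C x y \<Longrightarrow> a \<star> f \<in> Hom C x y"
    and plus_assoc: "f \<in> Hom C x y \<Longrightarrow> g \<in> Hom C x y \<Longrightarrow> h \<in> Hom C x y \<Longrightarrow>
      (f \<oplus> g) \<oplus> h = f \<oplus> (g \<oplus> h)"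
    and plus_commute: "f \<in> Hom C x y \<Longrightarrow> g \<in> Hom C x y \<Longrightarrow> f \<oplus> g = g \<oplus> f"
    and plus_null: "f \<in> Hom C x y \<Longrightarrow> f \<oplus> Null C x y = f"
    and plus_inverse: "f \<in> Hom C x y \<Longrightarrow> \<exists>g \<in> Hom C x y. f \<oplus> g = Null C x y"
    and scale_one: "f \<in> Hom C x y \<Longrightarrow> 1 \<star> f = f"
    and scale_scale: "f \<in> Hom C x y \<Longrightarrow> a \<star> (b \<star> f) = (a * b) \<star> f"
    and scale_plus_left: "f \<in> Hom C x y \<Longrightarrow> (a + b) \<star> f = (a \<star> f) \<oplus> (b \<star> f)"
    and scale_plus_right: "f \<in> Hom C x y \<Longrightarrow> g \<in> Hom C x y \<Longrightarrow>
      a \<star> (f \<oplus> g) = (a \<star> f) \<oplus> (a \<star> g)"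
    and comp_plus_left: "f \<in> Hom C x y \<Longrightarrow> g \<in> Hom C y z \<Longrightarrow> h \<in> Hom C y z \<Longrightarrow>
      (g \<oplus> h) \<cdot> f = (g \<cdot> f) \<oplus> (h \<cdot> f)"
    and comp_plus_right: "f \<in> Hom C x y \<Longrightarrow> g \<in> Hom C x y \<Longrightarrow> h \<in> Hom C y z \<Longrightarrow>
      h \<cdot> (f \<oplus> g) = (h \<cdot> f) \<oplus> (h \<cdot> g)"
    and comp_scale_left: "f \<in> Hom C x y \<Longrightarrow> g \<in> Hom C y z \<Longrightarrow> (a \<star> g) \<cdot> f = a \<star> (g \<cdot> f)"
    and comp_scale_right: "f \<in> Hom C x y \<Longrightarrow> g \<in> Hom C y z \<Longrightarrow> g \<cdot> (a \<star> f) = a \<star> (g \<cdot> f)"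

definition inverse_arrows :: "('o, 'm, 'k, 'z) lincat_scheme \<Rightarrow> 'm \<Rightarrow> 'm \<Rightarrow> bool" where
  "inverse_arrows C f g \<longleftrightarrow> (\<exists>x y. f \<in> Hom C x y \<and> g \<in> Hom C y x \<and>
     g \<cdot>\<^bsub>C\<^esub> f = Id C x \<and> f \<cdot>\<^bsub>C\<^esub> g = Id C y)"

definition isom :: "('o, 'm, 'k, 'z) lincat_scheme \<Rightarrow> 'm \<Rightarrow> bool" where
  "isom C f \<longleftrightarrow> (\<exists>g. inverse_arrows C f g)"

definition inv_arr :: "('o, 'm, 'k, 'z) lincat_scheme \<Rightarrow> 'm \<Rightarrow> 'm" where
  "inv_arr C f = (THE g. inverse_arrows C f g)"

definition Iso :: "('o, 'm, 'k, 'z) lincat_scheme \<Rightarrow> 'o \<Rightarrow> 'o \<Rightarrow> 'm set" where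
  "Iso C x y = {f \<in> Hom C x y. isom C f}"

definition isomorphic :: "('o, 'm, 'k, 'z) lincat_scheme \<Rightarrow> 'o \<Rightarrow> 'o \<Rightarrow> bool" where
  "isomorphic C x y \<longleftrightarrow> Iso C x y \<noteq> {}"

definition iso_class :: "('o, 'm, 'k, 'z) lincat_scheme \<Rightarrow> 'o \<Rightarrow> 'o set" where
  "iso_class C x = {y \<in> Obj C. isomorphic C x y}"

definition monic :: "('o, 'm, 'k, 'z) lincat_scheme \<Rightarrow> 'm \<Rightarrow> bool" where
  "monic C f \<longleftrightarrow> f \<in> Arr C \<and> (\<forall>x. \<forall>g \<in> Hom C x (Dom C f). \<forall>h \<in> Hom C x (Dom C f).
     f \<cdot>\<^bsub>C\<^esub> g = f \<cdot>\<^bsub>C\<^esub> h \<longrightarrow> g = h)"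

definition epic :: "('o, 'm, 'k, 'z) lincat_scheme \<Rightarrow> 'm \<Rightarrow> bool" where
  "epic C f \<longleftrightarrow> f \<in> Arr C \<and> (\<forall>x. \<forall>g \<in> Hom C (Cod C f) x. \<forall>h \<in> Hom C (Cod C f) x.
     g \<cdot>\<^bsub>C\<^esub> f = h \<cdot>\<^bsub>C\<^esub> f \<longrightarrow> g = h)"

definition is_kernel :: "('o, 'm, 'k, 'z) lincat_scheme \<Rightarrow> 'm \<Rightarrow> 'm \<Rightarrow> bool" where
  "is_kernel C j f \<longleftrightarrow> j \<in> Arr C \<and> f \<in> Arr C \<and> Cod C j = Dom C f \<and>
     f \<cdot>\<^bsub>C\<^esub> j = Null C (Dom C j) (Cod C f) \<and>
     (\<forall>x. \<forall>h \<in> Hom C x (Dom C f). f \<cdot>\<^bsub>C\<^esub> h = Null C x (Cod C f) \<longrightarrow>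
        (\<exists>!u. u \<in> Hom C x (Dom C j) \<and> j \<cdot>\<^bsub>C\<^esub> u = h))"

definition is_cokernel :: "('o, 'm, 'k, 'z) lincat_scheme \<Rightarrow> 'm \<Rightarrow> 'm \<Rightarrow> bool" where
  "is_cokernel C q f \<longleftrightarrow> q \<in> Arr C \<and> f \<in> Arr C \<and> Dom C q = Cod C f \<and>
     q \<cdot>\<^bsub>C\<^esub> f = Null C (Dom C f) (Cod C q) \<and>
     (\<forall>x. \<forall>h \<in> Hom C (Cod C f) x. h \<cdot>\<^bsub>C\<^esub> f = Null C (Dom C f) x \<longrightarrow>
        (\<exists>!u. u \<in> Hom C (Cod C q) x \<and> u \<cdot>\<^bsub>C\<^esub> q = h))"

definition zero_object :: "('o, 'm, 'k, 'z) lincat_scheme \<Rightarrow> 'o \<Rightarrow> bool" where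
  "zero_object C z \<longleftrightarrow> z \<in> Obj C \<and>
     (\<forall>x \<in> Obj C. (\<exists>!f. f \<in> Hom C z x) \<and> (\<exists>!f. f \<in> Hom C x z))"

definition direct_sum :: "('o, 'm, 'k, 'z) lincat_scheme \<Rightarrow> 'o \<Rightarrow> 'o list \<Rightarrow> bool" where
  "direct_sum C x ys \<longleftrightarrow> x \<in> Obj C \<and> set ys \<subseteq> Obj C \<and>
     (\<exists>i p.
        (\<forall>r < length ys. i r \<in> Hom C (ys ! r) x \<and> p r \<in> Hom C x (ys ! r)) \<and>
        (\<forall>r < length ys. \<forall>s < length ys. p r \<cdot>\<^bsub>C\<^esub> i s =
           (if r = s then Id C (ys ! r) else Null C (ys ! s) (ys ! r))) \<and>
        foldr (Plus C) (map (\<lambda>r. i r \<cdot>\<^bsub>C\<^esub> p r) [0..<length ys]) (Null C x x) = Id C x)"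

definition abelian_category :: "('o, 'm, 'k::field, 'z) lincat_scheme \<Rightarrow> bool" where
  "abelian_category C \<longleftrightarrow> linear_category C \<and>
     (\<exists>z. zero_object C z) \<and>
     (\<forall>x \<in> Obj C. \<forall>y \<in> Obj C. \<exists>s. direct_sum C s [x, y]) \<and>
     (\<forall>f \<in> Arr C. (\<exists>j. is_kernel C j f) \<and> (\<exists>q. is_cokernel C q f)) \<and>
     (\<forall>f. monic C f \<longrightarrow> (\<exists>g. is_kernel C f g)) \<and>
     (\<forall>f. epic C f \<longrightarrow> (\<exists>g. is_cokernel C f g))"

definition simple_object :: "('o, 'm, 'k, 'z) lincat_scheme \<Rightarrow> 'o \<Rightarrow> bool" where
  "simple_object C x \<longleftrightarrow> x \<in> Obj C \<and> \<not> zero_object C x \<and>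
     (\<forall>y. \<forall>f \<in> Hom C y x. monic C f \<longrightarrow> zero_object C y \<or> isom C f)"

definition Irr :: "('o, 'm, 'k, 'z) lincat_scheme \<Rightarrow> 'o set set" where
  "Irr C = iso_class C ` {x. simple_object C x}"

inductive_set lspan :: "('o, 'm, 'k, 'z) lincat_scheme \<Rightarrow> 'o \<Rightarrow> 'o \<Rightarrow> 'm set \<Rightarrow> 'm set"
  for C x y S where
  null: "Null C x y \<in> lspan C x y S"
| step: "f \<in> S \<Longrightarrow> g \<in> lspan C x y S \<Longrightarrow> (a \<star>\<^bsub>C\<^esub> f) \<oplus>\<^bsub>C\<^esub> g \<in> lspan C x y S"

text \<open>The dimension of a finite-dimensional Hom space, as the least size of a spanning set.\<close>

definition hom_dim :: "('o, 'm, 'k, 'z) lincat_scheme \<Rightarrow> 'o \<Rightarrow> 'o \<Rightarrow> nat" where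
  "hom_dim C x y =
     (LEAST n. \<exists>S \<subseteq> Hom C x y. finite S \<and> card S = n \<and> lspan C x y S = Hom C x y)"

definition finite_semisimple_category :: "('o, 'm, 'k::field, 'z) lincat_scheme \<Rightarrow> bool" where
  "finite_semisimple_category C \<longleftrightarrow> abelian_category C \<and>
     (\<forall>x \<in> Obj C. \<exists>ys. (\<forall>y \<in> set ys. simple_object C y) \<and> direct_sum C x ys) \<and>
     finite (Irr C) \<and>
     (\<forall>x \<in> Obj C. \<forall>y \<in> Obj C. \<exists>S \<subseteq> Hom C x y. finite S \<and> lspan C x y S = Hom C x y)"

definition full_subcategory ::
  "('o, 'm, 'k, 'z) lincat_scheme \<Rightarrow> 'o set \<Rightarrow> ('o, 'm, 'k, 'z) lincat_scheme" where
  "full_subcategory C S =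
     C\<lparr>Obj := S, Arr := {f \<in> Arr C. Dom C f \<in> S \<and> Cod C f \<in> S}\<rparr>"

locale linear_functor =
  fixes C :: "('o, 'm, 'k::field, 'z) lincat_scheme"
    and D :: "('p, 'n, 'k, 'y) lincat_scheme"
    and Fo :: "'o \<Rightarrow> 'p" and Fa :: "'m \<Rightarrow> 'n"
  assumes functor_obj: "x \<in> Obj C \<Longrightarrow> Fo x \<in> Obj D"
    and functor_arr: "f \<in> Hom C x y \<Longrightarrow> Fa f \<in> Hom D (Fo x) (Fo y)"
    and functor_id: "x \<in> Obj C \<Longrightarrow> Fa (Id C x) = Id D (Fo x)"
    and functor_comp: "f \<in> Hom C x y \<Longrightarrow> g \<in> Hom C y z \<Longrightarrow>
      Fa (g \<cdot>\<^bsub>C\<^esub> f) = Fa g \<cdot>\<^bsub>D\<^esub> Fa f"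
    and functor_plus: "f \<in> Hom C x y \<Longrightarrow> g \<in> Hom C x y \<Longrightarrow>
      Fa (f \<oplus>\<^bsub>C\<^esub> g) = Fa f \<oplus>\<^bsub>D\<^esub> Fa g"
    and functor_scale: "f \<in> Hom C x y \<Longrightarrow> Fa (a \<star>\<^bsub>C\<^esub> f) = a \<star>\<^bsub>D\<^esub> Fa f"

definition equivalence_functor ::
  "('o, 'm, 'k, 'z) lincat_scheme \<Rightarrow> ('p, 'n, 'k, 'y) lincat_scheme \<Rightarrow>
     ('o \<Rightarrow> 'p) \<Rightarrow> ('m \<Rightarrow> 'n) \<Rightarrow> bool" where
  "equivalence_functor C D Fo Fa \<longleftrightarrow>
     (\<forall>x \<in> Obj C. \<forall>y \<in> Obj C. bij_betw Fa (Hom C x y) (Hom D (Fo x) (Fo y))) \<and>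
     (\<forall>z \<in> Obj D. \<exists>x \<in> Obj C. isomorphic D (Fo x) z)"

section \<open>Fusion categories\<close>

record ('o, 'm, 'k) moncat = "('o, 'm, 'k) lincat" +
  TensO :: "'o \<Rightarrow> 'o \<Rightarrow> 'o"  (infixr "\<odot>\<index>" 80)
  TensA :: "'m \<Rightarrow> 'm \<Rightarrow> 'm"  (infixr "\<Odot>\<index>" 80)
  Unit :: 'o
  Assoc :: "'o \<Rightarrow> 'o \<Rightarrow> 'o \<Rightarrow> 'm"
  LUnit :: "'o \<Rightarrow> 'm"
  RUnit :: "'o \<Rightarrow> 'm"

locale monoidal_linear_category = linear_category C
  for C :: "('o, 'm, 'k::field, 'z) moncat_scheme" (structure) +
  assumes unit_obj: "Unit C \<in> Obj C"
    and tens_obj: "x \<in> Obj C \<Longrightarrow> y \<in> Obj C \<Longrightarrow> x \<odot> y \<in> Obj C"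
    and tens_arr: "f \<in> Hom C x y \<Longrightarrow> g \<in> Hom C z w \<Longrightarrow> f \<Odot> g \<in> Hom C (x \<odot> z) (y \<odot> w)"
    and tens_id: "x \<in> Obj C \<Longrightarrow> y \<in> Obj C \<Longrightarrow> Id C x \<Odot> Id C y = Id C (x \<odot> y)"
    and tens_comp: "f \<in> Hom C x y \<Longrightarrow> f' \<in> Hom C y z \<Longrightarrow>
      g \<in> Hom C u v \<Longrightarrow> g' \<in> Hom C v w \<Longrightarrow>
      (f' \<cdot> f) \<Odot> (g' \<cdot> g) = (f' \<Odot> g') \<cdot> (f \<Odot> g)"
    and tens_plus_left: "f \<in> Hom C x y \<Longrightarrow> f' \<in> Hom C x y \<Longrightarrow> g \<in> Hom C z w \<Longrightarrow>
      (f \<oplus> f') \<Odot> g = (f \<Odot> g) \<oplus> (f' \<Odot> g)"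
    and tens_plus_right: "f \<in> Hom C x y \<Longrightarrow> g \<in> Hom C z w \<Longrightarrow> g' \<in> Hom C z w \<Longrightarrow>
      f \<Odot> (g \<oplus> g') = (f \<Odot> g) \<oplus> (f \<Odot> g')"
    and tens_scale_left: "f \<in> Hom C x y \<Longrightarrow> g \<in> Hom C z w \<Longrightarrow>
      (a \<star> f) \<Odot> g = a \<star> (f \<Odot> g)"
    and tens_scale_right: "f \<in> Hom C x y \<Longrightarrow> g \<in> Hom C z w \<Longrightarrow>
      f \<Odot> (a \<star> g) = a \<star> (f \<Odot> g)"
    and assoc_iso: "x \<in> Obj C \<Longrightarrow> y \<in> Obj C \<Longrightarrow> z \<in> Obj C \<Longrightarrow>
      Assoc C x y z \<in> Iso C ((x \<odot> y) \<odot> z) (x \<odot> (y \<odot> z))"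
    and lunit_iso: "x \<in> Obj C \<Longrightarrow> LUnit C x \<in> Iso C (Unit C \<odot> x) x"
    and runit_iso: "x \<in> Obj C \<Longrightarrow> RUnit C x \<in> Iso C (x \<odot> Unit C) x"
    and assoc_natural: "f \<in> Hom C x x' \<Longrightarrow> g \<in> Hom C y y' \<Longrightarrow> h \<in> Hom C z z' \<Longrightarrow>
      Assoc C x' y' z' \<cdot> ((f \<Odot> g) \<Odot> h) = (f \<Odot> (g \<Odot> h)) \<cdot> Assoc C x y z"
    and lunit_natural: "f \<in> Hom C x y \<Longrightarrow>
      LUnit C y \<cdot> (Id C (Unit C) \<Odot> f) = f \<cdot> LUnit C x"
    and runit_natural: "f \<in> Hom C x y \<Longrightarrow>
      RUnit C y \<cdot> (f \<Odot> Id C (Unit C)) = f \<cdot> RUnit C x"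
    and pentagon: "x \<in> Obj C \<Longrightarrow> y \<in> Obj C \<Longrightarrow> z \<in> Obj C \<Longrightarrow> w \<in> Obj C \<Longrightarrow>
      Assoc C x y (z \<odot> w) \<cdot> Assoc C (x \<odot> y) z w =
      (Id C x \<Odot> Assoc C y z w) \<cdot> Assoc C x (y \<odot> z) w \<cdot> (Assoc C x y z \<Odot> Id C w)"
    and triangle: "x \<in> Obj C \<Longrightarrow> y \<in> Obj C \<Longrightarrow>
      (Id C x \<Odot> LUnit C y) \<cdot> Assoc C x (Unit C) y = RUnit C x \<Odot> Id C y"

text \<open>\<open>dual_pair C y x\<close>: \<open>y\<close> is a left dual of \<open>x\<close>, equivalently \<open>x\<close> is a right dual of \<open>y\<close>.\<close>

definition dual_pair :: "('o, 'm, 'k, 'z) moncat_scheme \<Rightarrow> 'o \<Rightarrow> 'o \<Rightarrow> bool" where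
  "dual_pair C y x \<longleftrightarrow> x \<in> Obj C \<and> y \<in> Obj C \<and>
     (\<exists>ev \<in> Hom C (y \<odot>\<^bsub>C\<^esub> x) (Unit C). \<exists>coev \<in> Hom C (Unit C) (x \<odot>\<^bsub>C\<^esub> y).
        RUnit C x \<cdot>\<^bsub>C\<^esub> (Id C x \<Odot>\<^bsub>C\<^esub> ev) \<cdot>\<^bsub>C\<^esub> Assoc C x y x \<cdot>\<^bsub>C\<^esub>
          (coev \<Odot>\<^bsub>C\<^esub> Id C x) \<cdot>\<^bsub>C\<^esub> inv_arr C (LUnit C x) = Id C x \<and>
        LUnit C y \<cdot>\<^bsub>C\<^esub> (ev \<Odot>\<^bsub>C\<^esub> Id C y) \<cdot>\<^bsub>C\<^esub> inv_arr C (Assoc C y x y) \<cdot>\<^bsub>C\<^esub>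
          (Id C y \<Odot>\<^bsub>C\<^esub> coev) \<cdot>\<^bsub>C\<^esub> inv_arr C (RUnit C y) = Id C y)"

locale fusion_category = monoidal_linear_category C
  for C :: "('o, 'm, 'k::field, 'z) moncat_scheme" (structure) +
  assumes finite_semisimple: "finite_semisimple_category C"
    and rigid: "x \<in> Obj C \<Longrightarrow> (\<exists>y. dual_pair C y x) \<and> (\<exists>y. dual_pair C x y)"
    and unit_simple: "simple_object C (Unit C)"

definition invertible_object :: "('o, 'm, 'k, 'z) moncat_scheme \<Rightarrow> 'o \<Rightarrow> bool" where
  "invertible_object C x \<longleftrightarrow> x \<in> Obj C \<and>
     (\<exists>y \<in> Obj C. isomorphic C (x \<odot>\<^bsub>C\<^esub> y) (Unit C) \<and> isomorphic C (y \<odot>\<^bsub>C\<^esub> x) (Unit C))"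

definition Inv :: "('o, 'm, 'k, 'z) moncat_scheme \<Rightarrow> 'o set monoid" where
  "Inv C = \<lparr>carrier = iso_class C ` {x. invertible_object C x},
            monoid.mult = (\<lambda>a b. {z \<in> Obj C. \<exists>x \<in> a. \<exists>y \<in> b. isomorphic C (x \<odot>\<^bsub>C\<^esub> y) z}),
            one = iso_class C (Unit C)\<rparr>"

definition pointed :: "('o, 'm, 'k, 'z) moncat_scheme \<Rightarrow> bool" where
  "pointed C \<longleftrightarrow> (\<forall>x. simple_object C x \<longrightarrow> invertible_object C x)"

text \<open>The matrix of left multiplication by \<open>x\<close> on the Grothendieck ring has the entry
  \<open>dim Hom(Z, x \<otimes> Y)\<close> at the simple classes \<open>Y\<close>, \<open>Z\<close>; \<open>FPdim\<close> is its largest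
  non-negative real eigenvalue.\<close>

definition fusion_coeff :: "('o, 'm, 'k, 'z) moncat_scheme \<Rightarrow> 'o \<Rightarrow> 'o set \<Rightarrow> 'o set \<Rightarrow> nat" where
  "fusion_coeff C x Y Z = hom_dim C (SOME z. z \<in> Z) (x \<odot>\<^bsub>C\<^esub> (SOME y. y \<in> Y))"

definition FPdim :: "('o, 'm, 'k, 'z) moncat_scheme \<Rightarrow> 'o \<Rightarrow> real" where
  "FPdim C x = Max {t. t \<ge> 0 \<and> (\<exists>v :: 'o set \<Rightarrow> real. (\<exists>Y \<in> Irr C. v Y \<noteq> 0) \<and>
     (\<forall>Y \<in> Irr C. (\<Sum>Z \<in> Irr C. real (fusion_coeff C x Y Z) * v Z) = t * v Y))}"

fun tensor_list :: "('o, 'm, 'k, 'z) moncat_scheme \<Rightarrow> 'o list \<Rightarrow> 'o" where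
  "tensor_list C [] = Unit C"
| "tensor_list C [x] = x"
| "tensor_list C (x # y # ys) = x \<odot>\<^bsub>C\<^esub> tensor_list C (y # ys)"

definition tensor_generated_by :: "('o, 'm, 'k, 'z) moncat_scheme \<Rightarrow> 'o set \<Rightarrow> bool" where
  "tensor_generated_by C S \<longleftrightarrow> (\<forall>y. simple_object C y \<longrightarrow>
     (\<exists>xs. xs \<noteq> [] \<and> set xs \<subseteq> S \<and> (\<exists>f \<in> Hom C y (tensor_list C xs). monic C f)))"

section \<open>Braided fusion categories\<close>

record ('o, 'm, 'k) braidcat = "('o, 'm, 'k) moncat" +
  Braid :: "'o \<Rightarrow> 'o \<Rightarrow> 'm"

locale braided_fusion_category = fusion_category C
  for C :: "('o, 'm, 'k::field, 'z) braidcat_scheme" (structure) +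
  assumes braid_iso: "x \<in> Obj C \<Longrightarrow> y \<in> Obj C \<Longrightarrow> Braid C x y \<in> Iso C (x \<odot> y) (y \<odot> x)"
    and braid_natural: "f \<in> Hom C x x' \<Longrightarrow> g \<in> Hom C y y' \<Longrightarrow>
      Braid C x' y' \<cdot> (f \<Odot> g) = (g \<Odot> f) \<cdot> Braid C x y"
    and hexagon_right: "x \<in> Obj C \<Longrightarrow> y \<in> Obj C \<Longrightarrow> z \<in> Obj C \<Longrightarrow>
      Assoc C y z x \<cdot> Braid C x (y \<odot> z) \<cdot> Assoc C x y z =
      (Id C y \<Odot> Braid C x z) \<cdot> Assoc C y x z \<cdot> (Braid C x y \<Odot> Id C z)"
    and hexagon_left: "x \<in> Obj C \<Longrightarrow> y \<in> Obj C \<Longrightarrow> z \<in> Obj C \<Longrightarrow>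
      inv_arr C (Assoc C z x y) \<cdot> Braid C (x \<odot> y) z \<cdot> inv_arr C (Assoc C x y z) =
      (Braid C x z \<Odot> Id C y) \<cdot> inv_arr C (Assoc C x z y) \<cdot> (Id C x \<Odot> Braid C y z)"

definition nondegenerate :: "('o, 'm, 'k, 'z) braidcat_scheme \<Rightarrow> bool" where
  "nondegenerate C \<longleftrightarrow> (\<forall>x. simple_object C x \<and>
     (\<forall>y \<in> Obj C. Braid C y x \<cdot>\<^bsub>C\<^esub> Braid C x y = Id C (x \<odot>\<^bsub>C\<^esub> y)) \<longrightarrow>
     isomorphic C x (Unit C))"

section \<open>Module categories over a braided fusion category\<close>

record ('d, 'e, 'o, 'm, 'k) modcat = "('o, 'm, 'k) lincat" +
  MActO :: "'d \<Rightarrow> 'o \<Rightarrow> 'o"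
  MActA :: "'e \<Rightarrow> 'm \<Rightarrow> 'm"
  MAssoc :: "'d \<Rightarrow> 'd \<Rightarrow> 'o \<Rightarrow> 'm"
  MUnit :: "'o \<Rightarrow> 'm"

locale module_category =
  fixes D :: "('d, 'e, 'k::field, 'y) moncat_scheme"
    and M :: "('d, 'e, 'o, 'm, 'k, 'z) modcat_scheme"
  assumes finite_semisimple: "finite_semisimple_category M"
    and act_obj: "x \<in> Obj D \<Longrightarrow> m \<in> Obj M \<Longrightarrow> MActO M x m \<in> Obj M"
    and act_arr: "f \<in> Hom D x y \<Longrightarrow> s \<in> Hom M m n \<Longrightarrow>
      MActA M f s \<in> Hom M (MActO M x m) (MActO M y n)"
    and act_id: "x \<in> Obj D \<Longrightarrow> m \<in> Obj M \<Longrightarrow>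
      MActA M (Id D x) (Id M m) = Id M (MActO M x m)"
    and act_comp: "f \<in> Hom D x y \<Longrightarrow> f' \<in> Hom D y z \<Longrightarrow> s \<in> Hom M l m \<Longrightarrow> s' \<in> Hom M m n \<Longrightarrow>
      MActA M (f' \<cdot>\<^bsub>D\<^esub> f) (s' \<cdot>\<^bsub>M\<^esub> s) = MActA M f' s' \<cdot>\<^bsub>M\<^esub> MActA M f s"
    and act_plus_left: "f \<in> Hom D x y \<Longrightarrow> f' \<in> Hom D x y \<Longrightarrow> s \<in> Hom M m n \<Longrightarrow>
      MActA M (f \<oplus>\<^bsub>D\<^esub> f') s = MActA M f s \<oplus>\<^bsub>M\<^esub> MActA M f' s"
    and act_plus_right: "f \<in> Hom D x y \<Longrightarrow> s \<in> Hom M m n \<Longrightarrow> s' \<in> Hom M m n \<Longrightarrow>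
      MActA M f (s \<oplus>\<^bsub>M\<^esub> s') = MActA M f s \<oplus>\<^bsub>M\<^esub> MActA M f s'"
    and act_scale_left: "f \<in> Hom D x y \<Longrightarrow> s \<in> Hom M m n \<Longrightarrow>
      MActA M (a \<star>\<^bsub>D\<^esub> f) s = a \<star>\<^bsub>M\<^esub> MActA M f s"
    and act_scale_right: "f \<in> Hom D x y \<Longrightarrow> s \<in> Hom M m n \<Longrightarrow>
      MActA M f (a \<star>\<^bsub>M\<^esub> s) = a \<star>\<^bsub>M\<^esub> MActA M f s"
    and massoc_iso: "x \<in> Obj D \<Longrightarrow> y \<in> Obj D \<Longrightarrow> m \<in> Obj M \<Longrightarrow>
      MAssoc M x y m \<in> Iso M (MActO M (x \<odot>\<^bsub>D\<^esub> y) m) (MActO M x (MActO M y m))"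
    and munit_iso: "m \<in> Obj M \<Longrightarrow> MUnit M m \<in> Iso M (MActO M (Unit D) m) m"
    and massoc_natural: "f \<in> Hom D x x' \<Longrightarrow> g \<in> Hom D y y' \<Longrightarrow> s \<in> Hom M m n \<Longrightarrow>
      MAssoc M x' y' n \<cdot>\<^bsub>M\<^esub> MActA M (f \<Odot>\<^bsub>D\<^esub> g) s =
      MActA M f (MActA M g s) \<cdot>\<^bsub>M\<^esub> MAssoc M x y m"
    and munit_natural: "s \<in> Hom M m n \<Longrightarrow>
      MUnit M n \<cdot>\<^bsub>M\<^esub> MActA M (Id D (Unit D)) s = s \<cdot>\<^bsub>M\<^esub> MUnit M m"
    and module_pentagon: "x \<in> Obj D \<Longrightarrow> y \<in> Obj D \<Longrightarrow> z \<in> Obj D \<Longrightarrow> m \<in> Obj M \<Longrightarrow>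
      MAssoc M x y (MActO M z m) \<cdot>\<^bsub>M\<^esub> MAssoc M (x \<odot>\<^bsub>D\<^esub> y) z m =
      MActA M (Id D x) (MAssoc M y z m) \<cdot>\<^bsub>M\<^esub> MAssoc M x (y \<odot>\<^bsub>D\<^esub> z) m \<cdot>\<^bsub>M\<^esub>
        MActA M (Assoc D x y z) (Id M m)"
    and module_triangle: "x \<in> Obj D \<Longrightarrow> m \<in> Obj M \<Longrightarrow>
      MActA M (Id D x) (MUnit M m) \<cdot>\<^bsub>M\<^esub> MAssoc M x (Unit D) m =
      MActA M (RUnit D x) (Id M m)"

record ('d, 'o, 'm, 'p, 'n) modfun =
  FunO :: "'o \<Rightarrow> 'p"
  FunA :: "'m \<Rightarrow> 'n"
  FunS :: "'d \<Rightarrow> 'o \<Rightarrow> 'n"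

locale module_functor =
  fixes D :: "('d, 'e, 'k::field, 'y) moncat_scheme"
    and M :: "('d, 'e, 'o, 'm, 'k, 'z) modcat_scheme"
    and N :: "('d, 'e, 'p, 'n, 'k, 'w) modcat_scheme"
    and F :: "('d, 'o, 'm, 'p, 'n) modfun"
  assumes linear_functor: "linear_functor M N (FunO F) (FunA F)"
    and str_iso: "x \<in> Obj D \<Longrightarrow> m \<in> Obj M \<Longrightarrow>
      FunS F x m \<in> Iso N (FunO F (MActO M x m)) (MActO N x (FunO F m))"
    and str_natural: "f \<in> Hom D x y \<Longrightarrow> s \<in> Hom M m n \<Longrightarrow>
      FunS F y n \<cdot>\<^bsub>N\<^esub> FunA F (MActA M f s) = MActA N f (FunA F s) \<cdot>\<^bsub>N\<^esub> FunS F x m"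
    and str_assoc: "x \<in> Obj D \<Longrightarrow> y \<in> Obj D \<Longrightarrow> m \<in> Obj M \<Longrightarrow>
      MAssoc N x y (FunO F m) \<cdot>\<^bsub>N\<^esub> FunS F (x \<odot>\<^bsub>D\<^esub> y) m =
      MActA N (Id D x) (FunS F y m) \<cdot>\<^bsub>N\<^esub> FunS F x (MActO M y m) \<cdot>\<^bsub>N\<^esub> FunA F (MAssoc M x y m)"
    and str_unit: "m \<in> Obj M \<Longrightarrow>
      MUnit N (FunO F m) \<cdot>\<^bsub>N\<^esub> FunS F (Unit D) m = FunA F (MUnit M m)"

definition module_functors_isomorphic ::
  "('d, 'e, 'k, 'y) moncat_scheme \<Rightarrow> ('d, 'e, 'o, 'm, 'k, 'z) modcat_scheme \<Rightarrow>
   ('d, 'e, 'p, 'n, 'k, 'w) modcat_scheme \<Rightarrow>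
   ('d, 'o, 'm, 'p, 'n) modfun \<Rightarrow> ('d, 'o, 'm, 'p, 'n) modfun \<Rightarrow> bool" where
  "module_functors_isomorphic D M N F F' \<longleftrightarrow> (\<exists>\<eta>.
     (\<forall>m \<in> Obj M. \<eta> m \<in> Iso N (FunO F m) (FunO F' m)) \<and>
     (\<forall>m n. \<forall>s \<in> Hom M m n. \<eta> n \<cdot>\<^bsub>N\<^esub> FunA F s = FunA F' s \<cdot>\<^bsub>N\<^esub> \<eta> m) \<and>
     (\<forall>x \<in> Obj D. \<forall>m \<in> Obj M. FunS F' x m \<cdot>\<^bsub>N\<^esub> \<eta> (MActO M x m) =
        MActA N (Id D x) (\<eta> m) \<cdot>\<^bsub>N\<^esub> FunS F x m))"

definition module_equivalent ::
  "('d, 'e, 'k::field, 'y) moncat_scheme \<Rightarrow> ('d, 'e, 'o, 'm, 'k, 'z) modcat_scheme \<Rightarrow>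
   ('d, 'e, 'p, 'n, 'k, 'w) modcat_scheme \<Rightarrow> bool" where
  "module_equivalent D M N \<longleftrightarrow>
     (\<exists>F. module_functor D M N F \<and> equivalence_functor M N (FunO F) (FunA F))"

text \<open>The equivalence class \<open>[M]\<close> of a \<open>D\<close>-module category. For invertible \<open>M\<close> this is an element
  of \<open>Pic(D)\<close>: invertibility is invariant under equivalence, so the class is the same whether
  or not it is formed among invertible module categories only. Module categories on the same
  object and arrow types as \<open>M\<close> suffice, since \<open>[M] = [N]\<close> just means that \<open>M\<close> and \<open>N\<close> are
  equivalent. The product \<open>\<boxtimes>\<^sub>D\<close> of \<open>Pic(D)\<close> is not constructed: it enters below only
  through the group \<open>O(A,Q)\<close>, in which it is composition.\<close>

definition module_class ::
  "('d, 'e, 'k::field, 'y) moncat_scheme \<Rightarrow> ('d, 'e, 'o, 'm, 'k) modcat \<Rightarrow>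
   ('d, 'e, 'o, 'm, 'k) modcat set" where
  "module_class D M = {N. module_category D N \<and> module_equivalent D M N}"

text \<open>Acting by \<open>x \<in> D\<close> is a \<open>D\<close>-module endofunctor of \<open>M\<close> in two ways: the structure
  isomorphism \<open>x(ym) \<rightarrow> (xy)m \<rightarrow> (yx)m \<rightarrow> y(xm)\<close> uses the braiding \<open>c(x,y)\<close> for \<open>\<alpha>\<^sup>+\<close> and
  the reverse braiding \<open>c(y,x)\<^sup>-\<^sup>1\<close> for \<open>\<alpha>\<^sup>-\<close>.\<close>

definition alpha_plus ::
  "('d, 'e, 'k, 'y) braidcat_scheme \<Rightarrow> ('d, 'e, 'o, 'm, 'k, 'z) modcat_scheme \<Rightarrow>
   'd \<Rightarrow> ('d, 'o, 'm, 'o, 'm) modfun" where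
  "alpha_plus D M x = \<lparr>FunO = MActO M x, FunA = MActA M (Id D x),
     FunS = (\<lambda>y m. MAssoc M y x m \<cdot>\<^bsub>M\<^esub> MActA M (Braid D x y) (Id M m) \<cdot>\<^bsub>M\<^esub>
                   inv_arr M (MAssoc M x y m))\<rparr>"

definition alpha_minus ::
  "('d, 'e, 'k, 'y) braidcat_scheme \<Rightarrow> ('d, 'e, 'o, 'm, 'k, 'z) modcat_scheme \<Rightarrow>
   'd \<Rightarrow> ('d, 'o, 'm, 'o, 'm) modfun" where
  "alpha_minus D M x = \<lparr>FunO = MActO M x, FunA = MActA M (Id D x),
     FunS = (\<lambda>y m. MAssoc M y x m \<cdot>\<^bsub>M\<^esub> MActA M (inv_arr D (Braid D y x)) (Id M m) \<cdot>\<^bsub>M\<^esub>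
                   inv_arr M (MAssoc M x y m))\<rparr>"

text \<open>The identification \<open>Pic(D) = Aut\<^sup>b\<^sup>r(D)\<close> of Etingof, Nikshych and Ostrik sends an invertible
  module category \<open>M\<close> to the braided autoequivalence \<open>\<partial>\<close> characterised by
  \<open>\<alpha>\<^sup>-(\<partial>(x)) \<cong> \<alpha>\<^sup>+(x)\<close> as module endofunctors of \<open>M\<close>. For pointed \<open>D\<close> it is determined by its
  action on \<open>Inv(D)\<close>, which is the map below. (Interchanging \<open>\<alpha>\<^sup>+\<close> and \<open>\<alpha>\<^sup>-\<close> replaces \<open>\<partial>\<close> by
  its inverse.)\<close>

definition pic_isometry ::
  "('d, 'e, 'k, 'y) braidcat_scheme \<Rightarrow> ('d, 'e, 'o, 'm, 'k, 'z) modcat_scheme \<Rightarrow>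
   'd set \<Rightarrow> 'd set" where
  "pic_isometry D M = (\<lambda>a \<in> carrier (Inv D). THE b. b \<in> carrier (Inv D) \<and>
     (\<exists>x \<in> a. \<exists>y \<in> b. module_functors_isomorphic D M M (alpha_minus D M y) (alpha_plus D M x)))"

section \<open>The quadratic space of a pointed braided fusion category\<close>

definition elementary_abelian_group :: "nat \<Rightarrow> ('a, 'b) monoid_scheme \<Rightarrow> bool" where
  "elementary_abelian_group p A \<longleftrightarrow> comm_group A \<and> finite (carrier A) \<and>
     (\<forall>a \<in> carrier A. a [^]\<^bsub>A\<^esub> p = \<one>\<^bsub>A\<^esub>)"

definition primitive_root_of_unity :: "nat \<Rightarrow> 'k::field \<Rightarrow> bool" where
  "primitive_root_of_unity n \<zeta> \<longleftrightarrow> \<zeta> ^ n = 1 \<and> (\<forall>j. 0 < j \<and> j < n \<longrightarrow> \<zeta> ^ j \<noteq> 1)"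

text \<open>Elements of \<open>\<F>\<^sub>p\<close> are represented by the integers in \<open>{0..<p}\<close>, and the
  \<open>\<F>\<^sub>p\<close>-vector space \<open>Inv D\<close> is written multiplicatively. The form is given by
  \<open>c(x,x) = \<zeta>\<^bsup>Q(x)\<^esup> id\<close>, and \<open>B\<close> is its polarization, so that \<open>Q(a) = B(a,a)\<close>.\<close>

definition quad_form ::
  "('d, 'e, 'k::field, 'y) braidcat_scheme \<Rightarrow> nat \<Rightarrow> 'k \<Rightarrow> 'd set \<Rightarrow> int" where
  "quad_form D p \<zeta> a = (THE n. n \<in> {0..<int p} \<and>
     (\<exists>x \<in> a. Braid D x x = (\<zeta> ^ nat n) \<star>\<^bsub>D\<^esub> Id D (x \<odot>\<^bsub>D\<^esub> x)))"

definition bilin_form ::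
  "('d, 'e, 'k::field, 'y) braidcat_scheme \<Rightarrow> nat \<Rightarrow> 'k \<Rightarrow> 'd set \<Rightarrow> 'd set \<Rightarrow> int" where
  "bilin_form D p \<zeta> a b = (THE n. n \<in> {0..<int p} \<and>
     [2 * n = quad_form D p \<zeta> (a \<otimes>\<^bsub>Inv D\<^esub> b) - quad_form D p \<zeta> a - quad_form D p \<zeta> b]
       (mod int p))"

text \<open>Group endomorphisms of an elementary abelian \<open>p\<close>-group are the \<open>\<F>\<^sub>p\<close>-linear maps.\<close>

definition orthogonal_group ::
  "('d, 'e, 'k::field, 'y) braidcat_scheme \<Rightarrow> nat \<Rightarrow> 'k \<Rightarrow> ('d set \<Rightarrow> 'd set) monoid" where
  "orthogonal_group D p \<zeta> = (BijGroup (carrier (Inv D)))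
     \<lparr>carrier := {T \<in> auto (Inv D).
        \<forall>a \<in> carrier (Inv D). quad_form D p \<zeta> (T a) = quad_form D p \<zeta> a}\<rparr>"

definition reflection ::
  "('d, 'e, 'k::field, 'y) braidcat_scheme \<Rightarrow> nat \<Rightarrow> 'k \<Rightarrow> 'd set \<Rightarrow> 'd set \<Rightarrow> 'd set" where
  "reflection D p \<zeta> a = (\<lambda>v \<in> carrier (Inv D). v \<otimes>\<^bsub>Inv D\<^esub>
     (a [^]\<^bsub>Inv D\<^esub> (- 2 * bilin_form D p \<zeta> v a * modular_inverse (int p) (bilin_form D p \<zeta> a a))))"

definition reflections ::
  "('d, 'e, 'k::field, 'y) braidcat_scheme \<Rightarrow> nat \<Rightarrow> 'k \<Rightarrow> ('d set \<Rightarrow> 'd set) set" where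
  "reflections D p \<zeta> = reflection D p \<zeta> ` {a \<in> carrier (Inv D). bilin_form D p \<zeta> a a \<noteq> 0}"

section \<open>\<open>G\<close>-crossed fusion categories\<close>

text \<open>\<open>ActTens g x y\<close>, \<open>ActUnit g\<close>, \<open>ActComp g h x\<close> and \<open>ActId x\<close> are the canonical
  isomorphisms of the action,
  \<open>g\<^sub>*(x \<otimes> y) \<rightarrow> g\<^sub>*x \<otimes> g\<^sub>*y\<close>, \<open>g\<^sub>*1 \<rightarrow> 1\<close>, \<open>(gh)\<^sub>*x \<rightarrow> g\<^sub>*h\<^sub>*x\<close> and \<open>e\<^sub>*x \<rightarrow> x\<close>.
  \<open>CBraid g x y\<close> is the \<open>G\<close>-braiding for \<open>x\<close> in degree \<open>g\<close>; the degree is an argument because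
  zero objects lie in every degree.\<close>

record ('g, 'o, 'm, 'k) crossedcat = "('o, 'm, 'k) moncat" +
  Grade :: "'g \<Rightarrow> 'o set"
  ActO :: "'g \<Rightarrow> 'o \<Rightarrow> 'o"
  ActA :: "'g \<Rightarrow> 'm \<Rightarrow> 'm"
  ActTens :: "'g \<Rightarrow> 'o \<Rightarrow> 'o \<Rightarrow> 'm"
  ActUnit :: "'g \<Rightarrow> 'm"
  ActComp :: "'g \<Rightarrow> 'g \<Rightarrow> 'o \<Rightarrow> 'm"
  ActId :: "'o \<Rightarrow> 'm"
  CBraid :: "'g \<Rightarrow> 'o \<Rightarrow> 'o \<Rightarrow> 'm"

text \<open>A faithful grading \<open>B = \<Oplus>\<^sub>g B\<^sub>g\<close> into full additive replete subcategories.\<close>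

locale graded_fusion_category = group G + fusion_category B
  for G :: "('g, 'w) monoid_scheme"
    and B :: "('g, 'o, 'm, 'k::field, 'z) crossedcat_scheme" +
  assumes grade_obj: "g \<in> carrier G \<Longrightarrow> Grade B g \<subseteq> Obj B"
    and grade_replete: "g \<in> carrier G \<Longrightarrow> x \<in> Grade B g \<Longrightarrow> isomorphic B x y \<Longrightarrow> y \<in> Grade B g"
    and grade_sum: "g \<in> carrier G \<Longrightarrow> set ys \<subseteq> Grade B g \<Longrightarrow> direct_sum B x ys \<Longrightarrow> x \<in> Grade B g"
    and grade_orthogonal: "g \<in> carrier G \<Longrightarrow> h \<in> carrier G \<Longrightarrow> g \<noteq> h \<Longrightarrow>
      x \<in> Grade B g \<Longrightarrow> y \<in> Grade B h \<Longrightarrow> Hom B x y = {Null B x y}"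
    and grade_decomposition: "x \<in> Obj B \<Longrightarrow>
      \<exists>ys. set ys \<subseteq> (\<Union>g \<in> carrier G. Grade B g) \<and> direct_sum B x ys"
    and grade_faithful: "g \<in> carrier G \<Longrightarrow> \<exists>x \<in> Grade B g. \<not> zero_object B x"
    and grade_tensor: "g \<in> carrier G \<Longrightarrow> h \<in> carrier G \<Longrightarrow> x \<in> Grade B g \<Longrightarrow> y \<in> Grade B h \<Longrightarrow>
      x \<odot>\<^bsub>B\<^esub> y \<in> Grade B (g \<otimes>\<^bsub>G\<^esub> h)"

locale G_crossed_fusion_category = graded_fusion_category G B
  for G :: "('g, 'w) monoid_scheme" and B :: "('g, 'o, 'm, 'k::field, 'z) crossedcat_scheme" +
  \<comment> \<open>every \<open>g\<^sub>*\<close> is a tensor functor\<close>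
  assumes action_functor: "g \<in> carrier G \<Longrightarrow> linear_functor B B (ActO B g) (ActA B g)"
    and action_tens_iso: "g \<in> carrier G \<Longrightarrow> x \<in> Obj B \<Longrightarrow> y \<in> Obj B \<Longrightarrow>
      ActTens B g x y \<in> Iso B (ActO B g (x \<odot>\<^bsub>B\<^esub> y)) (ActO B g x \<odot>\<^bsub>B\<^esub> ActO B g y)"
    and action_tens_natural: "g \<in> carrier G \<Longrightarrow> f \<in> Hom B x x' \<Longrightarrow> f' \<in> Hom B y y' \<Longrightarrow>
      ActTens B g x' y' \<cdot>\<^bsub>B\<^esub> ActA B g (f \<Odot>\<^bsub>B\<^esub> f') =
      (ActA B g f \<Odot>\<^bsub>B\<^esub> ActA B g f') \<cdot>\<^bsub>B\<^esub> ActTens B g x y"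
    and action_unit_iso: "g \<in> carrier G \<Longrightarrow> ActUnit B g \<in> Iso B (ActO B g (Unit B)) (Unit B)"
    and action_tens_assoc: "g \<in> carrier G \<Longrightarrow> x \<in> Obj B \<Longrightarrow> y \<in> Obj B \<Longrightarrow> z \<in> Obj B \<Longrightarrow>
      Assoc B (ActO B g x) (ActO B g y) (ActO B g z) \<cdot>\<^bsub>B\<^esub>
        (ActTens B g x y \<Odot>\<^bsub>B\<^esub> Id B (ActO B g z)) \<cdot>\<^bsub>B\<^esub> ActTens B g (x \<odot>\<^bsub>B\<^esub> y) z =
      (Id B (ActO B g x) \<Odot>\<^bsub>B\<^esub> ActTens B g y z) \<cdot>\<^bsub>B\<^esub> ActTens B g x (y \<odot>\<^bsub>B\<^esub> z) \<cdot>\<^bsub>B\<^esub>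
        ActA B g (Assoc B x y z)"
    and action_tens_lunit: "g \<in> carrier G \<Longrightarrow> x \<in> Obj B \<Longrightarrow>
      LUnit B (ActO B g x) \<cdot>\<^bsub>B\<^esub> (ActUnit B g \<Odot>\<^bsub>B\<^esub> Id B (ActO B g x)) \<cdot>\<^bsub>B\<^esub>
        ActTens B g (Unit B) x = ActA B g (LUnit B x)"
    and action_tens_runit: "g \<in> carrier G \<Longrightarrow> x \<in> Obj B \<Longrightarrow>
      RUnit B (ActO B g x) \<cdot>\<^bsub>B\<^esub> (Id B (ActO B g x) \<Odot>\<^bsub>B\<^esub> ActUnit B g) \<cdot>\<^bsub>B\<^esub>
        ActTens B g x (Unit B) = ActA B g (RUnit B x)"
  \<comment> \<open>\<open>g \<mapsto> g\<^sub>*\<close> is monoidal; in particular every \<open>g\<^sub>*\<close> is an autoequivalence\<close>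
    and action_comp_iso: "g \<in> carrier G \<Longrightarrow> h \<in> carrier G \<Longrightarrow> x \<in> Obj B \<Longrightarrow>
      ActComp B g h x \<in> Iso B (ActO B (g \<otimes>\<^bsub>G\<^esub> h) x) (ActO B g (ActO B h x))"
    and action_comp_natural: "g \<in> carrier G \<Longrightarrow> h \<in> carrier G \<Longrightarrow> f \<in> Hom B x y \<Longrightarrow>
      ActComp B g h y \<cdot>\<^bsub>B\<^esub> ActA B (g \<otimes>\<^bsub>G\<^esub> h) f =
      ActA B g (ActA B h f) \<cdot>\<^bsub>B\<^esub> ActComp B g h x"
    and action_comp_tens: "g \<in> carrier G \<Longrightarrow> h \<in> carrier G \<Longrightarrow> x \<in> Obj B \<Longrightarrow> y \<in> Obj B \<Longrightarrow>
      (ActComp B g h x \<Odot>\<^bsub>B\<^esub> ActComp B g h y) \<cdot>\<^bsub>B\<^esub> ActTens B (g \<otimes>\<^bsub>G\<^esub> h) x y =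
      ActTens B g (ActO B h x) (ActO B h y) \<cdot>\<^bsub>B\<^esub> ActA B g (ActTens B h x y) \<cdot>\<^bsub>B\<^esub>
        ActComp B g h (x \<odot>\<^bsub>B\<^esub> y)"
    and action_comp_unit: "g \<in> carrier G \<Longrightarrow> h \<in> carrier G \<Longrightarrow>
      ActUnit B g \<cdot>\<^bsub>B\<^esub> ActA B g (ActUnit B h) \<cdot>\<^bsub>B\<^esub> ActComp B g h (Unit B) =
      ActUnit B (g \<otimes>\<^bsub>G\<^esub> h)"
    and action_id_iso: "x \<in> Obj B \<Longrightarrow> ActId B x \<in> Iso B (ActO B \<one>\<^bsub>G\<^esub> x) x"
    and action_id_natural: "f \<in> Hom B x y \<Longrightarrow>
      ActId B y \<cdot>\<^bsub>B\<^esub> ActA B \<one>\<^bsub>G\<^esub> f = f \<cdot>\<^bsub>B\<^esub> ActId B x"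
    and action_id_tens: "x \<in> Obj B \<Longrightarrow> y \<in> Obj B \<Longrightarrow>
      (ActId B x \<Odot>\<^bsub>B\<^esub> ActId B y) \<cdot>\<^bsub>B\<^esub> ActTens B \<one>\<^bsub>G\<^esub> x y = ActId B (x \<odot>\<^bsub>B\<^esub> y)"
    and action_id_unit: "ActUnit B \<one>\<^bsub>G\<^esub> = ActId B (Unit B)"
    and action_comp_assoc: "g \<in> carrier G \<Longrightarrow> h \<in> carrier G \<Longrightarrow> k \<in> carrier G \<Longrightarrow> x \<in> Obj B \<Longrightarrow>
      ActComp B g h (ActO B k x) \<cdot>\<^bsub>B\<^esub> ActComp B (g \<otimes>\<^bsub>G\<^esub> h) k x =
      ActA B g (ActComp B h k x) \<cdot>\<^bsub>B\<^esub> ActComp B g (h \<otimes>\<^bsub>G\<^esub> k) x"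
    and action_id_comp_left: "g \<in> carrier G \<Longrightarrow> x \<in> Obj B \<Longrightarrow>
      ActId B (ActO B g x) \<cdot>\<^bsub>B\<^esub> ActComp B \<one>\<^bsub>G\<^esub> g x = Id B (ActO B g x)"
    and action_id_comp_right: "g \<in> carrier G \<Longrightarrow> x \<in> Obj B \<Longrightarrow>
      ActA B g (ActId B x) \<cdot>\<^bsub>B\<^esub> ActComp B g \<one>\<^bsub>G\<^esub> x = Id B (ActO B g x)"
    and action_grade: "g \<in> carrier G \<Longrightarrow> h \<in> carrier G \<Longrightarrow> x \<in> Grade B h \<Longrightarrow>
      ActO B g x \<in> Grade B (g \<otimes>\<^bsub>G\<^esub> h \<otimes>\<^bsub>G\<^esub> inv\<^bsub>G\<^esub> g)"
  \<comment> \<open>the \<open>G\<close>-braiding\<close>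
    and cbraid_iso: "g \<in> carrier G \<Longrightarrow> x \<in> Grade B g \<Longrightarrow> y \<in> Obj B \<Longrightarrow>
      CBraid B g x y \<in> Iso B (x \<odot>\<^bsub>B\<^esub> y) (ActO B g y \<odot>\<^bsub>B\<^esub> x)"
    and cbraid_natural: "g \<in> carrier G \<Longrightarrow> x \<in> Grade B g \<Longrightarrow> x' \<in> Grade B g \<Longrightarrow>
      f \<in> Hom B x x' \<Longrightarrow> f' \<in> Hom B y y' \<Longrightarrow>
      CBraid B g x' y' \<cdot>\<^bsub>B\<^esub> (f \<Odot>\<^bsub>B\<^esub> f') = (ActA B g f' \<Odot>\<^bsub>B\<^esub> f) \<cdot>\<^bsub>B\<^esub> CBraid B g x y"
    and cbraid_action: "g \<in> carrier G \<Longrightarrow> h \<in> carrier G \<Longrightarrow> x \<in> Grade B h \<Longrightarrow> z \<in> Obj B \<Longrightarrow>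
      ((ActComp B (g \<otimes>\<^bsub>G\<^esub> h \<otimes>\<^bsub>G\<^esub> inv\<^bsub>G\<^esub> g) g z \<cdot>\<^bsub>B\<^esub> inv_arr B (ActComp B g h z)) \<Odot>\<^bsub>B\<^esub>
          Id B (ActO B g x)) \<cdot>\<^bsub>B\<^esub>
        ActTens B g (ActO B h z) x \<cdot>\<^bsub>B\<^esub> ActA B g (CBraid B h x z) =
      CBraid B (g \<otimes>\<^bsub>G\<^esub> h \<otimes>\<^bsub>G\<^esub> inv\<^bsub>G\<^esub> g) (ActO B g x) (ActO B g z) \<cdot>\<^bsub>B\<^esub> ActTens B g x z"
    and cbraid_hexagon_right: "g \<in> carrier G \<Longrightarrow> x \<in> Grade B g \<Longrightarrow> y \<in> Obj B \<Longrightarrow> z \<in> Obj B \<Longrightarrow>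
      CBraid B g x (y \<odot>\<^bsub>B\<^esub> z) =
      (inv_arr B (ActTens B g y z) \<Odot>\<^bsub>B\<^esub> Id B x) \<cdot>\<^bsub>B\<^esub>
        inv_arr B (Assoc B (ActO B g y) (ActO B g z) x) \<cdot>\<^bsub>B\<^esub>
        (Id B (ActO B g y) \<Odot>\<^bsub>B\<^esub> CBraid B g x z) \<cdot>\<^bsub>B\<^esub>
        Assoc B (ActO B g y) x z \<cdot>\<^bsub>B\<^esub>
        (CBraid B g x y \<Odot>\<^bsub>B\<^esub> Id B z) \<cdot>\<^bsub>B\<^esub>
        inv_arr B (Assoc B x y z)"
    and cbraid_hexagon_left: "g \<in> carrier G \<Longrightarrow> h \<in> carrier G \<Longrightarrow>
      x \<in> Grade B g \<Longrightarrow> y \<in> Grade B h \<Longrightarrow> z \<in> Obj B \<Longrightarrow>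
      CBraid B (g \<otimes>\<^bsub>G\<^esub> h) (x \<odot>\<^bsub>B\<^esub> y) z =
      (inv_arr B (ActComp B g h z) \<Odot>\<^bsub>B\<^esub> Id B (x \<odot>\<^bsub>B\<^esub> y)) \<cdot>\<^bsub>B\<^esub>
        Assoc B (ActO B g (ActO B h z)) x y \<cdot>\<^bsub>B\<^esub>
        (CBraid B g x (ActO B h z) \<Odot>\<^bsub>B\<^esub> Id B y) \<cdot>\<^bsub>B\<^esub>
        inv_arr B (Assoc B x (ActO B h z) y) \<cdot>\<^bsub>B\<^esub>
        (Id B x \<Odot>\<^bsub>B\<^esub> CBraid B h y z) \<cdot>\<^bsub>B\<^esub>
        Assoc B x y z"

text \<open>The braided category \<open>B\<^sub>e\<close>: its braiding is the \<open>G\<close>-braiding followed by \<open>e\<^sub>*y \<cong> y\<close>.\<close>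

definition neutral_component ::
  "('g, 'w) monoid_scheme \<Rightarrow> ('g, 'o, 'm, 'k, 'z) crossedcat_scheme \<Rightarrow> ('o, 'm, 'k) braidcat" where
  "neutral_component G B =
     moncat.extend (moncat.truncate (full_subcategory B (Grade B \<one>\<^bsub>G\<^esub>)))
       (braidcat.fields (\<lambda>x y. (ActId B y \<Odot>\<^bsub>B\<^esub> Id B x) \<cdot>\<^bsub>B\<^esub> CBraid B \<one>\<^bsub>G\<^esub> x y))"

text \<open>The component \<open>B\<^sub>g\<close> as a module category over \<open>B\<^sub>e\<close> via the tensor product of \<open>B\<close>.\<close>

definition module_component ::
  "('g, 'o, 'm, 'k, 'z) crossedcat_scheme \<Rightarrow> 'g \<Rightarrow> ('o, 'm, 'o, 'm, 'k) modcat" where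
  "module_component B g =
     lincat.extend (lincat.truncate (full_subcategory B (Grade B g)))
       (modcat.fields (TensO B) (TensA B) (Assoc B) (LUnit B))"

section \<open>Reflection groups and reflection fusion categories\<close>

definition reflection_group_in_Pic ::
  "nat \<Rightarrow> 'k \<Rightarrow> ('g, 'w) monoid_scheme \<Rightarrow> ('g, 'o, 'm, 'k::field, 'z) crossedcat_scheme \<Rightarrow> bool" where
  "reflection_group_in_Pic p \<zeta> G B \<longleftrightarrow>
     inj_on (\<lambda>g. module_class (neutral_component G B) (module_component B g)) (carrier G) \<and>
     (\<exists>S \<subseteq> reflections (neutral_component G B) p \<zeta>.
        (\<lambda>g. pic_isometry (neutral_component G B) (module_component B g)) ` carrier G =
        generate (orthogonal_group (neutral_component G B) p \<zeta>) S)"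

definition reflection_fusion_category ::
  "nat \<Rightarrow> ('g, 'w) monoid_scheme \<Rightarrow> ('g, 'o, 'm, 'k::field, 'z) crossedcat_scheme \<Rightarrow> bool" where
  "reflection_fusion_category p G B \<longleftrightarrow>
     G_crossed_fusion_category G B \<and>
     braided_fusion_category (neutral_component G B) \<and>
     nondegenerate (neutral_component G B) \<and>
     pointed (neutral_component G B) \<and>
     elementary_abelian_group p (Inv (neutral_component G B)) \<and>
     carrier (Inv B) = carrier (Inv (neutral_component G B)) \<and>
     tensor_generated_by B
       ({x. invertible_object B x} \<union> {x. simple_object B x \<and> FPdim B x = sqrt (real p)})"

end

theory Submission
  imports Defs
begin

text \<open>The group \<open>A = Inv(B\<^sub>e)\<close> acts transitively on the simple objects of \<open>B\<^sub>g\<close> by tensoring, so they share one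
  stabilizer, and counting simple summands gives \<open>FPdim(x)\<^sup>2 = |Stab(x)|\<close>. The \<open>G\<close>-braiding of \<open>x\<close> with
  \<open>a \<in> A\<close> shows \<open>(g - 1)A \<subseteq> Stab(x)\<close>; the monodromy of a stabilizer element with a fixed point of \<open>g\<close> is trivial by
  Schur's lemma, so \<open>Stab(x) \<subseteq> (ker(g - 1))\<^sup>\<bottom>\<close>, and non-degeneracy makes all three groups equal. Hence
  \<open>FPdim(x) = \<surd>p\<close> means that \<open>g - 1\<close> has rank one, that is, \<open>g\<close> acts on \<open>A\<close> as a reflection; and if
  \<open>g\<close> acts trivially, then \<open>B\<^sub>g\<close> contains an invertible object, so that \<open>B\<^sub>g \<simeq> B\<^sub>e\<close> as module categories.
  Conversely, equivalent components give the same isometry. Since the product of non-zero homogeneous objects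
  is non-zero and \<open>A\<close> permutes the simple objects of a component transitively, tensor generation of \<open>B\<close>
  amounts to generation of \<open>G\<close> by the degrees of the generators.\<close>

text \<open>Dimensions are found by exhibiting a positive eigenvector. The number of simple summands
  of x \<otimes> y depends only on the degrees of x and y; counting it through a left and through a
  right dual of y shows that the square roots of the stabilizer orders form an eigenvector of every
  fusion matrix. The two duals are not identified with each other; their lengths agree by the same
  count with the first factor in degree e. The chain from the image of g - 1 through the stabilizer
  to the orthogonal complement of the fixed subgroup closes because its ends have equal order. That
  comes from character sums in the ground field, where characteristic zero turns an equation of
  field elements into one of integers. The isometry of a component is the action of g on A because
  the double braiding of w and m, from w \<otimes> m through m \<otimes> w to
  \<open>g\<^sub>*w \<otimes> m\<close>, is compatible with the module structure. That no other
  class fits, and that equivalent components have the same isometry, are two instances of one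
  transport argument, in which all coherence isomorphisms cancel and only values of the bicharacter
  remain.\<close>

section \<open>Linear relations over a field\<close>

lemma nontrivial_relation:
  fixes h :: "'i \<Rightarrow> 'j \<Rightarrow> 'k::field"
  assumes "finite J" "finite I" "card J < card I"
  shows "\<exists>a. (\<exists>i\<in>I. a i \<noteq> 0) \<and> (\<forall>j\<in>J. (\<Sum>i\<in>I. a i * h i j) = 0)"
  using assms
proof (induction J arbitrary: I h rule: finite_induct)
  case empty
  then have "I \<noteq> {}" by auto
  then show ?case by (intro exI[of _ "\<lambda>_. 1"]) auto
next
  case (insert j J)
  show ?case
  proof (cases "\<forall>i\<in>I. h i j = 0")
    case True
    from insert obtain a where "\<exists>i\<in>I. a i \<noteq> 0" "\<forall>j\<in>J. (\<Sum>i\<in>I. a i * h i j) = 0"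
      by (metis card_insert_disjoint less_SucI Suc_lessD)
    with True show ?thesis by (intro exI[of _ a]) auto
  next
    case False
    then obtain i0 where i0: "i0 \<in> I" "h i0 j \<noteq> 0" by auto
    \<comment> \<open>Gaussian elimination with pivot \<open>i0\<close>: the other unknowns satisfy
      the reduced system \<open>?h\<close>, which has one equation fewer, and \<open>s\<close> is
      then the value at the pivot that makes equation \<open>j\<close> hold.\<close>
    let ?h = "\<lambda>i j'. h i j' - h i j / h i0 j * h i0 j'"
    have "card J < card (I - {i0})" using insert i0 by simp
    with insert obtain a where a: "\<exists>i\<in>I - {i0}. a i \<noteq> 0"
      "\<forall>j\<in>J. (\<Sum>i\<in>I - {i0}. a i * ?h i j) = 0"
      using insert.IH[of "I - {i0}" ?h] by blast
    define s where "s = - (\<Sum>i\<in>I - {i0}. a i * h i j / h i0 j)"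
    define b where "b = a(i0 := s)"
    have b: "(\<Sum>i\<in>I. b i * h i j') = s * h i0 j' + (\<Sum>i\<in>I - {i0}. a i * h i j')" for j'
      using i0 insert.prems by (subst sum.remove[of _ i0]) (auto simp: b_def intro!: sum.cong)
    have "(\<Sum>i\<in>I. b i * h i j') = (\<Sum>i\<in>I - {i0}. a i * ?h i j')" for j'
      unfolding b by (simp add: s_def algebra_simps sum_subtractf sum_distrib_left sum_distrib_right)
    moreover have "(\<Sum>i\<in>I - {i0}. a i * ?h i j) = 0"
      using i0 by simp
    ultimately show ?thesis using a by (intro exI[of _ b]) (auto simp: b_def)
  qed
qed

section \<open>Arithmetic of arrows in a linear category\<close>

abbreviation lsum where "lsum C x y f l \<equiv> foldr (Plus C) (map f l) (Null C x y)"

context linear_category begin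

lemma Hom_iff: "f \<in> Hom C x y \<longleftrightarrow> f \<in> Arr C \<and> Dom C f = x \<and> Cod C f = y"
  by (auto simp: Hom_def)

lemma dom_cod_obj [simp]: "f \<in> Arr C \<Longrightarrow> Dom C f \<in> Obj C" "f \<in> Arr C \<Longrightarrow> Cod C f \<in> Obj C"
  using dom_cod by auto

lemma Hom_obj: "f \<in> Hom C x y \<Longrightarrow> x \<in> Obj C" "f \<in> Hom C x y \<Longrightarrow> y \<in> Obj C"
  by (auto simp: Hom_iff)

lemma HomI: "f \<in> Arr C \<Longrightarrow> Dom C f = x \<Longrightarrow> Cod C f = y \<Longrightarrow> f \<in> Hom C x y"
  by (simp add: Hom_iff)

lemma comp_arr [simp]:
  assumes "f \<in> Arr C" "g \<in> Arr C" "Dom C g = Cod C f"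
  shows "g \<cdot> f \<in> Arr C" "Dom C (g \<cdot> f) = Dom C f" "Cod C (g \<cdot> f) = Cod C g"
  using assms comp_in_Hom[of f "Dom C f" "Cod C f" g "Cod C g"] by (auto simp: Hom_iff)

lemma id_arr [simp]:
  assumes "x \<in> Obj C"
  shows "Id C x \<in> Arr C" "Dom C (Id C x) = x" "Cod C (Id C x) = x"
  using id_in_Hom[OF assms] by (auto simp: Hom_iff)

lemma null_arr [simp]:
  assumes "x \<in> Obj C" "y \<in> Obj C"
  shows "Null C x y \<in> Arr C" "Dom C (Null C x y) = x" "Cod C (Null C x y) = y"
  using null_in_Hom[OF assms] by (auto simp: Hom_iff)

lemma plus_arr [simp]:
  assumes "f \<in> Arr C" "g \<in> Arr C" "Dom C g = Dom C f" "Cod C g = Cod C f"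
  shows "f \<oplus> g \<in> Arr C" "Dom C (f \<oplus> g) = Dom C f" "Cod C (f \<oplus> g) = Cod C f"
  using assms plus_in_Hom[of f "Dom C f" "Cod C f" g] by (auto simp: Hom_iff)

lemma scale_arr [simp]:
  assumes "f \<in> Arr C"
  shows "a \<star> f \<in> Arr C" "Dom C (a \<star> f) = Dom C f" "Cod C (a \<star> f) = Cod C f"
  using assms scale_in_Hom[of f "Dom C f" "Cod C f" a] by (auto simp: Hom_iff)

lemma assoc_arr:
  assumes "f \<in> Arr C" "g \<in> Arr C" "h \<in> Arr C" "Dom C g = Cod C f" "Dom C h = Cod C g"
  shows "(h \<cdot> g) \<cdot> f = h \<cdot> (g \<cdot> f)"
  using assms comp_assoc[of f "Dom C f" "Cod C f" g "Cod C g" h "Cod C h"] by (auto simp: Hom_iff)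

lemma id_comp_arr [simp]: "f \<in> Arr C \<Longrightarrow> Cod C f = y \<Longrightarrow> Id C y \<cdot> f = f"
  using id_comp[of f "Dom C f" y] by (auto simp: Hom_iff)

lemma comp_id_arr [simp]: "f \<in> Arr C \<Longrightarrow> Dom C f = x \<Longrightarrow> f \<cdot> Id C x = f"
  using comp_id[of f x "Cod C f"] by (auto simp: Hom_iff)

lemma plus_cancel:
  assumes "f \<in> Hom C x y" "g \<in> Hom C x y" "h \<in> Hom C x y" "f \<oplus> g = f \<oplus> h"
  shows "g = h"
proof -
  obtain f' where f': "f' \<in> Hom C x y" "f \<oplus> f' = Null C x y" using plus_inverse assms by blast
  have *: "f' \<oplus> (f \<oplus> k) = k" if "k \<in> Hom C x y" for k
  proof -
    have "f' \<oplus> (f \<oplus> k) = (f \<oplus> f') \<oplus> k"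
      using plus_assoc[OF f'(1) assms(1) that] plus_commute[OF f'(1) assms(1)] by simp
    also have "\<dots> = k \<oplus> Null C x y"
      using f'(2) plus_commute[OF null_in_Hom that] Hom_obj[OF that] by simp
    finally show ?thesis using plus_null[OF that] by simp
  qed
  show ?thesis using *[OF assms(2)] *[OF assms(3)] assms(4) by metis
qed

lemma plus_swap:
  assumes "a \<in> Hom C x y" "b \<in> Hom C x y" "c \<in> Hom C x y" "d \<in> Hom C x y"
  shows "a \<oplus> b \<oplus> (c \<oplus> d) = a \<oplus> c \<oplus> (b \<oplus> d)"
proof -
  have "a \<oplus> b \<oplus> (c \<oplus> d) = a \<oplus> (b \<oplus> c \<oplus> d)"
    using assms by (simp add: plus_assoc[of _ x y] plus_in_Hom)
  also have "\<dots> = a \<oplus> (c \<oplus> b \<oplus> d)"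
    using assms plus_commute[of b x y c] by simp
  also have "\<dots> = a \<oplus> c \<oplus> (b \<oplus> d)"
    using assms by (simp add: plus_assoc[of _ x y] plus_in_Hom)
  finally show ?thesis .
qed

lemma null_plus: "f \<in> Hom C x y \<Longrightarrow> Null C x y \<oplus> f = f"
  by (metis plus_commute plus_null null_in_Hom Hom_obj)

lemma scale_zero: assumes "f \<in> Hom C x y" shows "0 \<star> f = Null C x y"
proof (rule plus_cancel)
  show "f \<oplus> 0 \<star> f = f \<oplus> Null C x y"
    using assms scale_plus_left[of f x y 1 0] by (simp add: scale_one plus_null)
qed (use assms in \<open>auto intro: scale_in_Hom null_in_Hom dest: Hom_obj\<close>)

lemma scale_null: assumes "x \<in> Obj C" "y \<in> Obj C" shows "a \<star> Null C x y = Null C x y"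
  using assms scale_zero scale_scale null_in_Hom by (metis mult_zero_right)

lemma comp_null: assumes "g \<in> Hom C y z" "x \<in> Obj C" shows "g \<cdot> Null C x y = Null C x z"
proof -
  have n: "Null C x y \<in> Hom C x y" using assms by (auto intro: null_in_Hom dest: Hom_obj)
  have "g \<cdot> (0 \<star> Null C x y) = 0 \<star> (g \<cdot> Null C x y)" using comp_scale_right[OF n assms(1)] .
  then show ?thesis using scale_zero n comp_in_Hom[OF n assms(1)] by metis
qed

lemma null_comp: assumes "f \<in> Hom C x y" "z \<in> Obj C" shows "Null C y z \<cdot> f = Null C x z"
proof -
  have n: "Null C y z \<in> Hom C y z" using assms by (auto intro: null_in_Hom dest: Hom_obj)
  have "(0 \<star> Null C y z) \<cdot> f = 0 \<star> (Null C y z \<cdot> f)" using comp_scale_left[OF assms(1) n] .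
  then show ?thesis using scale_zero n comp_in_Hom[OF assms(1) n] by metis
qed

lemma scale_eq_null:
  assumes "f \<in> Hom C x y" "a \<star> f = Null C x y" "a \<noteq> 0" shows "f = Null C x y"
proof -
  have "f = inverse a \<star> (a \<star> f)"
    using scale_scale[OF assms(1), of "inverse a" a] scale_one[OF assms(1)] assms(3) by simp
  then show ?thesis using assms scale_null Hom_obj by metis
qed

lemma scale_inj:
  assumes f: "f \<in> Hom C x y" "f \<noteq> Null C x y" and eq: "a \<star> f = b \<star> f" shows "a = b"
proof -
  have "(a - b) \<star> f \<oplus> b \<star> f = a \<star> f" using scale_plus_left[OF f(1), of "a - b" b] by simp
  also have "\<dots> = Null C x y \<oplus> b \<star> f" using eq null_plus scale_in_Hom f by metis
  finally have "b \<star> f \<oplus> (a - b) \<star> f = b \<star> f \<oplus> Null C x y"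
    using plus_commute scale_in_Hom f null_in_Hom Hom_obj by metis
  then have "(a - b) \<star> f = Null C x y" using plus_cancel scale_in_Hom f null_in_Hom Hom_obj by metis
  with f show ?thesis using scale_eq_null by fastforce
qed

lemma plus_minus: assumes "f \<in> Hom C x y" shows "f \<oplus> (- 1) \<star> f = Null C x y"
  using scale_plus_left[OF assms, of 1 "-1"] assms by (simp add: scale_one scale_zero)

lemma eq_if_diff_null:
  assumes "f \<in> Hom C x y" "g \<in> Hom C x y" "f \<oplus> (- 1) \<star> g = Null C x y" shows "f = g"
proof (rule plus_cancel)
  have g: "(- 1) \<star> g \<in> Hom C x y" using assms scale_in_Hom by blast
  show "(- 1) \<star> g \<in> Hom C x y" by fact
  show "(- 1) \<star> g \<oplus> f = (- 1) \<star> g \<oplus> g"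
    using assms g plus_minus[OF assms(2)] by (metis plus_commute)
qed (use assms in auto)

subsection \<open>Isomorphisms\<close>

lemma inverse_arrows_unique:
  assumes "inverse_arrows C f g" "inverse_arrows C f g'" shows "g = g'"
  using assms unfolding inverse_arrows_def by (auto simp: Hom_iff) (metis assoc_arr id_comp_arr comp_id_arr)

lemma inverse_arrows_sym: "inverse_arrows C f g \<Longrightarrow> inverse_arrows C g f"
  unfolding inverse_arrows_def by blast

lemma inv_arr_eq: "inverse_arrows C f g \<Longrightarrow> inv_arr C f = g"
  unfolding inv_arr_def using inverse_arrows_unique by blast

lemma inverse_inv_arr: "isom C f \<Longrightarrow> inverse_arrows C f (inv_arr C f)"
  unfolding isom_def using inv_arr_eq by blast

lemma isom_arr [simp]: "isom C f \<Longrightarrow> f \<in> Arr C"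
  unfolding isom_def inverse_arrows_def by (auto simp: Hom_iff)

lemma inv_arr_arr [simp]:
  assumes "isom C f"
  shows "inv_arr C f \<in> Arr C" "Dom C (inv_arr C f) = Cod C f" "Cod C (inv_arr C f) = Dom C f"
    "inv_arr C f \<cdot> f = Id C (Dom C f)" "f \<cdot> inv_arr C f = Id C (Cod C f)"
    "isom C (inv_arr C f)" "inv_arr C (inv_arr C f) = f"
proof -
  note i = inverse_inv_arr[OF assms]
  show "inv_arr C f \<in> Arr C" "Dom C (inv_arr C f) = Cod C f" "Cod C (inv_arr C f) = Dom C f"
    "inv_arr C f \<cdot> f = Id C (Dom C f)" "f \<cdot> inv_arr C f = Id C (Cod C f)"
    using i unfolding inverse_arrows_def by (auto simp: Hom_iff)
  show "isom C (inv_arr C f)" using inverse_arrows_sym[OF i] unfolding isom_def by blast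
  show "inv_arr C (inv_arr C f) = f" using inverse_arrows_sym[OF i] inv_arr_eq by blast
qed

lemma inv_arr_cancel [simp]:
  assumes "isom C f" "h \<in> Arr C"
  shows "Cod C h = Dom C f \<Longrightarrow> inv_arr C f \<cdot> (f \<cdot> h) = h"
    "Cod C h = Cod C f \<Longrightarrow> f \<cdot> (inv_arr C f \<cdot> h) = h"
  using assms by (simp_all flip: assoc_arr)

lemma isomI:
  assumes "f \<in> Hom C x y" "g \<in> Hom C y x" "g \<cdot> f = Id C x" "f \<cdot> g = Id C y"
  shows "isom C f" "inv_arr C f = g"
proof -
  have "inverse_arrows C f g" using assms unfolding inverse_arrows_def by blast
  then show "isom C f" "inv_arr C f = g" using inv_arr_eq unfolding isom_def by blast+
qed

lemma isom_id [simp]: assumes "x \<in> Obj C" shows "isom C (Id C x)" "inv_arr C (Id C x) = Id C x"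
  using isomI[of "Id C x" x x "Id C x"] assms by (auto simp: Hom_iff)

lemma isom_comp [simp]:
  assumes "isom C f" "isom C g" "Dom C g = Cod C f"
  shows "isom C (g \<cdot> f)" "inv_arr C (g \<cdot> f) = inv_arr C f \<cdot> inv_arr C g"
proof -
  have "inv_arr C f \<cdot> inv_arr C g \<cdot> (g \<cdot> f) = Id C (Dom C f)" using assms by (simp add: assoc_arr)
  moreover have "g \<cdot> f \<cdot> (inv_arr C f \<cdot> inv_arr C g) = Id C (Cod C g)"
    using assms by (simp add: assoc_arr)
  ultimately show "isom C (g \<cdot> f)" "inv_arr C (g \<cdot> f) = inv_arr C f \<cdot> inv_arr C g"
    using isomI[of "g \<cdot> f" "Dom C f" "Cod C g" "inv_arr C f \<cdot> inv_arr C g"] assms by (auto simp: Hom_iff)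
qed

lemma isom_cancel_left:
  assumes "isom C f" "g \<in> Arr C" "h \<in> Arr C" "Cod C g = Dom C f" "Cod C h = Dom C f"
  shows "f \<cdot> g = f \<cdot> h \<longleftrightarrow> g = h"
  using assms inv_arr_cancel(1) by metis

lemma isom_cancel_right:
  assumes "isom C f" "g \<in> Arr C" "h \<in> Arr C" "Dom C g = Cod C f" "Dom C h = Cod C f"
  shows "g \<cdot> f = h \<cdot> f \<longleftrightarrow> g = h"
  using assms by (metis assoc_arr comp_id_arr inv_arr_arr(1,2,3,5) isom_arr)

lemma isom_move_left:
  assumes "isom C f" "g \<in> Arr C" "h \<in> Arr C" "Cod C g = Dom C f" "Cod C h = Cod C f"
  shows "f \<cdot> g = h \<longleftrightarrow> g = inv_arr C f \<cdot> h"
  using assms by (metis inv_arr_cancel)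

lemma isom_move_right:
  assumes "isom C f" "g \<in> Arr C" "h \<in> Arr C" "Dom C g = Cod C f" "Dom C h = Dom C f"
  shows "g \<cdot> f = h \<longleftrightarrow> g = h \<cdot> inv_arr C f"
  using assms by (metis assoc_arr comp_id_arr inv_arr_arr(1-5) isom_arr)

lemma Iso_iff: "f \<in> Iso C x y \<longleftrightarrow> isom C f \<and> Dom C f = x \<and> Cod C f = y"
  by (auto simp: Iso_def Hom_iff)

lemma isomorphicI: "isom C f \<Longrightarrow> Dom C f = x \<Longrightarrow> Cod C f = y \<Longrightarrow> isomorphic C x y"
  unfolding isomorphic_def using Iso_iff by blast

lemma isomorphicE:
  assumes "isomorphic C x y" obtains f where "isom C f" "Dom C f = x" "Cod C f = y"
proof -
  obtain f where "f \<in> Iso C x y" using assms unfolding isomorphic_def by blast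
  then show thesis using that Iso_iff by blast
qed

lemma isomorphic_obj: "isomorphic C x y \<Longrightarrow> x \<in> Obj C" "isomorphic C x y \<Longrightarrow> y \<in> Obj C"
  by (auto elim!: isomorphicE)

lemma isomorphic_refl: "x \<in> Obj C \<Longrightarrow> isomorphic C x x"
  by (rule isomorphicI[of "Id C x"]) auto

lemma isomorphic_sym: "isomorphic C x y \<Longrightarrow> isomorphic C y x"
  by (elim isomorphicE) (rule isomorphicI, rule inv_arr_arr(6), auto)

lemma isomorphic_trans:
  assumes "isomorphic C x y" "isomorphic C y z" shows "isomorphic C x z"
  using assms
proof (elim isomorphicE)
  fix f g assume "isom C f" "Dom C f = x" "Cod C f = y" "isom C g" "Dom C g = y" "Cod C g = z"
  then show ?thesis by (intro isomorphicI[of "g \<cdot> f"]) auto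
qed

lemma iso_class_eq_iff: "x \<in> Obj C \<Longrightarrow> y \<in> Obj C \<Longrightarrow> iso_class C x = iso_class C y \<longleftrightarrow> isomorphic C x y"
  unfolding iso_class_def using isomorphic_refl isomorphic_sym isomorphic_trans by blast

lemma mem_iso_class: "x \<in> Obj C \<Longrightarrow> x \<in> iso_class C x"
  unfolding iso_class_def using isomorphic_refl by blast

subsection \<open>Zero objects\<close>

lemma zero_object_iff: "zero_object C x \<longleftrightarrow> x \<in> Obj C \<and> Id C x = Null C x x"
proof
  assume "zero_object C x"
  then show "x \<in> Obj C \<and> Id C x = Null C x x"
    unfolding zero_object_def using id_in_Hom null_in_Hom by metis
next
  assume x: "x \<in> Obj C \<and> Id C x = Null C x x"
  have "f = Null C x y" if "f \<in> Hom C x y" for f y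
    using x that comp_id comp_null by metis
  moreover have "f = Null C y x" if "f \<in> Hom C y x" for f y
    using x that id_comp null_comp by metis
  ultimately show "zero_object C x" unfolding zero_object_def using x null_in_Hom by blast
qed

lemma zero_object_Hom:
  assumes "zero_object C x"
  shows "f \<in> Hom C x y \<Longrightarrow> f = Null C x y" "f \<in> Hom C y x \<Longrightarrow> f = Null C y x"
  using assms comp_id[of f x y] id_comp[of f y x] comp_null[of f x y x] null_comp[of f y x x]
  unfolding zero_object_iff by auto

lemma zero_object_iso:
  assumes "isomorphic C x y" "zero_object C x" shows "zero_object C y"
proof -
  obtain f where f: "isom C f" "Dom C f = x" "Cod C f = y" using assms isomorphicE by blast
  have "Id C y = f \<cdot> (Id C x \<cdot> inv_arr C f)" using f by auto
  also have "\<dots> = f \<cdot> Null C y x"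
    using zero_object_Hom(2)[OF assms(2), of "Id C x \<cdot> inv_arr C f" y] f by (auto simp: Hom_iff)
  also have "\<dots> = Null C y y" using comp_null[of f x y y] f by (auto simp: Hom_iff)
  finally show ?thesis using zero_object_iff f by auto
qed

subsection \<open>Finite sums and direct sums\<close>

lemma lsum_in_Hom:
  assumes "x \<in> Obj C" "y \<in> Obj C" "\<And>r. r \<in> set l \<Longrightarrow> f r \<in> Hom C x y"
  shows "lsum C x y f l \<in> Hom C x y"
  using assms by (induction l) (auto intro: null_in_Hom plus_in_Hom)

lemma comp_lsum:
  assumes "x \<in> Obj C" "g \<in> Hom C y z" "\<And>r. r \<in> set l \<Longrightarrow> f r \<in> Hom C x y"
  shows "g \<cdot> lsum C x y f l = lsum C x z (\<lambda>r. g \<cdot> f r) l"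
  using assms
proof (induction l)
  case Nil
  then show ?case by (simp add: comp_null)
next
  case (Cons r l)
  have "lsum C x y f l \<in> Hom C x y" by (rule lsum_in_Hom) (use Cons Hom_obj in auto)
  with Cons show ?case using comp_plus_right[of "f r" x y "lsum C x y f l" g z] by auto
qed

lemma lsum_comp:
  assumes "z \<in> Obj C" "g \<in> Hom C x y" "\<And>r. r \<in> set l \<Longrightarrow> f r \<in> Hom C y z"
  shows "lsum C y z f l \<cdot> g = lsum C x z (\<lambda>r. f r \<cdot> g) l"
  using assms
proof (induction l)
  case Nil
  then show ?case by (simp add: null_comp)
next
  case (Cons r l)
  have "lsum C y z f l \<in> Hom C y z" by (rule lsum_in_Hom) (use Cons Hom_obj in auto)
  with Cons show ?case using comp_plus_left[of g x y "f r" z "lsum C y z f l"] by auto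
qed

lemma lsum_cong: "(\<And>r. r \<in> set l \<Longrightarrow> f r = g r) \<Longrightarrow> lsum C x y f l = lsum C x y g l"
  by (induction l) auto

lemma lsum_null:
  assumes "x \<in> Obj C" "y \<in> Obj C" "\<And>r. r \<in> set l \<Longrightarrow> f r = Null C x y"
  shows "lsum C x y f l = Null C x y"
  using assms by (induction l) (auto intro!: plus_null null_in_Hom)

lemma lsum_single:
  assumes "x \<in> Obj C" "y \<in> Obj C" "distinct l" "r \<in> set l" "f r \<in> Hom C x y"
    "\<And>s. s \<in> set l \<Longrightarrow> s \<noteq> r \<Longrightarrow> f s = Null C x y"
  shows "lsum C x y f l = f r"
  using assms
proof (induction l)
  case (Cons s l)
  show ?case
  proof (cases "s = r")
    case True
    then have "lsum C x y f l = Null C x y" using Cons by (intro lsum_null) auto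
    then show ?thesis using Cons True plus_null by auto
  next
    case False
    then show ?thesis using Cons null_plus by auto
  qed
qed auto

lemma lsum_plus:
  assumes "x \<in> Obj C" "y \<in> Obj C"
    "\<And>r. r \<in> set l \<Longrightarrow> f r \<in> Hom C x y" "\<And>r. r \<in> set l \<Longrightarrow> g r \<in> Hom C x y"
  shows "lsum C x y (\<lambda>r. f r \<oplus> g r) l = lsum C x y f l \<oplus> lsum C x y g l"
  using assms
proof (induction l)
  case Nil
  then show ?case using plus_null null_in_Hom by auto
next
  case (Cons r l)
  have h: "lsum C x y f l \<in> Hom C x y" "lsum C x y g l \<in> Hom C x y" "f r \<in> Hom C x y" "g r \<in> Hom C x y"
    using Cons by (auto intro!: lsum_in_Hom)
  from plus_swap[OF h(3) h(4) h(1) h(2)] Cons show ?case by auto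
qed

lemma lsum_scale:
  assumes "x \<in> Obj C" "y \<in> Obj C" "\<And>r. r \<in> set l \<Longrightarrow> f r \<in> Hom C x y"
  shows "a \<star> lsum C x y f l = lsum C x y (\<lambda>r. a \<star> f r) l"
  using assms
proof (induction l)
  case (Cons r l)
  then show ?case using scale_plus_right[of "f r" x y "lsum C x y f l" a] lsum_in_Hom[of x y l f] by auto
qed (auto simp: scale_null)

end

text \<open>The witnesses that \<open>direct_sum\<close> quantifies existentially, named so that a
  locale can fix them and a linear functor can carry them over.\<close>

definition direct_sum_maps ::
  "('o, 'm, 'k, 'z) lincat_scheme \<Rightarrow> 'o \<Rightarrow> 'o list \<Rightarrow> (nat \<Rightarrow> 'm) \<Rightarrow> (nat \<Rightarrow> 'm) \<Rightarrow> bool" where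
  "direct_sum_maps C x ys i p \<longleftrightarrow>
        (\<forall>r < length ys. i r \<in> Hom C (ys ! r) x \<and> p r \<in> Hom C x (ys ! r)) \<and>
        (\<forall>r < length ys. \<forall>s < length ys. p r \<cdot>\<^bsub>C\<^esub> i s =
           (if r = s then Id C (ys ! r) else Null C (ys ! s) (ys ! r))) \<and>
        lsum C x x (\<lambda>r. i r \<cdot>\<^bsub>C\<^esub> p r) [0..<length ys] = Id C x"

lemma direct_sum_iff_maps: "direct_sum C x ys \<longleftrightarrow> x \<in> Obj C \<and> set ys \<subseteq> Obj C \<and> (\<exists>i p. direct_sum_maps C x ys i p)"
  unfolding direct_sum_def direct_sum_maps_def by blast

locale direct_sum_diagram = linear_category C
  for C :: "('o, 'm, 'k::field, 'z) lincat_scheme" (structure) +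
  fixes x ys i p
  assumes x_obj: "x \<in> Obj C" and ys_obj: "set ys \<subseteq> Obj C" and maps: "direct_sum_maps C x ys i p"
begin

lemma ys_nth: "r < length ys \<Longrightarrow> ys ! r \<in> Obj C"
  using ys_obj by auto

lemma i_Hom: "r < length ys \<Longrightarrow> i r \<in> Hom C (ys ! r) x"
  and p_Hom: "r < length ys \<Longrightarrow> p r \<in> Hom C x (ys ! r)"
  and p_i: "r < length ys \<Longrightarrow> s < length ys \<Longrightarrow>
     p r \<cdot> i s = (if r = s then Id C (ys ! r) else Null C (ys ! s) (ys ! r))"
  and sum_ip: "lsum C x x (\<lambda>r. i r \<cdot> p r) [0..<length ys] = Id C x"
  using maps unfolding direct_sum_maps_def by blast+

lemma expand_in:
  assumes "f \<in> Hom C z x" shows "lsum C z x (\<lambda>r. i r \<cdot> (p r \<cdot> f)) [0..<length ys] = f"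
proof -
  have "f = lsum C x x (\<lambda>r. i r \<cdot> p r) [0..<length ys] \<cdot> f"
    using assms sum_ip id_comp by simp
  also have "\<dots> = lsum C z x (\<lambda>r. i r \<cdot> p r \<cdot> f) [0..<length ys]"
    using assms x_obj by (intro lsum_comp) (auto intro!: comp_in_Hom[OF p_Hom i_Hom])
  also have "\<dots> = lsum C z x (\<lambda>r. i r \<cdot> (p r \<cdot> f)) [0..<length ys]"
    using comp_assoc[OF assms p_Hom i_Hom] by (intro lsum_cong) auto
  finally show ?thesis ..
qed

lemma expand_out:
  assumes "f \<in> Hom C x z" shows "lsum C x z (\<lambda>r. (f \<cdot> i r) \<cdot> p r) [0..<length ys] = f"
proof -
  have "f = f \<cdot> lsum C x x (\<lambda>r. i r \<cdot> p r) [0..<length ys]"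
    using assms sum_ip comp_id by simp
  also have "\<dots> = lsum C x z (\<lambda>r. f \<cdot> (i r \<cdot> p r)) [0..<length ys]"
    using assms x_obj by (intro comp_lsum) (auto intro!: comp_in_Hom[OF p_Hom i_Hom])
  also have "\<dots> = lsum C x z (\<lambda>r. (f \<cdot> i r) \<cdot> p r) [0..<length ys]"
    using comp_assoc[OF p_Hom i_Hom assms] by (intro lsum_cong) auto
  finally show ?thesis ..
qed

lemma ext_in:
  assumes "f \<in> Hom C z x" "g \<in> Hom C z x" "\<And>r. r < length ys \<Longrightarrow> p r \<cdot> f = p r \<cdot> g" shows "f = g"
proof -
  have "lsum C z x (\<lambda>r. i r \<cdot> (p r \<cdot> f)) [0..<length ys] = lsum C z x (\<lambda>r. i r \<cdot> (p r \<cdot> g)) [0..<length ys]"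
    by (rule lsum_cong) (simp add: assms(3))
  then show ?thesis unfolding expand_in[OF assms(1)] expand_in[OF assms(2)] .
qed

lemma ext_out:
  assumes "f \<in> Hom C x z" "g \<in> Hom C x z" "\<And>r. r < length ys \<Longrightarrow> f \<cdot> i r = g \<cdot> i r" shows "f = g"
proof -
  have "lsum C x z (\<lambda>r. (f \<cdot> i r) \<cdot> p r) [0..<length ys] = lsum C x z (\<lambda>r. (g \<cdot> i r) \<cdot> p r) [0..<length ys]"
    by (rule lsum_cong) (simp add: assms(3))
  then show ?thesis unfolding expand_out[OF assms(1)] expand_out[OF assms(2)] .
qed

lemma p_comp_family:
  assumes "z \<in> Obj C" "\<And>r. r < length ys \<Longrightarrow> f r \<in> Hom C z (ys ! r)" "s < length ys"
  shows "p s \<cdot> lsum C z x (\<lambda>r. i r \<cdot> f r) [0..<length ys] = f s"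
proof -
  have i: "i r \<cdot> f r \<in> Hom C z x" if "r < length ys" for r
    using that comp_in_Hom[OF assms(2) i_Hom] by auto
  have "p s \<cdot> lsum C z x (\<lambda>r. i r \<cdot> f r) [0..<length ys] = lsum C z (ys ! s) (\<lambda>r. p s \<cdot> (i r \<cdot> f r)) [0..<length ys]"
    using assms i p_Hom by (intro comp_lsum) auto
  also have "\<dots> = lsum C z (ys ! s) (\<lambda>r. if r = s then f s else Null C z (ys ! s)) [0..<length ys]"
  proof (rule lsum_cong)
    fix r assume "r \<in> set [0..<length ys]"
    then have r: "r < length ys" by simp
    then have "p s \<cdot> (i r \<cdot> f r) = (if s = r then Id C (ys ! s) else Null C (ys ! r) (ys ! s)) \<cdot> f r"
      using comp_assoc[OF assms(2)[OF r] i_Hom[OF r] p_Hom[OF assms(3)]] p_i[OF assms(3) r] by simp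
    then show "p s \<cdot> (i r \<cdot> f r) = (if r = s then f s else Null C z (ys ! s))"
      using id_comp[OF assms(2)[OF assms(3)]] null_comp[OF assms(2)[OF r]] assms r ys_nth by auto
  qed
  also have "\<dots> = f s"
    using lsum_single[of z "ys ! s" "[0..<length ys]" s "\<lambda>r. if r = s then f s else Null C z (ys ! s)"] assms ys_nth
    by auto
  finally show ?thesis .
qed

end

context linear_category begin

lemma direct_sumE:
  assumes "direct_sum C x ys" obtains i p where "direct_sum_diagram C x ys i p"
proof -
  obtain i p where ip: "x \<in> Obj C" "set ys \<subseteq> Obj C" "direct_sum_maps C x ys i p"
    using assms unfolding direct_sum_iff_maps by blast
  show thesis
    using that[of i p] ip by (simp add: direct_sum_diagram_def direct_sum_diagram_axioms_def linear_category_axioms)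
qed

lemma direct_sum_obj: "direct_sum C x ys \<Longrightarrow> x \<in> Obj C" "direct_sum C x ys \<Longrightarrow> y \<in> set ys \<Longrightarrow> y \<in> Obj C"
  unfolding direct_sum_def by auto

lemma direct_sum_iso:
  assumes "direct_sum C x ys" "isomorphic C x z" shows "direct_sum C z ys"
proof -
  obtain i p where "direct_sum_diagram C x ys i p" using direct_sumE assms by blast
  then interpret d: direct_sum_diagram C x ys i p .
  obtain f where f: "isom C f" "Dom C f = x" "Cod C f = z" using assms isomorphicE by blast
  note h = d.i_Hom d.p_Hom
  have z: "z \<in> Obj C" using f by auto
  have "direct_sum_maps C z ys (\<lambda>r. f \<cdot> i r) (\<lambda>r. p r \<cdot> inv_arr C f)"
    unfolding direct_sum_maps_def
  proof (intro conjI allI impI)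
    fix r assume r: "r < length ys"
    show "f \<cdot> i r \<in> Hom C (ys ! r) z" "p r \<cdot> inv_arr C f \<in> Hom C z (ys ! r)"
      using h[OF r] f by (auto simp: Hom_iff)
    fix s assume s: "s < length ys"
    show "p r \<cdot> inv_arr C f \<cdot> (f \<cdot> i s) = (if r = s then Id C (ys ! r) else Null C (ys ! s) (ys ! r))"
      using h[OF r] h[OF s] f d.p_i[OF r s] by (auto simp: Hom_iff assoc_arr)
  next
    have "lsum C z z (\<lambda>r. f \<cdot> i r \<cdot> (p r \<cdot> inv_arr C f)) [0..<length ys]
        = lsum C z z (\<lambda>r. f \<cdot> (i r \<cdot> p r \<cdot> inv_arr C f)) [0..<length ys]"
      using h f by (intro lsum_cong) (auto simp: Hom_iff assoc_arr)
    also have "\<dots> = f \<cdot> lsum C z x (\<lambda>r. i r \<cdot> p r \<cdot> inv_arr C f) [0..<length ys]"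
      using h f z by (intro comp_lsum[symmetric]) (auto simp: Hom_iff)
    also have "\<dots> = f \<cdot> (lsum C x x (\<lambda>r. i r \<cdot> p r) [0..<length ys] \<cdot> inv_arr C f)"
      using h f z by (subst lsum_comp[of x "inv_arr C f" z x]) (auto simp: Hom_iff)
    also have "\<dots> = Id C z" using f by (auto simp: d.sum_ip)
    finally show "lsum C z z (\<lambda>r. f \<cdot> i r \<cdot> (p r \<cdot> inv_arr C f)) [0..<length ys] = Id C z" .
  qed
  then show ?thesis unfolding direct_sum_iff_maps using z d.ys_obj by blast
qed

lemma direct_sum_Nil: "direct_sum C x [] \<longleftrightarrow> zero_object C x"
  unfolding direct_sum_iff_maps direct_sum_maps_def zero_object_iff by auto

end

section \<open>Dimensions of Hom spaces\<close>

text \<open>Hom spaces are bare sets of arrows, so a basis is encoded by its coordinate map, a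
  linear isomorphism onto the functions supported on \<open>I\<close>. The index type stays free so
  that a direct sum of Hom spaces can be indexed by pairs.\<close>

definition coordinates ::
  "('o, 'm, 'k::field, 'z) lincat_scheme \<Rightarrow> 'o \<Rightarrow> 'o \<Rightarrow> 'i set \<Rightarrow> ('m \<Rightarrow> 'i \<Rightarrow> 'k) \<Rightarrow> bool" where
  "coordinates C x y I \<phi> \<longleftrightarrow>
     (\<forall>f \<in> Hom C x y. \<forall>g \<in> Hom C x y. \<phi> (f \<oplus>\<^bsub>C\<^esub> g) = (\<lambda>i. \<phi> f i + \<phi> g i)) \<and>
     (\<forall>a. \<forall>f \<in> Hom C x y. \<phi> (a \<star>\<^bsub>C\<^esub> f) = (\<lambda>i. a * \<phi> f i)) \<and>
     bij_betw \<phi> (Hom C x y) {v. \<forall>i. i \<notin> I \<longrightarrow> v i = 0}"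

text \<open>The working notion of dimension: coordinates can be transported along linear bijections
  and glued along direct sums, which is awkward for a least size of spanning sets. The link to
  \<open>hom_dim\<close> is \<open>hom_dim_eq\<close>.\<close>

definition has_dim :: "('o, 'm, 'k::field, 'z) lincat_scheme \<Rightarrow> 'o \<Rightarrow> 'o \<Rightarrow> nat \<Rightarrow> bool" where
  "has_dim C x y n \<longleftrightarrow> (\<exists>\<phi>. coordinates C x y {..<n} \<phi>)"

lemma (in linear_category) lspan_subset_Hom:
  assumes "x \<in> Obj C" "y \<in> Obj C" "S \<subseteq> Hom C x y" shows "lspan C x y S \<subseteq> Hom C x y"
proof
  fix f assume "f \<in> lspan C x y S"
  then show "f \<in> Hom C x y"
    by induction (use assms in \<open>auto intro: null_in_Hom plus_in_Hom scale_in_Hom\<close>)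
qed

locale hom_coordinates = linear_category C
  for C :: "('o, 'm, 'k::field, 'z) lincat_scheme" (structure) +
  fixes x y and I :: "'i set" and \<phi>
  assumes x: "x \<in> Obj C" and y: "y \<in> Obj C" and fin: "finite I"
    and coords: "coordinates C x y I \<phi>"
begin

lemma additive: "f \<in> Hom C x y \<Longrightarrow> g \<in> Hom C x y \<Longrightarrow> \<phi> (f \<oplus> g) i = \<phi> f i + \<phi> g i"
  and homogeneous: "f \<in> Hom C x y \<Longrightarrow> \<phi> (a \<star> f) i = a * \<phi> f i"
  and bij: "bij_betw \<phi> (Hom C x y) {v. \<forall>i. i \<notin> I \<longrightarrow> v i = 0}"
  using coords unfolding coordinates_def by auto

lemma inj: "f \<in> Hom C x y \<Longrightarrow> g \<in> Hom C x y \<Longrightarrow> \<phi> f = \<phi> g \<Longrightarrow> f = g"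
  using bij unfolding bij_betw_def inj_on_def by blast

lemma surj: assumes "\<And>i. i \<notin> I \<Longrightarrow> v i = 0" obtains f where "f \<in> Hom C x y" "\<phi> f = v"
proof -
  have "v \<in> \<phi> ` Hom C x y" using bij assms unfolding bij_betw_def by blast
  then show thesis using that by blast
qed

lemma support: "f \<in> Hom C x y \<Longrightarrow> i \<notin> I \<Longrightarrow> \<phi> f i = 0"
  using bij unfolding bij_betw_def by blast

lemma coord_null: "\<phi> (Null C x y) i = 0"
proof -
  have "\<phi> (0 \<star> Null C x y) i = 0 * \<phi> (Null C x y) i" by (rule homogeneous) (simp add: null_in_Hom x y)
  then show ?thesis using scale_null[OF x y] by simp
qed

definition basis where "basis i = (SOME f. f \<in> Hom C x y \<and> \<phi> f = (\<lambda>j. if j = i then 1 else 0))"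

lemma basis: assumes "i \<in> I" shows "basis i \<in> Hom C x y" "\<phi> (basis i) = (\<lambda>j. if j = i then 1 else 0)"
proof -
  obtain f where "f \<in> Hom C x y" "\<phi> f = (\<lambda>j. if j = i then 1 else 0)"
    by (rule surj[of "\<lambda>j. if j = i then 1 else 0"]) (use assms in auto)
  then have "\<exists>f. f \<in> Hom C x y \<and> \<phi> f = (\<lambda>j. if j = i then 1 else 0)" by blast
  from someI_ex[OF this] show "basis i \<in> Hom C x y" "\<phi> (basis i) = (\<lambda>j. if j = i then 1 else 0)"
    unfolding basis_def by auto
qed

text \<open>Induction on the set of coordinates that may be non-zero: subtracting the component
  along \<open>basis k\<close> clears coordinate \<open>k\<close>.\<close>

lemma basis_spans: "lspan C x y (basis ` I) = Hom C x y"
proof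
  show "lspan C x y (basis ` I) \<subseteq> Hom C x y"
    by (rule lspan_subset_Hom) (use x y basis in auto)
  have "\<And>f. f \<in> Hom C x y \<Longrightarrow> (\<And>i. i \<notin> K \<Longrightarrow> \<phi> f i = 0) \<Longrightarrow> f \<in> lspan C x y (basis ` I)"
    if "K \<subseteq> I" for K
    using finite_subset[OF that fin] that
  proof (induction K rule: finite_induct)
    case empty
    have "f = Null C x y" by (rule inj) (use empty x y null_in_Hom coord_null in auto)
    then show ?case by (simp add: lspan.null)
  next
    case (insert k K)
    have k: "basis k \<in> Hom C x y" "\<phi> (basis k) = (\<lambda>j. if j = k then 1 else 0)" using basis insert by auto
    define g where "g = f \<oplus> (- \<phi> f k) \<star> basis k"
    have g: "g \<in> Hom C x y" unfolding g_def using k insert by (intro plus_in_Hom scale_in_Hom) auto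
    have "\<phi> g i = \<phi> f i - \<phi> f k * (if i = k then 1 else 0)" for i
      unfolding g_def using k insert scale_in_Hom[OF k(1)] by (simp add: additive homogeneous)
    then have "g \<in> lspan C x y (basis ` I)" using insert g by auto
    then have "\<phi> f k \<star> basis k \<oplus> g \<in> lspan C x y (basis ` I)"
      using insert.prems by (intro lspan.step) auto
    moreover have "\<phi> f k \<star> basis k \<oplus> g = f"
      by (rule inj) (use k insert g scale_in_Hom[OF k(1)] plus_in_Hom in \<open>auto simp: additive homogeneous g_def\<close>)
    ultimately show ?case by simp
  qed
  from this[of I] show "Hom C x y \<subseteq> lspan C x y (basis ` I)" using support by blast
qed

lemma lspan_coords:
  assumes "S \<subseteq> Hom C x y" "finite S" "g \<in> lspan C x y S"
  shows "\<exists>c. \<forall>j. \<phi> g j = (\<Sum>s\<in>S. c s * \<phi> s j)"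
  using assms(3)
proof induction
  case null
  show ?case by (intro exI[of _ "\<lambda>_. 0"]) (simp add: coord_null)
next
  case (step f g a)
  then obtain c where c: "\<And>j. \<phi> g j = (\<Sum>s\<in>S. c s * \<phi> s j)" by blast
  have h: "g \<in> Hom C x y" "f \<in> Hom C x y" using step lspan_subset_Hom[OF x y assms(1)] assms(1) by auto
  have "\<phi> (a \<star> f \<oplus> g) j = (\<Sum>s\<in>S. (c(f := c f + a)) s * \<phi> s j)" for j
  proof -
    have "(\<Sum>s\<in>S. (c(f := c f + a)) s * \<phi> s j) = (c f + a) * \<phi> f j + (\<Sum>s\<in>S - {f}. c s * \<phi> s j)"
      using assms(2) step(1) by (subst sum.remove[of S f]) auto
    also have "\<dots> = a * \<phi> f j + (\<Sum>s\<in>S. c s * \<phi> s j)"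
      using sum.remove[OF assms(2) step(1), of "\<lambda>s. c s * \<phi> s j"] by (simp add: algebra_simps)
    finally show ?thesis using h c by (simp add: additive homogeneous scale_in_Hom)
  qed
  then show ?case by blast
qed

text \<open>With fewer spanning arrows than basis arrows, \<open>nontrivial_relation\<close> applied
  to the coefficients of the basis in terms of \<open>S\<close> yields a linear relation among the
  basis arrows, which their unit coordinates exclude.\<close>

lemma card_le_spanning:
  assumes "S \<subseteq> Hom C x y" "finite S" "lspan C x y S = Hom C x y" shows "card I \<le> card S"
proof (rule ccontr)
  assume "\<not> card I \<le> card S"
  have "\<exists>c. \<forall>j. \<phi> (basis i) j = (\<Sum>s\<in>S. c s * \<phi> s j)" if "i \<in> I" for i
    using lspan_coords[OF assms(1,2)] assms(3) basis that by blast
  then obtain c where c: "\<And>i j. i \<in> I \<Longrightarrow> \<phi> (basis i) j = (\<Sum>s\<in>S. c i s * \<phi> s j)" by metis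
  obtain a where a: "\<exists>i\<in>I. a i \<noteq> 0" "\<forall>s\<in>S. (\<Sum>i\<in>I. a i * c i s) = 0"
    using nontrivial_relation[OF assms(2) fin, of c] \<open>\<not> card I \<le> card S\<close> by auto
  have "a j = 0" if "j \<in> I" for j
  proof -
    have "a j = (\<Sum>i\<in>I. a i * \<phi> (basis i) j)"
      using that fin basis(2) by (simp add: if_distrib sum.delta cong: if_cong)
    also have "\<dots> = (\<Sum>i\<in>I. \<Sum>s\<in>S. a i * c i s * \<phi> s j)"
      using c by (simp add: sum_distrib_left algebra_simps)
    also have "\<dots> = (\<Sum>s\<in>S. (\<Sum>i\<in>I. a i * c i s) * \<phi> s j)"
      by (subst sum.swap) (simp add: sum_distrib_right)
    finally show ?thesis using a by simp
  qed
  with a show False by blast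
qed

lemma hom_dim_eq: "hom_dim C x y = card I"
  unfolding hom_dim_def
proof (rule Least_equality)
  have "inj_on basis I"
    by (rule inj_onI) (metis basis(2) zero_neq_one)
  then show "\<exists>S\<subseteq>Hom C x y. finite S \<and> card S = card I \<and> lspan C x y S = Hom C x y"
    using basis_spans basis fin by (intro exI[of _ "basis ` I"]) (auto simp: card_image)
qed (use card_le_spanning in blast)

text \<open>Reindexes by an initial segment of the natural numbers, the common form in which
  dimensions of different Hom spaces are compared.\<close>

lemma has_dim: "has_dim C x y (card I)"
proof -
  obtain b where b: "bij_betw b {..<card I} I" using ex_bij_betw_nat_finite[OF fin] by (auto simp: atLeast0LessThan)
  define \<psi> where "\<psi> f j = (if j < card I then \<phi> f (b j) else 0)" for f j
  have bI: "j < card I \<Longrightarrow> b j \<in> I" for j using b by (auto simp: bij_betw_def)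
  have "coordinates C x y {..<card I} \<psi>"
    unfolding coordinates_def
  proof (intro conjI ballI allI)
    show "bij_betw \<psi> (Hom C x y) {v. \<forall>i. i \<notin> {..<card I} \<longrightarrow> v i = 0}"
    proof (rule bij_betw_imageI)
      show "inj_on \<psi> (Hom C x y)"
      proof (rule inj_onI)
        fix f g assume fg: "f \<in> Hom C x y" "g \<in> Hom C x y" "\<psi> f = \<psi> g"
        show "f = g"
        proof (rule inj[OF fg(1,2)], rule ext)
          fix i show "\<phi> f i = \<phi> g i"
          proof (cases "i \<in> I")
            case True
            then have "i \<in> b ` {..<card I}" using b by (simp add: bij_betw_def)
            then obtain j where "j < card I" "b j = i" by auto
            then show ?thesis using fun_cong[OF fg(3), of j] by (auto simp: \<psi>_def)
          qed (use support fg in auto)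
        qed
      qed
      show "\<psi> ` Hom C x y = {v. \<forall>i. i \<notin> {..<card I} \<longrightarrow> v i = 0}"
      proof (intro equalityI subsetI)
        fix v :: "nat \<Rightarrow> 'k" assume v: "v \<in> {v. \<forall>i. i \<notin> {..<card I} \<longrightarrow> v i = 0}"
        obtain f where f: "f \<in> Hom C x y" "\<phi> f = (\<lambda>i. if i \<in> I then v (inv_into {..<card I} b i) else 0)"
          by (rule surj[of "\<lambda>i. if i \<in> I then v (inv_into {..<card I} b i) else 0"]) auto
        have "\<psi> f = v"
          using v bI bij_betw_inv_into_left[OF b] by (auto simp: \<psi>_def f fun_eq_iff)
        then show "v \<in> \<psi> ` Hom C x y" using f by blast
      qed (auto simp: \<psi>_def)
    qed
  qed (auto simp: \<psi>_def additive homogeneous)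
  then show ?thesis unfolding has_dim_def by blast
qed

end

context linear_category begin

lemma hom_coordinatesI:
  "x \<in> Obj C \<Longrightarrow> y \<in> Obj C \<Longrightarrow> finite I \<Longrightarrow> coordinates C x y I \<phi> \<Longrightarrow> hom_coordinates C x y I \<phi>"
  by (simp add: hom_coordinates_def hom_coordinates_axioms_def linear_category_axioms)

lemma has_dim_hom_dim:
  assumes "has_dim C x y n" "x \<in> Obj C" "y \<in> Obj C" shows "hom_dim C x y = n"
proof -
  obtain \<phi> where "coordinates C x y {..<n} \<phi>" using assms unfolding has_dim_def by auto
  then interpret hom_coordinates C x y "{..<n}" \<phi> using assms by (intro hom_coordinatesI) auto
  show ?thesis using hom_dim_eq by simp
qed

lemma has_dim_zero:
  assumes "\<And>f. f \<in> Hom C x y \<Longrightarrow> f = Null C x y" "x \<in> Obj C" "y \<in> Obj C"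
  shows "has_dim C x y 0"
proof -
  have "Hom C x y = {Null C x y}" using assms null_in_Hom by blast
  then have "coordinates C x y {..<0::nat} (\<lambda>_ _. 0)"
    unfolding coordinates_def by (auto simp: bij_betw_def fun_eq_iff)
  then show ?thesis unfolding has_dim_def by blast
qed

lemma has_dim_one:
  assumes "u \<in> Hom C x y" "u \<noteq> Null C x y" "\<And>f. f \<in> Hom C x y \<Longrightarrow> \<exists>c. f = c \<star> u"
  shows "has_dim C x y 1"
proof -
  define c where "c f = (THE c. f = c \<star> u)" for f
  have c: "c (a \<star> u) = a" for a
    unfolding c_def using scale_inj[OF assms(1,2)] by (intro the_equality) auto
  have f: "f = c f \<star> u" if "f \<in> Hom C x y" for f using assms(3)[OF that] c by auto
  have "coordinates C x y {..<1} (\<lambda>f i. if i = (0::nat) then c f else 0)"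
    unfolding coordinates_def
  proof (intro conjI ballI allI)
    fix f g a assume fg: "f \<in> Hom C x y" "g \<in> Hom C x y"
    have "c (f \<oplus> g) = c f + c g"
      using f[OF fg(1)] f[OF fg(2)] scale_plus_left[OF assms(1), of "c f" "c g"] c by metis
    then show "(\<lambda>i. if i = (0::nat) then c (f \<oplus> g) else 0) = (\<lambda>i. (if i = 0 then c f else 0) + (if i = 0 then c g else 0))"
      by auto
  next
    fix a f assume "f \<in> Hom C x y"
    have "c (a \<star> f) = a * c f" using f[OF \<open>f \<in> Hom C x y\<close>] scale_scale[OF assms(1), of a "c f"] c by metis
    then show "(\<lambda>i. if i = (0::nat) then c (a \<star> f) else 0) = (\<lambda>i. a * (if i = 0 then c f else 0))" by auto
  next
    have "inj_on (\<lambda>f i. if i = (0::nat) then c f else 0) (Hom C x y)"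
    proof (rule inj_onI)
      fix g h assume gh: "g \<in> Hom C x y" "h \<in> Hom C x y"
        and e: "(\<lambda>i. if i = (0::nat) then c g else 0) = (\<lambda>i. if i = (0::nat) then c h else 0)"
      from fun_cong[OF e, of 0] have "c g = c h" by simp
      then show "g = h" using f[OF gh(1)] f[OF gh(2)] by metis
    qed
    moreover have "v \<in> (\<lambda>f i. if i = (0::nat) then c f else 0) ` Hom C x y" if "\<forall>i. i \<notin> {..<1} \<longrightarrow> v i = 0" for v
    proof (rule image_eqI)
      show "v = (\<lambda>i. if i = (0::nat) then c (v 0 \<star> u) else 0)" using that c by (auto simp: fun_eq_iff)
    qed (use assms scale_in_Hom in blast)
    ultimately show "bij_betw (\<lambda>f i. if i = (0::nat) then c f else 0) (Hom C x y) {v. \<forall>i. i \<notin> {..<1} \<longrightarrow> v i = 0}"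
      unfolding bij_betw_def by (intro conjI equalityI subsetI) auto
  qed
  then show ?thesis unfolding has_dim_def by blast
qed

text \<open>Meant for the duality adjunction, whose bijection between Hom(u \<otimes> x, v) and
  Hom(u, v \<otimes> y) is linear.\<close>

lemma has_dim_transfer:
  assumes "has_dim C x y n"
    and bij: "bij_betw T (Hom D x' y') (Hom C x y)"
    and plus: "\<And>f g. f \<in> Hom D x' y' \<Longrightarrow> g \<in> Hom D x' y' \<Longrightarrow> T (f \<oplus>\<^bsub>D\<^esub> g) = T f \<oplus> T g"
    and scale: "\<And>a f. f \<in> Hom D x' y' \<Longrightarrow> T (a \<star>\<^bsub>D\<^esub> f) = a \<star> T f"
  shows "has_dim D x' y' n"
proof -
  obtain \<phi> where \<phi>: "coordinates C x y {..<n} \<phi>" using assms unfolding has_dim_def by auto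
  have T: "T f \<in> Hom C x y" if "f \<in> Hom D x' y'" for f using bij that by (auto simp: bij_betw_def)
  have "coordinates D x' y' {..<n} (\<phi> \<circ> T)"
    using \<phi> T plus scale bij_betw_trans[OF bij] unfolding coordinates_def by auto
  then show ?thesis unfolding has_dim_def by blast
qed

text \<open>Composition with the projections identifies Hom(z, x) with the product of the Hom spaces
  into the summands; the coordinates of the factors are put side by side over the disjoint union
  \<open>I\<close> of their index sets.\<close>

lemma has_dim_direct_sum_in:
  assumes "direct_sum C x ys" "\<And>r. r < length ys \<Longrightarrow> has_dim C z (ys ! r) (n r)" "z \<in> Obj C"
  shows "has_dim C z x (\<Sum>r<length ys. n r)"
proof -
  obtain i p where "direct_sum_diagram C x ys i p" using direct_sumE assms by blast
  then interpret d: direct_sum_diagram C x ys i p .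
  have "\<forall>r. \<exists>\<phi>. r < length ys \<longrightarrow> coordinates C z (ys ! r) {..<n r} \<phi>" using assms(2) unfolding has_dim_def by blast
  then obtain \<phi> where \<phi>: "\<And>r. r < length ys \<Longrightarrow> coordinates C z (ys ! r) {..<n r} (\<phi> r)" by metis
  have hc: "hom_coordinates C z (ys ! r) {..<n r} (\<phi> r)" if "r < length ys" for r
    by (rule hom_coordinatesI) (use \<phi> that assms d.ys_nth in auto)
  define I where "I = Sigma {..<length ys} (\<lambda>r. {..<n r})"
  define \<psi> where "\<psi> f = (\<lambda>(r, j). if r < length ys then \<phi> r (p r \<cdot> f) j else 0)" for f
  have pf: "p r \<cdot> f \<in> Hom C z (ys ! r)" if "r < length ys" "f \<in> Hom C z x" for r f
    using that d.p_Hom comp_in_Hom by blast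
  have "coordinates C z x I \<psi>"
    unfolding coordinates_def
  proof (intro conjI ballI allI)
    fix f g assume fg: "f \<in> Hom C z x" "g \<in> Hom C z x"
    show "\<psi> (f \<oplus> g) = (\<lambda>i. \<psi> f i + \<psi> g i)"
      using fg pf hom_coordinates.additive[OF hc] comp_plus_right[OF fg d.p_Hom] by (auto simp: \<psi>_def fun_eq_iff)
  next
    fix a f assume f: "f \<in> Hom C z x"
    show "\<psi> (a \<star> f) = (\<lambda>i. a * \<psi> f i)"
      using f pf hom_coordinates.homogeneous[OF hc] comp_scale_right[OF f d.p_Hom] by (auto simp: \<psi>_def fun_eq_iff)
  next
    show "bij_betw \<psi> (Hom C z x) {v. \<forall>i. i \<notin> I \<longrightarrow> v i = 0}"
    proof (rule bij_betw_imageI)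
      show "inj_on \<psi> (Hom C z x)"
      proof (rule inj_onI)
        fix f g assume fg: "f \<in> Hom C z x" "g \<in> Hom C z x" "\<psi> f = \<psi> g"
        show "f = g"
        proof (rule d.ext_in[OF fg(1,2)])
          fix r assume r: "r < length ys"
          show "p r \<cdot> f = p r \<cdot> g"
          proof (rule hom_coordinates.inj[OF hc[OF r]])
            show "\<phi> r (p r \<cdot> f) = \<phi> r (p r \<cdot> g)"
            proof
              fix j show "\<phi> r (p r \<cdot> f) j = \<phi> r (p r \<cdot> g) j"
                using fun_cong[OF fg(3), of "(r, j)"] r by (simp add: \<psi>_def)
            qed
          qed (use pf fg r in auto)
        qed
      qed
      show "\<psi> ` Hom C z x = {v. \<forall>i. i \<notin> I \<longrightarrow> v i = 0}"
      proof (intro equalityI subsetI)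
        fix v assume "v \<in> \<psi> ` Hom C z x"
        then show "v \<in> {v. \<forall>i. i \<notin> I \<longrightarrow> v i = 0}"
          using hom_coordinates.support[OF hc] pf by (auto simp: \<psi>_def I_def)
      next
        fix v :: "nat \<times> nat \<Rightarrow> 'k" assume v: "v \<in> {v. \<forall>i. i \<notin> I \<longrightarrow> v i = 0}"
        have "\<forall>r. \<exists>f. r < length ys \<longrightarrow> f \<in> Hom C z (ys ! r) \<and> \<phi> r f = (\<lambda>j. v (r, j))"
        proof (intro allI)
          fix r show "\<exists>f. r < length ys \<longrightarrow> f \<in> Hom C z (ys ! r) \<and> \<phi> r f = (\<lambda>j. v (r, j))"
          proof (cases "r < length ys")
            case True
            obtain f where "f \<in> Hom C z (ys ! r)" "\<phi> r f = (\<lambda>j. v (r, j))"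
              by (rule hom_coordinates.surj[OF hc[OF True], of "\<lambda>j. v (r, j)"]) (use v True in \<open>auto simp: I_def\<close>)
            then show ?thesis by blast
          qed simp
        qed
        then obtain f where f: "\<And>r. r < length ys \<Longrightarrow> f r \<in> Hom C z (ys ! r)"
          "\<And>r. r < length ys \<Longrightarrow> \<phi> r (f r) = (\<lambda>j. v (r, j))" by metis
        define F where "F = lsum C z x (\<lambda>r. i r \<cdot> f r) [0..<length ys]"
        have F: "F \<in> Hom C z x" unfolding F_def
          by (rule lsum_in_Hom) (use assms d.x_obj comp_in_Hom[OF f(1) d.i_Hom] in auto)
        have "p r \<cdot> F = f r" if "r < length ys" for r
          unfolding F_def using d.p_comp_family[OF assms(3) f(1)] that by auto
        then have "\<psi> F = v" using f v by (auto simp: \<psi>_def fun_eq_iff I_def)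
        with F show "v \<in> \<psi> ` Hom C z x" by blast
      qed
    qed
  qed
  then interpret h: hom_coordinates C z x I \<psi>
    by (intro hom_coordinatesI) (use assms d.x_obj in \<open>auto simp: I_def\<close>)
  show ?thesis using h.has_dim by (simp add: I_def)
qed

text \<open>The opposite category turns statements about the first argument of Hom into statements about the
  second one.\<close>

definition opposite :: "('o, 'm, 'k) lincat" where
  "opposite = \<lparr>Obj = Obj C, Arr = Arr C, Dom = Cod C, Cod = Dom C, Id = Id C,
     Comp = (\<lambda>g f. f \<cdot> g), Plus = Plus C, Null = (\<lambda>x y. Null C y x), Scale = Scale C\<rparr>"

lemma Hom_opposite [simp]: "Hom opposite x y = Hom C y x"
  unfolding Hom_def opposite_def by auto

lemma linear_category_opposite: "linear_category opposite"
  by unfold_locales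
    (simp_all add: Hom_opposite, simp_all add: opposite_def id_in_Hom comp_in_Hom comp_assoc null_in_Hom plus_in_Hom scale_in_Hom plus_assoc
      plus_null plus_inverse scale_one scale_scale scale_plus_left scale_plus_right comp_plus_left comp_plus_right
      comp_scale_left comp_scale_right id_comp comp_id plus_commute)

lemma direct_sum_opposite: assumes "direct_sum C x ys" shows "direct_sum opposite x ys"
proof -
  obtain i p where "direct_sum_diagram C x ys i p" using direct_sumE assms by blast
  then interpret d: direct_sum_diagram C x ys i p .
  have "direct_sum_maps opposite x ys p i"
    unfolding direct_sum_maps_def using d.i_Hom d.p_Hom d.p_i d.sum_ip by (auto simp: opposite_def[symmetric]) (auto simp: opposite_def)
  then show ?thesis unfolding direct_sum_iff_maps using d.x_obj d.ys_obj by (auto simp: opposite_def)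
qed

lemma has_dim_opposite [simp]: "has_dim opposite x y n \<longleftrightarrow> has_dim C y x n"
  unfolding has_dim_def coordinates_def by (simp add: Hom_opposite) (simp add: opposite_def)

lemma has_dim_direct_sum_out:
  assumes "direct_sum C x ys" "\<And>r. r < length ys \<Longrightarrow> has_dim C (ys ! r) z (n r)" "z \<in> Obj C"
  shows "has_dim C x z (\<Sum>r<length ys. n r)"
proof -
  interpret o: linear_category opposite by (rule linear_category_opposite)
  have "z \<in> Obj opposite" using assms by (simp add: opposite_def)
  then show ?thesis using o.has_dim_direct_sum_in[OF direct_sum_opposite[OF assms(1)], of z n] assms by simp
qed

end

section \<open>Semisimple categories over an algebraically closed field\<close>

lemma (in linear_category) lspan_lsum:
  assumes "x \<in> Obj C" "y \<in> Obj C" "set ss \<subseteq> Hom C x y" "distinct ss" "g \<in> lspan C x y (set ss)"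
  shows "\<exists>c. g = lsum C x y (\<lambda>s. c s \<star> s) ss"
  using assms(5)
proof induction
  case null
  have "lsum C x y (\<lambda>s. 0 \<star> s) ss = Null C x y"
    using assms by (intro lsum_null) (auto simp: scale_zero)
  then show ?case by (intro exI[of _ "\<lambda>_. 0"]) simp
next
  case (step f g a)
  then obtain c where c: "g = lsum C x y (\<lambda>s. c s \<star> s) ss" by blast
  have f: "a \<star> f \<in> Hom C x y" using step assms by (auto intro: scale_in_Hom)
  have s: "\<And>s. s \<in> set ss \<Longrightarrow> s \<in> Hom C x y" using assms by auto
  have "a \<star> f = lsum C x y (\<lambda>s. (if s = f then a else 0) \<star> s) ss"
    using lsum_single[of x y ss f "\<lambda>s. (if s = f then a else 0) \<star> s"] assms step(1) f s
    by (auto simp: scale_zero)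
  then have "a \<star> f \<oplus> g = lsum C x y (\<lambda>s. (if s = f then a else 0) \<star> s) ss \<oplus> lsum C x y (\<lambda>s. c s \<star> s) ss"
    using c by simp
  also have "\<dots> = lsum C x y (\<lambda>s. (if s = f then a else 0) \<star> s \<oplus> c s \<star> s) ss"
    using assms(1,2) scale_in_Hom s by (intro lsum_plus[symmetric]) blast+
  also have "\<dots> = lsum C x y (\<lambda>s. ((if s = f then a else 0) + c s) \<star> s) ss"
    using s by (intro lsum_cong) (simp add: scale_plus_left[of _ x y])
  finally show ?case by (rule exI[of _ "\<lambda>s. (if s = f then a else 0) + c s"])
qed

lemma (in linear_category) lsum_lsum:
  assumes "x \<in> Obj C" "y \<in> Obj C" "set ss \<subseteq> Hom C x y"
  shows "lsum C x y (\<lambda>i. a i \<star> lsum C x y (\<lambda>s. c i s \<star> s) ss) l =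
    lsum C x y (\<lambda>s. (\<Sum>i\<leftarrow>l. a i * c i s) \<star> s) ss"
proof (induction l)
  case Nil
  have "lsum C x y (\<lambda>s. 0 \<star> s) ss = Null C x y"
    using assms by (intro lsum_null) (auto simp: scale_zero)
  then show ?case by simp
next
  case (Cons i l)
  have s: "\<And>s. s \<in> set ss \<Longrightarrow> s \<in> Hom C x y" using assms by auto
  have "a i \<star> lsum C x y (\<lambda>s. c i s \<star> s) ss = lsum C x y (\<lambda>s. a i \<star> c i s \<star> s) ss"
    using s assms by (intro lsum_scale) (auto intro: scale_in_Hom)
  also have "\<dots> = lsum C x y (\<lambda>s. (a i * c i s) \<star> s) ss"
    using s by (intro lsum_cong) (simp add: scale_scale[of _ x y])
  finally have "a i \<star> lsum C x y (\<lambda>s. c i s \<star> s) ss \<oplus> lsum C x y (\<lambda>s. (\<Sum>i\<leftarrow>l. a i * c i s) \<star> s) ss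
     = lsum C x y (\<lambda>s. (a i * c i s) \<star> s \<oplus> (\<Sum>i\<leftarrow>l. a i * c i s) \<star> s) ss"
    using s assms by (subst lsum_plus) (auto intro: scale_in_Hom)
  also have "\<dots> = lsum C x y (\<lambda>s. (\<Sum>i\<leftarrow>i # l. a i * c i s) \<star> s) ss"
    using s by (intro lsum_cong) (simp add: scale_plus_left[of _ x y])
  finally show ?case using Cons by simp
qed

text \<open>Writing each \<open>g i\<close> in terms of \<open>S\<close> turns the relation into
  \<open>card S\<close> equations in \<open>n\<close> unknowns, one for each spanning arrow.\<close>

lemma (in linear_category) linear_dependence:
  assumes "x \<in> Obj C" "y \<in> Obj C" "finite S" "S \<subseteq> Hom C x y" "lspan C x y S = Hom C x y"
    "\<And>i. g i \<in> Hom C x y" "card S < n"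
  shows "\<exists>a. (\<exists>i<n. a i \<noteq> 0) \<and> lsum C x y (\<lambda>i. a i \<star> g i) [0..<n] = Null C x y"
proof -
  obtain ss where ss: "set ss = S" "distinct ss" using finite_distinct_list[OF assms(3)] by blast
  have "\<exists>c. g i = lsum C x y (\<lambda>s. c s \<star> s) ss" for i
    using lspan_lsum[of x y ss "g i"] assms ss by auto
  then obtain c where c: "\<And>i. g i = lsum C x y (\<lambda>s. c i s \<star> s) ss" by metis
  obtain a where a: "\<exists>i\<in>{..<n}. a i \<noteq> 0" "\<forall>s\<in>S. (\<Sum>i<n. a i * c i s) = 0"
    using nontrivial_relation[OF assms(3), of "{..<n}" c] assms(7) by auto
  have "lsum C x y (\<lambda>i. a i \<star> g i) [0..<n] = lsum C x y (\<lambda>s. (\<Sum>i\<leftarrow>[0..<n]. a i * c i s) \<star> s) ss"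
    unfolding c using assms ss by (intro lsum_lsum) auto
  also have "\<dots> = Null C x y"
    using assms ss a by (intro lsum_null) (auto simp: interv_sum_list_conv_sum_set_nat atLeast0LessThan scale_zero)
  finally show ?thesis using a by auto
qed

text \<open>Evaluation of a polynomial at the endomorphism \<open>f\<close>, by Horner's
  scheme.\<close>

definition poly_arr :: "('o, 'm, 'k::field, 'z) lincat_scheme \<Rightarrow> 'o \<Rightarrow> 'm \<Rightarrow> 'k poly \<Rightarrow> 'm" where
  "poly_arr C x f q = fold_coeffs (\<lambda>a g. a \<star>\<^bsub>C\<^esub> Id C x \<oplus>\<^bsub>C\<^esub> f \<cdot>\<^bsub>C\<^esub> g) q (Null C x x)"

context linear_category begin

lemma poly_arr_0: "poly_arr C x f 0 = Null C x x"
  unfolding poly_arr_def by simp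

context
  fixes x f assumes f: "f \<in> Hom C x x"
begin

lemma fx: "x \<in> Obj C" "Id C x \<in> Hom C x x" "Null C x x \<in> Hom C x x"
  using f Hom_obj id_in_Hom null_in_Hom by auto

lemma poly_arr_pCons: "poly_arr C x f (pCons a q) = a \<star> Id C x \<oplus> f \<cdot> poly_arr C x f q"
proof (cases "a = 0 \<and> q = 0")
  case True
  then show ?thesis using fx f by (simp add: poly_arr_0 scale_zero[of _ x x] comp_null[of _ x x x] plus_null)
next
  case False
  then have "pCons a q \<noteq> 0" by auto
  then show ?thesis unfolding poly_arr_def using fold_coeffs_pCons_not_0_0_eq False by (cases "q = 0") auto
qed

lemma poly_arr_in_Hom: "poly_arr C x f q \<in> Hom C x x"
proof (induction q)
  case (pCons a q)
  then show ?case unfolding poly_arr_pCons using f fx by (intro plus_in_Hom scale_in_Hom comp_in_Hom) auto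
qed (use fx poly_arr_0 in auto)

lemma poly_arr_add: "poly_arr C x f (p + q) = poly_arr C x f p \<oplus> poly_arr C x f q"
proof (induction p arbitrary: q)
  case 0
  then show ?case using null_plus[OF poly_arr_in_Hom] by (simp add: poly_arr_0)
next
  case (pCons a p)
  obtain b q' where q: "q = pCons b q'" by (cases q)
  note h = poly_arr_in_Hom[of p] poly_arr_in_Hom[of q']
  have "poly_arr C x f (pCons a p + q) = (a + b) \<star> Id C x \<oplus> f \<cdot> (poly_arr C x f p \<oplus> poly_arr C x f q')"
    using pCons by (simp add: q poly_arr_pCons)
  also have "\<dots> = (a \<star> Id C x \<oplus> b \<star> Id C x) \<oplus> (f \<cdot> poly_arr C x f p \<oplus> f \<cdot> poly_arr C x f q')"
    using scale_plus_left[OF fx(2)] comp_plus_right[OF h f] by simp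
  also have "\<dots> = poly_arr C x f (pCons a p) \<oplus> poly_arr C x f q"
    unfolding q poly_arr_pCons using fx h f by (intro plus_swap scale_in_Hom comp_in_Hom) auto
  finally show ?case .
qed

lemma poly_arr_smult: "poly_arr C x f (smult c q) = c \<star> poly_arr C x f q"
proof (induction q)
  case 0
  then show ?case using fx scale_null by (simp add: poly_arr_0)
next
  case (pCons a q)
  note h = poly_arr_in_Hom[of q]
  show ?case using pCons fx f h comp_in_Hom[OF h f]
    by (simp add: poly_arr_pCons scale_scale[of _ x x] scale_plus_right[of _ x x] comp_scale_right[of _ x x _ x] scale_in_Hom)
qed

lemma poly_arr_root:
  assumes "poly q c = 0"
  shows "\<exists>r. q = [:-c, 1:] * r \<and> poly_arr C x f q = (f \<oplus> (- c) \<star> Id C x) \<cdot> poly_arr C x f r"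
proof -
  obtain r where r: "q = [:-c, 1:] * r" using assms by (auto simp: poly_eq_0_iff_dvd dvd_def)
  note h = poly_arr_in_Hom[of r]
  have "poly_arr C x f q = poly_arr C x f (smult (- c) r + pCons 0 r)" unfolding r by simp
  also have "\<dots> = (- c) \<star> poly_arr C x f r \<oplus> f \<cdot> poly_arr C x f r"
    unfolding poly_arr_add poly_arr_smult poly_arr_pCons
    using fx f h comp_in_Hom[OF h f] by (simp add: scale_zero[of _ x x] null_plus)
  also have "\<dots> = f \<cdot> poly_arr C x f r \<oplus> ((- c) \<star> Id C x) \<cdot> poly_arr C x f r"
    using fx f h plus_commute[of "f \<cdot> poly_arr C x f r" x x] comp_in_Hom[OF h f] scale_in_Hom[OF h]
    by (simp add: comp_scale_left[of _ x x _ x] id_comp[of _ x x])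
  also have "\<dots> = (f \<oplus> (- c) \<star> Id C x) \<cdot> poly_arr C x f r"
    using comp_plus_left[OF h f scale_in_Hom[OF fx(2)]] by simp
  finally show ?thesis using r by blast
qed

lemma poly_arr_lsum:
  "lsum C x x (\<lambda>i. a i \<star> poly_arr C x f (monom 1 i)) l = poly_arr C x f (\<Sum>i\<leftarrow>l. monom (a i) i)"
  by (induction l) (simp_all add: poly_arr_0 poly_arr_add smult_monom flip: poly_arr_smult)

text \<open>If every f - c were invertible, the linear factors of the annihilating polynomial could
  be cancelled one at a time until a non-zero constant annihilates \<open>Id C x\<close>, which is
  impossible for a non-zero object.\<close>

lemma poly_arr_eq_null:
  fixes q :: "'k poly"
  assumes alg_closed: "\<And>q :: 'k poly. degree q > 0 \<Longrightarrow> \<exists>z. poly q z = 0"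
    and x: "Id C x \<noteq> Null C x x" and "q \<noteq> 0" "poly_arr C x f q = Null C x x"
  shows "\<exists>c. \<not> isom C (f \<oplus> (- c) \<star> Id C x)"
  using assms(3,4)
proof (induction "degree q" arbitrary: q rule: less_induct)
  case less
  show ?case
  proof (cases "degree q = 0")
    case True
    then obtain a where a: "q = [:a:]" by (rule degree_eq_zeroE)
    with less have "a \<noteq> 0" "a \<star> Id C x = Null C x x"
      using f fx by (auto simp: poly_arr_pCons poly_arr_0 comp_null[of _ x x x] plus_null scale_in_Hom)
    then show ?thesis using scale_eq_null[OF fx(2)] x by blast
  next
    case False
    then obtain c where "poly q c = 0" using alg_closed by auto
    then obtain r where r: "q = [:-c, 1:] * r" "poly_arr C x f q = (f \<oplus> (- c) \<star> Id C x) \<cdot> poly_arr C x f r"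
      using poly_arr_root by blast
    let ?g = "f \<oplus> (- c) \<star> Id C x"
    have g: "?g \<in> Hom C x x" using f fx by (intro plus_in_Hom scale_in_Hom)
    show ?thesis
    proof (cases "isom C ?g")
      case True
      have "?g \<cdot> poly_arr C x f r = ?g \<cdot> Null C x x" using r less comp_null[OF g] fx by simp
      then have "poly_arr C x f r = Null C x x"
        using isom_cancel_left[OF True] g fx poly_arr_in_Hom[of r] by (auto simp: Hom_iff)
      moreover have "r \<noteq> 0" using less r(1) by auto
      moreover have "degree r < degree q" unfolding r(1) using \<open>r \<noteq> 0\<close> by (subst degree_mult_eq) auto
      ultimately show ?thesis using less by blast
    qed blast
  qed
qed

end

lemma simple_object_obj: "simple_object C x \<Longrightarrow> x \<in> Obj C"
  unfolding simple_object_def by blast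

lemma not_zero_id: "simple_object C x \<Longrightarrow> Id C x \<noteq> Null C x x"
  unfolding simple_object_def zero_object_iff by blast

lemma isom_not_null:
  assumes "isom C f" "\<not> zero_object C (Dom C f)" shows "f \<noteq> Null C (Dom C f) (Cod C f)"
proof
  assume "f = Null C (Dom C f) (Cod C f)"
  then have "inv_arr C f \<cdot> f = Null C (Dom C f) (Dom C f)"
    using comp_null[of "inv_arr C f" "Cod C f" "Dom C f" "Dom C f"] assms by (simp add: Hom_iff)
  then show False using assms by (simp add: zero_object_iff)
qed

end

locale semisimple_category =
  fixes C :: "('o, 'm, 'k::alg_closed_field, 'z) lincat_scheme" (structure)
  assumes semisimple: "finite_semisimple_category C"
begin

lemma abelian: "abelian_category C"
  using semisimple unfolding finite_semisimple_category_def by blast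

sublocale linear_category C
  using abelian unfolding abelian_category_def by blast

lemma finite_Irr: "finite (Irr C)"
  using semisimple unfolding finite_semisimple_category_def by blast

lemma decompose: "x \<in> Obj C \<Longrightarrow> \<exists>ys. (\<forall>y \<in> set ys. simple_object C y) \<and> direct_sum C x ys"
  using semisimple unfolding finite_semisimple_category_def by blast

lemma finite_spanning: "x \<in> Obj C \<Longrightarrow> y \<in> Obj C \<Longrightarrow> \<exists>S \<subseteq> Hom C x y. finite S \<and> lspan C x y S = Hom C x y"
  using semisimple unfolding finite_semisimple_category_def by blast

text \<open>The kernel of \<open>f\<close> is a subobject of the simple object \<open>x\<close>, so
  its arrow \<open>j\<close> has zero domain or is invertible. The latter would make
  \<open>f\<close> null; in the former case the difference of two arrows equalized by
  \<open>f\<close> factors through zero.\<close>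

lemma simple_source_monic:
  assumes x: "simple_object C x" and f: "f \<in> Hom C x y" "f \<noteq> Null C x y"
  shows "monic C f"
proof -
  obtain j where j: "is_kernel C j f" using abelian f unfolding abelian_category_def Hom_iff by blast
  then have jH: "j \<in> Hom C (Dom C j) x" and fj: "f \<cdot> j = Null C (Dom C j) y"
    and univ: "\<And>w h. h \<in> Hom C w x \<Longrightarrow> f \<cdot> h = Null C w y \<Longrightarrow> \<exists>!u. u \<in> Hom C w (Dom C j) \<and> j \<cdot> u = h"
    using f unfolding is_kernel_def by (auto simp: Hom_iff)
  have "g = h" if gh: "g \<in> Hom C w (Dom C j)" "h \<in> Hom C w (Dom C j)" "j \<cdot> g = j \<cdot> h" for w g h
  proof -
    have w: "w \<in> Obj C" using gh Hom_obj by blast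
    have "f \<cdot> (j \<cdot> g) = Null C w y"
      using comp_assoc[OF gh(1) jH f(1)] fj null_comp[OF gh(1), of y] f Hom_obj by auto
    then show ?thesis using univ[OF comp_in_Hom[OF gh(1) jH]] gh by auto
  qed
  then have "monic C j" unfolding monic_def using jH by (auto simp: Hom_iff)
  then consider "zero_object C (Dom C j)" | "isom C j" using x jH unfolding simple_object_def by blast
  then show ?thesis
  proof cases
    case 2
    have "f = f \<cdot> j \<cdot> inv_arr C j" using 2 jH f by (auto simp: Hom_iff assoc_arr)
    also have "\<dots> = Null C x y" unfolding fj using null_comp[of "inv_arr C j" x "Dom C j" y] 2 jH f Hom_obj by (auto simp: Hom_iff)
    finally show ?thesis using f by simp
  next
    case 1
    have "g = h" if gh: "g \<in> Hom C w x" "h \<in> Hom C w x" "f \<cdot> g = f \<cdot> h" for w g h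
    proof (rule eq_if_diff_null[OF gh(1,2)])
      let ?d = "g \<oplus> (- 1) \<star> h"
      have w: "w \<in> Obj C" using gh Hom_obj by blast
      have d: "?d \<in> Hom C w x" using gh by (intro plus_in_Hom scale_in_Hom)
      have "f \<cdot> ?d = f \<cdot> h \<oplus> (- 1) \<star> (f \<cdot> h)"
        using gh comp_plus_right[OF gh(1) scale_in_Hom[OF gh(2)] f(1)] comp_scale_right[OF gh(2) f(1)] by simp
      also have "\<dots> = Null C w y" using plus_minus[OF comp_in_Hom[OF gh(2) f(1)]] .
      finally obtain u where u: "u \<in> Hom C w (Dom C j)" "j \<cdot> u = ?d" using univ[OF d] by blast
      then have "u = Null C w (Dom C j)" using zero_object_Hom[OF 1] by blast
      then show "?d = Null C w x" using u comp_null[OF jH w] by simp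
    qed
    then show ?thesis unfolding monic_def using f by (auto simp: Hom_iff)
  qed
qed

lemma schur_isom:
  assumes "simple_object C x" "simple_object C y" "f \<in> Hom C x y" "f \<noteq> Null C x y" shows "isom C f"
  using simple_source_monic[OF assms(1,3,4)] assms unfolding simple_object_def by blast

text \<open>The powers of \<open>f\<close> lie in a finite-dimensional space, so \<open>f\<close>
  satisfies a polynomial equation and, the field being algebraically closed, some f - c is not
  invertible. On a simple object such an endomorphism is null.\<close>

lemma schur_scalar:
  assumes x: "simple_object C x" and f: "f \<in> Hom C x x"
  shows "\<exists>c. f = c \<star> Id C x"
proof -
  note xo = simple_object_obj[OF x]
  obtain S where S: "S \<subseteq> Hom C x x" "finite S" "lspan C x x S = Hom C x x" using finite_spanning[OF xo xo] by blast
  obtain a where a: "\<exists>i<Suc (card S). a i \<noteq> 0"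
    "lsum C x x (\<lambda>i. a i \<star> poly_arr C x f (monom 1 i)) [0..<Suc (card S)] = Null C x x"
    using linear_dependence[OF xo xo S(2,1,3), of "\<lambda>i. poly_arr C x f (monom 1 i)" "Suc (card S)"]
      poly_arr_in_Hom[OF f] by blast
  define q where "q = (\<Sum>i<Suc (card S). monom (a i) i)"
  have "q = (\<Sum>i\<leftarrow>[0..<Suc (card S)]. monom (a i) i)"
    unfolding q_def interv_sum_list_conv_sum_set_nat set_upt atLeast0LessThan ..
  then have "poly_arr C x f q = Null C x x" using a(2) poly_arr_lsum[OF f] by metis
  moreover have "coeff q i = a i" if "i < Suc (card S)" for i
    using that by (simp add: q_def coeff_sum coeff_monom sum.delta)
  then have "q \<noteq> 0" using a(1) by (metis coeff_0)
  ultimately obtain c where c: "\<not> isom C (f \<oplus> (- c) \<star> Id C x)"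
    using poly_arr_eq_null[OF f alg_closed_imp_poly_has_root not_zero_id[OF x]] by blast
  have i: "Id C x \<in> Hom C x x" using xo id_in_Hom by blast
  have "f \<oplus> (- c) \<star> Id C x \<in> Hom C x x" using f i by (intro plus_in_Hom scale_in_Hom)
  then have "f \<oplus> (- c) \<star> Id C x = Null C x x" using schur_isom[OF x x] c by blast
  then have "f = c \<star> Id C x"
    using eq_if_diff_null[OF f scale_in_Hom[OF i]] scale_scale[OF i, of "-1" c] by simp
  then show ?thesis ..
qed

lemma schur_multiple:
  assumes "simple_object C x" "simple_object C y" "isom C u" "Dom C u = x" "Cod C u = y" "f \<in> Hom C x y"
  shows "\<exists>c. f = c \<star> u"
proof -
  have u: "u \<in> Hom C x y" "inv_arr C u \<in> Hom C y x" using assms by (auto simp: Hom_iff)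
  obtain c where c: "inv_arr C u \<cdot> f = c \<star> Id C x" using schur_scalar[OF assms(1)] comp_in_Hom[OF assms(6) u(2)] by blast
  have "f = u \<cdot> (inv_arr C u \<cdot> f)" using assms by (auto simp: Hom_iff)
  also have "\<dots> = c \<star> (u \<cdot> Id C x)" unfolding c using comp_scale_right[OF id_in_Hom u(1)] u Hom_obj by blast
  also have "\<dots> = c \<star> u" using u comp_id by simp
  finally show ?thesis ..
qed

lemma has_dim_simple:
  assumes "simple_object C x" "simple_object C y"
  shows "has_dim C x y (if isomorphic C x y then 1 else 0)"
proof (cases "isomorphic C x y")
  case True
  then obtain u where u: "isom C u" "Dom C u = x" "Cod C u = y" using isomorphicE by blast
  have "has_dim C x y 1"
  proof (rule has_dim_one[of u])
    show "u \<noteq> Null C x y" using isom_not_null[OF u(1)] u assms unfolding simple_object_def by auto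
  qed (use schur_multiple[OF assms u] u in \<open>auto simp: Hom_iff\<close>)
  then show ?thesis using True by simp
next
  case False
  have "has_dim C x y 0"
    by (rule has_dim_zero) (use schur_isom[OF assms] False simple_object_obj assms in \<open>auto intro: isomorphicI simp: Hom_iff\<close>)
  then show ?thesis using False by simp
qed

lemma has_dim: assumes "x \<in> Obj C" "y \<in> Obj C" shows "has_dim C x y (hom_dim C x y)"
proof -
  obtain xs ys where xs: "\<forall>z\<in>set xs. simple_object C z" "direct_sum C x xs"
    and ys: "\<forall>z\<in>set ys. simple_object C z" "direct_sum C y ys" using decompose assms by meson
  have "has_dim C (xs ! r) y (\<Sum>s<length ys. if isomorphic C (xs ! r) (ys ! s) then 1 else 0)" if "r < length xs" for r
    using that xs ys by (intro has_dim_direct_sum_in[OF ys(2)] has_dim_simple) (auto intro: simple_object_obj)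
  from has_dim_direct_sum_out[OF xs(2) this assms(2)] have "\<exists>n. has_dim C x y n" by blast
  then show ?thesis using has_dim_hom_dim assms by metis
qed

lemma hom_dim_simple:
  "simple_object C x \<Longrightarrow> simple_object C y \<Longrightarrow> hom_dim C x y = (if isomorphic C x y then 1 else 0)"
  using has_dim_hom_dim[OF has_dim_simple] simple_object_obj by blast

lemma hom_dim_direct_sum_in:
  "direct_sum C x ys \<Longrightarrow> z \<in> Obj C \<Longrightarrow> hom_dim C z x = (\<Sum>r<length ys. hom_dim C z (ys ! r))"
  by (intro has_dim_hom_dim has_dim_direct_sum_in has_dim)
    (auto intro: direct_sum_obj(1) direct_sum_obj(2)[OF _ nth_mem])

lemma hom_dim_direct_sum_out:
  "direct_sum C x ys \<Longrightarrow> z \<in> Obj C \<Longrightarrow> hom_dim C x z = (\<Sum>r<length ys. hom_dim C (ys ! r) z)"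
  by (intro has_dim_hom_dim has_dim_direct_sum_out has_dim)
    (auto intro: direct_sum_obj(1) direct_sum_obj(2)[OF _ nth_mem])

text \<open>Both sides count the pairs of isomorphic simple summands of \<open>x\<close> and
  \<open>y\<close>.\<close>

lemma hom_dim_commute: assumes "x \<in> Obj C" "y \<in> Obj C" shows "hom_dim C x y = hom_dim C y x"
proof -
  obtain xs ys where xs: "\<forall>z\<in>set xs. simple_object C z" "direct_sum C x xs"
    and ys: "\<forall>z\<in>set ys. simple_object C z" "direct_sum C y ys" using decompose assms by meson
  have s: "hom_dim C (xs ! r) (ys ! s) = hom_dim C (ys ! s) (xs ! r)" if "r < length xs" "s < length ys" for r s
    using that xs ys hom_dim_simple isomorphic_sym by (metis nth_mem)
  have xo: "xs ! r \<in> Obj C" if "r < length xs" for r using that xs(2) direct_sum_obj by auto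
  have yo: "ys ! r \<in> Obj C" if "r < length ys" for r using that ys(2) direct_sum_obj by auto
  have "hom_dim C x y = (\<Sum>r<length xs. \<Sum>s<length ys. hom_dim C (xs ! r) (ys ! s))"
    using hom_dim_direct_sum_out[OF xs(2) assms(2)] hom_dim_direct_sum_in[OF ys(2)] xo by simp
  also have "\<dots> = (\<Sum>s<length ys. \<Sum>r<length xs. hom_dim C (ys ! s) (xs ! r))"
    by (subst sum.swap) (simp add: s)
  also have "\<dots> = hom_dim C y x"
    using hom_dim_direct_sum_out[OF ys(2) assms(1)] hom_dim_direct_sum_in[OF xs(2)] yo by simp
  finally show ?thesis .
qed

lemma hom_dim_eq_0_iff:
  assumes "x \<in> Obj C" "y \<in> Obj C" shows "hom_dim C x y = 0 \<longleftrightarrow> Hom C x y = {Null C x y}"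
proof
  assume "hom_dim C x y = 0"
  then obtain \<phi> where \<phi>: "coordinates C x y {..<0::nat} \<phi>" using has_dim[OF assms] unfolding has_dim_def by auto
  then interpret hom_coordinates C x y "{..<0::nat}" \<phi> using assms by (intro hom_coordinatesI) auto
  have "f = Null C x y" if "f \<in> Hom C x y" for f
    by (rule inj[OF that]) (use null_in_Hom assms support that in \<open>auto intro!: ext simp: coord_null\<close>)
  then show "Hom C x y = {Null C x y}" using null_in_Hom assms by blast
next
  assume "Hom C x y = {Null C x y}"
  then show "hom_dim C x y = 0" using has_dim_hom_dim[OF has_dim_zero] assms by auto
qed

lemma hom_dim_pos_iff:
  assumes "x \<in> Obj C" "y \<in> Obj C" shows "hom_dim C x y > 0 \<longleftrightarrow> (\<exists>f \<in> Hom C x y. f \<noteq> Null C x y)"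
  using hom_dim_eq_0_iff[OF assms] null_in_Hom[OF assms] by auto

lemma hom_dim_iso:
  assumes "isomorphic C x x'" "y \<in> Obj C" shows "hom_dim C x y = hom_dim C x' y" "hom_dim C y x = hom_dim C y x'"
proof -
  obtain ys where "\<forall>z\<in>set ys. simple_object C z" "direct_sum C x ys" using decompose isomorphic_obj assms by meson
  then show "hom_dim C x y = hom_dim C x' y" "hom_dim C y x = hom_dim C y x'"
    using hom_dim_direct_sum_out[of _ ys y] hom_dim_direct_sum_in[of _ ys y] direct_sum_iso assms by metis+
qed

lemma zero_object_iff_hom_dim: "zero_object C x \<longleftrightarrow> x \<in> Obj C \<and> hom_dim C x x = 0"
  using hom_dim_eq_0_iff[of x x] zero_object_Hom(1)[of x _ x] id_in_Hom[of x] null_in_Hom[of x x]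
  unfolding zero_object_iff by auto

lemma direct_sum_single: assumes "direct_sum C x [y]" shows "isomorphic C x y"
proof -
  obtain i p where "direct_sum_diagram C x [y] i p" using direct_sumE assms by blast
  then interpret d: direct_sum_diagram C x "[y]" i p .
  have H: "i 0 \<in> Hom C y x" "p 0 \<in> Hom C x y" using d.i_Hom[of 0] d.p_Hom[of 0] by auto
  have "p 0 \<cdot> i 0 = Id C y" using d.p_i[of 0 0] by simp
  moreover have "i 0 \<cdot> p 0 = Id C x" using d.sum_ip comp_in_Hom[OF H(2,1)] by (simp add: plus_null)
  ultimately show ?thesis using isomI[OF H(2,1)] H by (intro isomorphicI[of "p 0"]) (auto simp: Hom_iff)
qed

text \<open>Each simple summand of \<open>x\<close> adds at least one to the dimension of End(x), so
  dimension one leaves a single summand. In this form simplicity passes to full subcategories and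
  along isomorphisms.\<close>

lemma simple_iff_hom_dim: "simple_object C x \<longleftrightarrow> x \<in> Obj C \<and> hom_dim C x x = 1"
proof
  assume "simple_object C x"
  then show "x \<in> Obj C \<and> hom_dim C x x = 1"
    using hom_dim_simple isomorphic_refl simple_object_obj by auto
next
  assume x: "x \<in> Obj C \<and> hom_dim C x x = 1"
  then obtain xs where xs: "\<forall>z\<in>set xs. simple_object C z" "direct_sum C x xs" using decompose by meson
  have xo: "xs ! r \<in> Obj C" if "r < length xs" for r using that xs(2) direct_sum_obj by auto
  have "1 \<le> hom_dim C (xs ! r) x" if r: "r < length xs" for r
  proof -
    have "1 = hom_dim C (xs ! r) (xs ! r)" using hom_dim_simple xs r isomorphic_refl xo by simp
    also have "\<dots> \<le> (\<Sum>s<length xs. hom_dim C (xs ! r) (xs ! s))" using r by (intro member_le_sum) auto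
    also have "\<dots> = hom_dim C (xs ! r) x" using hom_dim_direct_sum_in[OF xs(2) xo[OF r]] by simp
    finally show ?thesis .
  qed
  then have "(\<Sum>r<length xs. 1) \<le> (\<Sum>r<length xs. hom_dim C (xs ! r) x)" by (intro sum_mono) auto
  also have "\<dots> = 1" using hom_dim_direct_sum_out[OF xs(2), of x] x by simp
  finally have "length xs \<le> 1" by simp
  moreover have "xs \<noteq> []" using xs direct_sum_Nil zero_object_iff_hom_dim x by auto
  ultimately obtain y where y: "xs = [y]" by (cases xs) auto
  then have iso: "isomorphic C x y" using direct_sum_single xs by simp
  have ys: "simple_object C y" using xs y by simp
  have nz: "\<not> zero_object C x" using x zero_object_iff_hom_dim by simp
  have "zero_object C z \<or> isom C f" if f: "f \<in> Hom C z x" "monic C f" for z f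
  proof -
    obtain u where u: "isom C u" "Dom C u = x" "Cod C u = y" using iso isomorphicE by blast
    have uf: "u \<cdot> f \<in> Hom C z y" using u f by (auto simp: Hom_iff)
    have "monic C (u \<cdot> f)"
      unfolding monic_def
    proof (intro conjI allI ballI impI)
      fix w g h assume gh: "g \<in> Hom C w (Dom C (u \<cdot> f))" "h \<in> Hom C w (Dom C (u \<cdot> f))" "u \<cdot> f \<cdot> g = u \<cdot> f \<cdot> h"
      then have "u \<cdot> (f \<cdot> g) = u \<cdot> (f \<cdot> h)" using u f by (auto simp: Hom_iff assoc_arr)
      then have "f \<cdot> g = f \<cdot> h" using isom_cancel_left[OF u(1)] u f gh by (auto simp: Hom_iff)
      then show "g = h" using f gh u unfolding monic_def by (auto simp: Hom_iff)
    qed (use uf in \<open>auto simp: Hom_iff\<close>)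
    then consider "zero_object C z" | "isom C (u \<cdot> f)" using ys uf unfolding simple_object_def by blast
    then show ?thesis
    proof cases
      case 2
      have "f = inv_arr C u \<cdot> (u \<cdot> f)" using u f by (auto simp: Hom_iff)
      moreover have "isom C (inv_arr C u \<cdot> (u \<cdot> f))"
        by (rule isom_comp(1)) (use 2 u f in \<open>auto simp: Hom_iff\<close>)
      ultimately show ?thesis by metis
    qed blast
  qed
  then show "simple_object C x" unfolding simple_object_def using nz x by blast
qed

lemma simple_iso: "simple_object C x \<Longrightarrow> isomorphic C x y \<Longrightarrow> simple_object C y"
  unfolding simple_iff_hom_dim using hom_dim_iso isomorphic_obj by metis

lemma simple_hom_iso:
  assumes "simple_object C x" "simple_object C y" "hom_dim C x y > 0" shows "isomorphic C x y"
  using hom_dim_simple[OF assms(1,2)] assms(3) by (simp split: if_splits)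

subsection \<open>Multiplicities and length\<close>

text \<open>The additive extension to all objects of a function on the simple classes. The constant
  function 1 gives the length, and the weight of x \<otimes> y is the sum that occurs in the
  eigenvalue equation of \<open>FPdim\<close>.\<close>

definition weight :: "('o set \<Rightarrow> real) \<Rightarrow> 'o \<Rightarrow> real" where
  "weight w x = (\<Sum>Z \<in> Irr C. real (hom_dim C (SOME z. z \<in> Z) x) * w Z)"

lemma Irr_rep:
  assumes "Z \<in> Irr C"
  shows "simple_object C (SOME z. z \<in> Z)" "iso_class C (SOME z. z \<in> Z) = Z"
proof -
  obtain x where x: "simple_object C x" "Z = iso_class C x" using assms unfolding Irr_def by auto
  have "x \<in> Z" using x mem_iso_class simple_object_obj by blast
  then have "(SOME z. z \<in> Z) \<in> Z" by (rule someI)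
  then have *: "isomorphic C x (SOME z. z \<in> Z)" using x unfolding iso_class_def by simp
  show "simple_object C (SOME z. z \<in> Z)" using simple_iso[OF x(1) *] .
  show "iso_class C (SOME z. z \<in> Z) = Z" using * x iso_class_eq_iff isomorphic_obj by blast
qed

lemma iso_class_in_Irr: "simple_object C x \<Longrightarrow> iso_class C x \<in> Irr C"
  unfolding Irr_def by blast

lemma weight_simple: assumes "simple_object C x" shows "weight w x = w (iso_class C x)"
proof -
  have "weight w x = (\<Sum>Z \<in> Irr C. if Z = iso_class C x then w Z else 0)"
    unfolding weight_def
  proof (rule sum.cong[OF refl])
    fix Z assume Z: "Z \<in> Irr C"
    have "isomorphic C (SOME z. z \<in> Z) x \<longleftrightarrow> Z = iso_class C x"
      using iso_class_eq_iff[of "SOME z. z \<in> Z" x] Irr_rep[OF Z] assms simple_object_obj by simp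
    then show "real (hom_dim C (SOME z. z \<in> Z) x) * w Z = (if Z = iso_class C x then w Z else 0)"
      using hom_dim_simple[OF Irr_rep(1)[OF Z] assms] by simp
  qed
  then show ?thesis using finite_Irr iso_class_in_Irr[OF assms] by simp
qed

lemma weight_direct_sum:
  assumes "direct_sum C x ys" shows "weight w x = (\<Sum>r<length ys. weight w (ys ! r))"
proof -
  have "weight w x = (\<Sum>Z \<in> Irr C. \<Sum>r<length ys. real (hom_dim C (SOME z. z \<in> Z) (ys ! r)) * w Z)"
    unfolding weight_def using hom_dim_direct_sum_in[OF assms] simple_object_obj[OF Irr_rep(1)]
    by (simp add: sum_distrib_right)
  then show ?thesis unfolding weight_def by (subst (asm) sum.swap) simp
qed

lemma weight_iso: "isomorphic C x y \<Longrightarrow> weight w x = weight w y"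
  unfolding weight_def using hom_dim_iso(2) Irr_rep(1) simple_object_obj by (metis (no_types, lifting) sum.cong)

definition len :: "'o \<Rightarrow> nat" where
  "len x = (\<Sum>Z \<in> Irr C. hom_dim C (SOME z. z \<in> Z) x)"

lemma len_weight: "real (len x) = weight (\<lambda>_. 1) x"
  unfolding len_def weight_def by simp

lemma len_simple: "simple_object C x \<Longrightarrow> len x = 1"
  using weight_simple[of x "\<lambda>_. 1"] by (simp flip: len_weight)

lemma len_direct_sum: "direct_sum C x ys \<Longrightarrow> len x = (\<Sum>r<length ys. len (ys ! r))"
  using weight_direct_sum[of x ys "\<lambda>_. 1"] unfolding len_weight[symmetric] of_nat_sum[symmetric] of_nat_eq_iff .

lemma len_iso: "isomorphic C x y \<Longrightarrow> len x = len y"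
  using weight_iso[of x y "\<lambda>_. 1"] by (simp flip: len_weight)

lemma len_eq_1: assumes "x \<in> Obj C" "len x = 1" shows "simple_object C x"
proof -
  obtain xs where xs: "\<forall>z\<in>set xs. simple_object C z" "direct_sum C x xs" using decompose assms by meson
  then have "length xs = 1" using len_direct_sum[OF xs(2)] len_simple assms by simp
  then obtain y where y: "xs = [y]" by (cases xs) auto
  then show ?thesis using direct_sum_single simple_iso isomorphic_sym xs by (metis list.set_intros(1))
qed

end

section \<open>Linear functors\<close>

context linear_category begin

lemma functor_null:
  assumes "linear_category D" "linear_functor C D Fo Fa" "x \<in> Obj C" "y \<in> Obj C"
  shows "Fa (Null C x y) = Null D (Fo x) (Fo y)"
proof -
  interpret D: linear_category D by fact
  interpret F: linear_functor C D Fo Fa by fact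
  have n: "Null C x y \<in> Hom C x y" using assms null_in_Hom by blast
  show ?thesis using F.functor_scale[OF n, of 0] scale_zero[OF n] D.scale_zero[OF F.functor_arr[OF n]] by simp
qed

lemma functor_lsum:
  assumes "linear_category D" "linear_functor C D Fo Fa" "x \<in> Obj C" "y \<in> Obj C"
    "\<And>r. r \<in> set l \<Longrightarrow> f r \<in> Hom C x y"
  shows "Fa (lsum C x y f l) = lsum D (Fo x) (Fo y) (\<lambda>r. Fa (f r)) l"
  using assms(5)
proof (induction l)
  case Nil
  then show ?case using functor_null assms by simp
next
  case (Cons r l)
  then show ?case
    using linear_functor.functor_plus[OF assms(2), of "f r" x y "lsum C x y f l"] lsum_in_Hom[of x y l f] assms by simp
qed

lemma functor_direct_sum_diagram:
  assumes "linear_category D" "linear_functor C D Fo Fa" "direct_sum_diagram C x ys i p"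
  shows "direct_sum_diagram D (Fo x) (map Fo ys) (\<lambda>r. Fa (i r)) (\<lambda>r. Fa (p r))"
proof -
  interpret D: linear_category D by fact
  interpret F: linear_functor C D Fo Fa by fact
  interpret d: direct_sum_diagram C x ys i p by fact
  have "direct_sum_maps D (Fo x) (map Fo ys) (\<lambda>r. Fa (i r)) (\<lambda>r. Fa (p r))"
    unfolding direct_sum_maps_def length_map
  proof (intro conjI allI impI)
    fix r assume r: "r < length ys"
    show "Fa (i r) \<in> Hom D (map Fo ys ! r) (Fo x)" "Fa (p r) \<in> Hom D (Fo x) (map Fo ys ! r)"
      using F.functor_arr d.i_Hom d.p_Hom r by auto
    fix s assume s: "s < length ys"
    have "Fa (p r) \<cdot>\<^bsub>D\<^esub> Fa (i s) = Fa (p r \<cdot> i s)" using F.functor_comp[OF d.i_Hom[OF s] d.p_Hom[OF r]] by simp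
    then show "Fa (p r) \<cdot>\<^bsub>D\<^esub> Fa (i s) =
      (if r = s then Id D (map Fo ys ! r) else Null D (map Fo ys ! s) (map Fo ys ! r))"
      using r s d.p_i[OF r s] F.functor_id functor_null[OF assms(1,2)] d.ys_nth by auto
  next
    have "Id D (Fo x) = Fa (lsum C x x (\<lambda>r. i r \<cdot> p r) [0..<length ys])"
      using F.functor_id d.x_obj d.sum_ip by simp
    also have "\<dots> = lsum D (Fo x) (Fo x) (\<lambda>r. Fa (i r \<cdot> p r)) [0..<length ys]"
      using d.x_obj by (intro functor_lsum[OF assms(1,2)]) (auto intro!: comp_in_Hom[OF d.p_Hom d.i_Hom])
    also have "\<dots> = lsum D (Fo x) (Fo x) (\<lambda>r. Fa (i r) \<cdot>\<^bsub>D\<^esub> Fa (p r)) [0..<length ys]"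
      by (rule D.lsum_cong) (use F.functor_comp[OF d.p_Hom d.i_Hom] in auto)
    finally show "lsum D (Fo x) (Fo x) (\<lambda>r. Fa (i r) \<cdot>\<^bsub>D\<^esub> Fa (p r)) [0..<length ys] = Id D (Fo x)" ..
  qed
  then show ?thesis using F.functor_obj d.x_obj d.ys_obj
    by (auto simp: direct_sum_diagram_def direct_sum_diagram_axioms_def assms(1))
qed

lemma functor_direct_sum:
  assumes "linear_category D" "linear_functor C D Fo Fa" "direct_sum C x ys"
  shows "direct_sum D (Fo x) (map Fo ys)"
proof -
  obtain i p where "direct_sum_diagram C x ys i p" using direct_sumE assms by blast
  then interpret d: direct_sum_diagram D "Fo x" "map Fo ys" "\<lambda>r. Fa (i r)" "\<lambda>r. Fa (p r)"
    using functor_direct_sum_diagram assms by blast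
  show ?thesis unfolding direct_sum_iff_maps using d.x_obj d.ys_obj d.maps by blast
qed

lemma functor_isom:
  assumes "linear_category D" "linear_functor C D Fo Fa" "isom C f"
  shows "isom D (Fa f)" "inv_arr D (Fa f) = Fa (inv_arr C f)"
proof -
  interpret D: linear_category D by fact
  interpret F: linear_functor C D Fo Fa by fact
  let ?x = "Dom C f" and ?y = "Cod C f"
  have f: "f \<in> Hom C ?x ?y" "inv_arr C f \<in> Hom C ?y ?x" using assms by (auto simp: Hom_iff)
  have "Fa (inv_arr C f) \<cdot>\<^bsub>D\<^esub> Fa f = Id D (Fo ?x)" "Fa f \<cdot>\<^bsub>D\<^esub> Fa (inv_arr C f) = Id D (Fo ?y)"
    using F.functor_comp[OF f] F.functor_comp[OF f(2,1)] assms F.functor_id by auto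
  then show "isom D (Fa f)" "inv_arr D (Fa f) = Fa (inv_arr C f)"
    using D.isomI[OF F.functor_arr[OF f(1)] F.functor_arr[OF f(2)]] by auto
qed

lemma functor_isomorphic:
  assumes "linear_category D" "linear_functor C D Fo Fa" "isomorphic C x y"
  shows "isomorphic D (Fo x) (Fo y)"
proof -
  interpret D: linear_category D by fact
  obtain f where f: "isom C f" "Dom C f = x" "Cod C f = y" using assms isomorphicE by blast
  then have "Fa f \<in> Hom D (Fo x) (Fo y)" using linear_functor.functor_arr[OF assms(2)] by (auto simp: Hom_iff)
  then show ?thesis using functor_isom(1)[OF assms(1,2) f(1)] by (intro D.isomorphicI[of "Fa f"]) (auto simp: D.Hom_iff)
qed

lemma functor_zero:
  assumes "linear_category D" "linear_functor C D Fo Fa" "zero_object C x"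
  shows "zero_object D (Fo x)"
  using assms functor_null linear_functor.functor_id[OF assms(2)] linear_functor.functor_obj[OF assms(2)]
  unfolding linear_category.zero_object_iff[OF assms(1)] zero_object_iff by metis

end

lemma (in semisimple_category) len_zero_iff: assumes "x \<in> Obj C" shows "len x = 0 \<longleftrightarrow> zero_object C x"
proof -
  obtain xs where xs: "\<forall>z\<in>set xs. simple_object C z" "direct_sum C x xs" using decompose assms by meson
  then have l: "len x = length xs" using len_direct_sum[OF xs(2)] len_simple by simp
  show ?thesis
  proof
    assume "len x = 0" then show "zero_object C x" using l xs direct_sum_Nil by auto
  next
    assume z: "zero_object C x"
    have zero: "hom_dim C (xs ! r) x = 0" if "r < length xs" for r
    proof -
      have xo: "xs ! r \<in> Obj C" using xs that simple_object_obj by auto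
      then have "Hom C (xs ! r) x = {Null C (xs ! r) x}" using zero_object_Hom(2)[OF z] null_in_Hom[OF xo assms] by blast
      then show ?thesis using hom_dim_eq_0_iff[OF xo assms] by simp
    qed
    have "1 \<le> hom_dim C (xs ! r) x" if r: "r < length xs" for r
    proof -
      have xr: "simple_object C (xs ! r)" using xs r by simp
      have "1 = hom_dim C (xs ! r) (xs ! r)" using xr simple_iff_hom_dim by simp
      also have "\<dots> \<le> (\<Sum>s<length xs. hom_dim C (xs ! r) (xs ! s))" using r by (intro member_le_sum) auto
      also have "\<dots> = hom_dim C (xs ! r) x" using hom_dim_direct_sum_in[OF xs(2)] simple_object_obj[OF xr] by simp
      finally show ?thesis .
    qed
    then show "len x = 0" using zero[of 0] l by fastforce
  qed
qed

text \<open>\<open>Ho\<close> sends every summand of \<open>Fo u\<close> to a non-zero object, since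
  \<open>Fo\<close> brings it back, and the lengths of these images add up to the length of
  \<open>Ho (Fo u)\<close>, which is one. The lemma serves both tensoring with an invertible object
  and the action of a group element.\<close>

lemma (in semisimple_category) functor_simple:
  assumes F: "linear_functor C C Fo Fa" and H: "linear_functor C C Ho Ha"
    and HF: "\<And>u. u \<in> Obj C \<Longrightarrow> isomorphic C (Ho (Fo u)) u" and FH: "\<And>u. u \<in> Obj C \<Longrightarrow> isomorphic C (Fo (Ho u)) u"
    and u: "simple_object C u"
  shows "simple_object C (Fo u)"
proof (rule len_eq_1)
  have uo: "u \<in> Obj C" using u simple_object_obj by blast
  show Fu: "Fo u \<in> Obj C" using linear_functor.functor_obj[OF F uo] .
  obtain xs where xs: "\<forall>z\<in>set xs. simple_object C z" "direct_sum C (Fo u) xs" using decompose Fu by meson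
  have xo: "xs ! r \<in> Obj C" if "r < length xs" for r using that xs(2) direct_sum_obj by auto
  have "1 \<le> len (Ho (xs ! r))" if r: "r < length xs" for r
  proof (rule ccontr)
    assume "\<not> 1 \<le> len (Ho (xs ! r))"
    then have "len (Ho (xs ! r)) = 0" by simp
    then have "zero_object C (Ho (xs ! r))" using len_zero_iff linear_functor.functor_obj[OF H xo[OF r]] by blast
    then have "zero_object C (xs ! r)"
      using functor_zero[OF linear_category_axioms F] FH[OF xo[OF r]] zero_object_iso by blast
    then show False using xs r unfolding simple_object_def by auto
  qed
  then have "(\<Sum>r<length xs. 1) \<le> (\<Sum>r<length xs. len (Ho (xs ! r)))" by (intro sum_mono) auto
  also have "\<dots> = len (Ho (Fo u))"
    using len_direct_sum[OF functor_direct_sum[OF linear_category_axioms H xs(2)]] by simp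
  also have "\<dots> = 1" using len_iso[OF HF[OF uo]] len_simple[OF u] by simp
  finally have "length xs \<le> 1" by simp
  moreover have "len (Fo u) = length xs" using len_direct_sum[OF xs(2)] len_simple xs by simp
  moreover have "\<not> zero_object C (Fo u)"
  proof
    assume "zero_object C (Fo u)"
    then have "zero_object C u" using functor_zero[OF linear_category_axioms H] HF[OF uo] zero_object_iso by blast
    then show False using u unfolding simple_object_def by blast
  qed
  then have "len (Fo u) \<noteq> 0" using len_zero_iff Fu by simp
  ultimately show "len (Fo u) = 1" by linarith
qed

section \<open>Monoidal linear categories\<close>

context monoidal_linear_category begin

lemma tens_obj' [simp]: "x \<in> Obj C \<Longrightarrow> y \<in> Obj C \<Longrightarrow> x \<odot> y \<in> Obj C"
  by (rule tens_obj)

lemma unit_obj' [simp]: "Unit C \<in> Obj C"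
  by (rule unit_obj)

lemma tens_arr' [simp]:
  assumes "f \<in> Arr C" "g \<in> Arr C"
  shows "f \<Odot> g \<in> Arr C" "Dom C (f \<Odot> g) = Dom C f \<odot> Dom C g" "Cod C (f \<Odot> g) = Cod C f \<odot> Cod C g"
  using tens_arr[of f "Dom C f" "Cod C f" g "Dom C g" "Cod C g"] assms by (auto simp: Hom_iff)

lemma tens_id' [simp]: "x \<in> Obj C \<Longrightarrow> y \<in> Obj C \<Longrightarrow> Id C x \<Odot> Id C y = Id C (x \<odot> y)"
  by (rule tens_id)

lemma tens_comp_arr:
  assumes "f \<in> Arr C" "f' \<in> Arr C" "g \<in> Arr C" "g' \<in> Arr C" "Dom C f' = Cod C f" "Dom C g' = Cod C g"
  shows "(f' \<Odot> g') \<cdot> (f \<Odot> g) = (f' \<cdot> f) \<Odot> (g' \<cdot> g)"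
  using tens_comp[of f "Dom C f" "Cod C f" f' "Cod C f'" g "Dom C g" "Cod C g" g' "Cod C g'"] assms
  by (auto simp: Hom_iff)

lemma whisker_left:
  assumes "g \<in> Arr C" "g' \<in> Arr C" "Dom C g' = Cod C g" "x \<in> Obj C"
  shows "(Id C x \<Odot> g') \<cdot> (Id C x \<Odot> g) = Id C x \<Odot> (g' \<cdot> g)"
  using assms by (simp add: tens_comp_arr)

lemma whisker_right:
  assumes "g \<in> Arr C" "g' \<in> Arr C" "Dom C g' = Cod C g" "x \<in> Obj C"
  shows "(g' \<Odot> Id C x) \<cdot> (g \<Odot> Id C x) = (g' \<cdot> g) \<Odot> Id C x"
  using assms by (simp add: tens_comp_arr)

lemma interchange:
  assumes "f \<in> Arr C" "g \<in> Arr C" "Dom C f = x" "Cod C f = x'" "Dom C g = y" "Cod C g = y'"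
  shows "(Id C x' \<Odot> g) \<cdot> (f \<Odot> Id C y) = f \<Odot> g" "(f \<Odot> Id C y') \<cdot> (Id C x \<Odot> g) = f \<Odot> g"
  using assms by (auto simp: tens_comp_arr)

lemma assoc_arr' [simp]:
  assumes "x \<in> Obj C" "y \<in> Obj C" "z \<in> Obj C"
  shows "isom C (Assoc C x y z)" "Dom C (Assoc C x y z) = (x \<odot> y) \<odot> z" "Cod C (Assoc C x y z) = x \<odot> (y \<odot> z)"
  using assoc_iso[OF assms] by (auto simp: Iso_iff)

lemma lunit_arr' [simp]:
  assumes "x \<in> Obj C"
  shows "isom C (LUnit C x)" "Dom C (LUnit C x) = Unit C \<odot> x" "Cod C (LUnit C x) = x"
  using lunit_iso[OF assms] by (auto simp: Iso_iff)

lemma runit_arr' [simp]: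
  assumes "x \<in> Obj C"
  shows "isom C (RUnit C x)" "Dom C (RUnit C x) = x \<odot> Unit C" "Cod C (RUnit C x) = x"
  using runit_iso[OF assms] by (auto simp: Iso_iff)

lemma tens_isom [simp]:
  assumes "isom C f" "isom C g" shows "isom C (f \<Odot> g)" "inv_arr C (f \<Odot> g) = inv_arr C f \<Odot> inv_arr C g"
proof -
  have "f \<Odot> g \<in> Hom C (Dom C f \<odot> Dom C g) (Cod C f \<odot> Cod C g)"
    "inv_arr C f \<Odot> inv_arr C g \<in> Hom C (Cod C f \<odot> Cod C g) (Dom C f \<odot> Dom C g)"
    using assms by (auto simp: Hom_iff)
  from isomI[OF this] show "isom C (f \<Odot> g)" "inv_arr C (f \<Odot> g) = inv_arr C f \<Odot> inv_arr C g"
    using assms by (auto simp: tens_comp_arr)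
qed

lemma assoc_nat:
  assumes "f \<in> Arr C" "g \<in> Arr C" "h \<in> Arr C" "Dom C f = x" "Cod C f = x'" "Dom C g = y" "Cod C g = y'"
    "Dom C h = z" "Cod C h = z'"
  shows "Assoc C x' y' z' \<cdot> ((f \<Odot> g) \<Odot> h) = (f \<Odot> (g \<Odot> h)) \<cdot> Assoc C x y z"
  using assms by (intro assoc_natural) (auto simp: Hom_iff)

lemma assoc_inv_nat:
  assumes "f \<in> Arr C" "g \<in> Arr C" "h \<in> Arr C" "Dom C f = x" "Cod C f = x'" "Dom C g = y" "Cod C g = y'"
    "Dom C h = z" "Cod C h = z'"
  shows "inv_arr C (Assoc C x' y' z') \<cdot> (f \<Odot> (g \<Odot> h)) = ((f \<Odot> g) \<Odot> h) \<cdot> inv_arr C (Assoc C x y z)"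
proof -
  have o: "x \<in> Obj C" "y \<in> Obj C" "z \<in> Obj C" "x' \<in> Obj C" "y' \<in> Obj C" "z' \<in> Obj C" using assms by auto
  have "f \<Odot> (g \<Odot> h) = Assoc C x' y' z' \<cdot> ((f \<Odot> g) \<Odot> h) \<cdot> inv_arr C (Assoc C x y z)"
    unfolding assoc_nat[OF assms] using o assms by (simp add: assoc_arr)
  then show ?thesis using o assms by (simp add: assoc_arr)
qed

lemma runit_nat: "f \<in> Arr C \<Longrightarrow> Dom C f = x \<Longrightarrow> Cod C f = y \<Longrightarrow>
    RUnit C y \<cdot> (f \<Odot> Id C (Unit C)) = f \<cdot> RUnit C x"
  by (rule runit_natural) (simp add: Hom_iff)

text \<open>Rewrites the two leading arrows of a right-nested composite, the shape in which the
  coherence computations below keep their composites.\<close>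

lemma comp_eq_extend:
  assumes "a \<cdot> b = c" "a \<in> Arr C" "b \<in> Arr C" "h \<in> Arr C" "Dom C a = Cod C b" "Dom C b = Cod C h"
  shows "a \<cdot> (b \<cdot> h) = c \<cdot> h"
  using assms by (simp flip: assoc_arr)

text \<open>Tensoring with the unit is naturally isomorphic to the identity functor through
  \<open>RUnit\<close>.\<close>

lemma tens_unit_right_faithful:
  assumes "f \<in> Hom C x y" "g \<in> Hom C x y" "f \<Odot> Id C (Unit C) = g \<Odot> Id C (Unit C)"
  shows "f = g"
proof -
  have "f \<cdot> RUnit C x = g \<cdot> RUnit C x"
    using runit_natural[OF assms(1)] runit_natural[OF assms(2)] assms(3) by simp
  then show ?thesis
    by (subst (asm) isom_cancel_right) (use assms Hom_obj in \<open>auto simp: Hom_iff\<close>)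
qed

lemma tens_unit_left_faithful:
  assumes "f \<in> Hom C x y" "g \<in> Hom C x y" "Id C (Unit C) \<Odot> f = Id C (Unit C) \<Odot> g"
  shows "f = g"
proof -
  have "f \<cdot> LUnit C x = g \<cdot> LUnit C x"
    using lunit_natural[OF assms(1)] lunit_natural[OF assms(2)] assms(3) by simp
  then show ?thesis
    by (subst (asm) isom_cancel_right) (use assms Hom_obj in \<open>auto simp: Hom_iff\<close>)
qed

text \<open>Kelly's unit coherences: the pentagon with two unit factors, stripped of its outer unit.\<close>

lemma runit_tens:
  assumes [simp]: "u \<in> Obj C" "x \<in> Obj C"
  shows "(Id C u \<Odot> RUnit C x) \<cdot> Assoc C u x (Unit C) = RUnit C (u \<odot> x)"
proof (rule tens_unit_right_faithful[of _ "(u \<odot> x) \<odot> Unit C" "u \<odot> x"])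
  let ?I = "Unit C" and ?a = "Assoc C u x (Unit C)"
  have "?a \<cdot> (RUnit C (u \<odot> x) \<Odot> Id C ?I) = ?a \<cdot> ((Id C (u \<odot> x) \<Odot> LUnit C ?I) \<cdot> Assoc C (u \<odot> x) ?I ?I)"
    using triangle[of "u \<odot> x" ?I] by simp
  also have "\<dots> = (?a \<cdot> ((Id C u \<Odot> Id C x) \<Odot> LUnit C ?I)) \<cdot> Assoc C (u \<odot> x) ?I ?I"
    by (simp add: assoc_arr)
  also have "\<dots> = (Id C u \<Odot> (Id C x \<Odot> LUnit C ?I)) \<cdot> (Assoc C u x (?I \<odot> ?I) \<cdot> Assoc C (u \<odot> x) ?I ?I)"
    by (subst assoc_nat[of _ _ _ u _ x _ "?I \<odot> ?I"]) (simp_all add: assoc_arr)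
  also have "\<dots> = (Id C u \<Odot> (Id C x \<Odot> LUnit C ?I)) \<cdot> ((Id C u \<Odot> Assoc C x ?I ?I) \<cdot> Assoc C u (x \<odot> ?I) ?I \<cdot> (?a \<Odot> Id C ?I))"
    using pentagon[of u x ?I ?I] by simp
  also have "\<dots> = ((Id C u \<Odot> (Id C x \<Odot> LUnit C ?I)) \<cdot> (Id C u \<Odot> Assoc C x ?I ?I)) \<cdot> (Assoc C u (x \<odot> ?I) ?I \<cdot> (?a \<Odot> Id C ?I))"
    by (simp add: assoc_arr)
  also have "\<dots> = (Id C u \<Odot> (RUnit C x \<Odot> Id C ?I)) \<cdot> (Assoc C u (x \<odot> ?I) ?I \<cdot> (?a \<Odot> Id C ?I))"
    using triangle[of x ?I] by (simp add: whisker_left)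
  also have "\<dots> = ((Id C u \<Odot> (RUnit C x \<Odot> Id C ?I)) \<cdot> Assoc C u (x \<odot> ?I) ?I) \<cdot> (?a \<Odot> Id C ?I)"
    by (simp add: assoc_arr)
  also have "\<dots> = (?a \<cdot> ((Id C u \<Odot> RUnit C x) \<Odot> Id C ?I)) \<cdot> (?a \<Odot> Id C ?I)"
    by (subst assoc_nat[of _ _ _ u _ "x \<odot> ?I" _ ?I]) simp_all
  also have "\<dots> = ?a \<cdot> (((Id C u \<Odot> RUnit C x) \<cdot> ?a) \<Odot> Id C ?I)"
    by (simp add: assoc_arr whisker_right)
  finally show "((Id C u \<Odot> RUnit C x) \<cdot> ?a) \<Odot> Id C ?I = RUnit C (u \<odot> x) \<Odot> Id C ?I"
    by (subst (asm) isom_cancel_left) simp_all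
qed (simp_all add: Hom_iff)

lemma lunit_tens:
  assumes [simp]: "x \<in> Obj C" "y \<in> Obj C"
  shows "LUnit C (x \<odot> y) \<cdot> Assoc C (Unit C) x y = LUnit C x \<Odot> Id C y"
proof (rule tens_unit_left_faithful[of _ "(Unit C \<odot> x) \<odot> y" "x \<odot> y"])
  let ?I = "Unit C" and ?b = "Assoc C (Unit C) (Unit C) x \<Odot> Id C y"
  have "(Id C ?I \<Odot> (LUnit C (x \<odot> y) \<cdot> Assoc C ?I x y)) \<cdot> (Assoc C ?I (?I \<odot> x) y \<cdot> ?b)
      = (Id C ?I \<Odot> LUnit C (x \<odot> y)) \<cdot> ((Id C ?I \<Odot> Assoc C ?I x y) \<cdot> Assoc C ?I (?I \<odot> x) y \<cdot> ?b)"
    by (subst whisker_left[symmetric]) (simp_all add: assoc_arr)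
  also have "\<dots> = (Id C ?I \<Odot> LUnit C (x \<odot> y)) \<cdot> (Assoc C ?I ?I (x \<odot> y) \<cdot> Assoc C (?I \<odot> ?I) x y)"
    using pentagon[of ?I ?I x y] by simp
  also have "\<dots> = (RUnit C ?I \<Odot> (Id C x \<Odot> Id C y)) \<cdot> Assoc C (?I \<odot> ?I) x y"
    using triangle[of ?I "x \<odot> y"] by (simp flip: assoc_arr)
  also have "\<dots> = Assoc C ?I x y \<cdot> ((RUnit C ?I \<Odot> Id C x) \<Odot> Id C y)"
    by (subst assoc_nat[of _ _ _ "?I \<odot> ?I" _ x _ y]) simp_all
  also have "\<dots> = Assoc C ?I x y \<cdot> (((Id C ?I \<Odot> LUnit C x) \<Odot> Id C y) \<cdot> ?b)"
    using triangle[of ?I x] by (simp add: whisker_right)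
  also have "\<dots> = (Assoc C ?I x y \<cdot> ((Id C ?I \<Odot> LUnit C x) \<Odot> Id C y)) \<cdot> ?b"
    by (simp add: assoc_arr)
  also have "\<dots> = (Id C ?I \<Odot> (LUnit C x \<Odot> Id C y)) \<cdot> (Assoc C ?I (?I \<odot> x) y \<cdot> ?b)"
    by (subst assoc_nat[of _ _ _ ?I _ "?I \<odot> x" _ y]) (simp_all add: assoc_arr)
  finally show "Id C ?I \<Odot> (LUnit C (x \<odot> y) \<cdot> Assoc C ?I x y) = Id C ?I \<Odot> (LUnit C x \<Odot> Id C y)"
    by (subst (asm) isom_cancel_right) simp_all
qed (simp_all add: Hom_iff)

subsection \<open>Duality\<close>

context
  fixes x y ev coev
  assumes x [simp]: "x \<in> Obj C" and y [simp]: "y \<in> Obj C"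
    and ev: "ev \<in> Hom C (y \<odot> x) (Unit C)" and coev: "coev \<in> Hom C (Unit C) (x \<odot> y)"
    and zigzag1: "RUnit C x \<cdot> (Id C x \<Odot> ev) \<cdot> Assoc C x y x \<cdot> (coev \<Odot> Id C x) \<cdot> inv_arr C (LUnit C x) = Id C x"
    and zigzag2: "LUnit C y \<cdot> (ev \<Odot> Id C y) \<cdot> inv_arr C (Assoc C y x y) \<cdot> (Id C y \<Odot> coev) \<cdot> inv_arr C (RUnit C y) = Id C y"
begin

lemma ev_coev_arr [simp]:
  "ev \<in> Arr C" "Dom C ev = y \<odot> x" "Cod C ev = Unit C" "coev \<in> Arr C" "Dom C coev = Unit C" "Cod C coev = x \<odot> y"
  using ev coev by (auto simp: Hom_iff)

text \<open>Unit of the adjunction between right tensoring with \<open>x\<close> and right tensoring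
  with \<open>y\<close>; \<open>adj_counit\<close> is its counit.\<close>

definition adj_unit where
  "adj_unit u = inv_arr C (Assoc C u x y) \<cdot> ((Id C u \<Odot> coev) \<cdot> inv_arr C (RUnit C u))"

definition adj_counit where
  "adj_counit v = RUnit C v \<cdot> ((Id C v \<Odot> ev) \<cdot> Assoc C v y x)"

lemma adj_unit_arr [simp]: "u \<in> Obj C \<Longrightarrow> adj_unit u \<in> Arr C" "u \<in> Obj C \<Longrightarrow> Dom C (adj_unit u) = u"
  "u \<in> Obj C \<Longrightarrow> Cod C (adj_unit u) = (u \<odot> x) \<odot> y"
  unfolding adj_unit_def by simp_all

lemma adj_counit_arr [simp]: "v \<in> Obj C \<Longrightarrow> adj_counit v \<in> Arr C" "v \<in> Obj C \<Longrightarrow> Dom C (adj_counit v) = (v \<odot> y) \<odot> x"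
  "v \<in> Obj C \<Longrightarrow> Cod C (adj_counit v) = v"
  unfolding adj_counit_def by simp_all

lemma adj_counit_nat:
  assumes [simp]: "f \<in> Arr C" "Dom C f = u" "Cod C f = v"
  shows "adj_counit v \<cdot> ((f \<Odot> Id C y) \<Odot> Id C x) = f \<cdot> adj_counit u"
proof -
  have [simp]: "u \<in> Obj C" "v \<in> Obj C" using assms dom_cod_obj by blast+
  have "adj_counit v \<cdot> ((f \<Odot> Id C y) \<Odot> Id C x)
     = RUnit C v \<cdot> ((Id C v \<Odot> ev) \<cdot> (Assoc C v y x \<cdot> ((f \<Odot> Id C y) \<Odot> Id C x)))"
    unfolding adj_counit_def by (simp add: assoc_arr)
  also have "\<dots> = RUnit C v \<cdot> (((Id C v \<Odot> ev) \<cdot> (f \<Odot> Id C (y \<odot> x))) \<cdot> Assoc C u y x)"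
    by (subst assoc_nat[of _ _ _ u _ y _ x]) (simp_all add: assoc_arr)
  also have "\<dots> = (RUnit C v \<cdot> (f \<Odot> Id C (Unit C))) \<cdot> ((Id C u \<Odot> ev) \<cdot> Assoc C u y x)"
  proof -
    have "(Id C v \<Odot> ev) \<cdot> (f \<Odot> Id C (y \<odot> x)) = (f \<Odot> Id C (Unit C)) \<cdot> (Id C u \<Odot> ev)"
      by (simp add: tens_comp_arr)
    then show ?thesis by (simp add: assoc_arr)
  qed
  also have "\<dots> = f \<cdot> adj_counit u"
    unfolding adj_counit_def by (subst runit_nat[of f u v]) (simp_all add: assoc_arr)
  finally show ?thesis .
qed

lemma adj_unit_nat:
  assumes [simp]: "g \<in> Arr C" "Dom C g = u" "Cod C g = v"
  shows "((g \<Odot> Id C x) \<Odot> Id C y) \<cdot> adj_unit u = adj_unit v \<cdot> g"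
proof -
  have [simp]: "u \<in> Obj C" "v \<in> Obj C" using assms dom_cod_obj by blast+
  have r: "(g \<Odot> Id C (Unit C)) \<cdot> inv_arr C (RUnit C u) = inv_arr C (RUnit C v) \<cdot> g"
  proof -
    have "RUnit C v \<cdot> ((g \<Odot> Id C (Unit C)) \<cdot> inv_arr C (RUnit C u)) = g"
      by (subst comp_eq_extend[OF runit_nat[of g u v]]) (simp_all add: assoc_arr)
    then show ?thesis by (subst (asm) isom_move_left) simp_all
  qed
  have "((g \<Odot> Id C x) \<Odot> Id C y) \<cdot> adj_unit u
      = (((g \<Odot> Id C x) \<Odot> Id C y) \<cdot> inv_arr C (Assoc C u x y)) \<cdot> ((Id C u \<Odot> coev) \<cdot> inv_arr C (RUnit C u))"
    unfolding adj_unit_def by (simp add: assoc_arr)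
  also have "\<dots> = inv_arr C (Assoc C v x y) \<cdot> ((g \<Odot> Id C (x \<odot> y)) \<cdot> ((Id C u \<Odot> coev) \<cdot> inv_arr C (RUnit C u)))"
    by (subst assoc_inv_nat[of g "Id C x" "Id C y" u v x x y y, symmetric]) (simp_all add: assoc_arr)
  also have "\<dots> = inv_arr C (Assoc C v x y) \<cdot> ((Id C v \<Odot> coev) \<cdot> ((g \<Odot> Id C (Unit C)) \<cdot> inv_arr C (RUnit C u)))"
  proof -
    have "(g \<Odot> Id C (x \<odot> y)) \<cdot> (Id C u \<Odot> coev) = (Id C v \<Odot> coev) \<cdot> (g \<Odot> Id C (Unit C))"
      by (simp add: tens_comp_arr)
    from comp_eq_extend[OF this, of "inv_arr C (RUnit C u)"] show ?thesis by (simp add: assoc_arr)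
  qed
  also have "\<dots> = adj_unit v \<cdot> g"
    unfolding adj_unit_def r by (simp add: assoc_arr)
  finally show ?thesis .
qed

text \<open>All constraints are moved into the second tensor factor, where \<open>zigzag1\<close>
  tensored with \<open>u\<close> remains. \<open>P\<close> is the pentagon, \<open>N1\<close> and
  \<open>N2\<close> are naturality of the associator, \<open>K\<close> is the unit coherence
  \<open>runit_tens\<close> at the target and \<open>T\<close> the triangle axiom at the
  source.\<close>

lemma adj_triangle1:
  assumes u [simp]: "u \<in> Obj C"
  shows "adj_counit (u \<odot> x) \<cdot> (adj_unit u \<Odot> Id C x) = Id C (u \<odot> x)"
proof -
  let ?I = "Unit C"
  have P: "Assoc C (u \<odot> x) y x \<cdot> (inv_arr C (Assoc C u x y) \<Odot> Id C x)
      = inv_arr C (Assoc C u x (y \<odot> x)) \<cdot> ((Id C u \<Odot> Assoc C x y x) \<cdot> Assoc C u (x \<odot> y) x)"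
  proof -
    have "Assoc C u x (y \<odot> x) \<cdot> (Assoc C (u \<odot> x) y x \<cdot> (inv_arr C (Assoc C u x y) \<Odot> Id C x))
      = (Id C u \<Odot> Assoc C x y x) \<cdot> (Assoc C u (x \<odot> y) x \<cdot> ((Assoc C u x y \<Odot> Id C x) \<cdot> (inv_arr C (Assoc C u x y) \<Odot> Id C x)))"
      by (subst comp_eq_extend[OF pentagon]) (simp_all add: assoc_arr)
    also have "\<dots> = (Id C u \<Odot> Assoc C x y x) \<cdot> Assoc C u (x \<odot> y) x"
      by (subst whisker_right) simp_all
    finally show ?thesis by (subst (asm) isom_move_left) simp_all
  qed
  have N1: "Assoc C u (x \<odot> y) x \<cdot> ((Id C u \<Odot> coev) \<Odot> Id C x) = (Id C u \<Odot> (coev \<Odot> Id C x)) \<cdot> Assoc C u ?I x"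
    by (rule assoc_nat) simp_all
  have N2: "(Id C (u \<odot> x) \<Odot> ev) \<cdot> inv_arr C (Assoc C u x (y \<odot> x)) = inv_arr C (Assoc C u x ?I) \<cdot> (Id C u \<Odot> (Id C x \<Odot> ev))"
    by (subst assoc_inv_nat[of _ _ _ u _ x _ "y \<odot> x"]) simp_all
  have K: "RUnit C (u \<odot> x) \<cdot> inv_arr C (Assoc C u x ?I) = Id C u \<Odot> RUnit C x"
    by (subst runit_tens[symmetric]) (simp_all add: assoc_arr)
  have T: "Assoc C u ?I x \<cdot> (inv_arr C (RUnit C u) \<Odot> Id C x) = Id C u \<Odot> inv_arr C (LUnit C x)"
  proof -
    have "(Id C u \<Odot> LUnit C x) \<cdot> (Assoc C u ?I x \<cdot> (inv_arr C (RUnit C u) \<Odot> Id C x)) = Id C (u \<odot> x)"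
      by (subst comp_eq_extend[OF triangle]) (simp_all add: whisker_right)
    then show ?thesis by (subst (asm) isom_move_left) simp_all
  qed
  have "adj_counit (u \<odot> x) \<cdot> (adj_unit u \<Odot> Id C x)
     = RUnit C (u \<odot> x) \<cdot> ((Id C (u \<odot> x) \<Odot> ev) \<cdot> (Assoc C (u \<odot> x) y x \<cdot> ((inv_arr C (Assoc C u x y) \<Odot> Id C x) \<cdot>
         (((Id C u \<Odot> coev) \<Odot> Id C x) \<cdot> (inv_arr C (RUnit C u) \<Odot> Id C x)))))"
    unfolding adj_counit_def adj_unit_def by (simp add: assoc_arr whisker_right)
  also have "\<dots> = RUnit C (u \<odot> x) \<cdot> ((Id C (u \<odot> x) \<Odot> ev) \<cdot> (inv_arr C (Assoc C u x (y \<odot> x)) \<cdot> ((Id C u \<Odot> Assoc C x y x) \<cdot> (Assoc C u (x \<odot> y) x \<cdot>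
         (((Id C u \<Odot> coev) \<Odot> Id C x) \<cdot> (inv_arr C (RUnit C u) \<Odot> Id C x))))))"
    by (subst comp_eq_extend[OF P]) (simp_all add: assoc_arr)
  also have "\<dots> = RUnit C (u \<odot> x) \<cdot> ((Id C (u \<odot> x) \<Odot> ev) \<cdot> (inv_arr C (Assoc C u x (y \<odot> x)) \<cdot> ((Id C u \<Odot> Assoc C x y x) \<cdot>
         ((Id C u \<Odot> (coev \<Odot> Id C x)) \<cdot> (Assoc C u ?I x \<cdot> (inv_arr C (RUnit C u) \<Odot> Id C x))))))"
    by (subst comp_eq_extend[OF N1]) (simp_all add: assoc_arr)
  also have "\<dots> = RUnit C (u \<odot> x) \<cdot> (inv_arr C (Assoc C u x ?I) \<cdot> ((Id C u \<Odot> (Id C x \<Odot> ev)) \<cdot> ((Id C u \<Odot> Assoc C x y x) \<cdot>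
         ((Id C u \<Odot> (coev \<Odot> Id C x)) \<cdot> (Id C u \<Odot> inv_arr C (LUnit C x))))))"
    unfolding T by (subst comp_eq_extend[OF N2]) (simp_all add: assoc_arr)
  also have "\<dots> = (Id C u \<Odot> RUnit C x) \<cdot> ((Id C u \<Odot> (Id C x \<Odot> ev)) \<cdot> ((Id C u \<Odot> Assoc C x y x) \<cdot>
         ((Id C u \<Odot> (coev \<Odot> Id C x)) \<cdot> (Id C u \<Odot> inv_arr C (LUnit C x)))))"
    by (subst comp_eq_extend[OF K]) (simp_all add: assoc_arr)
  also have "\<dots> = Id C u \<Odot> (RUnit C x \<cdot> (Id C x \<Odot> ev) \<cdot> Assoc C x y x \<cdot> (coev \<Odot> Id C x) \<cdot> inv_arr C (LUnit C x))"
    by (simp add: whisker_left assoc_arr)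
  finally show ?thesis unfolding zigzag1 by simp
qed

text \<open>The same transport of associators ends in \<open>zigzag2\<close> tensored with
  \<open>v\<close>; now the unit coherence \<open>K\<close> is applied at the source and the
  triangle \<open>T\<close> at the target.\<close>

lemma adj_triangle2:
  assumes v [simp]: "v \<in> Obj C"
  shows "(adj_counit v \<Odot> Id C y) \<cdot> adj_unit (v \<odot> y) = Id C (v \<odot> y)"
proof -
  let ?I = "Unit C"
  have P: "(Assoc C v y x \<Odot> Id C y) \<cdot> inv_arr C (Assoc C (v \<odot> y) x y)
      = inv_arr C (Assoc C v (y \<odot> x) y) \<cdot> ((Id C v \<Odot> inv_arr C (Assoc C y x y)) \<cdot> Assoc C v y (x \<odot> y))"
  proof -
    have "(Id C v \<Odot> Assoc C y x y) \<cdot> (Assoc C v (y \<odot> x) y \<cdot> ((Assoc C v y x \<Odot> Id C y) \<cdot> inv_arr C (Assoc C (v \<odot> y) x y)))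
      = (Id C v \<Odot> Assoc C y x y) \<cdot> (Assoc C v (y \<odot> x) y) \<cdot> (Assoc C v y x \<Odot> Id C y) \<cdot> inv_arr C (Assoc C (v \<odot> y) x y)"
      by (simp add: assoc_arr)
    also have "\<dots> = Assoc C v y (x \<odot> y)"
      unfolding pentagon[OF v y x y, symmetric] by (simp add: assoc_arr)
    finally show ?thesis
      by (subst (asm) isom_move_left) (simp_all, subst (asm) isom_move_left, simp_all)
  qed
  have N1: "Assoc C v y (x \<odot> y) \<cdot> (Id C (v \<odot> y) \<Odot> coev) = (Id C v \<Odot> (Id C y \<Odot> coev)) \<cdot> Assoc C v y ?I"
    using assoc_nat[of "Id C v" "Id C y" coev v v y y ?I "x \<odot> y"] by simp
  have K: "Assoc C v y ?I \<cdot> inv_arr C (RUnit C (v \<odot> y)) = Id C v \<Odot> inv_arr C (RUnit C y)"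
  proof -
    have "(Id C v \<Odot> RUnit C y) \<cdot> (Assoc C v y ?I \<cdot> inv_arr C (RUnit C (v \<odot> y))) = Id C (v \<odot> y)"
      by (subst comp_eq_extend[OF runit_tens]) simp_all
    then show ?thesis by (subst (asm) isom_move_left) simp_all
  qed
  have N2: "((Id C v \<Odot> ev) \<Odot> Id C y) \<cdot> inv_arr C (Assoc C v (y \<odot> x) y) = inv_arr C (Assoc C v ?I y) \<cdot> (Id C v \<Odot> (ev \<Odot> Id C y))"
    by (subst assoc_inv_nat[of _ _ _ v _ "y \<odot> x" _ y]) simp_all
  have T: "(RUnit C v \<Odot> Id C y) \<cdot> inv_arr C (Assoc C v ?I y) = Id C v \<Odot> LUnit C y"
    by (subst triangle[symmetric]) (simp_all add: assoc_arr)
  have "(adj_counit v \<Odot> Id C y) \<cdot> adj_unit (v \<odot> y)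
     = (RUnit C v \<Odot> Id C y) \<cdot> (((Id C v \<Odot> ev) \<Odot> Id C y) \<cdot> ((Assoc C v y x \<Odot> Id C y) \<cdot> (inv_arr C (Assoc C (v \<odot> y) x y) \<cdot>
         ((Id C (v \<odot> y) \<Odot> coev) \<cdot> inv_arr C (RUnit C (v \<odot> y))))))"
    unfolding adj_counit_def adj_unit_def by (simp add: assoc_arr whisker_right[symmetric])
  also have "\<dots> = (RUnit C v \<Odot> Id C y) \<cdot> (((Id C v \<Odot> ev) \<Odot> Id C y) \<cdot> (inv_arr C (Assoc C v (y \<odot> x) y) \<cdot> ((Id C v \<Odot> inv_arr C (Assoc C y x y)) \<cdot> (Assoc C v y (x \<odot> y) \<cdot>
         ((Id C (v \<odot> y) \<Odot> coev) \<cdot> inv_arr C (RUnit C (v \<odot> y)))))))"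
    by (subst comp_eq_extend[OF P]) (simp_all add: assoc_arr)
  also have "\<dots> = (RUnit C v \<Odot> Id C y) \<cdot> (((Id C v \<Odot> ev) \<Odot> Id C y) \<cdot> (inv_arr C (Assoc C v (y \<odot> x) y) \<cdot> ((Id C v \<Odot> inv_arr C (Assoc C y x y)) \<cdot>
         ((Id C v \<Odot> (Id C y \<Odot> coev)) \<cdot> (Assoc C v y ?I \<cdot> inv_arr C (RUnit C (v \<odot> y)))))))"
    by (subst comp_eq_extend[OF N1]) (simp_all add: assoc_arr)
  also have "\<dots> = (RUnit C v \<Odot> Id C y) \<cdot> (inv_arr C (Assoc C v ?I y) \<cdot> ((Id C v \<Odot> (ev \<Odot> Id C y)) \<cdot> ((Id C v \<Odot> inv_arr C (Assoc C y x y)) \<cdot>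
         ((Id C v \<Odot> (Id C y \<Odot> coev)) \<cdot> (Id C v \<Odot> inv_arr C (RUnit C y))))))"
    unfolding K by (subst comp_eq_extend[OF N2]) (simp_all add: assoc_arr)
  also have "\<dots> = (Id C v \<Odot> LUnit C y) \<cdot> ((Id C v \<Odot> (ev \<Odot> Id C y)) \<cdot> ((Id C v \<Odot> inv_arr C (Assoc C y x y)) \<cdot>
         ((Id C v \<Odot> (Id C y \<Odot> coev)) \<cdot> (Id C v \<Odot> inv_arr C (RUnit C y)))))"
    by (subst comp_eq_extend[OF T]) (simp_all add: assoc_arr)
  also have "\<dots> = Id C v \<Odot> (LUnit C y \<cdot> (ev \<Odot> Id C y) \<cdot> inv_arr C (Assoc C y x y) \<cdot> (Id C y \<Odot> coev) \<cdot> inv_arr C (RUnit C y))"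
    by (simp add: whisker_left assoc_arr)
  finally show ?thesis unfolding zigzag2 by simp
qed

lemma adjunction_bij:
  assumes [simp]: "u \<in> Obj C" "v \<in> Obj C"
  shows "bij_betw (\<lambda>f. (f \<Odot> Id C y) \<cdot> adj_unit u) (Hom C (u \<odot> x) v) (Hom C u (v \<odot> y))"
proof (rule bij_betw_byWitness[where f' = "\<lambda>g. adj_counit v \<cdot> (g \<Odot> Id C x)"])
  show "\<forall>f\<in>Hom C (u \<odot> x) v. adj_counit v \<cdot> (((f \<Odot> Id C y) \<cdot> adj_unit u) \<Odot> Id C x) = f"
  proof
    fix f assume "f \<in> Hom C (u \<odot> x) v"
    then have f [simp]: "f \<in> Arr C" "Dom C f = u \<odot> x" "Cod C f = v" by (auto simp: Hom_iff)
    have "adj_counit v \<cdot> (((f \<Odot> Id C y) \<cdot> adj_unit u) \<Odot> Id C x)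
        = (adj_counit v \<cdot> ((f \<Odot> Id C y) \<Odot> Id C x)) \<cdot> (adj_unit u \<Odot> Id C x)"
      by (subst whisker_right[symmetric]) (simp_all add: assoc_arr)
    also have "\<dots> = f" unfolding adj_counit_nat[OF f] by (simp add: assoc_arr adj_triangle1)
    finally show "adj_counit v \<cdot> (((f \<Odot> Id C y) \<cdot> adj_unit u) \<Odot> Id C x) = f" .
  qed
  show "\<forall>g\<in>Hom C u (v \<odot> y). (adj_counit v \<cdot> (g \<Odot> Id C x)) \<Odot> Id C y \<cdot> adj_unit u = g"
  proof
    fix g assume "g \<in> Hom C u (v \<odot> y)"
    then have g [simp]: "g \<in> Arr C" "Dom C g = u" "Cod C g = v \<odot> y" by (auto simp: Hom_iff)
    have "((adj_counit v \<cdot> (g \<Odot> Id C x)) \<Odot> Id C y) \<cdot> adj_unit u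
        = (adj_counit v \<Odot> Id C y) \<cdot> (((g \<Odot> Id C x) \<Odot> Id C y) \<cdot> adj_unit u)"
      by (subst whisker_right[symmetric]) (simp_all add: assoc_arr)
    also have "\<dots> = g" unfolding adj_unit_nat[OF g]
      by (subst assoc_arr[symmetric]) (simp_all add: adj_triangle2)
    finally show "((adj_counit v \<cdot> (g \<Odot> Id C x)) \<Odot> Id C y) \<cdot> adj_unit u = g" .
  qed
qed (auto simp: Hom_iff)

lemma adjunction_has_dim:
  assumes [simp]: "u \<in> Obj C" "v \<in> Obj C" and "has_dim C u (v \<odot> y) n"
  shows "has_dim C (u \<odot> x) v n"
proof (rule has_dim_transfer[OF assms(3) adjunction_bij[OF assms(1,2)]])
  fix f g assume fg: "f \<in> Hom C (u \<odot> x) v" "g \<in> Hom C (u \<odot> x) v"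
  have h: "f \<Odot> Id C y \<in> Hom C ((u \<odot> x) \<odot> y) (v \<odot> y)" "g \<Odot> Id C y \<in> Hom C ((u \<odot> x) \<odot> y) (v \<odot> y)"
    "adj_unit u \<in> Hom C u ((u \<odot> x) \<odot> y)" using fg by (auto simp: Hom_iff)
  show "((f \<oplus> g) \<Odot> Id C y) \<cdot> adj_unit u = (f \<Odot> Id C y) \<cdot> adj_unit u \<oplus> (g \<Odot> Id C y) \<cdot> adj_unit u"
    using tens_plus_left[OF fg id_in_Hom[OF y]] comp_plus_left[OF h(3,1,2)] by simp
next
  fix a f assume f: "f \<in> Hom C (u \<odot> x) v"
  have h: "f \<Odot> Id C y \<in> Hom C ((u \<odot> x) \<odot> y) (v \<odot> y)" "adj_unit u \<in> Hom C u ((u \<odot> x) \<odot> y)" using f by (auto simp: Hom_iff)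
  show "((a \<star> f) \<Odot> Id C y) \<cdot> adj_unit u = a \<star> ((f \<Odot> Id C y) \<cdot> adj_unit u)"
    using tens_scale_left[OF f id_in_Hom[OF y]] comp_scale_left[OF h(2,1)] by simp
qed

end

end

section \<open>Frobenius--Perron dimensions\<close>

text \<open>The powers \<open>P k\<close> of the matrix, one more than it has entries, are linearly
  dependent; the relation is a non-zero polynomial that vanishes at every eigenvalue. Finiteness
  gives a meaning to the maximum in \<open>FPdim\<close>.\<close>

lemma finite_eigenvalues:
  fixes M :: "'i \<Rightarrow> 'i \<Rightarrow> real"
  assumes "finite I"
  shows "finite {t. \<exists>v. (\<exists>Y\<in>I. v Y \<noteq> 0) \<and> (\<forall>Y\<in>I. (\<Sum>Z\<in>I. M Y Z * v Z) = t * v Y)}" (is "finite ?E")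
proof -
  define P where "P = rec_nat (\<lambda>Y Z. if Y = Z then 1 else 0) (\<lambda>_ Q Y Z. \<Sum>W\<in>I. M Y W * Q W Z)"
  have P0: "P 0 Y Z = (if Y = Z then 1 else 0)" and PS: "P (Suc k) Y Z = (\<Sum>W\<in>I. M Y W * P k W Z)" for k Y Z
    unfolding P_def by simp_all
  define n where "n = card (I \<times> I)"
  obtain a where a: "\<exists>k\<in>{..n}. a k \<noteq> 0" "\<forall>j\<in>I \<times> I. (\<Sum>k\<in>{..n}. a k * P k (fst j) (snd j)) = 0"
    using nontrivial_relation[of "I \<times> I" "{..n}" "\<lambda>k j. P k (fst j) (snd j)"] assms n_def by auto
  define q where "q = (\<Sum>k\<le>n. monom (a k) k)"
  have "coeff q k = a k" if "k \<le> n" for k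
    using that by (simp add: q_def coeff_sum coeff_monom sum.delta)
  then have q: "q \<noteq> 0" using a(1) by (metis atMost_iff coeff_0)
  have "poly q t = 0" if t: "t \<in> ?E" for t
  proof -
    obtain v where v': "\<exists>Y\<in>I. v Y \<noteq> 0" "\<forall>Y\<in>I. (\<Sum>Z\<in>I. M Y Z * v Z) = t * v Y"
      using t by blast
    then obtain Y where v: "Y \<in> I" "v Y \<noteq> 0" by blast
    have p: "(\<Sum>Z\<in>I. P k Y Z * v Z) = t ^ k * v Y" if "Y \<in> I" for k Y
      using that
    proof (induction k arbitrary: Y)
      case 0
      then show ?case using assms by (simp add: P0 if_distrib[of "\<lambda>c. c * _"] cong: if_cong)
    next
      case (Suc k)
      have "(\<Sum>Z\<in>I. P (Suc k) Y Z * v Z) = (\<Sum>W\<in>I. M Y W * (\<Sum>Z\<in>I. P k W Z * v Z))"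
        unfolding PS sum_distrib_right sum_distrib_left by (subst sum.swap) (simp add: mult.assoc)
      also have "\<dots> = (\<Sum>W\<in>I. t ^ k * (M Y W * v W))" using Suc by (intro sum.cong) auto
      also have "\<dots> = t ^ Suc k * v Y" using v'(2) Suc.prems by (simp flip: sum_distrib_left)
      finally show ?case .
    qed
    have "poly q t * v Y = (\<Sum>k\<le>n. a k * (\<Sum>Z\<in>I. P k Y Z * v Z))"
      using p[OF v(1)] by (simp add: q_def poly_sum poly_monom sum_distrib_right mult.assoc)
    also have "\<dots> = (\<Sum>Z\<in>I. (\<Sum>k\<le>n. a k * P k Y Z) * v Z)"
      unfolding sum_distrib_left sum_distrib_right by (subst sum.swap) (simp add: mult.assoc)
    also have "\<dots> = 0" using a(2) v(1) by (intro sum.neutral) auto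
    finally show ?thesis using v(2) by simp
  qed
  then have "?E \<subseteq> {t. poly q t = 0}" by blast
  then show ?thesis using poly_roots_finite[OF q] finite_subset by blast
qed

locale closed_fusion_category = fusion_category C
  for C :: "('o, 'm, 'k::alg_closed_field, 'z) moncat_scheme" (structure)
begin

sublocale semisimple_category C
  by unfold_locales (rule finite_semisimple)

text \<open>A positive eigenvector of a non-negative matrix belongs to its largest eigenvalue: any
  other eigenvector is dominated by a multiple of \<open>w\<close>, and the eigenvalues can be
  compared at a class where the domination is an equality.\<close>

lemma FPdim_eqI:
  assumes x: "x \<in> Obj C" and t: "t \<ge> 0" and w: "\<And>Z. Z \<in> Irr C \<Longrightarrow> w Z > 0"
    and eigen: "\<And>y. simple_object C y \<Longrightarrow> weight w (x \<odot> y) = t * w (iso_class C y)"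
  shows "FPdim C x = t"
  unfolding FPdim_def
proof (rule Max_eqI)
  let ?E = "{t. t \<ge> 0 \<and> (\<exists>v :: 'o set \<Rightarrow> real. (\<exists>Y \<in> Irr C. v Y \<noteq> 0) \<and>
     (\<forall>Y \<in> Irr C. (\<Sum>Z \<in> Irr C. real (fusion_coeff C x Y Z) * v Z) = t * v Y))}"
  show "finite ?E" using finite_eigenvalues[OF finite_Irr, of "\<lambda>Y Z. real (fusion_coeff C x Y Z)"] by (rule rev_finite_subset) blast
  have w_eigen: "(\<Sum>Z \<in> Irr C. real (fusion_coeff C x Y Z) * w Z) = t * w Y" if "Y \<in> Irr C" for Y
    using eigen[OF Irr_rep(1)[OF that]] Irr_rep(2)[OF that] unfolding weight_def fusion_coeff_def by simp
  have ne: "iso_class C (Unit C) \<in> Irr C" using unit_simple iso_class_in_Irr by blast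
  have "w (iso_class C (Unit C)) \<noteq> 0" using w[OF ne] by simp
  then show "t \<in> ?E" using t w_eigen ne by blast
  fix s assume "s \<in> ?E"
  then obtain v where s: "s \<ge> 0" and v: "\<exists>Y \<in> Irr C. v Y \<noteq> 0"
    "\<forall>Y \<in> Irr C. (\<Sum>Z \<in> Irr C. real (fusion_coeff C x Y Z) * v Z) = s * v Y"
    by blast
  \<comment> \<open>The least factor for which r w dominates the absolute value of \<open>v\<close>;
    it is attained at the class \<open>Y\<close> obtained below.\<close>
  define r where "r = Max ((\<lambda>Z. \<bar>v Z\<bar> / w Z) ` Irr C)"
  have fin: "finite ((\<lambda>Z. \<bar>v Z\<bar> / w Z) ` Irr C)" using finite_Irr by simp
  have le: "\<bar>v Z\<bar> \<le> r * w Z" if "Z \<in> Irr C" for Z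
  proof -
    have "\<bar>v Z\<bar> / w Z \<le> r" unfolding r_def using that fin by (intro Max_ge) auto
    then show ?thesis using w[OF that] by (simp add: pos_divide_le_eq)
  qed
  have "r \<in> (\<lambda>Z. \<bar>v Z\<bar> / w Z) ` Irr C" unfolding r_def using ne by (intro Max_in fin) auto
  then obtain Y where Y: "Y \<in> Irr C" "r = \<bar>v Y\<bar> / w Y" by blast
  obtain Y' where Y': "Y' \<in> Irr C" "v Y' \<noteq> 0" using v(1) by blast
  have "0 < r * w Y'" using le[OF Y'(1)] Y'(2) by linarith
  then have r: "0 < r" using w[OF Y'(1)] by (simp add: zero_less_mult_iff)
  have rY: "\<bar>v Y\<bar> = r * w Y" using Y w[OF Y(1)] by simp
  have "s * (r * w Y) = \<bar>s * v Y\<bar>" using s rY by (simp add: abs_mult)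
  also have "\<dots> = \<bar>\<Sum>Z \<in> Irr C. real (fusion_coeff C x Y Z) * v Z\<bar>" using v(2) Y(1) by simp
  also have "\<dots> \<le> (\<Sum>Z \<in> Irr C. real (fusion_coeff C x Y Z) * \<bar>v Z\<bar>)"
    using sum_abs[of "\<lambda>Z. real (fusion_coeff C x Y Z) * v Z" "Irr C"] by (simp add: abs_mult)
  also have "\<dots> \<le> (\<Sum>Z \<in> Irr C. real (fusion_coeff C x Y Z) * (r * w Z))"
    using le by (intro sum_mono mult_left_mono) auto
  also have "\<dots> = r * (t * w Y)" unfolding w_eigen[OF Y(1), symmetric] by (simp add: sum_distrib_left algebra_simps)
  finally have "s * (r * w Y) \<le> t * (r * w Y)" by (simp add: algebra_simps)
  then show "s \<le> t" using r w[OF Y(1)] by simp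
qed

section \<open>Tensor products in fusion categories\<close>

lemma tens_left_functor:
  assumes x: "x \<in> Obj C" shows "linear_functor C C (\<lambda>y. x \<odot> y) (\<lambda>f. Id C x \<Odot> f)"
proof
  note i = id_in_Hom[OF x]
  show "Id C x \<Odot> f \<in> Hom C (x \<odot> y) (x \<odot> z)" if "f \<in> Hom C y z" for f y z using tens_arr[OF i that] .
  show "Id C x \<Odot> (g \<cdot> f) = (Id C x \<Odot> g) \<cdot> (Id C x \<Odot> f)" if "f \<in> Hom C y z" "g \<in> Hom C z w" for f g y z w
    using tens_comp[OF i i that] x by simp
  show "Id C x \<Odot> (f \<oplus> g) = (Id C x \<Odot> f) \<oplus> (Id C x \<Odot> g)" if "f \<in> Hom C y z" "g \<in> Hom C y z" for f g y z
    using tens_plus_right[OF i that] .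
  show "Id C x \<Odot> (a \<star> f) = a \<star> (Id C x \<Odot> f)" if "f \<in> Hom C y z" for a f y z
    using tens_scale_right[OF i that] .
qed (use x in simp_all)

lemma tens_right_functor:
  assumes x: "x \<in> Obj C" shows "linear_functor C C (\<lambda>y. y \<odot> x) (\<lambda>f. f \<Odot> Id C x)"
proof
  note i = id_in_Hom[OF x]
  show "f \<Odot> Id C x \<in> Hom C (y \<odot> x) (z \<odot> x)" if "f \<in> Hom C y z" for f y z using tens_arr[OF that i] .
  show "(g \<cdot> f) \<Odot> Id C x = (g \<Odot> Id C x) \<cdot> (f \<Odot> Id C x)" if "f \<in> Hom C y z" "g \<in> Hom C z w" for f g y z w
    using tens_comp[OF that i i] x by simp
  show "(f \<oplus> g) \<Odot> Id C x = (f \<Odot> Id C x) \<oplus> (g \<Odot> Id C x)" if "f \<in> Hom C y z" "g \<in> Hom C y z" for f g y z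
    using tens_plus_left[OF that i] .
  show "(a \<star> f) \<Odot> Id C x = a \<star> (f \<Odot> Id C x)" if "f \<in> Hom C y z" for a f y z
    using tens_scale_left[OF that i] .
qed (use x in simp_all)

lemma tens_isomorphic:
  assumes "isomorphic C x x'" "isomorphic C y y'" shows "isomorphic C (x \<odot> y) (x' \<odot> y')"
proof -
  obtain f g where "isom C f" "Dom C f = x" "Cod C f = x'" "isom C g" "Dom C g = y" "Cod C g = y'"
    using assms by (meson isomorphicE)
  then show ?thesis by (intro isomorphicI[of "f \<Odot> g"]) auto
qed

lemma assoc_isomorphic:
  "x \<in> Obj C \<Longrightarrow> y \<in> Obj C \<Longrightarrow> z \<in> Obj C \<Longrightarrow> isomorphic C ((x \<odot> y) \<odot> z) (x \<odot> (y \<odot> z))"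
  by (rule isomorphicI[of "Assoc C x y z"]) auto

lemma unit_isomorphic:
  "x \<in> Obj C \<Longrightarrow> isomorphic C (Unit C \<odot> x) x" "x \<in> Obj C \<Longrightarrow> isomorphic C (x \<odot> Unit C) x"
  by (rule isomorphicI[of "LUnit C x"], auto, rule isomorphicI[of "RUnit C x"], auto)

lemma hom_dim_adjunction:
  assumes "dual_pair C y x" "u \<in> Obj C" "v \<in> Obj C" shows "hom_dim C (u \<odot> x) v = hom_dim C u (v \<odot> y)"
proof -
  obtain ev coev where d: "x \<in> Obj C" "y \<in> Obj C" "ev \<in> Hom C (y \<odot> x) (Unit C)" "coev \<in> Hom C (Unit C) (x \<odot> y)"
    "RUnit C x \<cdot> (Id C x \<Odot> ev) \<cdot> Assoc C x y x \<cdot> (coev \<Odot> Id C x) \<cdot> inv_arr C (LUnit C x) = Id C x"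
    "LUnit C y \<cdot> (ev \<Odot> Id C y) \<cdot> inv_arr C (Assoc C y x y) \<cdot> (Id C y \<Odot> coev) \<cdot> inv_arr C (RUnit C y) = Id C y"
    using assms(1) unfolding dual_pair_def by blast
  show ?thesis
    using has_dim_hom_dim[OF adjunction_has_dim[OF d assms(2,3) has_dim]] d assms by simp
qed

lemma direct_sum_tens_left: "x \<in> Obj C \<Longrightarrow> direct_sum C y ys \<Longrightarrow> direct_sum C (x \<odot> y) (map (\<lambda>z. x \<odot> z) ys)"
  by (rule functor_direct_sum[OF linear_category_axioms tens_left_functor])

lemma direct_sum_tens_right: "x \<in> Obj C \<Longrightarrow> direct_sum C y ys \<Longrightarrow> direct_sum C (y \<odot> x) (map (\<lambda>z. z \<odot> x) ys)"
  by (rule functor_direct_sum[OF linear_category_axioms tens_right_functor])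

lemma tens_zero:
  assumes "x \<in> Obj C" "zero_object C y" shows "zero_object C (x \<odot> y)" "zero_object C (y \<odot> x)"
  using functor_zero[OF linear_category_axioms tens_left_functor] functor_zero[OF linear_category_axioms tens_right_functor] assms
  by blast+

subsection \<open>Invertible objects\<close>

lemma invertible_obj: "invertible_object C x \<Longrightarrow> x \<in> Obj C"
  unfolding invertible_object_def by blast

lemma invertibleE:
  assumes "invertible_object C x"
  obtains y where "invertible_object C y" "isomorphic C (x \<odot> y) (Unit C)" "isomorphic C (y \<odot> x) (Unit C)"
  using assms unfolding invertible_object_def by blast

lemma invertible_unit: "invertible_object C (Unit C)"
  unfolding invertible_object_def using unit_isomorphic[of "Unit C"] by auto

lemma invertible_iso:
  assumes "invertible_object C x" "isomorphic C x x'" shows "invertible_object C x'"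
proof -
  obtain y where y: "y \<in> Obj C" "isomorphic C (x \<odot> y) (Unit C)" "isomorphic C (y \<odot> x) (Unit C)"
    using assms unfolding invertible_object_def by blast
  have "isomorphic C (x' \<odot> y) (Unit C)" "isomorphic C (y \<odot> x') (Unit C)"
    using y assms(2) tens_isomorphic isomorphic_refl isomorphic_sym isomorphic_trans by meson+
  then show ?thesis unfolding invertible_object_def using y isomorphic_obj[OF assms(2)] by blast
qed

lemma cancel_isomorphic:
  assumes "isomorphic C (x \<odot> y) (Unit C)" "x \<in> Obj C" "y \<in> Obj C" "u \<in> Obj C"
  shows "isomorphic C (x \<odot> (y \<odot> u)) u" "isomorphic C ((u \<odot> x) \<odot> y) u"
proof -
  have "isomorphic C (x \<odot> (y \<odot> u)) ((x \<odot> y) \<odot> u)" using assms assoc_isomorphic isomorphic_sym by blast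
  moreover have "isomorphic C ((x \<odot> y) \<odot> u) (Unit C \<odot> u)" using assms tens_isomorphic isomorphic_refl by blast
  ultimately show "isomorphic C (x \<odot> (y \<odot> u)) u" using unit_isomorphic(1)[OF assms(4)] isomorphic_trans by blast
  have "isomorphic C ((u \<odot> x) \<odot> y) (u \<odot> (x \<odot> y))" using assms assoc_isomorphic by blast
  moreover have "isomorphic C (u \<odot> (x \<odot> y)) (u \<odot> Unit C)" using assms tens_isomorphic isomorphic_refl by blast
  ultimately show "isomorphic C ((u \<odot> x) \<odot> y) u" using unit_isomorphic(2)[OF assms(4)] isomorphic_trans by blast
qed

lemma invertible_tens:
  assumes "invertible_object C x" "invertible_object C y" shows "invertible_object C (x \<odot> y)"
proof -
  obtain x' y' where x': "x' \<in> Obj C" "isomorphic C (x \<odot> x') (Unit C)" "isomorphic C (x' \<odot> x) (Unit C)"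
    and y': "y' \<in> Obj C" "isomorphic C (y \<odot> y') (Unit C)" "isomorphic C (y' \<odot> y) (Unit C)"
    using assms unfolding invertible_object_def by blast
  have o: "x \<in> Obj C" "y \<in> Obj C" using assms invertible_obj by auto
  have *: "isomorphic C ((a \<odot> b) \<odot> (b' \<odot> a')) (Unit C)"
    if "a \<in> Obj C" "b \<in> Obj C" "a' \<in> Obj C" "b' \<in> Obj C" "isomorphic C (a \<odot> a') (Unit C)" "isomorphic C (b \<odot> b') (Unit C)"
    for a b a' b'
  proof -
    have "isomorphic C ((a \<odot> b) \<odot> (b' \<odot> a')) (a \<odot> (b \<odot> (b' \<odot> a')))" using that assoc_isomorphic by simp
    moreover have "isomorphic C (a \<odot> (b \<odot> (b' \<odot> a'))) (a \<odot> a')"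
      using cancel_isomorphic(1)[OF that(6,2,4,3)] tens_isomorphic isomorphic_refl that by blast
    ultimately show ?thesis using that isomorphic_trans by blast
  qed
  show ?thesis unfolding invertible_object_def
    using *[OF o x'(1) y'(1) x'(2) y'(2)] *[OF y'(1) x'(1) o(2,1) y'(3) x'(3)] x' y' o by auto
qed

lemma invertible_tens_simple:
  assumes "invertible_object C a" "simple_object C u" shows "simple_object C (a \<odot> u)" "simple_object C (u \<odot> a)"
proof -
  obtain b where b: "b \<in> Obj C" "isomorphic C (a \<odot> b) (Unit C)" "isomorphic C (b \<odot> a) (Unit C)"
    using assms unfolding invertible_object_def by blast
  have a: "a \<in> Obj C" using assms invertible_obj by auto
  show "simple_object C (a \<odot> u)"
    by (rule functor_simple[OF tens_left_functor[OF a] tens_left_functor[OF b(1)] _ _ assms(2)])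
      (use cancel_isomorphic a b in auto)
  show "simple_object C (u \<odot> a)"
    by (rule functor_simple[OF tens_right_functor[OF a] tens_right_functor[OF b(1)] _ _ assms(2)])
      (use cancel_isomorphic a b in auto)
qed

lemma invertible_simple: "invertible_object C x \<Longrightarrow> simple_object C x"
  using invertible_tens_simple(2)[OF _ unit_simple] unit_isomorphic(1) invertible_obj simple_iso by blast

text \<open>As for inverses in a monoid, both objects are isomorphic to y \<otimes> (x \<otimes>
  z).\<close>

lemma inverse_unique_iso:
  assumes "x \<in> Obj C" "y \<in> Obj C" "z \<in> Obj C" "isomorphic C (y \<odot> x) (Unit C)" "isomorphic C (x \<odot> z) (Unit C)"
  shows "isomorphic C y z"
  using cancel_isomorphic(1)[OF assms(4,2,1,3)] cancel_isomorphic(2)[OF assms(5,1,3,2)]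
    assoc_isomorphic[OF assms(2,1,3)] isomorphic_sym isomorphic_trans by blast

lemma InvE: assumes "a \<in> carrier (Inv C)" obtains x where "invertible_object C x" "a = iso_class C x"
  using assms unfolding Inv_def by auto

lemma Inv_mult:
  assumes "invertible_object C x" "invertible_object C y"
  shows "iso_class C x \<otimes>\<^bsub>Inv C\<^esub> iso_class C y = iso_class C (x \<odot> y)"
proof -
  have o: "x \<in> Obj C" "y \<in> Obj C" using assms invertible_obj by auto
  have "(\<exists>x'\<in>iso_class C x. \<exists>y'\<in>iso_class C y. isomorphic C (x' \<odot> y') z) \<longleftrightarrow> isomorphic C (x \<odot> y) z" for z
    using mem_iso_class o tens_isomorphic isomorphic_trans unfolding iso_class_def by blast
  then show ?thesis unfolding Inv_def iso_class_def[of C "x \<odot> y"] by simp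
qed

lemma Inv_one: "\<one>\<^bsub>Inv C\<^esub> = iso_class C (Unit C)"
  unfolding Inv_def by simp

lemma Inv_mem:
  assumes "a \<in> carrier (Inv C)" "x \<in> a" shows "invertible_object C x" "iso_class C x = a"
proof -
  obtain z where z: "invertible_object C z" "a = iso_class C z" using assms InvE by blast
  then have "isomorphic C z x" using assms unfolding iso_class_def by simp
  then show "invertible_object C x" "iso_class C x = a"
    using z invertible_iso iso_class_eq_iff isomorphic_obj by blast+
qed

end

section \<open>Full subcategories\<close>

lemma full_subcategory_simps [simp]:
  "Obj (full_subcategory C S) = S"
  "Arr (full_subcategory C S) = {f \<in> Arr C. Dom C f \<in> S \<and> Cod C f \<in> S}"
  "Dom (full_subcategory C S) = Dom C" "Cod (full_subcategory C S) = Cod C" "Id (full_subcategory C S) = Id C"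
  "Comp (full_subcategory C S) = Comp C" "Plus (full_subcategory C S) = Plus C"
  "Null (full_subcategory C S) = Null C" "Scale (full_subcategory C S) = Scale C"
  by (simp_all add: full_subcategory_def)

lemma neutral_component_simps [simp]:
  "Obj (neutral_component G B) = Grade B \<one>\<^bsub>G\<^esub>"
  "Arr (neutral_component G B) = {f \<in> Arr B. Dom B f \<in> Grade B \<one>\<^bsub>G\<^esub> \<and> Cod B f \<in> Grade B \<one>\<^bsub>G\<^esub>}"
  "Dom (neutral_component G B) = Dom B" "Cod (neutral_component G B) = Cod B" "Id (neutral_component G B) = Id B"
  "Comp (neutral_component G B) = Comp B" "Plus (neutral_component G B) = Plus B"
  "Null (neutral_component G B) = Null B" "Scale (neutral_component G B) = Scale B"
  "TensO (neutral_component G B) = TensO B" "TensA (neutral_component G B) = TensA B"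
  "Unit (neutral_component G B) = Unit B" "Assoc (neutral_component G B) = Assoc B"
  "LUnit (neutral_component G B) = LUnit B" "RUnit (neutral_component G B) = RUnit B"
  by (simp_all add: neutral_component_def full_subcategory_def moncat.defs braidcat.defs)

lemma Braid_neutral_component:
  "Braid (neutral_component G B) x y = (ActId B y \<Odot>\<^bsub>B\<^esub> Id B x) \<cdot>\<^bsub>B\<^esub> CBraid B \<one>\<^bsub>G\<^esub> x y"
  by (simp add: neutral_component_def full_subcategory_def moncat.defs braidcat.defs)

lemma module_component_simps [simp]:
  "Obj (module_component B g) = Grade B g"
  "Arr (module_component B g) = {f \<in> Arr B. Dom B f \<in> Grade B g \<and> Cod B f \<in> Grade B g}"
  "Dom (module_component B g) = Dom B" "Cod (module_component B g) = Cod B" "Id (module_component B g) = Id B"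
  "Comp (module_component B g) = Comp B" "Plus (module_component B g) = Plus B"
  "Null (module_component B g) = Null B" "Scale (module_component B g) = Scale B"
  "MActO (module_component B g) = TensO B" "MActA (module_component B g) = TensA B"
  "MAssoc (module_component B g) = Assoc B" "MUnit (module_component B g) = LUnit B"
  by (simp_all add: module_component_def full_subcategory_def lincat.defs modcat.defs)

text \<open>The neutral component and the components as modules extend \<open>lincat\<close> by
  different fields, so the comparison with the ambient category is made for any record
  \<open>S\<close> that inherits the operations, instead of for \<open>full_subcategory\<close>
  itself.\<close>

definition is_full_subcategory ::
  "('o, 'm, 'k, 'z) lincat_scheme \<Rightarrow> ('o, 'm, 'k, 'y) lincat_scheme \<Rightarrow> bool" where
  "is_full_subcategory S C \<longleftrightarrow> Obj S \<subseteq> Obj C \<and> Arr S = {f \<in> Arr C. Dom C f \<in> Obj S \<and> Cod C f \<in> Obj S} \<and>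
     Dom S = Dom C \<and> Cod S = Cod C \<and> Id S = Id C \<and> Comp S = Comp C \<and> Plus S = Plus C \<and> Null S = Null C \<and> Scale S = Scale C"

locale full_sub = linear_category C
  for C :: "('o, 'm, 'k::field, 'z) lincat_scheme" and S :: "('o, 'm, 'k, 'y) lincat_scheme" +
  assumes sub: "is_full_subcategory S C"
begin

lemma sub_obj: "x \<in> Obj S \<Longrightarrow> x \<in> Obj C"
  using sub unfolding is_full_subcategory_def by blast

lemma sub_simps: "Dom S = Dom C" "Cod S = Cod C" "Id S = Id C" "Comp S = Comp C" "Plus S = Plus C" "Null S = Null C" "Scale S = Scale C"
  using sub unfolding is_full_subcategory_def by auto

lemma sub_arr: "f \<in> Arr S \<longleftrightarrow> f \<in> Arr C \<and> Dom C f \<in> Obj S \<and> Cod C f \<in> Obj S"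
  using sub unfolding is_full_subcategory_def by auto

lemma sub_Hom: "f \<in> Hom S x y \<longleftrightarrow> f \<in> Hom C x y \<and> x \<in> Obj S \<and> y \<in> Obj S"
  unfolding Hom_def by (auto simp: sub_arr sub_simps)

lemma sub_Hom_eq: "x \<in> Obj S \<Longrightarrow> y \<in> Obj S \<Longrightarrow> Hom S x y = Hom C x y"
  using sub_Hom by blast

lemma linear_category_sub: "linear_category S"
proof (unfold_locales, goal_cases)
  case (1 f)
  then show ?case by (simp add: sub_arr sub_simps)
next
  case (2 x)
  then show ?case using id_in_Hom sub_obj by (simp add: sub_Hom sub_simps)
next
  case (3 f x y g z)
  then show ?case using comp_in_Hom[of f x y g z] by (simp add: sub_Hom sub_simps)
next
  case (4 f x y g z h w)
  then show ?case using comp_assoc[of f x y g z h w] by (simp add: sub_Hom sub_simps)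
next
  case (5 f x y)
  then show ?case using id_comp[of f x y] by (simp add: sub_Hom sub_simps)
next
  case (6 f x y)
  then show ?case using comp_id[of f x y] by (simp add: sub_Hom sub_simps)
next
  case (7 x y)
  then show ?case using null_in_Hom[of x y] sub_obj by (simp add: sub_Hom sub_simps)
next
  case (8 f x y g)
  then show ?case using plus_in_Hom[of f x y g] by (simp add: sub_Hom sub_simps)
next
  case (9 f x y a)
  then show ?case using scale_in_Hom[of f x y a] by (simp add: sub_Hom sub_simps)
next
  case (10 f x y g h)
  then show ?case using plus_assoc[of f x y g h] by (simp add: sub_Hom sub_simps)
next
  case (11 f x y g)
  then show ?case using plus_commute[of f x y g] by (simp add: sub_Hom sub_simps)
next
  case (12 f x y)
  then show ?case using plus_null[of f x y] by (simp add: sub_Hom sub_simps)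
next
  case (13 f x y)
  then show ?case using plus_inverse[of f x y] sub_Hom[of _ x y] by (auto simp add: sub_simps)
next
  case (14 f x y)
  then show ?case using scale_one[of f x y] by (simp add: sub_Hom sub_simps)
next
  case (15 f x y a b)
  then show ?case using scale_scale[of f x y a b] by (simp add: sub_Hom sub_simps)
next
  case (16 f x y a b)
  then show ?case using scale_plus_left[of f x y a b] by (simp add: sub_Hom sub_simps)
next
  case (17 f x y g a)
  then show ?case using scale_plus_right[of f x y g a] by (simp add: sub_Hom sub_simps)
next
  case (18 f x y g z h)
  then show ?case using comp_plus_left[of f x y g z h] by (simp add: sub_Hom sub_simps)
next
  case (19 f x y g h z)
  then show ?case using comp_plus_right[of f x y g h z] by (simp add: sub_Hom sub_simps)
next
  case (20 f x y g z a)
  then show ?case using comp_scale_left[of f x y g z a] by (simp add: sub_Hom sub_simps)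
next
  case (21 f x y g z a)
  then show ?case using comp_scale_right[of f x y g z a] by (simp add: sub_Hom sub_simps)
qed

lemma inverse_arrows_sub:
  "inverse_arrows S f g \<longleftrightarrow> f \<in> Arr S \<and> inverse_arrows C f g"
  unfolding inverse_arrows_def by (auto simp: sub_Hom sub_arr sub_simps Hom_iff)

lemma isom_sub: "isom S f \<longleftrightarrow> f \<in> Arr S \<and> isom C f"
  unfolding isom_def inverse_arrows_sub by blast

lemma inv_arr_sub: "f \<in> Arr S \<Longrightarrow> inv_arr S f = inv_arr C f"
  unfolding inv_arr_def inverse_arrows_sub by simp

lemma Iso_sub: "f \<in> Iso S x y \<longleftrightarrow> f \<in> Iso C x y \<and> x \<in> Obj S \<and> y \<in> Obj S"
  unfolding Iso_def by (auto simp: isom_sub sub_arr sub_Hom Hom_iff)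

lemma isomorphic_sub: "isomorphic S x y \<longleftrightarrow> isomorphic C x y \<and> x \<in> Obj S \<and> y \<in> Obj S"
  unfolding isomorphic_def using Iso_sub[of _ x y] by blast

lemma zero_object_sub: "zero_object S x \<longleftrightarrow> zero_object C x \<and> x \<in> Obj S"
  using linear_category.zero_object_iff[OF linear_category_sub, of x] zero_object_iff[of x] sub_obj by (auto simp: sub_simps)

lemma lspan_sub: "lspan S x y T = lspan C x y T"
proof -
  have "f \<in> lspan S x y T" if "f \<in> lspan C x y T" for f
    using that
  proof induction
    case null
    show ?case using lspan.null[of S x y T] by (simp add: sub_simps)
  next
    case (step f g a)
    then show ?case using lspan.step[of f T g S x y a] by (simp add: sub_simps)
  qed
  moreover have "f \<in> lspan C x y T" if "f \<in> lspan S x y T" for f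
    using that
  proof induction
    case null
    show ?case using lspan.null[of C x y T] by (simp add: sub_simps)
  next
    case (step f g a)
    then show ?case using lspan.step[of f T g C x y a] by (simp add: sub_simps)
  qed
  ultimately show ?thesis by blast
qed

lemma hom_dim_sub: "x \<in> Obj S \<Longrightarrow> y \<in> Obj S \<Longrightarrow> hom_dim S x y = hom_dim C x y"
  unfolding hom_dim_def by (simp add: sub_Hom_eq lspan_sub)

lemma direct_sum_sub: "direct_sum S x ys \<longleftrightarrow> direct_sum C x ys \<and> x \<in> Obj S \<and> set ys \<subseteq> Obj S"
proof -
  have "direct_sum_maps S x ys i p \<longleftrightarrow> direct_sum_maps C x ys i p" if "x \<in> Obj S" "set ys \<subseteq> Obj S" for i p
  proof -
    have "ys ! r \<in> Obj S" if "r < length ys" for r using that \<open>set ys \<subseteq> Obj S\<close> by auto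
    then show ?thesis using that unfolding direct_sum_maps_def by (auto simp: sub_simps sub_Hom)
  qed
  then show ?thesis unfolding direct_sum_iff_maps using sub_obj by blast
qed

end

section \<open>Graded fusion categories\<close>

locale closed_graded_fusion_category = graded_fusion_category G B
  for G :: "('g, 'w) monoid_scheme" and B :: "('g, 'o, 'm, 'k::alg_closed_field, 'z) crossedcat_scheme" (structure)
begin

sublocale closed_fusion_category B
  by unfold_locales

abbreviation "e \<equiv> \<one>\<^bsub>G\<^esub>"

lemma grade_obj': "x \<in> Grade B g \<Longrightarrow> g \<in> carrier G \<Longrightarrow> x \<in> Obj B"
  using grade_obj by blast

lemma grade_unique:
  assumes "g \<in> carrier G" "h \<in> carrier G" "x \<in> Grade B g" "x \<in> Grade B h" "\<not> zero_object B x" shows "g = h"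
proof (rule ccontr)
  assume "g \<noteq> h"
  then have "Hom B x x = {Null B x x}" using grade_orthogonal assms by blast
  then show False using id_in_Hom assms zero_object_iff grade_obj' by blast
qed

lemma grade_hom:
  assumes "g \<in> carrier G" "h \<in> carrier G" "x \<in> Grade B g" "y \<in> Grade B h" "hom_dim B x y > 0" shows "g = h"
  using grade_orthogonal[OF assms(1,2) _ assms(3,4)] hom_dim_eq_0_iff[of x y] assms grade_obj' by auto

lemma zero_in_grade: "g \<in> carrier G \<Longrightarrow> zero_object B x \<Longrightarrow> x \<in> Grade B g"
  using grade_sum[of g "[]" x] direct_sum_Nil by simp

text \<open>Some homogeneous summand has a non-zero arrow to \<open>x\<close>; it is non-zero and,
  as a summand of an object of length one, simple, hence isomorphic to \<open>x\<close>.\<close>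

lemma simple_homogeneous: assumes "simple_object B x" obtains g where "g \<in> carrier G" "x \<in> Grade B g"
proof -
  have xo: "x \<in> Obj B" using assms simple_object_obj by blast
  obtain ys where ys: "set ys \<subseteq> (\<Union>g \<in> carrier G. Grade B g)" "direct_sum B x ys" using grade_decomposition xo by blast
  have yo: "ys ! r \<in> Obj B" if "r < length ys" for r using that ys(2) direct_sum_obj by auto
  have "(\<Sum>r<length ys. hom_dim B (ys ! r) x) \<noteq> 0"
    using hom_dim_direct_sum_out[OF ys(2) xo] assms simple_iff_hom_dim by simp
  then obtain r where r: "r < length ys" "hom_dim B (ys ! r) x \<noteq> 0" by (meson lessThan_iff sum.neutral)
  have "len (ys ! r) \<le> (\<Sum>r<length ys. len (ys ! r))" using r by (intro member_le_sum) auto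
  then have "len (ys ! r) \<le> 1" using len_direct_sum[OF ys(2)] len_simple[OF assms] by simp
  moreover have "len (ys ! r) \<noteq> 0"
    using r len_zero_iff[OF yo[OF r(1)]] zero_object_Hom(1)[of "ys ! r"] hom_dim_pos_iff[OF yo[OF r(1)] xo] by auto
  ultimately have "simple_object B (ys ! r)" using len_eq_1 yo r by (metis le_antisym less_one linorder_not_le)
  then have "isomorphic B (ys ! r) x" using simple_hom_iso assms r by simp
  moreover obtain g where "g \<in> carrier G" "ys ! r \<in> Grade B g" using ys(1) r(1) nth_mem by blast
  ultimately show thesis using that grade_replete by blast
qed

lemma grade_of_simple_hom:
  assumes "simple_object B y" "g \<in> carrier G" "x \<in> Grade B g" "hom_dim B y x > 0" shows "y \<in> Grade B g"
proof -
  obtain h where "h \<in> carrier G" "y \<in> Grade B h" using simple_homogeneous assms by blast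
  then show ?thesis using grade_hom assms by blast
qed

lemma summand_hom_pos:
  assumes "direct_sum B x ys" "r < length ys" "simple_object B (ys ! r)" shows "hom_dim B (ys ! r) x > 0"
proof -
  have "0 < hom_dim B (ys ! r) (ys ! r)" using assms simple_iff_hom_dim by simp
  also have "\<dots> \<le> (\<Sum>s<length ys. hom_dim B (ys ! r) (ys ! s))" using assms by (intro member_le_sum) auto
  also have "\<dots> = hom_dim B (ys ! r) x" using hom_dim_direct_sum_in[OF assms(1)] simple_object_obj[OF assms(3)] by simp
  finally show ?thesis .
qed

lemma grade_decompose:
  assumes "g \<in> carrier G" "x \<in> Grade B g"
  obtains ys where "direct_sum B x ys" "\<And>r. r < length ys \<Longrightarrow> simple_object B (ys ! r)" "\<And>r. r < length ys \<Longrightarrow> ys ! r \<in> Grade B g"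
proof -
  obtain ys where ys: "\<forall>y \<in> set ys. simple_object B y" "direct_sum B x ys" using decompose grade_obj' assms by blast
  then have "ys ! r \<in> Grade B g" if "r < length ys" for r
    using grade_of_simple_hom[OF _ assms summand_hom_pos[OF ys(2) that]] that by simp
  with ys that show thesis by simp
qed

lemma exists_simple: assumes "g \<in> carrier G" obtains x where "simple_object B x" "x \<in> Grade B g"
proof -
  obtain x where x: "x \<in> Grade B g" "\<not> zero_object B x" using grade_faithful assms by blast
  obtain ys where ys: "direct_sum B x ys" "\<And>r. r < length ys \<Longrightarrow> simple_object B (ys ! r)" "\<And>r. r < length ys \<Longrightarrow> ys ! r \<in> Grade B g"
    using grade_decompose[OF assms x(1)] by blast
  have "ys \<noteq> []" using ys(1) x direct_sum_Nil by auto
  then show thesis using that ys(2,3)[of 0] by simp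
qed

lemma exists_simple_hom:
  assumes "g \<in> carrier G" "x \<in> Grade B g" "\<not> zero_object B x"
  obtains y where "simple_object B y" "y \<in> Grade B g" "hom_dim B y x > 0"
proof -
  obtain ys where ys: "direct_sum B x ys" "\<And>r. r < length ys \<Longrightarrow> simple_object B (ys ! r)" "\<And>r. r < length ys \<Longrightarrow> ys ! r \<in> Grade B g"
    using grade_decompose[OF assms(1,2)] by blast
  have "ys \<noteq> []" using ys(1) assms direct_sum_Nil by auto
  then show thesis using that ys(2,3)[of 0] summand_hom_pos[OF ys(1), of 0] by simp
qed

lemma simple_not_zero: "simple_object B x \<Longrightarrow> \<not> zero_object B x"
  unfolding simple_object_def by blast

text \<open>Since 1 \<otimes> 1 is isomorphic to 1, the degree of the unit is an idempotent of the
  group.\<close>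

lemma unit_grade: "Unit B \<in> Grade B e"
proof -
  obtain g where g: "g \<in> carrier G" "Unit B \<in> Grade B g" using simple_homogeneous unit_simple by blast
  have "Unit B \<odot> Unit B \<in> Grade B (g \<otimes>\<^bsub>G\<^esub> g)" using grade_tensor g by blast
  then have "Unit B \<in> Grade B (g \<otimes>\<^bsub>G\<^esub> g)" using grade_replete[OF _ _ unit_isomorphic(1)[OF unit_obj]] g by simp
  then have "g \<otimes>\<^bsub>G\<^esub> g = g" using grade_unique[of "g \<otimes>\<^bsub>G\<^esub> g" g] g simple_not_zero[OF unit_simple] by simp
  then have "g = e" using g by (metis l_cancel_one one_closed)
  then show ?thesis using g by simp
qed

text \<open>By adjunction a simple summand \<open>?u\<close> of \<open>y\<close> has a non-zero
  arrow from \<open>?u \<odot> x\<close> to the unit, so its degree is inverse to \<open>g\<close>.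
  Homogeneity of the dual is part of the claim, hence the argument summand by summand.\<close>

lemma dual_grade:
  assumes d: "dual_pair B y x" and g: "g \<in> carrier G" and x: "x \<in> Grade B g" shows "y \<in> Grade B (inv\<^bsub>G\<^esub> g)"
proof -
  have o: "x \<in> Obj B" "y \<in> Obj B" using d unfolding dual_pair_def by auto
  obtain ys where ys: "\<forall>y \<in> set ys. simple_object B y" "direct_sum B y ys" using decompose o by blast
  have "ys ! r \<in> Grade B (inv\<^bsub>G\<^esub> g)" if r: "r < length ys" for r
  proof -
    let ?u = "ys ! r"
    have u: "simple_object B ?u" "?u \<in> Obj B" using ys r simple_object_obj by auto
    obtain k where k: "k \<in> carrier G" "?u \<in> Grade B k" using simple_homogeneous u by blast
    have "0 < hom_dim B ?u y" using summand_hom_pos[OF ys(2) r u(1)] .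
    also have "\<dots> = hom_dim B (?u \<odot> x) (Unit B)"
      using hom_dim_adjunction[OF d u(2) unit_obj] hom_dim_iso(2)[OF unit_isomorphic(1)[OF o(2)] u(2)] by simp
    finally have "k \<otimes>\<^bsub>G\<^esub> g = e" using grade_hom[OF _ _ grade_tensor[OF k(1) g k(2) x] unit_grade] k g by simp
    then have "k = inv\<^bsub>G\<^esub> g" using k g inv_equality by simp
    then show ?thesis using k by simp
  qed
  then have "set ys \<subseteq> Grade B (inv\<^bsub>G\<^esub> g)" by (metis in_set_conv_nth subsetI)
  then show ?thesis using grade_sum[OF _ _ ys(2)] g by simp
qed

lemma dual_grade':
  assumes d: "dual_pair B y x" and g: "g \<in> carrier G" and y: "y \<in> Grade B g" shows "x \<in> Grade B (inv\<^bsub>G\<^esub> g)"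
proof -
  have o: "x \<in> Obj B" "y \<in> Obj B" using d unfolding dual_pair_def by auto
  obtain ys where ys: "\<forall>y \<in> set ys. simple_object B y" "direct_sum B x ys" using decompose o by blast
  have "ys ! r \<in> Grade B (inv\<^bsub>G\<^esub> g)" if r: "r < length ys" for r
  proof -
    let ?u = "ys ! r"
    have u: "simple_object B ?u" "?u \<in> Obj B" using ys r simple_object_obj by auto
    obtain k where k: "k \<in> carrier G" "?u \<in> Grade B k" using simple_homogeneous u by blast
    have "0 < hom_dim B x ?u" using summand_hom_pos[OF ys(2) r u(1)] hom_dim_commute[OF u(2) o(1)] by simp
    also have "\<dots> = hom_dim B (Unit B) (?u \<odot> y)"
      using hom_dim_adjunction[OF d unit_obj u(2)] hom_dim_iso(1)[OF unit_isomorphic(1)[OF o(1)] u(2)] by simp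
    finally have "k \<otimes>\<^bsub>G\<^esub> g = e" using grade_hom[OF _ _ unit_grade grade_tensor[OF k(1) g k(2) y]] k g by simp
    then have "k = inv\<^bsub>G\<^esub> g" using k g inv_equality by simp
    then show ?thesis using k by simp
  qed
  then have "set ys \<subseteq> Grade B (inv\<^bsub>G\<^esub> g)" by (metis in_set_conv_nth subsetI)
  then show ?thesis using grade_sum[OF _ _ ys(2)] g by simp
qed

lemma component_full_sub: "g \<in> carrier G \<Longrightarrow> full_sub B (module_component B g)"
  by (simp add: full_sub_def full_sub_axioms_def linear_category_axioms is_full_subcategory_def grade_obj)

lemma neutral_full_sub: "full_sub B (neutral_component G B)"
  by (simp add: full_sub_def full_sub_axioms_def linear_category_axioms is_full_subcategory_def grade_obj)

sublocale N: full_sub B "neutral_component G B"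
  by (rule neutral_full_sub)

end

section \<open>Pointed neutral component\<close>

locale pointed_crossed_category = G_crossed_fusion_category G B
  for G :: "('g, 'w) monoid_scheme"
    and B :: "('g, 'o, 'm, 'k::{alg_closed_field, field_char_0}, 'z) crossedcat_scheme" (structure) +
  fixes p :: nat and \<zeta> :: 'k
  assumes prime_p: "prime p" and odd_p: "odd p" and root: "primitive_root_of_unity p \<zeta>"
    and neutral_braided: "braided_fusion_category (neutral_component G B)"
    and neutral_nondegenerate: "nondegenerate (neutral_component G B)"
    and neutral_pointed: "pointed (neutral_component G B)"
    and neutral_elementary: "elementary_abelian_group p (Inv (neutral_component G B))"
begin

sublocale closed_graded_fusion_category G B
  by unfold_locales

sublocale D: closed_fusion_category "neutral_component G B"
  using neutral_braided unfolding closed_fusion_category_def braided_fusion_category_def by blast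

sublocale A: comm_group "Inv (neutral_component G B)"
  using neutral_elementary unfolding elementary_abelian_group_def by blast

abbreviation "A \<equiv> carrier (Inv (neutral_component G B))"
abbreviation A_mult (infixl "\<bullet>" 70) where "a \<bullet> b \<equiv> a \<otimes>\<^bsub>Inv (neutral_component G B)\<^esub> b"
abbreviation "A_one \<equiv> \<one>\<^bsub>Inv (neutral_component G B)\<^esub>"

lemma finite_A: "finite A"
  using neutral_elementary unfolding elementary_abelian_group_def by blast

lemma e_carrier [simp]: "e \<in> carrier G"
  by simp

lemma neutral_obj: "x \<in> Grade B e \<Longrightarrow> x \<in> Obj B"
  using grade_obj' by simp

lemma neutral_simple: "x \<in> Grade B e \<Longrightarrow> simple_object (neutral_component G B) x \<longleftrightarrow> simple_object B x"
  using D.simple_iff_hom_dim[of x] simple_iff_hom_dim[of x] N.hom_dim_sub[of x x] neutral_obj by simp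

lemma neutral_isomorphic: "x \<in> Grade B e \<Longrightarrow> isomorphic (neutral_component G B) x y \<longleftrightarrow> isomorphic B x y"
  using N.isomorphic_sub[of x y] grade_replete[of e x y] by auto

lemma neutral_iso_class: "x \<in> Grade B e \<Longrightarrow> iso_class (neutral_component G B) x = iso_class B x"
  using neutral_isomorphic grade_replete[of e x] isomorphic_obj unfolding iso_class_def by auto

text \<open>The degree of an inverse in \<open>B\<close> is not known at this point. An invertible
  object is simple, however, and a simple object of degree \<open>e\<close> is invertible inside the
  pointed neutral component.\<close>

lemma invertible_sub: "invertible_object (neutral_component G B) x \<longleftrightarrow> x \<in> Grade B e \<and> invertible_object B x"
proof
  assume "invertible_object (neutral_component G B) x"
  then obtain y where y: "x \<in> Grade B e" "y \<in> Grade B e"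
    "isomorphic (neutral_component G B) (x \<odot> y) (Unit B)" "isomorphic (neutral_component G B) (y \<odot> x) (Unit B)"
    unfolding invertible_object_def by auto
  then have "isomorphic B (x \<odot> y) (Unit B)" "isomorphic B (y \<odot> x) (Unit B)" using N.isomorphic_sub by blast+
  then show "x \<in> Grade B e \<and> invertible_object B x" unfolding invertible_object_def using y neutral_obj by blast
next
  assume x: "x \<in> Grade B e \<and> invertible_object B x"
  then show "invertible_object (neutral_component G B) x"
    using neutral_pointed invertible_simple neutral_simple unfolding pointed_def by blast
qed

lemma simple_neutral_invertible: "simple_object B x \<Longrightarrow> x \<in> Grade B e \<Longrightarrow> invertible_object B x"
  using neutral_pointed neutral_simple invertible_sub unfolding pointed_def by blast

text \<open>Elements of \<open>A\<close> are isomorphism classes, that is, sets of objects; tensor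
  products and braidings need a chosen member.\<close>

definition rep :: "'o set \<Rightarrow> 'o" where
  "rep a = (SOME x. x \<in> a)"

lemma A_mem_iff: "a \<in> A \<longleftrightarrow> (\<exists>x. x \<in> Grade B e \<and> invertible_object B x \<and> a = iso_class B x)"
  unfolding Inv_def using invertible_sub neutral_iso_class by auto

lemma rep:
  assumes "a \<in> A" shows "rep a \<in> Grade B e" "invertible_object B (rep a)" "iso_class B (rep a) = a"
proof -
  obtain x where x: "x \<in> Grade B e" "invertible_object B x" "a = iso_class B x" using assms A_mem_iff by blast
  then have "x \<in> a" using mem_iso_class invertible_obj by blast
  then have "rep a \<in> a" unfolding rep_def by (rule someI)
  then have *: "isomorphic B x (rep a)" using x unfolding iso_class_def by simp
  show "rep a \<in> Grade B e" "invertible_object B (rep a)" "iso_class B (rep a) = a"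
    using grade_replete[OF _ x(1) *] invertible_iso[OF x(2) *] * iso_class_eq_iff[of x "rep a"] isomorphic_obj[OF *] x(3) by auto
qed

lemma rep_obj: "a \<in> A \<Longrightarrow> rep a \<in> Obj B"
  using rep(1) neutral_obj by blast

lemma rep_class:
  assumes "x \<in> Grade B e" "invertible_object B x" shows "iso_class B x \<in> A" "isomorphic B (rep (iso_class B x)) x"
proof -
  show a: "iso_class B x \<in> A" using assms A_mem_iff by blast
  show "isomorphic B (rep (iso_class B x)) x"
    using rep[OF a] iso_class_eq_iff[of "rep (iso_class B x)" x] invertible_obj assms by blast
qed

lemma A_eq_iff: "a \<in> A \<Longrightarrow> b \<in> A \<Longrightarrow> a = b \<longleftrightarrow> isomorphic B (rep a) (rep b)"
  using rep(3)[of a] rep(3)[of b] iso_class_eq_iff[of "rep a" "rep b"] rep_obj by auto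

lemma class_mult:
  assumes "x \<in> Grade B e" "invertible_object B x" "y \<in> Grade B e" "invertible_object B y"
  shows "iso_class B x \<bullet> iso_class B y = iso_class B (x \<odot> y)"
  using D.Inv_mult[of x y] invertible_sub assms grade_tensor[of e e x y] by (simp add: neutral_iso_class)

lemma rep_mult: assumes "a \<in> A" "b \<in> A" shows "isomorphic B (rep (a \<bullet> b)) (rep a \<odot> rep b)"
proof -
  have "a \<bullet> b = iso_class B (rep a \<odot> rep b)"
    using class_mult[of "rep a" "rep b"] rep assms by simp
  moreover have "rep a \<odot> rep b \<in> Grade B e" using grade_tensor[of e e] rep assms by simp
  ultimately show ?thesis using rep_class(2) invertible_tens rep assms by simp
qed

lemma A_one_class: "A_one = iso_class B (Unit B)"
  using D.Inv_one neutral_iso_class[OF unit_grade] by simp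

lemma rep_one: "isomorphic B (rep A_one) (Unit B)"
  using rep_class(2)[OF unit_grade invertible_unit] A_one_class by simp

lemma rep_act_assoc:
  assumes "a \<in> A" "b \<in> A" "x \<in> Obj B" shows "isomorphic B (rep (a \<bullet> b) \<odot> x) (rep a \<odot> (rep b \<odot> x))"
  using tens_isomorphic[OF rep_mult[OF assms(1,2)] isomorphic_refl[OF assms(3)]]
    assoc_isomorphic[OF rep_obj[OF assms(1)] rep_obj[OF assms(2)] assms(3)] isomorphic_trans by blast

lemma rep_one_act: "x \<in> Obj B \<Longrightarrow> isomorphic B (rep A_one \<odot> x) x"
  using tens_isomorphic[OF rep_one isomorphic_refl] unit_isomorphic(1) isomorphic_trans by blast

lemma rep_act_cong: "a \<in> A \<Longrightarrow> isomorphic B x y \<Longrightarrow> isomorphic B (rep a \<odot> x) (rep a \<odot> y)"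
  using tens_isomorphic isomorphic_refl rep_obj by blast

lemma rep_act_simple: "a \<in> A \<Longrightarrow> simple_object B x \<Longrightarrow> simple_object B (rep a \<odot> x)"
  using invertible_tens_simple(1) rep(2) by blast

lemma act_rep_grade: "a \<in> A \<Longrightarrow> g \<in> carrier G \<Longrightarrow> x \<in> Grade B g \<Longrightarrow> x \<odot> rep a \<in> Grade B g"
  using grade_tensor[of g e x "rep a"] rep(1) by simp

definition Stab :: "'o \<Rightarrow> 'o set set" where
  "Stab x = {a \<in> A. isomorphic B (rep a \<odot> x) x}"

lemma Stab_finite: "finite (Stab x)"
  unfolding Stab_def using finite_A by simp

lemma one_in_Stab: "x \<in> Obj B \<Longrightarrow> A_one \<in> Stab x"
  unfolding Stab_def using rep_one_act by simp

lemma Stab_iso: "isomorphic B x y \<Longrightarrow> Stab x \<subseteq> Stab y"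
  unfolding Stab_def
  using isomorphic_trans[OF isomorphic_trans[OF rep_act_cong[OF _ isomorphic_sym]]] by blast

text \<open>Commutativity of \<open>A\<close> lets \<open>rep c\<close> pass
  \<open>rep a\<close>.\<close>

lemma Stab_act_subset:
  assumes "a \<in> A" "x \<in> Obj B" shows "Stab x \<subseteq> Stab (rep a \<odot> x)"
proof
  fix c assume "c \<in> Stab x"
  then have c: "c \<in> A" "isomorphic B (rep c \<odot> x) x" unfolding Stab_def by auto
  have "isomorphic B (rep c \<odot> (rep a \<odot> x)) (rep (c \<bullet> a) \<odot> x)"
    using rep_act_assoc[OF c(1) assms] isomorphic_sym by blast
  also have "isomorphic B (rep (c \<bullet> a) \<odot> x) (rep a \<odot> (rep c \<odot> x))"
    using rep_act_assoc[OF assms(1) c(1) assms(2)] A.m_comm[OF c(1) assms(1)] by simp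
  also (isomorphic_trans) have "isomorphic B (rep a \<odot> (rep c \<odot> x)) (rep a \<odot> x)"
    using rep_act_cong assms c by blast
  finally (isomorphic_trans) show "c \<in> Stab (rep a \<odot> x)" unfolding Stab_def using c by blast
qed

lemma simple_unit_hom: "simple_object B x \<Longrightarrow> dual_pair B y x \<Longrightarrow> hom_dim B (Unit B) (x \<odot> y) = 1"
  using hom_dim_adjunction[of y x "Unit B" x] hom_dim_iso(1)[OF unit_isomorphic(1), of x x] simple_iff_hom_dim[of x]
  by auto

lemma left_dual: assumes "x \<in> Obj B" obtains y where "dual_pair B y x"
  using rigid assms by blast

lemma dual_obj: "dual_pair B y x \<Longrightarrow> x \<in> Obj B" "dual_pair B y x \<Longrightarrow> y \<in> Obj B"
  unfolding dual_pair_def by auto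

lemma direct_sum_zero:
  assumes "direct_sum B x ys" "zero_object B x" "r < length ys" shows "zero_object B (ys ! r)"
proof -
  have o: "ys ! r \<in> Obj B" using assms direct_sum_obj by auto
  have "len x = 0" using assms(2) len_zero_iff direct_sum_obj(1)[OF assms(1)] by blast
  then have "(\<Sum>r<length ys. len (ys ! r)) = 0" unfolding len_direct_sum[OF assms(1)] .
  then have "len (ys ! r) = 0" using assms(3) by simp
  then show ?thesis using len_zero_iff o by simp
qed

text \<open>For a dual \<open>y\<close> of \<open>x\<close>, the object \<open>z \<odot> y\<close>
  has degree \<open>e\<close>, so any simple \<open>u\<close> with a non-zero arrow into it is
  invertible. By adjunction this arrow is a non-zero arrow from \<open>u \<odot> x\<close> to
  \<open>z\<close>, and both of these are simple.\<close>

lemma transitive: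
  assumes g: "g \<in> carrier G" and x: "simple_object B x" "x \<in> Grade B g" and z: "simple_object B z" "z \<in> Grade B g"
  obtains a where "a \<in> A" "isomorphic B (rep a \<odot> x) z"
proof -
  note o = simple_object_obj[OF x(1)] simple_object_obj[OF z(1)]
  obtain y where y: "dual_pair B y x" using left_dual o by blast
  have yo: "y \<in> Obj B" and yg: "y \<in> Grade B (inv\<^bsub>G\<^esub> g)" using dual_obj[OF y] dual_grade[OF y g x(2)] by auto
  have ynz: "\<not> zero_object B y"
  proof
    assume "zero_object B y"
    then have "zero_object B (x \<odot> y)" using tens_zero o by blast
    then show False using simple_unit_hom[OF x(1) y] zero_object_Hom(2)[of "x \<odot> y"] hom_dim_pos_iff[of "Unit B" "x \<odot> y"] o yo by auto
  qed
  have "hom_dim B (y \<odot> x) (Unit B) = hom_dim B y y"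
    using hom_dim_adjunction[OF y yo unit_obj] hom_dim_iso(2)[OF unit_isomorphic(1)[OF yo] yo] by simp
  also have "\<dots> > 0" using ynz zero_object_iff_hom_dim yo by auto
  finally have pos: "hom_dim B (y \<odot> x) (Unit B) > 0" .
  \<comment> \<open>The unit is a summand of y \<otimes> x, so \<open>z\<close> is a summand of z
    \<otimes> y \<otimes> x, which would vanish together with z \<otimes> y.\<close>
  have znz: "\<not> zero_object B (z \<odot> y)"
  proof
    assume "zero_object B (z \<odot> y)"
    then have "zero_object B (z \<odot> (y \<odot> x))"
      using tens_zero(2)[of x "z \<odot> y"] zero_object_iso assoc_isomorphic[of z y x] o yo by blast
    obtain ws where ws: "direct_sum B (y \<odot> x) ws" "\<forall>w\<in>set ws. simple_object B w" using decompose o yo tens_obj by blast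
    have "(\<Sum>r<length ws. hom_dim B (ws ! r) (Unit B)) \<noteq> 0" using pos unfolding hom_dim_direct_sum_out[OF ws(1) unit_obj] by (rule less_imp_neq[symmetric])
    then obtain r where r: "r < length ws" "hom_dim B (ws ! r) (Unit B) > 0" by (meson lessThan_iff neq0_conv sum.neutral)
    then have "isomorphic B (ws ! r) (Unit B)" using simple_hom_iso ws unit_simple by simp
    moreover have "zero_object B (z \<odot> ws ! r)"
      using direct_sum_zero[OF direct_sum_tens_left[OF o(2) ws(1)] \<open>zero_object B (z \<odot> (y \<odot> x))\<close>] r by simp
    ultimately have "zero_object B z"
      using tens_isomorphic[OF isomorphic_refl[OF o(2)]] unit_isomorphic(2)[OF o(2)] zero_object_iso by blast
    then show False using simple_not_zero z by blast
  qed
  have "z \<odot> y \<in> Grade B e" using grade_tensor[OF g _ z(2) yg] g by simp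
  then obtain u where u: "simple_object B u" "u \<in> Grade B e" "hom_dim B u (z \<odot> y) > 0"
    using exists_simple_hom[OF _ _ znz] by auto
  have ui: "invertible_object B u" using simple_neutral_invertible u by blast
  have "hom_dim B (u \<odot> x) z > 0" using hom_dim_adjunction[OF y _ o(2), of u] u invertible_obj[OF ui] by simp
  then have "isomorphic B (u \<odot> x) z" using simple_hom_iso invertible_tens_simple(1)[OF ui x(1)] z by blast
  moreover have "isomorphic B (rep (iso_class B u) \<odot> x) (u \<odot> x)"
    using rep_class(2)[OF u(2) ui] tens_isomorphic isomorphic_refl o by blast
  ultimately show thesis using that rep_class(1)[OF u(2) ui] isomorphic_trans by blast
qed

lemma Stab_component:
  assumes "g \<in> carrier G" "simple_object B x" "x \<in> Grade B g" "simple_object B z" "z \<in> Grade B g"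
  shows "Stab x = Stab z"
proof -
  have "Stab x \<subseteq> Stab z" if x: "simple_object B x" "x \<in> Grade B g" and z: "simple_object B z" "z \<in> Grade B g" for x z
  proof -
    obtain a where "a \<in> A" "isomorphic B (rep a \<odot> x) z" using transitive[OF assms(1) x z] .
    then show ?thesis using Stab_act_subset Stab_iso simple_object_obj[OF x(1)] by blast
  qed
  then show ?thesis using assms by blast
qed

definition component_simple :: "'g \<Rightarrow> 'o" where
  "component_simple g = (SOME x. simple_object B x \<and> x \<in> Grade B g)"

lemma component_simple:
  assumes "g \<in> carrier G" shows "simple_object B (component_simple g)" "component_simple g \<in> Grade B g"
proof -
  have "\<exists>x. simple_object B x \<and> x \<in> Grade B g" using exists_simple[OF assms] by blast
  from someI_ex[OF this] show "simple_object B (component_simple g)" "component_simple g \<in> Grade B g"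
    unfolding component_simple_def by auto
qed

text \<open>The choice of the simple object is immaterial by \<open>card_Stab\<close>. The square
  root of this number is the Frobenius-Perron dimension of the simple objects of degree
  \<open>g\<close>.\<close>

definition stab_order :: "'g \<Rightarrow> nat" where
  "stab_order g = card (Stab (component_simple g))"

lemma card_Stab: "g \<in> carrier G \<Longrightarrow> simple_object B x \<Longrightarrow> x \<in> Grade B g \<Longrightarrow> card (Stab x) = stab_order g"
  unfolding stab_order_def using Stab_component component_simple by metis

lemma stab_order_pos: "g \<in> carrier G \<Longrightarrow> stab_order g > 0"
  unfolding stab_order_def using one_in_Stab Stab_finite component_simple(1) simple_object_obj card_gt_0_iff by blast

text \<open>The elements that carry \<open>x\<close> to \<open>z\<close> form a coset of the
  stabilizer of \<open>x\<close>.\<close>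

lemma card_transporter:
  assumes g: "g \<in> carrier G" and x: "simple_object B x" "x \<in> Grade B g" and z: "simple_object B z" "z \<in> Grade B g"
  shows "card {a \<in> A. isomorphic B (rep a \<odot> x) z} = stab_order g"
proof -
  note o = simple_object_obj[OF x(1)] simple_object_obj[OF z(1)]
  obtain b where b: "b \<in> A" "isomorphic B (rep b \<odot> x) z" using transitive[OF g x z] .
  have "bij_betw (\<lambda>a. b \<bullet> a) (Stab x) {a \<in> A. isomorphic B (rep a \<odot> x) z}"
  proof (rule bij_betw_byWitness[where f' = "\<lambda>a. inv\<^bsub>Inv (neutral_component G B)\<^esub> b \<bullet> a"])
    show "(\<lambda>a. b \<bullet> a) ` Stab x \<subseteq> {a \<in> A. isomorphic B (rep a \<odot> x) z}"
    proof clarify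
      fix a assume "a \<in> Stab x"
      then have a: "a \<in> A" "isomorphic B (rep a \<odot> x) x" unfolding Stab_def by auto
      show "b \<bullet> a \<in> A \<and> isomorphic B (rep (b \<bullet> a) \<odot> x) z"
        using rep_act_assoc[OF b(1) a(1) o(1)] rep_act_cong[OF b(1) a(2)] b isomorphic_trans a by blast
    qed
    show "(\<lambda>a. inv\<^bsub>Inv (neutral_component G B)\<^esub> b \<bullet> a) ` {a \<in> A. isomorphic B (rep a \<odot> x) z} \<subseteq> Stab x"
    proof clarify
      fix a assume a: "a \<in> A" "isomorphic B (rep a \<odot> x) z"
      let ?b = "inv\<^bsub>Inv (neutral_component G B)\<^esub> b"
      have b': "?b \<in> A" using b by simp
      have "isomorphic B (rep (?b \<bullet> a) \<odot> x) (rep ?b \<odot> (rep a \<odot> x))" using rep_act_assoc b' a o by blast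
      also have "isomorphic B (rep ?b \<odot> (rep a \<odot> x)) (rep ?b \<odot> (rep b \<odot> x))"
        using rep_act_cong[OF b'] a b isomorphic_trans isomorphic_sym by blast
      also (isomorphic_trans) have "isomorphic B (rep ?b \<odot> (rep b \<odot> x)) (rep A_one \<odot> x)"
        using rep_act_assoc[OF b' b(1) o(1)] b isomorphic_sym by simp
      also (isomorphic_trans) have "isomorphic B (rep A_one \<odot> x) x" using rep_one_act o by blast
      finally (isomorphic_trans) show "?b \<bullet> a \<in> Stab x" unfolding Stab_def using a b' by simp
    qed
  qed (use b in \<open>auto simp: Stab_def A.m_assoc[symmetric]\<close>)
  from bij_betw_same_card[OF this] show ?thesis using card_Stab[OF g x] by simp
qed

text \<open>Exactly \<open>stab_order g\<close> of the translates of \<open>x\<close> are isomorphic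
  to a given simple summand of \<open>v\<close>. This exchanges sums over the simple objects of one
  degree for sums over the group \<open>A\<close>.\<close>

lemma sum_hom_act:
  assumes g: "g \<in> carrier G" and x: "simple_object B x" "x \<in> Grade B g" and v: "v \<in> Grade B g"
  shows "(\<Sum>a\<in>A. hom_dim B (rep a \<odot> x) v) = stab_order g * len v"
proof -
  obtain vs where vs: "direct_sum B v vs" "\<And>r. r < length vs \<Longrightarrow> simple_object B (vs ! r)" "\<And>r. r < length vs \<Longrightarrow> vs ! r \<in> Grade B g"
    using grade_decompose[OF g v] by blast
  note xo = simple_object_obj[OF x(1)]
  have "(\<Sum>a\<in>A. hom_dim B (rep a \<odot> x) v) = (\<Sum>a\<in>A. \<Sum>r<length vs. hom_dim B (rep a \<odot> x) (vs ! r))"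
    using hom_dim_direct_sum_in[OF vs(1)] rep_obj xo by simp
  also have "\<dots> = (\<Sum>r<length vs. \<Sum>a\<in>A. hom_dim B (rep a \<odot> x) (vs ! r))" by (rule sum.swap)
  also have "\<dots> = (\<Sum>r<length vs. stab_order g)"
  proof (rule sum.cong[OF refl])
    fix r assume r: "r \<in> {..<length vs}"
    have "(\<Sum>a\<in>A. hom_dim B (rep a \<odot> x) (vs ! r)) = (\<Sum>a\<in>A. if isomorphic B (rep a \<odot> x) (vs ! r) then 1 else 0)"
      using hom_dim_simple[OF rep_act_simple[OF _ x(1)] vs(2)] r by simp
    also have "\<dots> = card {a \<in> A. isomorphic B (rep a \<odot> x) (vs ! r)}" using finite_A by (simp add: sum.If_cases Int_def)
    finally show "(\<Sum>a\<in>A. hom_dim B (rep a \<odot> x) (vs ! r)) = stab_order g"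
      using card_transporter[OF g x vs(2,3)] r by simp
  qed
  also have "\<dots> = stab_order g * len v" using len_direct_sum[OF vs(1)] len_simple vs(2) by simp
  finally show ?thesis .
qed

lemma sum_hom_act':
  assumes g: "g \<in> carrier G" and x: "simple_object B x" "x \<in> Grade B g" and v: "v \<in> Grade B g"
  shows "(\<Sum>a\<in>A. hom_dim B x (rep a \<odot> v)) = stab_order g * len v"
proof -
  obtain vs where vs: "direct_sum B v vs" "\<And>r. r < length vs \<Longrightarrow> simple_object B (vs ! r)" "\<And>r. r < length vs \<Longrightarrow> vs ! r \<in> Grade B g"
    using grade_decompose[OF g v] by blast
  note xo = simple_object_obj[OF x(1)]
  have "hom_dim B x (rep a \<odot> v) = (\<Sum>r<length vs. hom_dim B (rep a \<odot> vs ! r) x)" if a: "a \<in> A" for a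
  proof -
    have "hom_dim B x (rep a \<odot> v) = (\<Sum>r<length vs. hom_dim B x (rep a \<odot> vs ! r))"
      using hom_dim_direct_sum_in[OF direct_sum_tens_left[OF rep_obj[OF a] vs(1)] xo] by simp
    then show ?thesis using hom_dim_commute[OF xo] rep_obj[OF a] simple_object_obj[OF vs(2)] by simp
  qed
  then have "(\<Sum>a\<in>A. hom_dim B x (rep a \<odot> v)) = (\<Sum>a\<in>A. \<Sum>r<length vs. hom_dim B (rep a \<odot> vs ! r) x)" by simp
  also have "\<dots> = (\<Sum>r<length vs. \<Sum>a\<in>A. hom_dim B (rep a \<odot> vs ! r) x)" by (rule sum.swap)
  also have "\<dots> = (\<Sum>r<length vs. stab_order g)"
    using sum_hom_act[OF g vs(2,3) x(2)] len_simple[OF x(1)] by simp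
  also have "\<dots> = stab_order g * len v" using len_direct_sum[OF vs(1)] len_simple vs(2) by simp
  finally show ?thesis .
qed

lemma A_subset_Irr: "A \<subseteq> Irr B"
  using A_mem_iff invertible_simple unfolding Irr_def by blast

text \<open>The simple objects of degree \<open>e\<close> are the members of the classes in
  \<open>A\<close>, so the other classes contribute nothing. The representatives in
  \<open>len\<close> and \<open>rep\<close> are the same choice, so the terms match
  literally.\<close>

lemma len_neutral: assumes v: "v \<in> Grade B e" shows "len v = (\<Sum>a\<in>A. hom_dim B (rep a) v)"
  unfolding len_def rep_def
proof (rule sum.mono_neutral_right[OF finite_Irr A_subset_Irr], rule)
  fix Z assume Z: "Z \<in> Irr B - A"
  let ?z = "SOME z. z \<in> Z"
  have z: "simple_object B ?z" "iso_class B ?z = Z" using Irr_rep Z by blast+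
  show "hom_dim B ?z v = 0"
  proof (rule ccontr)
    assume "hom_dim B ?z v \<noteq> 0"
    then have "?z \<in> Grade B e" using grade_of_simple_hom[OF z(1) _ v] by simp
    then have "iso_class B ?z \<in> A" using simple_neutral_invertible[OF z(1)] rep_class(1) by blast
    then show False using z(2) Z by simp
  qed
qed

text \<open>By adjunction the multiplicity of \<open>rep a\<close> in \<open>x \<odot> y\<close> is
  the dimension of Hom(a \<otimes> x, x): the summands are the stabilizer elements, each occurring
  once.\<close>

lemma len_dual:
  assumes g: "g \<in> carrier G" and x: "simple_object B x" "x \<in> Grade B g" and y: "dual_pair B y x"
  shows "len (x \<odot> y) = stab_order g"
proof -
  have "x \<odot> y \<in> Grade B e" using grade_tensor[OF g _ x(2) dual_grade[OF y g x(2)]] g by simp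
  then have "len (x \<odot> y) = (\<Sum>a\<in>A. hom_dim B (rep a) (x \<odot> y))" by (rule len_neutral)
  also have "\<dots> = (\<Sum>a\<in>A. hom_dim B (rep a \<odot> x) x)"
    using hom_dim_adjunction[OF y] rep_obj simple_object_obj[OF x(1)] by simp
  also have "\<dots> = stab_order g" using sum_hom_act[OF g x x(2)] len_simple[OF x(1)] by simp
  finally show ?thesis .
qed

lemma len_tens_invertible:
  assumes a: "invertible_object B a" and v: "v \<in> Obj B" shows "len (a \<odot> v) = len v" "len (v \<odot> a) = len v"
proof -
  obtain vs where vs: "\<forall>w\<in>set vs. simple_object B w" "direct_sum B v vs" using decompose v by meson
  have l: "len v = length vs" using len_direct_sum[OF vs(2)] len_simple vs(1) by simp
  show "len (a \<odot> v) = len v"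
    using len_direct_sum[OF direct_sum_tens_left[OF invertible_obj[OF a] vs(2)]] len_simple[OF invertible_tens_simple(1)[OF a]] vs(1) l by simp
  show "len (v \<odot> a) = len v"
    using len_direct_sum[OF direct_sum_tens_right[OF invertible_obj[OF a] vs(2)]] len_simple[OF invertible_tens_simple(2)[OF a]] vs(1) l by simp
qed

definition fusion_len :: "'g \<Rightarrow> 'g \<Rightarrow> nat" where
  "fusion_len g h = len (component_simple g \<odot> component_simple h)"

text \<open>Simple objects of one degree differ by an invertible factor from \<open>A\<close>, which
  does not change lengths when it stands outside. When it stands in the middle, it is absorbed into
  the left factor, which stays simple of degree \<open>g\<close>.\<close>

lemma len_tens_simple:
  assumes g: "g \<in> carrier G" and h: "h \<in> carrier G"
    and x: "simple_object B x" "x \<in> Grade B g" and y: "simple_object B y" "y \<in> Grade B h"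
  shows "len (x \<odot> y) = fusion_len g h"
proof -
  have left: "len (x' \<odot> y) = len (x \<odot> y)"
    if x: "simple_object B x" "x \<in> Grade B g" and x': "simple_object B x'" "x' \<in> Grade B g" and y: "y \<in> Obj B" for x x' y
  proof -
    obtain a where a: "a \<in> A" "isomorphic B (rep a \<odot> x) x'" using transitive[OF g x x'] .
    have xo: "x \<in> Obj B" using simple_object_obj x by blast
    have "isomorphic B (x' \<odot> y) (rep a \<odot> (x \<odot> y))"
      using tens_isomorphic[OF isomorphic_sym[OF a(2)] isomorphic_refl[OF y]]
        assoc_isomorphic[OF rep_obj[OF a(1)] xo y] isomorphic_trans by blast
    then show ?thesis using len_iso len_tens_invertible(1)[OF rep(2)[OF a(1)]] xo y by simp
  qed
  let ?x = "component_simple g" and ?y = "component_simple h"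
  note X = component_simple[OF g] and Y = component_simple[OF h]
  note o = simple_object_obj[OF X(1)] simple_object_obj[OF Y(1)] simple_object_obj[OF x(1)] simple_object_obj[OF y(1)]
  obtain b where b: "b \<in> A" "isomorphic B (rep b \<odot> ?y) y" using transitive[OF h Y y] .
  have "isomorphic B (?x \<odot> y) ((?x \<odot> rep b) \<odot> ?y)"
    using tens_isomorphic[OF isomorphic_refl[OF o(1)] isomorphic_sym[OF b(2)]]
      assoc_isomorphic[OF o(1) rep_obj[OF b(1)] o(2)] isomorphic_trans isomorphic_sym by blast
  then have "len (?x \<odot> y) = len ((?x \<odot> rep b) \<odot> ?y)" using len_iso by blast
  also have "\<dots> = len (?x \<odot> ?y)"
    using left[OF X _ _ o(2)] invertible_tens_simple(2)[OF rep(2)[OF b(1)] X(1)] act_rep_grade[OF b(1) g X(2)] by blast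
  finally have "len (?x \<odot> y) = fusion_len g h" unfolding fusion_len_def .
  then show ?thesis using left[OF X x o(4)] by simp
qed

lemma len_tens:
  assumes g: "g \<in> carrier G" and h: "h \<in> carrier G" and v: "v \<in> Grade B g" and w: "w \<in> Grade B h"
  shows "len (v \<odot> w) = len v * len w * fusion_len g h"
proof -
  obtain vs where vs: "direct_sum B v vs" "\<And>r. r < length vs \<Longrightarrow> simple_object B (vs ! r)" "\<And>r. r < length vs \<Longrightarrow> vs ! r \<in> Grade B g"
    using grade_decompose[OF g v] by blast
  obtain ws where ws: "direct_sum B w ws" "\<And>r. r < length ws \<Longrightarrow> simple_object B (ws ! r)" "\<And>r. r < length ws \<Longrightarrow> ws ! r \<in> Grade B h"
    using grade_decompose[OF h w] by blast
  have l: "len v = length vs" "len w = length ws"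
    using len_direct_sum[OF vs(1)] len_direct_sum[OF ws(1)] len_simple vs(2) ws(2) by simp_all
  have o: "w \<in> Obj B" using w h grade_obj' by blast
  have "len (v \<odot> w) = (\<Sum>r<length vs. len (vs ! r \<odot> w))"
    using len_direct_sum[OF direct_sum_tens_right[OF o vs(1)]] by simp
  also have "\<dots> = (\<Sum>r<length vs. \<Sum>s<length ws. len (vs ! r \<odot> ws ! s))"
    using len_direct_sum[OF direct_sum_tens_left[OF simple_object_obj[OF vs(2)] ws(1)]] by simp
  also have "\<dots> = (\<Sum>r<length vs. \<Sum>s<length ws. fusion_len g h)"
    using len_tens_simple[OF g h vs(2,3) ws(2,3)] by simp
  finally show ?thesis using l by simp
qed

text \<open>Both identities count simple summands: the first in \<open>x \<otimes> y \<otimes> y\<^sup>*\<close>, the second through the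
  adjunction \<open>Hom(z \<otimes> x', a \<otimes> x) = Hom(z, a \<otimes> x \<otimes> y)\<close>, summed over all invertible \<open>a\<close>.\<close>

lemma fusion_len_dual:
  assumes g: "g \<in> carrier G" and h: "h \<in> carrier G"
    and y: "simple_object B y" "y \<in> Grade B h" and d: "dual_pair B y' y"
  shows "fusion_len g h * len y' * fusion_len (g \<otimes>\<^bsub>G\<^esub> h) (inv\<^bsub>G\<^esub> h) = stab_order h"
proof -
  let ?x = "component_simple g"
  note X = component_simple[OF g]
  note o = simple_object_obj[OF X(1)] simple_object_obj[OF y(1)] dual_obj(2)[OF d]
  note y' = dual_grade[OF d h y(2)]
  have yy: "y \<odot> y' \<in> Grade B e" using grade_tensor[OF h _ y(2) y'] h by simp
  obtain ws where ws: "direct_sum B (y \<odot> y') ws" "\<And>r. r < length ws \<Longrightarrow> simple_object B (ws ! r)" "\<And>r. r < length ws \<Longrightarrow> ws ! r \<in> Grade B e"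
    using grade_decompose[OF _ yy] by auto
  have "len (?x \<odot> (y \<odot> y')) = (\<Sum>r<length ws. len (?x \<odot> ws ! r))"
    using len_direct_sum[OF direct_sum_tens_left[OF o(1) ws(1)]] by simp
  also have "\<dots> = (\<Sum>r<length ws. len (ws ! r))"
    using len_tens_invertible(2)[OF simple_neutral_invertible[OF ws(2,3)] o(1)] len_simple X(1) ws(2) by simp
  also have "\<dots> = stab_order h" using len_direct_sum[OF ws(1)] len_dual[OF h y d] by simp
  finally have "stab_order h = len ((?x \<odot> y) \<odot> y')" using len_iso[OF assoc_isomorphic[OF o]] by simp
  also have "\<dots> = fusion_len g h * len y' * fusion_len (g \<otimes>\<^bsub>G\<^esub> h) (inv\<^bsub>G\<^esub> h)"
    using len_tens[OF _ _ grade_tensor[OF g h X(2) y(2)] y'] len_tens_simple[OF g h X y] g h by simp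
  finally show ?thesis ..
qed

lemma fusion_len_adjoint:
  assumes g: "g \<in> carrier G" and h: "h \<in> carrier G"
    and y: "simple_object B y" "y \<in> Grade B h" and d: "dual_pair B y x'"
  shows "stab_order (g \<otimes>\<^bsub>G\<^esub> h) * fusion_len g h = stab_order g * len x' * fusion_len (g \<otimes>\<^bsub>G\<^esub> h) (inv\<^bsub>G\<^esub> h)"
proof -
  let ?x = "component_simple g" and ?z = "component_simple (g \<otimes>\<^bsub>G\<^esub> h)"
  have gh: "g \<otimes>\<^bsub>G\<^esub> h \<in> carrier G" using g h by simp
  note X = component_simple[OF g] and Z = component_simple[OF gh]
  note o = simple_object_obj[OF X(1)] simple_object_obj[OF y(1)] simple_object_obj[OF Z(1)] dual_obj(1)[OF d]
  note x' = dual_grade'[OF d h y(2)]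
  have "g \<otimes>\<^bsub>G\<^esub> h \<otimes>\<^bsub>G\<^esub> inv\<^bsub>G\<^esub> h = g" using g h by (simp add: m_assoc)
  then have zx: "?z \<odot> x' \<in> Grade B g" using grade_tensor[OF gh _ Z(2) x'] h by simp
  have "stab_order (g \<otimes>\<^bsub>G\<^esub> h) * fusion_len g h = (\<Sum>a\<in>A. hom_dim B ?z (rep a \<odot> (?x \<odot> y)))"
    using sum_hom_act'[OF gh Z grade_tensor[OF g h X(2) y(2)]] len_tens_simple[OF g h X y] by simp
  also have "\<dots> = (\<Sum>a\<in>A. hom_dim B ?z ((rep a \<odot> ?x) \<odot> y))"
    using hom_dim_iso(2)[OF assoc_isomorphic[OF rep_obj o(1,2)] o(3)] by simp
  also have "\<dots> = (\<Sum>a\<in>A. hom_dim B (rep a \<odot> ?x) (?z \<odot> x'))"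
    using hom_dim_adjunction[OF d o(3)] rep_obj o hom_dim_commute by simp
  also have "\<dots> = stab_order g * len (?z \<odot> x')" by (rule sum_hom_act[OF g X zx])
  also have "\<dots> = stab_order g * len x' * fusion_len (g \<otimes>\<^bsub>G\<^esub> h) (inv\<^bsub>G\<^esub> h)"
    using len_tens[OF gh _ Z(2) x'] len_simple[OF Z(1)] h by simp
  finally show ?thesis .
qed

lemma stab_order_one: "stab_order e = 1"
proof -
  have "Stab (Unit B) = {A_one}"
  proof (rule Set.set_eqI)
    fix a
    have "isomorphic B (rep a \<odot> Unit B) (Unit B) \<longleftrightarrow> a = A_one" if a: "a \<in> A"
    proof -
      have "isomorphic B (rep a \<odot> Unit B) (Unit B) \<longleftrightarrow> isomorphic B (rep a) (rep A_one)"
        using unit_isomorphic(2)[OF rep_obj[OF a]] rep_one isomorphic_trans isomorphic_sym by blast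
      then show ?thesis using A_eq_iff[OF a A.one_closed] by simp
    qed
    then show "a \<in> Stab (Unit B) \<longleftrightarrow> a \<in> {A_one}" unfolding Stab_def by auto
  qed
  then show ?thesis using card_Stab[OF _ unit_simple unit_grade] by simp
qed

lemma fusion_len_one: assumes "h \<in> carrier G" shows "fusion_len e h = 1"
proof -
  note Y = component_simple[OF assms]
  have "fusion_len e h = len (Unit B \<odot> component_simple h)"
    using len_tens_simple[OF _ assms unit_simple unit_grade Y] by simp
  then show ?thesis using len_iso[OF unit_isomorphic(1)[OF simple_object_obj[OF Y(1)]]] len_simple[OF Y(1)] by simp
qed

text \<open>With d the square root of \<open>stab_order\<close> and L the number of summands, this
  reads L d(gh) = d(g) d(h), the multiplicativity of dimensions on simple objects. It arises by
  eliminating \<open>?M\<close> between \<open>fusion_len_dual\<close> and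
  \<open>fusion_len_adjoint\<close>.\<close>

lemma fusion_len_square:
  assumes g: "g \<in> carrier G" and h: "h \<in> carrier G"
  shows "(fusion_len g h)\<^sup>2 * stab_order (g \<otimes>\<^bsub>G\<^esub> h) = stab_order g * stab_order h"
proof -
  let ?y = "component_simple h" and ?L = "fusion_len g h" and ?M = "fusion_len (g \<otimes>\<^bsub>G\<^esub> h) (inv\<^bsub>G\<^esub> h)"
  note Y = component_simple[OF h]
  obtain y' x' where d: "dual_pair B y' ?y" "dual_pair B ?y x'" using rigid simple_object_obj[OF Y(1)] by blast
  have 1: "len y' * fusion_len h (inv\<^bsub>G\<^esub> h) = stab_order h"
    using fusion_len_dual[OF one_closed h Y d(1)] fusion_len_one[OF h] h by simp
  moreover have "stab_order h = len x' * fusion_len h (inv\<^bsub>G\<^esub> h)"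
    using fusion_len_adjoint[OF one_closed h Y d(2)] fusion_len_one[OF h] stab_order_one h by simp
  \<comment> \<open>With first degree \<open>e\<close>, the two identities express
    \<open>stab_order h\<close> as the length of either dual times the same positive number.\<close>
  ultimately have "len y' = len x'" using stab_order_pos[OF h] by (metis mult_cancel2 mult_0_right less_irrefl)
  then have "?L * ?L * stab_order (g \<otimes>\<^bsub>G\<^esub> h) = stab_order g * (?L * len y' * ?M)"
    using fusion_len_adjoint[OF g h Y d(2)] by (simp add: algebra_simps)
  then show ?thesis using fusion_len_dual[OF g h Y d(1)] by (simp add: power2_eq_square)
qed

text \<open>Lengths multiply up to the factor \<open>fusion_len g h\<close>, which cannot vanish
  because the right-hand side of \<open>fusion_len_square\<close> is positive.\<close>

lemma tens_not_zero:
  assumes g: "g \<in> carrier G" and h: "h \<in> carrier G" and v: "v \<in> Grade B g" and w: "w \<in> Grade B h"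
    and nz: "\<not> zero_object B v" "\<not> zero_object B w"
  shows "\<not> zero_object B (v \<odot> w)"
proof -
  have o: "v \<in> Obj B" "w \<in> Obj B" using assms grade_obj' by blast+
  have "fusion_len g h \<noteq> 0"
    using fusion_len_square[OF g h] stab_order_pos[OF g] stab_order_pos[OF h] by (metis mult_is_0 not_gr_zero power2_eq_square)
  then have "len (v \<odot> w) \<noteq> 0" using len_tens[OF g h v w] nz o len_zero_iff by simp
  then show ?thesis using len_zero_iff o by simp
qed

text \<open>Moves the degree from objects to isomorphism classes, so that the eigenvector of
  \<open>FPdim_simple\<close> is a function on \<open>Irr B\<close>.\<close>

definition degree_of :: "'o set \<Rightarrow> 'g" where
  "degree_of Z = (THE g. g \<in> carrier G \<and> (SOME z. z \<in> Z) \<in> Grade B g)"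

lemma degree_of: assumes "g \<in> carrier G" "simple_object B x" "x \<in> Grade B g" shows "degree_of (iso_class B x) = g"
  unfolding degree_of_def
proof (rule the_equality)
  have xo: "x \<in> Obj B" using assms simple_object_obj by blast
  have "(SOME z. z \<in> iso_class B x) \<in> iso_class B x" by (rule someI, rule mem_iso_class[OF xo])
  then have i: "isomorphic B x (SOME z. z \<in> iso_class B x)" unfolding iso_class_def by simp
  show *: "g \<in> carrier G \<and> (SOME z. z \<in> iso_class B x) \<in> Grade B g" using grade_replete[OF assms(1,3) i] assms by simp
  fix h assume "h \<in> carrier G \<and> (SOME z. z \<in> iso_class B x) \<in> Grade B h"
  then show "h = g" using grade_unique * simple_not_zero[OF simple_iso[OF assms(2) i]] by blast
qed

text \<open>All summands of \<open>x \<odot> y\<close> have the degree of the product, and there are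
  \<open>fusion_len g h\<close> of them; \<open>fusion_len_square\<close> is then the eigenvalue
  equation for the square roots of the stabilizer orders.\<close>

lemma FPdim_simple:
  assumes g: "g \<in> carrier G" and x: "simple_object B x" "x \<in> Grade B g"
  shows "FPdim B x = sqrt (stab_order g)"
proof (rule FPdim_eqI)
  let ?w = "\<lambda>Z. sqrt (stab_order (degree_of Z))"
  show "x \<in> Obj B" using x simple_object_obj by blast
  show "?w Z > 0" if Z: "Z \<in> Irr B" for Z
  proof -
    obtain z where z: "simple_object B z" "Z = iso_class B z" using Z unfolding Irr_def by auto
    obtain h where "h \<in> carrier G" "z \<in> Grade B h" using simple_homogeneous z by blast
    then show ?thesis using degree_of z stab_order_pos by simp
  qed
  show "weight ?w (x \<odot> y) = sqrt (stab_order g) * ?w (iso_class B y)" if y: "simple_object B y" for y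
  proof -
    obtain h where h: "h \<in> carrier G" "y \<in> Grade B h" using simple_homogeneous y by blast
    have gh: "g \<otimes>\<^bsub>G\<^esub> h \<in> carrier G" using g h by simp
    obtain ws where ws: "direct_sum B (x \<odot> y) ws" "\<And>r. r < length ws \<Longrightarrow> simple_object B (ws ! r)"
      "\<And>r. r < length ws \<Longrightarrow> ws ! r \<in> Grade B (g \<otimes>\<^bsub>G\<^esub> h)"
      using grade_decompose[OF gh grade_tensor[OF g h(1) x(2) h(2)]] by blast
    have "length ws = fusion_len g h"
      using len_direct_sum[OF ws(1)] len_simple ws(2) len_tens_simple[OF g h(1) x y h(2)] by simp
    then have "weight ?w (x \<odot> y) = real (fusion_len g h) * sqrt (stab_order (g \<otimes>\<^bsub>G\<^esub> h))"
      using weight_direct_sum[OF ws(1)] weight_simple ws(2) degree_of[OF gh ws(2,3)] by simp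
    also have "\<dots> = sqrt (real ((fusion_len g h)\<^sup>2 * stab_order (g \<otimes>\<^bsub>G\<^esub> h)))"
      by (simp add: real_sqrt_mult)
    also have "\<dots> = sqrt (stab_order g) * ?w (iso_class B y)"
      using degree_of[OF h(1) y h(2)] by (simp add: fusion_len_square[OF g h(1)] real_sqrt_mult)
    finally show ?thesis .
  qed
qed simp

end

section \<open>The crossed braiding\<close>

context linear_category begin

lemma comp_scale_arr:
  assumes "f \<in> Arr C" "g \<in> Arr C" "Dom C g = Cod C f"
  shows "(a \<star> g) \<cdot> f = a \<star> (g \<cdot> f)" "g \<cdot> (a \<star> f) = a \<star> (g \<cdot> f)"
  using comp_scale_left[of f "Dom C f" "Cod C f" g "Cod C g" a] comp_scale_right[of f "Dom C f" "Cod C f" g "Cod C g" a] assms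
  by (auto simp: Hom_iff)

lemma scale_scale_arr: "f \<in> Arr C \<Longrightarrow> a \<star> (b \<star> f) = (a * b) \<star> f"
  using scale_scale[of f "Dom C f" "Cod C f"] by (simp add: Hom_iff)

lemma scale_one_arr [simp]: "f \<in> Arr C \<Longrightarrow> 1 \<star> f = f"
  using scale_one[of f "Dom C f" "Cod C f"] by (simp add: Hom_iff)

lemma isom_scalar_unique:
  assumes "isom C f" "\<not> zero_object C (Dom C f)" "a \<star> f = b \<star> f" shows "a = b"
  using scale_inj[of f "Dom C f" "Cod C f" a b] isom_not_null[OF assms(1,2)] assms by (simp add: Hom_iff)

end

lemma (in monoidal_linear_category) tens_scale_arr:
  assumes "f \<in> Arr C" "g \<in> Arr C"
  shows "(a \<star> f) \<Odot> g = a \<star> (f \<Odot> g)" "f \<Odot> (a \<star> g) = a \<star> (f \<Odot> g)"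
  using tens_scale_left[of f "Dom C f" "Cod C f" g "Dom C g" "Cod C g" a]
    tens_scale_right[of f "Dom C f" "Cod C f" g "Dom C g" "Cod C g" a] assms
  by (auto simp: Hom_iff)

context pointed_crossed_category begin

lemmas scalar_simps = comp_scale_arr scale_scale_arr tens_scale_arr

lemma neutral_obj' [simp]: "x \<in> Grade B e \<Longrightarrow> x \<in> Obj B"
  by (rule neutral_obj)

lemma act_obj [simp]: "g \<in> carrier G \<Longrightarrow> x \<in> Obj B \<Longrightarrow> ActO B g x \<in> Obj B"
  using linear_functor.functor_obj[OF action_functor] .

lemma act_arr [simp]:
  assumes "g \<in> carrier G" "f \<in> Arr B"
  shows "ActA B g f \<in> Arr B" "Dom B (ActA B g f) = ActO B g (Dom B f)" "Cod B (ActA B g f) = ActO B g (Cod B f)"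
  using linear_functor.functor_arr[OF action_functor[OF assms(1)], of f "Dom B f" "Cod B f"] assms by (auto simp: Hom_iff)

lemma act_isom [simp]:
  assumes "g \<in> carrier G" "isom B f" shows "isom B (ActA B g f)" "inv_arr B (ActA B g f) = ActA B g (inv_arr B f)"
  using functor_isom[OF linear_category_axioms action_functor[OF assms(1)] assms(2)] by auto

lemma act_id [simp]: "g \<in> carrier G \<Longrightarrow> x \<in> Obj B \<Longrightarrow> ActA B g (Id B x) = Id B (ActO B g x)"
  using linear_functor.functor_id[OF action_functor] .

lemma act_comp:
  assumes "g \<in> carrier G" "f \<in> Arr B" "k \<in> Arr B" "Dom B k = Cod B f"
  shows "ActA B g (k \<cdot> f) = ActA B g k \<cdot> ActA B g f"
  using linear_functor.functor_comp[OF action_functor[OF assms(1)], of f "Dom B f" "Cod B f" k "Cod B k"] assms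
  by (simp add: Hom_iff)

lemma act_tens_iso [simp]:
  assumes "g \<in> carrier G" "x \<in> Obj B" "y \<in> Obj B"
  shows "isom B (ActTens B g x y)" "Dom B (ActTens B g x y) = ActO B g (x \<odot> y)"
    "Cod B (ActTens B g x y) = ActO B g x \<odot> ActO B g y"
  using action_tens_iso[OF assms] by (auto simp: Iso_iff)

lemma act_comp_iso [simp]:
  assumes "g \<in> carrier G" "h \<in> carrier G" "x \<in> Obj B"
  shows "isom B (ActComp B g h x)" "Dom B (ActComp B g h x) = ActO B (g \<otimes>\<^bsub>G\<^esub> h) x"
    "Cod B (ActComp B g h x) = ActO B g (ActO B h x)"
  using action_comp_iso[OF assms] by (auto simp: Iso_iff)

lemma act_id_iso [simp]:
  assumes "x \<in> Obj B"
  shows "isom B (ActId B x)" "Dom B (ActId B x) = ActO B e x" "Cod B (ActId B x) = x"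
  using action_id_iso[OF assms] by (auto simp: Iso_iff)

lemma cbraid_arr:
  assumes "x \<in> Grade B g" "g \<in> carrier G" "y \<in> Obj B"
  shows "isom B (CBraid B g x y)" "Dom B (CBraid B g x y) = x \<odot> y" "Cod B (CBraid B g x y) = ActO B g y \<odot> x"
  using cbraid_iso[OF assms(2,1,3)] by (auto simp: Iso_iff)

lemma cbraid_nat:
  assumes "g \<in> carrier G" "x \<in> Grade B g" "x' \<in> Grade B g" "f \<in> Arr B" "Dom B f = x" "Cod B f = x'"
    "k \<in> Arr B" "Dom B k = y" "Cod B k = y'"
  shows "CBraid B g x' y' \<cdot> (f \<Odot> k) = (ActA B g k \<Odot> f) \<cdot> CBraid B g x y"
  using cbraid_natural[of g x x' f k y y'] assms by (simp add: Hom_iff)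

lemma act_id_nat:
  assumes "f \<in> Arr B" "Dom B f = x" "Cod B f = y" shows "ActId B y \<cdot> ActA B e f = f \<cdot> ActId B x"
  using action_id_natural[of f x y] assms by (simp add: Hom_iff)

lemma act_grade: "g \<in> carrier G \<Longrightarrow> x \<in> Grade B e \<Longrightarrow> ActO B g x \<in> Grade B e"
  using action_grade[of g e x] by simp

text \<open>On the neutral component this is its braiding. Here \<open>y\<close> may lie in any
  degree, so that objects of degree \<open>e\<close> can be moved past the objects of every
  component.\<close>

definition braid :: "'o \<Rightarrow> 'o \<Rightarrow> 'm" where
  "braid x y = (ActId B y \<Odot> Id B x) \<cdot> CBraid B e x y"

text \<open>The structure isomorphism of the module endofunctor \<open>alpha_plus\<close> of
  \<open>x\<close>; its inverse, with the roles of the two objects of degree \<open>e\<close>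
  exchanged, is that of \<open>alpha_minus\<close>.\<close>

definition shuffle :: "'o \<Rightarrow> 'o \<Rightarrow> 'o \<Rightarrow> 'm" where
  "shuffle x y m = Assoc B y x m \<cdot> ((braid x y \<Odot> Id B m) \<cdot> inv_arr B (Assoc B x y m))"

lemma neutral_Braid [simp]: "Braid (neutral_component G B) x y = braid x y"
  unfolding braid_def by (rule Braid_neutral_component)

lemma braid_arr [simp]:
  assumes "x \<in> Grade B e" "y \<in> Obj B"
  shows "isom B (braid x y)" "Dom B (braid x y) = x \<odot> y" "Cod B (braid x y) = y \<odot> x"
  unfolding braid_def using assms cbraid_arr[OF assms(1) e_carrier assms(2)] by simp_all

lemma braid_nat:
  assumes x: "x \<in> Grade B e" "x' \<in> Grade B e" and f: "f \<in> Arr B" "Dom B f = x" "Cod B f = x'"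
    and k: "k \<in> Arr B" "Dom B k = y" "Cod B k = y'"
  shows "braid x' y' \<cdot> (f \<Odot> k) = (k \<Odot> f) \<cdot> braid x y"
proof -
  have o [simp]: "y \<in> Obj B" "y' \<in> Obj B" "x \<in> Obj B" "x' \<in> Obj B" using x k by auto
  note c [simp] = cbraid_arr[OF x(1) e_carrier o(1)] cbraid_arr[OF x(2) e_carrier o(2)]
  have "braid x' y' \<cdot> (f \<Odot> k) = (ActId B y' \<Odot> Id B x') \<cdot> (CBraid B e x' y' \<cdot> (f \<Odot> k))"
    unfolding braid_def using f k by (simp add: assoc_arr)
  also have "\<dots> = ((ActId B y' \<Odot> Id B x') \<cdot> (ActA B e k \<Odot> f)) \<cdot> CBraid B e x y"
    unfolding cbraid_nat[OF e_carrier x f k] using f k by (simp add: assoc_arr)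
  also have "\<dots> = ((k \<Odot> f) \<cdot> (ActId B y \<Odot> Id B x)) \<cdot> CBraid B e x y"
    using f k act_id_nat[OF k] by (simp add: tens_comp_arr)
  also have "\<dots> = (k \<Odot> f) \<cdot> braid x y" unfolding braid_def using f k by (simp add: assoc_arr)
  finally show ?thesis .
qed

lemma shuffle_arr [simp]:
  assumes "x \<in> Grade B e" "y \<in> Obj B" "m \<in> Obj B"
  shows "isom B (shuffle x y m)" "Dom B (shuffle x y m) = x \<odot> (y \<odot> m)" "Cod B (shuffle x y m) = y \<odot> (x \<odot> m)"
  unfolding shuffle_def using assms by simp_all

lemma shuffle_nat_middle:
  assumes x [simp]: "x \<in> Grade B e" and k [simp]: "k \<in> Arr B" "Dom B k = y" "Cod B k = y'" and m [simp]: "m \<in> Obj B"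
  shows "shuffle x y' m \<cdot> (Id B x \<Odot> (k \<Odot> Id B m)) = (k \<Odot> Id B (x \<odot> m)) \<cdot> shuffle x y m"
proof -
  have [simp]: "y \<in> Obj B" "y' \<in> Obj B" using k dom_cod_obj by blast+
  have "shuffle x y' m \<cdot> (Id B x \<Odot> (k \<Odot> Id B m))
     = Assoc B y' x m \<cdot> ((braid x y' \<Odot> Id B m) \<cdot> (inv_arr B (Assoc B x y' m) \<cdot> (Id B x \<Odot> (k \<Odot> Id B m))))"
    unfolding shuffle_def by (simp add: assoc_arr)
  also have "\<dots> = Assoc B y' x m \<cdot> (((braid x y' \<Odot> Id B m) \<cdot> ((Id B x \<Odot> k) \<Odot> Id B m)) \<cdot> inv_arr B (Assoc B x y m))"
    by (subst assoc_inv_nat[of "Id B x" k "Id B m" x x y y' m m]) (simp_all add: assoc_arr)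
  also have "\<dots> = Assoc B y' x m \<cdot> ((((k \<Odot> Id B x) \<Odot> Id B m) \<cdot> (braid x y \<Odot> Id B m)) \<cdot> inv_arr B (Assoc B x y m))"
    by (simp add: whisker_right braid_nat[of x x "Id B x" k y y'])
  also have "\<dots> = (Assoc B y' x m \<cdot> ((k \<Odot> Id B x) \<Odot> Id B m)) \<cdot> ((braid x y \<Odot> Id B m) \<cdot> inv_arr B (Assoc B x y m))"
    by (simp add: assoc_arr)
  also have "\<dots> = (k \<Odot> Id B (x \<odot> m)) \<cdot> shuffle x y m"
    unfolding shuffle_def by (subst assoc_nat[of k "Id B x" "Id B m" y y' x x m m]) (simp_all add: assoc_arr)
  finally show ?thesis .
qed

text \<open>The two hexagons, in the form in which only the action of the neutral component is visible.\<close>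

lemma braid_tens_right:
  assumes w [simp]: "w \<in> Grade B e" and z [simp]: "z \<in> Obj B" and m [simp]: "m \<in> Obj B"
  shows "Assoc B z m w \<cdot> braid w (z \<odot> m) = (Id B z \<Odot> braid w m) \<cdot> shuffle w z m"
proof -
  let ?z = "ActO B e z" and ?m = "ActO B e m" and ?T = "ActTens B e z m"
  have c [simp]: "isom B (CBraid B e w y)" "Dom B (CBraid B e w y) = w \<odot> y" "Cod B (CBraid B e w y) = ActO B e y \<odot> w"
    if "y \<in> Obj B" for y using cbraid_arr[OF w e_carrier that] by auto
  have T: "ActId B (z \<odot> m) \<cdot> inv_arr B ?T = ActId B z \<Odot> ActId B m"
    unfolding action_id_tens[OF z m, symmetric] by (simp add: assoc_arr)
  have "braid w (z \<odot> m) = ((ActId B (z \<odot> m) \<Odot> Id B w) \<cdot> (inv_arr B ?T \<Odot> Id B w)) \<cdot> (inv_arr B (Assoc B ?z ?m w) \<cdot>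
      ((Id B ?z \<Odot> CBraid B e w m) \<cdot> (Assoc B ?z w m \<cdot> ((CBraid B e w z \<Odot> Id B m) \<cdot> inv_arr B (Assoc B w z m)))))"
    unfolding braid_def cbraid_hexagon_right[OF e_carrier w z m] by (simp add: assoc_arr)
  also have "\<dots> = ((ActId B z \<Odot> ActId B m) \<Odot> Id B w) \<cdot> (inv_arr B (Assoc B ?z ?m w) \<cdot>
      ((Id B ?z \<Odot> CBraid B e w m) \<cdot> (Assoc B ?z w m \<cdot> ((CBraid B e w z \<Odot> Id B m) \<cdot> inv_arr B (Assoc B w z m)))))"
    by (subst whisker_right) (simp_all add: T)
  finally have "Assoc B z m w \<cdot> braid w (z \<odot> m) = (Assoc B z m w \<cdot> ((ActId B z \<Odot> ActId B m) \<Odot> Id B w)) \<cdot> (inv_arr B (Assoc B ?z ?m w) \<cdot>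
      ((Id B ?z \<Odot> CBraid B e w m) \<cdot> (Assoc B ?z w m \<cdot> ((CBraid B e w z \<Odot> Id B m) \<cdot> inv_arr B (Assoc B w z m)))))"
    by (simp add: assoc_arr)
  also have "\<dots> = ((ActId B z \<Odot> (ActId B m \<Odot> Id B w)) \<cdot> (Id B ?z \<Odot> CBraid B e w m)) \<cdot>
      (Assoc B ?z w m \<cdot> ((CBraid B e w z \<Odot> Id B m) \<cdot> inv_arr B (Assoc B w z m)))"
    by (subst assoc_nat[of _ _ _ ?z _ ?m _ w]) (simp_all add: assoc_arr)
  also have "\<dots> = ((Id B z \<Odot> braid w m) \<cdot> (ActId B z \<Odot> (Id B w \<Odot> Id B m))) \<cdot>
      (Assoc B ?z w m \<cdot> ((CBraid B e w z \<Odot> Id B m) \<cdot> inv_arr B (Assoc B w z m)))"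
    unfolding braid_def by (simp add: tens_comp_arr del: tens_id') simp
  also have "\<dots> = (Id B z \<Odot> braid w m) \<cdot> (((ActId B z \<Odot> (Id B w \<Odot> Id B m)) \<cdot> Assoc B ?z w m) \<cdot>
      ((CBraid B e w z \<Odot> Id B m) \<cdot> inv_arr B (Assoc B w z m)))"
    by (simp add: assoc_arr del: tens_id')
  also have "\<dots> = (Id B z \<Odot> braid w m) \<cdot> ((Assoc B z w m \<cdot> ((ActId B z \<Odot> Id B w) \<Odot> Id B m)) \<cdot>
      ((CBraid B e w z \<Odot> Id B m) \<cdot> inv_arr B (Assoc B w z m)))"
    by (subst assoc_nat[of _ _ _ ?z _ w _ m]) simp_all
  also have "\<dots> = (Id B z \<Odot> braid w m) \<cdot> (Assoc B z w m \<cdot> ((((ActId B z \<Odot> Id B w) \<Odot> Id B m) \<cdot>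
      (CBraid B e w z \<Odot> Id B m)) \<cdot> inv_arr B (Assoc B w z m)))"
    by (simp add: assoc_arr)
  also have "\<dots> = (Id B z \<Odot> braid w m) \<cdot> shuffle w z m"
    unfolding shuffle_def braid_def by (subst whisker_right) simp_all
  finally show ?thesis .
qed

lemma cbraid_tens_left:
  assumes g [simp]: "g \<in> carrier G" and z [simp]: "z \<in> Grade B e" and m: "m \<in> Grade B g" and w [simp]: "w \<in> Obj B"
  shows "CBraid B g (z \<odot> m) w = shuffle z (ActO B g w) m \<cdot> ((Id B z \<Odot> CBraid B g m w) \<cdot> Assoc B z m w)"
proof -
  let ?w = "ActO B g w" and ?ew = "ActO B e (ActO B g w)"
  have [simp]: "m \<in> Obj B" using m g grade_obj' by blast
  have c [simp]: "isom B (CBraid B e z y)" "Dom B (CBraid B e z y) = z \<odot> y" "Cod B (CBraid B e z y) = ActO B e y \<odot> z"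
    if "y \<in> Obj B" for y using cbraid_arr[OF z e_carrier that] by auto
  note cm [simp] = cbraid_arr[OF m g w]
  have I: "inv_arr B (ActComp B e g w) = ActId B ?w"
  proof -
    have "ActId B ?w = Id B ?w \<cdot> inv_arr B (ActComp B e g w)"
      using action_id_comp_left[OF g w] by (subst (asm) isom_move_right) simp_all
    then show ?thesis by simp
  qed
  have eg: "e \<otimes>\<^bsub>G\<^esub> g = g" by simp
  have "CBraid B g (z \<odot> m) w = ((ActId B ?w \<Odot> (Id B z \<Odot> Id B m)) \<cdot> Assoc B ?ew z m) \<cdot> ((CBraid B e z ?w \<Odot> Id B m) \<cdot>
      (inv_arr B (Assoc B z ?w m) \<cdot> ((Id B z \<Odot> CBraid B g m w) \<cdot> Assoc B z m w)))"
    using cbraid_hexagon_left[OF e_carrier g z m w] unfolding eg I by (simp add: assoc_arr)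
  also have "\<dots> = (Assoc B ?w z m \<cdot> ((ActId B ?w \<Odot> Id B z) \<Odot> Id B m)) \<cdot> ((CBraid B e z ?w \<Odot> Id B m) \<cdot>
      (inv_arr B (Assoc B z ?w m) \<cdot> ((Id B z \<Odot> CBraid B g m w) \<cdot> Assoc B z m w)))"
    by (subst assoc_nat[of _ _ _ ?ew _ z _ m]) simp_all
  also have "\<dots> = Assoc B ?w z m \<cdot> ((((ActId B ?w \<Odot> Id B z) \<Odot> Id B m) \<cdot> (CBraid B e z ?w \<Odot> Id B m)) \<cdot>
      (inv_arr B (Assoc B z ?w m) \<cdot> ((Id B z \<Odot> CBraid B g m w) \<cdot> Assoc B z m w)))"
    by (simp add: assoc_arr)
  also have "\<dots> = shuffle z ?w m \<cdot> ((Id B z \<Odot> CBraid B g m w) \<cdot> Assoc B z m w)"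
    unfolding shuffle_def braid_def by (subst whisker_right) (simp_all add: assoc_arr)
  finally show ?thesis .
qed

text \<open>The double braiding of \<open>w\<close> with an object of degree \<open>g\<close>. The
  second crossing is the crossed braiding, so \<open>w\<close> comes back as
  \<open>ActO B g w\<close>; for \<open>g = e\<close> this is the monodromy up to
  \<open>ActId\<close>.\<close>

definition twist :: "'g \<Rightarrow> 'o \<Rightarrow> 'o \<Rightarrow> 'm" where
  "twist g w m = CBraid B g m w \<cdot> braid w m"

context
  fixes g assumes g [simp]: "g \<in> carrier G"
begin

lemma grade_obj_g: "m \<in> Grade B g \<Longrightarrow> m \<in> Obj B"
  using grade_obj' g by blast

lemma twist_arr [simp]:
  assumes "w \<in> Grade B e" "m \<in> Grade B g"
  shows "isom B (twist g w m)" "Dom B (twist g w m) = w \<odot> m" "Cod B (twist g w m) = ActO B g w \<odot> m"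
  unfolding twist_def using cbraid_arr[OF assms(2) g, of w] assms grade_obj_g by simp_all

lemma twist_nat:
  assumes w [simp]: "w \<in> Grade B e" "w' \<in> Grade B e" and m [simp]: "m \<in> Grade B g" "m' \<in> Grade B g"
    and k [simp]: "k \<in> Arr B" "Dom B k = w" "Cod B k = w'" and s [simp]: "s \<in> Arr B" "Dom B s = m" "Cod B s = m'"
  shows "twist g w' m' \<cdot> (k \<Odot> s) = (ActA B g k \<Odot> s) \<cdot> twist g w m"
proof -
  have [simp]: "m \<in> Obj B" "m' \<in> Obj B" using m grade_obj_g by blast+
  note [simp] = cbraid_arr[OF m(1) g, of w] cbraid_arr[OF m(2) g, of w']
  have "twist g w' m' \<cdot> (k \<Odot> s) = CBraid B g m' w' \<cdot> (braid w' m' \<cdot> (k \<Odot> s))"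
    unfolding twist_def by (simp add: assoc_arr)
  also have "\<dots> = (CBraid B g m' w' \<cdot> (s \<Odot> k)) \<cdot> braid w m"
    unfolding braid_nat[OF w k s] by (simp add: assoc_arr)
  also have "\<dots> = (ActA B g k \<Odot> s) \<cdot> twist g w m"
    unfolding twist_def by (subst cbraid_nat[OF g m s k]) (simp add: assoc_arr)
  finally show ?thesis .
qed

text \<open>Both hexagons together: carrying \<open>w\<close> around \<open>z \<odot> m\<close>
  means moving it past \<open>z\<close>, carrying it around \<open>m\<close>, and moving it back
  past \<open>z\<close>.\<close>

lemma twist_tens:
  assumes w [simp]: "w \<in> Grade B e" and z [simp]: "z \<in> Grade B e" and m [simp]: "m \<in> Grade B g"
  shows "twist g w (z \<odot> m) = shuffle z (ActO B g w) m \<cdot> ((Id B z \<Odot> twist g w m) \<cdot> shuffle w z m)"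
proof -
  have [simp]: "m \<in> Obj B" using m grade_obj_g by blast+
  note [simp] = cbraid_arr[OF m g, of w]
  have "twist g w (z \<odot> m) = shuffle z (ActO B g w) m \<cdot> ((Id B z \<Odot> CBraid B g m w) \<cdot> (Assoc B z m w \<cdot> braid w (z \<odot> m)))"
    unfolding twist_def cbraid_tens_left[OF g z m neutral_obj[OF w]] by (simp add: assoc_arr)
  also have "\<dots> = shuffle z (ActO B g w) m \<cdot> (((Id B z \<Odot> CBraid B g m w) \<cdot> (Id B z \<Odot> braid w m)) \<cdot> shuffle w z m)"
    by (subst braid_tens_right) (simp_all add: assoc_arr)
  also have "\<dots> = shuffle z (ActO B g w) m \<cdot> ((Id B z \<Odot> twist g w m) \<cdot> shuffle w z m)"
    unfolding twist_def by (subst whisker_left) simp_all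
  finally show ?thesis .
qed

end

subsection \<open>The braiding of the neutral component\<close>

text \<open>The monodromy of two invertible objects, a scalar by Schur's lemma. In terms of the
  quadratic space it is \<zeta> to the power 2B.\<close>

definition bichar :: "'o \<Rightarrow> 'o \<Rightarrow> 'k" where
  "bichar x y = (THE c. braid y x \<cdot> braid x y = c \<star> Id B (x \<odot> y))"

lemma scalar_unique:
  assumes "simple_object B x" "a \<star> Id B x = b \<star> Id B x" shows "a = b"
  using scale_inj[of "Id B x" x x a b] assms not_zero_id id_in_Hom simple_object_obj by blast

lemma bichar:
  assumes [simp]: "x \<in> Grade B e" "y \<in> Grade B e" and "invertible_object B x" "invertible_object B y"
  shows "braid y x \<cdot> braid x y = bichar x y \<star> Id B (x \<odot> y)"
proof -
  have s: "simple_object B (x \<odot> y)" using assms invertible_tens invertible_simple by blast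
  have "braid y x \<cdot> braid x y \<in> Hom B (x \<odot> y) (x \<odot> y)" by (simp add: Hom_iff)
  then obtain c where c: "braid y x \<cdot> braid x y = c \<star> Id B (x \<odot> y)" using schur_scalar[OF s] by blast
  show ?thesis unfolding bichar_def
    by (rule theI[of _ c]) (use c scalar_unique[OF s] in \<open>auto\<close>)
qed

lemma bichar_eqI:
  assumes "x \<in> Grade B e" "y \<in> Grade B e" "invertible_object B x" "invertible_object B y"
    "braid y x \<cdot> braid x y = c \<star> Id B (x \<odot> y)"
  shows "bichar x y = c"
  using bichar[OF assms(1-4)] assms(5) scalar_unique[of "x \<odot> y"] assms invertible_tens invertible_simple by metis

lemma bichar_commute:
  assumes [simp]: "x \<in> Grade B e" "y \<in> Grade B e" and i: "invertible_object B x" "invertible_object B y"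
  shows "bichar y x = bichar x y"
proof (rule bichar_eqI)
  have "(braid x y \<cdot> braid y x) \<cdot> braid x y = braid x y \<cdot> (braid y x \<cdot> braid x y)" by (simp add: assoc_arr)
  also have "\<dots> = (bichar x y \<star> Id B (y \<odot> x)) \<cdot> braid x y"
    unfolding bichar[OF assms] by (simp add: scalar_simps)
  finally show "braid x y \<cdot> braid y x = bichar x y \<star> Id B (y \<odot> x)"
    by (subst (asm) isom_cancel_right) simp_all
qed (use assms in auto)

lemma bichar_iso:
  assumes [simp]: "x \<in> Grade B e" "y \<in> Grade B e" and i: "invertible_object B x" "invertible_object B y"
    and iso: "isomorphic B x x'" "isomorphic B y y'"
  shows "bichar x' y' = bichar x y"
proof (rule bichar_eqI)
  obtain f k where f [simp]: "isom B f" "Dom B f = x" "Cod B f = x'" and k [simp]: "isom B k" "Dom B k = y" "Cod B k = y'"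
    using iso by (meson isomorphicE)
  show [simp]: "x' \<in> Grade B e" "y' \<in> Grade B e" using iso grade_replete assms(1,2) by blast+
  show "invertible_object B x'" "invertible_object B y'" using iso i invertible_iso by blast+
  have "(braid y' x' \<cdot> braid x' y') \<cdot> (f \<Odot> k) = braid y' x' \<cdot> (braid x' y' \<cdot> (f \<Odot> k))" by (simp add: assoc_arr)
  also have "\<dots> = (braid y' x' \<cdot> (k \<Odot> f)) \<cdot> braid x y"
    by (subst braid_nat[of x x' f k y y']) (simp_all add: assoc_arr)
  also have "\<dots> = (f \<Odot> k) \<cdot> (braid y x \<cdot> braid x y)"
    by (subst braid_nat[of y y' k f x x']) (simp_all add: assoc_arr)
  also have "\<dots> = (bichar x y \<star> Id B (x' \<odot> y')) \<cdot> (f \<Odot> k)"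
    unfolding bichar[OF assms(1-4)] by (simp add: scalar_simps)
  finally show "braid y' x' \<cdot> braid x' y' = bichar x y \<star> Id B (x' \<odot> y')"
    by (subst (asm) isom_cancel_right) simp_all
qed

lemma shuffle_shuffle:
  assumes [simp]: "x \<in> Grade B e" "y \<in> Grade B e" "m \<in> Obj B" and i: "invertible_object B x" "invertible_object B y"
  shows "shuffle y x m \<cdot> shuffle x y m = bichar x y \<star> Id B (x \<odot> (y \<odot> m))"
proof -
  have "shuffle y x m \<cdot> shuffle x y m
     = Assoc B x y m \<cdot> (((braid y x \<Odot> Id B m) \<cdot> (braid x y \<Odot> Id B m)) \<cdot> inv_arr B (Assoc B x y m))"
    unfolding shuffle_def by (simp add: assoc_arr)
  also have "\<dots> = bichar x y \<star> Id B (x \<odot> (y \<odot> m))"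
    by (subst whisker_right) (simp_all add: bichar[OF assms(1,2) i] scalar_simps)
  finally show ?thesis .
qed

lemma twist_neutral:
  assumes [simp]: "w \<in> Grade B e" "m \<in> Grade B e"
  shows "(ActId B w \<Odot> Id B m) \<cdot> twist e w m = braid m w \<cdot> braid w m"
  unfolding twist_def braid_def[of m w] using cbraid_arr[OF assms(2) e_carrier, of w] by (simp add: assoc_arr)

text \<open>Composed with \<open>k\<close>, the twist becomes an endomorphism of
  \<open>w \<odot> m\<close>, a scalar if \<open>w\<close> is invertible and \<open>m\<close>
  simple. The formula controls how this scalar changes when \<open>m\<close> is replaced by
  \<open>z \<odot> m\<close>.\<close>

lemma twist_fixed_tens:
  assumes g [simp]: "g \<in> carrier G" and w [simp]: "w \<in> Grade B e" and z [simp]: "z \<in> Grade B e" and m [simp]: "m \<in> Grade B g"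
    and k [simp]: "k \<in> Arr B" "Dom B k = ActO B g w" "Cod B k = w"
  shows "(k \<Odot> Id B (z \<odot> m)) \<cdot> twist g w (z \<odot> m)
    = shuffle z w m \<cdot> ((Id B z \<Odot> ((k \<Odot> Id B m) \<cdot> twist g w m)) \<cdot> shuffle w z m)"
proof -
  have [simp]: "m \<in> Obj B" using m g grade_obj' by blast
  have [simp]: "ActO B g w \<in> Grade B e" using act_grade by simp
  have "(k \<Odot> Id B (z \<odot> m)) \<cdot> twist g w (z \<odot> m)
    = ((k \<Odot> Id B (z \<odot> m)) \<cdot> shuffle z (ActO B g w) m) \<cdot> ((Id B z \<Odot> twist g w m) \<cdot> shuffle w z m)"
    unfolding twist_tens[OF g w z m] by (simp add: assoc_arr)
  also have "\<dots> = shuffle z w m \<cdot> (((Id B z \<Odot> (k \<Odot> Id B m)) \<cdot> (Id B z \<Odot> twist g w m)) \<cdot> shuffle w z m)"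
    by (subst shuffle_nat_middle[of z k "ActO B g w" w m, symmetric]) (simp_all add: assoc_arr)
  also have "\<dots> = shuffle z w m \<cdot> ((Id B z \<Odot> ((k \<Odot> Id B m) \<cdot> twist g w m)) \<cdot> shuffle w z m)"
    by (subst whisker_left) simp_all
  finally show ?thesis .
qed

text \<open>The case g = e of \<open>twist_fixed_tens\<close>, with the canonical
  \<open>ActId B w\<close> in the place of \<open>k\<close>.\<close>

lemma bichar_tens_right:
  assumes [simp]: "w \<in> Grade B e" "z \<in> Grade B e" "m \<in> Grade B e"
    and i: "invertible_object B w" "invertible_object B z" "invertible_object B m"
  shows "bichar w (z \<odot> m) = bichar w z * bichar w m"
proof (rule bichar_eqI)
  show zm [simp]: "z \<odot> m \<in> Grade B e" using grade_tensor[of e e z m] by simp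
  have "braid (z \<odot> m) w \<cdot> braid w (z \<odot> m) = (ActId B w \<Odot> Id B (z \<odot> m)) \<cdot> twist e w (z \<odot> m)"
    by (rule twist_neutral[symmetric]) simp_all
  also have "\<dots> = shuffle z w m \<cdot> ((Id B z \<Odot> (braid m w \<cdot> braid w m)) \<cdot> shuffle w z m)"
    by (subst twist_fixed_tens) (simp_all add: twist_neutral)
  also have "\<dots> = bichar w m \<star> (shuffle z w m \<cdot> shuffle w z m)"
    unfolding bichar[OF assms(1,3) i(1,3)] by (simp add: scalar_simps)
  also have "\<dots> = (bichar w z * bichar w m) \<star> Id B (w \<odot> (z \<odot> m))"
    by (subst shuffle_shuffle) (use i in \<open>simp_all add: scalar_simps mult.commute\<close>)
  finally show "braid (z \<odot> m) w \<cdot> braid w (z \<odot> m) = (bichar w z * bichar w m) \<star> Id B (w \<odot> (z \<odot> m))" .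
qed (use i invertible_tens in auto)

text \<open>A stabilizer element \<open>z\<close> of a simple object in degree \<open>g\<close> centralizes every \<open>w\<close> fixed by \<open>g\<close>, since
  the twist followed by \<open>g\<^sub>*w \<cong> w\<close> is a scalar on a simple object.\<close>

lemma stabilizer_centralizes_fixed:
  assumes g [simp]: "g \<in> carrier G" and w [simp]: "w \<in> Grade B e" "invertible_object B w"
    and z [simp]: "z \<in> Grade B e" "invertible_object B z"
    and x: "simple_object B x" "x \<in> Grade B g"
    and fixed: "isomorphic B (ActO B g w) w" and stab: "isomorphic B (z \<odot> x) x"
  shows "bichar w z = 1"
proof -
  have [simp]: "x \<in> Obj B" "x \<in> Grade B g" using x simple_object_obj by auto
  obtain k where k [simp]: "isom B k" "Dom B k = ActO B g w" "Cod B k = w" using fixed isomorphicE by blast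
  obtain s where s [simp]: "isom B s" "Dom B s = z \<odot> x" "Cod B s = x" using stab isomorphicE by blast
  define f where "f m = (k \<Odot> Id B m) \<cdot> twist g w m" for m
  have zx [simp]: "z \<odot> x \<in> Grade B g" using grade_tensor[of e g z x] by simp
  have wx: "simple_object B (w \<odot> x)" using invertible_tens_simple x w by blast
  have f_iso: "isom B (f x)" unfolding f_def by simp
  have "f x \<in> Hom B (w \<odot> x) (w \<odot> x)" unfolding f_def by (simp add: Hom_iff)
  then obtain c where c: "f x = c \<star> Id B (w \<odot> x)" using schur_scalar[OF wx] by blast
  \<comment> \<open>The two interchanges do not cancel; they compose to the monodromy of
    \<open>w\<close> and \<open>z\<close>.\<close>
  have fzx: "f (z \<odot> x) = (c * bichar w z) \<star> Id B (w \<odot> (z \<odot> x))"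
  proof -
    have "f (z \<odot> x) = shuffle z w x \<cdot> ((Id B z \<Odot> f x) \<cdot> shuffle w z x)"
      unfolding f_def by (rule twist_fixed_tens) simp_all
    also have "\<dots> = c \<star> (shuffle z w x \<cdot> shuffle w z x)" unfolding c by (simp add: scalar_simps)
    finally show ?thesis by (subst (asm) shuffle_shuffle) (simp_all add: scalar_simps)
  qed
  \<comment> \<open>Naturality along \<open>s\<close> identifies the scalar on
    \<open>z \<odot> x\<close> with the scalar on \<open>x\<close>.\<close>
  have "f x \<cdot> (Id B w \<Odot> s) = (k \<Odot> Id B x) \<cdot> (twist g w x \<cdot> (Id B w \<Odot> s))" unfolding f_def by (simp add: assoc_arr)
  also have "\<dots> = ((k \<Odot> Id B x) \<cdot> (Id B (ActO B g w) \<Odot> s)) \<cdot> twist g w (z \<odot> x)"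
    by (subst twist_nat[of g w w "z \<odot> x" x "Id B w" s]) (simp_all add: assoc_arr)
  also have "\<dots> = (Id B w \<Odot> s) \<cdot> f (z \<odot> x)" unfolding f_def by (simp add: tens_comp_arr flip: assoc_arr)
  finally have "c \<star> (Id B w \<Odot> s) = (c * bichar w z) \<star> (Id B w \<Odot> s)" unfolding c fzx by (simp add: scalar_simps)
  moreover have "\<not> zero_object B (Dom B (Id B w \<Odot> s))"
    using invertible_tens_simple(1)[OF z(2) x(1)] invertible_tens_simple(1)[OF w(2)] simple_not_zero by simp
  ultimately have "c = c * bichar w z" by (intro isom_scalar_unique[of "Id B w \<Odot> s"]) simp_all
  moreover have "c \<noteq> 0"
  proof
    assume "c = 0"
    then have "f x = Null B (w \<odot> x) (w \<odot> x)" using c scale_zero[OF id_in_Hom] by simp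
    then show False using isom_not_null[OF f_iso] simple_not_zero[OF wx] by (simp add: f_def)
  qed
  ultimately show ?thesis by simp
qed

text \<open>\<open>nondegenerate\<close> tests against all objects of degree \<open>e\<close>, the
  assumption only against invertible ones. Monodromy is natural, so it is trivial on a direct sum
  once it is trivial on the simple summands, which are invertible.\<close>

lemma bichar_nondegenerate:
  assumes x: "x \<in> Grade B e" "invertible_object B x"
    and c: "\<And>y. y \<in> Grade B e \<Longrightarrow> invertible_object B y \<Longrightarrow> bichar x y = 1"
  shows "isomorphic B x (Unit B)"
proof -
  note [simp] = x(1)
  have "braid y x \<cdot> braid x y = Id B (x \<odot> y)" if y [simp]: "y \<in> Grade B e" for y
  proof -
    obtain ys where ys: "direct_sum B y ys" "\<And>r. r < length ys \<Longrightarrow> simple_object B (ys ! r)" "\<And>r. r < length ys \<Longrightarrow> ys ! r \<in> Grade B e"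
      using grade_decompose[OF e_carrier y] by blast
    obtain i q where d: "direct_sum_diagram B y ys i q" using direct_sumE ys by blast
    interpret d: direct_sum_diagram B y ys i q by fact
    interpret xd: direct_sum_diagram B "x \<odot> y" "map (\<lambda>z. x \<odot> z) ys" "\<lambda>r. Id B x \<Odot> i r" "\<lambda>r. Id B x \<Odot> q r"
      by (rule functor_direct_sum_diagram[OF linear_category_axioms tens_left_functor d]) simp
    show ?thesis
    proof (rule xd.ext_out)
      fix r assume "r < length (map (\<lambda>z. x \<odot> z) ys)"
      then have r: "r < length ys" by simp
      have [simp]: "ys ! r \<in> Grade B e" "i r \<in> Arr B" "Dom B (i r) = ys ! r" "Cod B (i r) = y"
        using ys(3)[OF r] d.i_Hom[OF r] by (auto simp: Hom_iff)
      have "(braid y x \<cdot> braid x y) \<cdot> (Id B x \<Odot> i r) = braid y x \<cdot> (braid x y \<cdot> (Id B x \<Odot> i r))"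
        by (simp add: assoc_arr)
      also have "\<dots> = (braid y x \<cdot> (i r \<Odot> Id B x)) \<cdot> braid x (ys ! r)"
        by (subst braid_nat[of x x "Id B x" "i r" "ys ! r" y]) (simp_all add: assoc_arr)
      also have "\<dots> = (Id B x \<Odot> i r) \<cdot> (braid (ys ! r) x \<cdot> braid x (ys ! r))"
        by (subst braid_nat[of "ys ! r" y "i r" "Id B x" x x]) (simp_all add: assoc_arr)
      also have "\<dots> = Id B (x \<odot> y) \<cdot> (Id B x \<Odot> i r)"
        using bichar[OF x(1) _ x(2), of "ys ! r"] simple_neutral_invertible[OF ys(2)[OF r]] c by simp
      finally show "(braid y x \<cdot> braid x y) \<cdot> (Id B x \<Odot> i r) = Id B (x \<odot> y) \<cdot> (Id B x \<Odot> i r)" .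
    qed (simp_all add: Hom_iff)
  qed
  then have "isomorphic (neutral_component G B) x (Unit B)"
    using neutral_nondegenerate x invertible_simple neutral_simple unfolding nondegenerate_def by simp
  then show ?thesis using neutral_isomorphic x by blast
qed

subsection \<open>The quadratic form\<close>

definition self_braid :: "'o \<Rightarrow> 'k" where
  "self_braid x = (THE c. braid x x = c \<star> Id B (x \<odot> x))"

lemma self_braid:
  assumes [simp]: "x \<in> Grade B e" and "invertible_object B x"
  shows "braid x x = self_braid x \<star> Id B (x \<odot> x)"
proof -
  have s: "simple_object B (x \<odot> x)" using assms invertible_tens invertible_simple by blast
  have "braid x x \<in> Hom B (x \<odot> x) (x \<odot> x)" by (simp add: Hom_iff)
  then obtain c where c: "braid x x = c \<star> Id B (x \<odot> x)" using schur_scalar[OF s] by blast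
  show ?thesis unfolding self_braid_def
    by (rule theI[of _ c]) (use c scalar_unique[OF s] in \<open>auto\<close>)
qed

lemma self_braid_eqI:
  assumes "x \<in> Grade B e" "invertible_object B x" "braid x x = c \<star> Id B (x \<odot> x)" shows "self_braid x = c"
  using self_braid[OF assms(1,2)] assms(3) scalar_unique[of "x \<odot> x"] assms invertible_tens invertible_simple by metis

lemma self_braid_iso:
  assumes [simp]: "x \<in> Grade B e" and i: "invertible_object B x" and iso: "isomorphic B x x'"
  shows "self_braid x' = self_braid x"
proof (rule self_braid_eqI)
  obtain f where f [simp]: "isom B f" "Dom B f = x" "Cod B f = x'" using iso isomorphicE by blast
  show [simp]: "x' \<in> Grade B e" using iso grade_replete assms(1) by blast
  show "invertible_object B x'" using iso i invertible_iso by blast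
  have "braid x' x' \<cdot> (f \<Odot> f) = (f \<Odot> f) \<cdot> braid x x" by (rule braid_nat) simp_all
  also have "\<dots> = (self_braid x \<star> Id B (x' \<odot> x')) \<cdot> (f \<Odot> f)" unfolding self_braid[OF assms(1) i] by (simp add: scalar_simps)
  finally show "braid x' x' = self_braid x \<star> Id B (x' \<odot> x')" by (subst (asm) isom_cancel_right) simp_all
qed

lemma bichar_self:
  assumes [simp]: "x \<in> Grade B e" and i: "invertible_object B x" shows "bichar x x = (self_braid x)\<^sup>2"
proof (rule bichar_eqI)
  show "braid x x \<cdot> braid x x = (self_braid x)\<^sup>2 \<star> Id B (x \<odot> x)"
    unfolding self_braid[OF assms] by (simp add: scalar_simps power2_eq_square)
qed (use assms in auto)

text \<open>Braiding x \<otimes> y with itself takes four crossings: one of \<open>x\<close> with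
  itself, one of \<open>y\<close> with itself, and two between \<open>x\<close> and \<open>y\<close>
  that make up the monodromy. This is the polarization identity of the quadratic form.\<close>

lemma self_braid_tens:
  assumes x [simp]: "x \<in> Grade B e" and y [simp]: "y \<in> Grade B e" and i: "invertible_object B x" "invertible_object B y"
  shows "self_braid (x \<odot> y) = self_braid x * self_braid y * bichar x y"
proof (rule self_braid_eqI)
  let ?q = "self_braid x" and ?r = "self_braid y" and ?v = "x \<odot> y"
  show xy [simp]: "x \<odot> y \<in> Grade B e" using grade_tensor[of e e x y] by simp
  have 1: "braid y ?v = ?r \<star> ((braid y x \<Odot> Id B y) \<cdot> inv_arr B (Assoc B y x y))"
  proof -
    have "Assoc B x y y \<cdot> braid y ?v = ?r \<star> shuffle y x y"
      unfolding braid_tens_right[OF y neutral_obj[OF x] neutral_obj[OF y]] self_braid[OF y i(2)] by (simp add: scalar_simps)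
    then show ?thesis unfolding shuffle_def by (subst (asm) isom_move_left) (simp_all add: scalar_simps)
  qed
  have 2: "braid x ?v = ?q \<star> (inv_arr B (Assoc B x y x) \<cdot> (Id B x \<Odot> braid x y))"
  proof -
    have "shuffle x x y = ?q \<star> Id B (x \<odot> (x \<odot> y))"
      unfolding shuffle_def self_braid[OF x i(1)] by (simp add: scalar_simps)
    then have "Assoc B x y x \<cdot> braid x ?v = ?q \<star> (Id B x \<Odot> braid x y)"
      using braid_tens_right[OF x neutral_obj[OF x] neutral_obj[OF y]] by (simp add: scalar_simps)
    then show ?thesis by (subst (asm) isom_move_left) (simp_all add: scalar_simps)
  qed
  \<comment> \<open>The left hexagon splits the first copy of \<open>?v\<close>; the right hexagon
    for the second copy is contained in 1 and 2.\<close>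
  have 3: "braid ?v ?v = shuffle x ?v y \<cdot> ((Id B x \<Odot> braid y ?v) \<cdot> Assoc B x y ?v)"
  proof -
    have [simp]: "ActO B e ?v \<in> Grade B e" using act_grade by simp
    note [simp] = cbraid_arr[OF y e_carrier, of ?v]
    have "braid ?v ?v = ((ActId B ?v \<Odot> Id B ?v) \<cdot> shuffle x (ActO B e ?v) y) \<cdot> ((Id B x \<Odot> CBraid B e y ?v) \<cdot> Assoc B x y ?v)"
      unfolding braid_def[of ?v] cbraid_tens_left[OF e_carrier x y neutral_obj[OF xy]] by (simp add: assoc_arr)
    also have "\<dots> = shuffle x ?v y \<cdot> (((Id B x \<Odot> (ActId B ?v \<Odot> Id B y)) \<cdot> (Id B x \<Odot> CBraid B e y ?v)) \<cdot> Assoc B x y ?v)"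
      by (subst shuffle_nat_middle[of x "ActId B ?v" "ActO B e ?v" ?v y, symmetric]) (simp_all add: assoc_arr)
    also have "\<dots> = shuffle x ?v y \<cdot> ((Id B x \<Odot> braid y ?v) \<cdot> Assoc B x y ?v)"
      unfolding braid_def[of y] by (subst whisker_left) simp_all
    finally show ?thesis .
  qed
  have 4: "inv_arr B (Assoc B x ?v y) \<cdot> (Id B x \<Odot> (k \<Odot> Id B y)) = ((Id B x \<Odot> k) \<Odot> Id B y) \<cdot> inv_arr B (Assoc B x (y \<odot> x) y)"
    if "k \<in> Arr B" "Dom B k = y \<odot> x" "Cod B k = ?v" for k
    using that by (intro assoc_inv_nat) simp_all
  \<comment> \<open>The associators left over form a closed loop, trivial by the pentagon for
    \<open>x\<close>, \<open>y\<close>, \<open>x\<close>, \<open>y\<close>.\<close>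
  have 5: "(Assoc B ?v x y \<cdot> (inv_arr B (Assoc B x y x) \<Odot> Id B y)) \<cdot> (inv_arr B (Assoc B x (y \<odot> x) y) \<cdot>
      ((Id B x \<Odot> inv_arr B (Assoc B y x y)) \<cdot> Assoc B x y ?v)) = Id B (?v \<odot> ?v)"
  proof -
    let ?P = "(Id B x \<Odot> Assoc B y x y) \<cdot> (Assoc B x (y \<odot> x) y \<cdot> (Assoc B x y x \<Odot> Id B y))"
    have P: "Assoc B x y ?v \<cdot> Assoc B ?v x y = ?P" using pentagon[of x y x y] by (simp add: assoc_arr)
    have "isom B ?P" by simp
    have inv: "inv_arr B ?P = (inv_arr B (Assoc B x y x) \<Odot> Id B y) \<cdot> (inv_arr B (Assoc B x (y \<odot> x) y) \<cdot> (Id B x \<Odot> inv_arr B (Assoc B y x y)))"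
      by (simp add: assoc_arr)
    have "inv_arr B ?P = inv_arr B (Assoc B ?v x y) \<cdot> inv_arr B (Assoc B x y ?v)" unfolding P[symmetric] by simp
    then have "Assoc B ?v x y \<cdot> (inv_arr B ?P \<cdot> Assoc B x y ?v) = Id B (?v \<odot> ?v)" by (simp add: assoc_arr)
    then show ?thesis unfolding inv by (simp add: assoc_arr)
  qed
  let ?A = "Assoc B ?v x y \<cdot> (inv_arr B (Assoc B x y x) \<Odot> Id B y)"
  let ?Z = "(Id B x \<Odot> inv_arr B (Assoc B y x y)) \<cdot> Assoc B x y ?v"
  have "braid ?v ?v = (?q * ?r) \<star> (?A \<cdot> (((Id B x \<Odot> braid x y) \<Odot> Id B y) \<cdot> (inv_arr B (Assoc B x ?v y) \<cdot>
       ((Id B x \<Odot> (braid y x \<Odot> Id B y)) \<cdot> ?Z))))"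
    unfolding 3 shuffle_def 1 2
    by (simp add: scalar_simps assoc_arr whisker_left[symmetric] whisker_right[symmetric] mult.commute)
  also have "\<dots> = (?q * ?r) \<star> (?A \<cdot> ((((Id B x \<Odot> braid x y) \<Odot> Id B y) \<cdot> ((Id B x \<Odot> braid y x) \<Odot> Id B y)) \<cdot>
       (inv_arr B (Assoc B x (y \<odot> x) y) \<cdot> ?Z)))"
    by (subst comp_eq_extend[OF 4]) (simp_all add: assoc_arr)
  also have "((Id B x \<Odot> braid x y) \<Odot> Id B y) \<cdot> ((Id B x \<Odot> braid y x) \<Odot> Id B y) = bichar x y \<star> Id B ((x \<odot> (y \<odot> x)) \<odot> y)"
    using bichar[OF y x i(2,1)] bichar_commute[OF x y i] by (simp add: whisker_left whisker_right scalar_simps)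
  also have "(?q * ?r) \<star> (?A \<cdot> ((bichar x y \<star> Id B ((x \<odot> (y \<odot> x)) \<odot> y)) \<cdot> (inv_arr B (Assoc B x (y \<odot> x) y) \<cdot> ?Z)))
     = (?q * ?r * bichar x y) \<star> (?A \<cdot> (inv_arr B (Assoc B x (y \<odot> x) y) \<cdot> ?Z))"
    by (simp add: scalar_simps)
  finally show "braid ?v ?v = (?q * ?r * bichar x y) \<star> Id B (?v \<odot> ?v)" unfolding 5 .
qed (use i invertible_tens in auto)

text \<open>The compatibility of crossed braiding and action, at degree \<open>e\<close>, which
  conjugation by \<open>g\<close> fixes. The comparison isomorphisms of the action cancel by the
  unit constraints \<open>I1\<close> and \<open>I2\<close>. It follows that \<open>g\<close>
  preserves the quadratic form.\<close>

lemma self_braid_act: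
  assumes g [simp]: "g \<in> carrier G" and x [simp]: "x \<in> Grade B e" and i: "invertible_object B x" "invertible_object B (ActO B g x)"
  shows "self_braid (ActO B g x) = self_braid x"
proof (rule self_braid_eqI)
  let ?y = "ActO B g x" and ?T = "ActTens B g x x"
  show y [simp]: "?y \<in> Grade B e" using act_grade by simp
  note [simp] = cbraid_arr[OF x e_carrier, of x] cbraid_arr[OF y e_carrier, of ?y]
  have ge: "g \<otimes>\<^bsub>G\<^esub> e \<otimes>\<^bsub>G\<^esub> inv\<^bsub>G\<^esub> g = e" by simp
  have I1: "ActId B ?y \<cdot> ActComp B e g x = Id B ?y" using action_id_comp_left by simp
  have I2: "inv_arr B (ActComp B g e x) = ActA B g (ActId B x)"
  proof -
    have "ActA B g (ActId B x) = Id B ?y \<cdot> inv_arr B (ActComp B g e x)"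
      using action_id_comp_right[OF g neutral_obj[OF x]] by (subst (asm) isom_move_right) simp_all
    then show ?thesis by simp
  qed
  have n: "(ActA B g (ActId B x) \<Odot> Id B ?y) \<cdot> ActTens B g (ActO B e x) x = ?T \<cdot> ActA B g (ActId B x \<Odot> Id B x)"
    using action_tens_natural[OF g, of "ActId B x" "ActO B e x" x "Id B x" x x] by (simp add: Hom_iff)
  have c: "(((ActComp B e g x \<cdot> ActA B g (ActId B x)) \<Odot> Id B ?y) \<cdot> ActTens B g (ActO B e x) x) \<cdot> ActA B g (CBraid B e x x) =
      CBraid B e ?y ?y \<cdot> ?T"
    using cbraid_action[OF g e_carrier x neutral_obj[OF x]] unfolding ge I2 by simp
  have "braid ?y ?y \<cdot> ?T = (ActId B ?y \<Odot> Id B ?y) \<cdot> (CBraid B e ?y ?y \<cdot> ?T)"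
    unfolding braid_def by (simp add: assoc_arr)
  also have "\<dots> = ((ActId B ?y \<Odot> Id B ?y) \<cdot> ((ActComp B e g x \<cdot> ActA B g (ActId B x)) \<Odot> Id B ?y)) \<cdot> (ActTens B g (ActO B e x) x \<cdot> ActA B g (CBraid B e x x))"
    unfolding c[symmetric] by (simp add: assoc_arr)
  also have "\<dots> = ((ActA B g (ActId B x) \<Odot> Id B ?y) \<cdot> ActTens B g (ActO B e x) x) \<cdot> ActA B g (CBraid B e x x)"
    by (subst whisker_right) (simp_all add: assoc_arr[symmetric] I1)
  also have "\<dots> = ?T \<cdot> ActA B g (braid x x)"
    unfolding n braid_def by (simp add: assoc_arr act_comp)
  also have "\<dots> = (self_braid x \<star> Id B (?y \<odot> ?y)) \<cdot> ?T"
    using linear_functor.functor_scale[OF action_functor[OF g], of "Id B (x \<odot> x)" "x \<odot> x" "x \<odot> x" "self_braid x"]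
    unfolding self_braid[OF x i(1)] by (simp add: scalar_simps Hom_iff)
  finally show "braid ?y ?y = self_braid x \<star> Id B (?y \<odot> ?y)" by (subst (asm) isom_cancel_right) simp_all
qed (use i in auto)

end

section \<open>The quadratic space of invertible objects\<close>

context pointed_crossed_category begin

text \<open>The action of the inverse element is a quasi-inverse, so \<open>functor_simple\<close>
  applies.\<close>

lemma action_functor_simple: assumes g: "g \<in> carrier G" and x: "simple_object B x" shows "simple_object B (ActO B g x)"
proof (rule functor_simple[OF action_functor[OF g] action_functor[of "inv\<^bsub>G\<^esub> g"] _ _ x])
  have *: "isomorphic B (ActO B h (ActO B k u)) u" if "h \<in> carrier G" "k \<in> carrier G" "h \<otimes>\<^bsub>G\<^esub> k = e" "u \<in> Obj B" for h k u
  proof -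
    have "isomorphic B (ActO B e u) (ActO B h (ActO B k u))"
      using that act_comp_iso[of h k u] by (intro isomorphicI[of "ActComp B h k u"]) auto
    moreover have "isomorphic B (ActO B e u) u" using that by (intro isomorphicI[of "ActId B u"]) auto
    ultimately show ?thesis using isomorphic_sym isomorphic_trans by blast
  qed
  show "isomorphic B (ActO B (inv\<^bsub>G\<^esub> g) (ActO B g u)) u" "isomorphic B (ActO B g (ActO B (inv\<^bsub>G\<^esub> g) u)) u"
    if "u \<in> Obj B" for u using *[OF _ _ _ that] g by simp_all
qed (use g in simp)

lemma act_invertible:
  assumes g: "g \<in> carrier G" and x: "x \<in> Grade B e" "invertible_object B x" shows "invertible_object B (ActO B g x)"
  using simple_neutral_invertible[OF action_functor_simple[OF g invertible_simple[OF x(2)]] act_grade[OF g x(1)]] .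

lemma act_isomorphic: "g \<in> carrier G \<Longrightarrow> isomorphic B x y \<Longrightarrow> isomorphic B (ActO B g x) (ActO B g y)"
  using functor_isomorphic[OF linear_category_axioms action_functor] .

definition act_class :: "'g \<Rightarrow> 'o set \<Rightarrow> 'o set" where
  "act_class g a = iso_class B (ActO B g (rep a))"

text \<open>Together with \<open>quad\<close>, the form before exponents are taken:
  \<open>pairing\<close> is \<zeta> to the power 2B and \<open>quad\<close> is \<zeta> to the power
  Q.\<close>

definition pairing :: "'o set \<Rightarrow> 'o set \<Rightarrow> 'k" where
  "pairing a b = bichar (rep a) (rep b)"

definition quad :: "'o set \<Rightarrow> 'k" where
  "quad a = self_braid (rep a)"

lemma isomorphic_class: "isomorphic B x y \<Longrightarrow> iso_class B x = iso_class B y"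
  using iso_class_eq_iff[of x y] isomorphic_obj[of x y] by blast

lemma act_class_in: assumes "g \<in> carrier G" "a \<in> A" shows "act_class g a \<in> A"
  unfolding act_class_def
  by (rule rep_class(1)[OF act_grade[OF assms(1)] act_invertible[OF assms(1)]]) (use rep assms(2) in auto)

lemma rep_act_class: assumes "g \<in> carrier G" "a \<in> A" shows "isomorphic B (rep (act_class g a)) (ActO B g (rep a))"
  unfolding act_class_def
  by (rule rep_class(2)[OF act_grade[OF assms(1)] act_invertible[OF assms(1)]]) (use rep assms(2) in auto)

lemma act_class_eq:
  assumes "g \<in> carrier G" "x \<in> Grade B e" "invertible_object B x"
  shows "act_class g (iso_class B x) = iso_class B (ActO B g x)"
proof -
  have "isomorphic B (ActO B g (rep (iso_class B x))) (ActO B g x)"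
    by (rule act_isomorphic[OF assms(1) rep_class(2)[OF assms(2,3)]])
  then show ?thesis unfolding act_class_def by (rule isomorphic_class)
qed

lemma A_eqI: "a \<in> A \<Longrightarrow> b \<in> A \<Longrightarrow> isomorphic B (rep a) (rep b) \<Longrightarrow> a = b"
  using A_eq_iff by blast

lemma act_class_hom:
  assumes g: "g \<in> carrier G" and a: "a \<in> A" and b: "b \<in> A" shows "act_class g (a \<bullet> b) = act_class g a \<bullet> act_class g b"
proof -
  let ?x = "rep a" and ?y = "rep b"
  note x = rep[OF a] and y = rep[OF b]
  have xy: "?x \<odot> ?y \<in> Grade B e" using grade_tensor[of e e] x y by simp
  have "act_class g (a \<bullet> b) = act_class g (iso_class B (?x \<odot> ?y))" using class_mult[OF x(1,2) y(1,2)] x y by simp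
  also have "\<dots> = iso_class B (ActO B g (?x \<odot> ?y))" by (rule act_class_eq[OF g xy invertible_tens[OF x(2) y(2)]])
  also have "\<dots> = iso_class B (ActO B g ?x \<odot> ActO B g ?y)"
  proof -
    have "isomorphic B (ActO B g (?x \<odot> ?y)) (ActO B g ?x \<odot> ActO B g ?y)"
      using g x y by (intro isomorphicI[of "ActTens B g ?x ?y"]) auto
    then show ?thesis by (rule isomorphic_class)
  qed
  also have "\<dots> = act_class g a \<bullet> act_class g b"
    unfolding act_class_def using class_mult act_grade act_invertible g x y by simp
  finally show ?thesis .
qed

lemma act_class_comp:
  assumes "g \<in> carrier G" "h \<in> carrier G" "a \<in> A" shows "act_class (g \<otimes>\<^bsub>G\<^esub> h) a = act_class g (act_class h a)"
proof -
  have r: "rep a \<in> Grade B e" "invertible_object B (rep a)" "rep a \<in> Obj B" using rep assms by auto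
  have "act_class g (act_class h a) = iso_class B (ActO B g (ActO B h (rep a)))"
    unfolding act_class_def[of h]
    by (rule act_class_eq[OF assms(1) act_grade[OF assms(2) r(1)] act_invertible[OF assms(2) r(1,2)]])
  moreover have "isomorphic B (ActO B (g \<otimes>\<^bsub>G\<^esub> h) (rep a)) (ActO B g (ActO B h (rep a)))"
    using assms r by (intro isomorphicI[of "ActComp B g h (rep a)"]) auto
  ultimately show ?thesis unfolding act_class_def[of "g \<otimes>\<^bsub>G\<^esub> h"] using isomorphic_class by metis
qed

lemma act_class_one: assumes "a \<in> A" shows "act_class e a = a"
proof -
  have "isomorphic B (ActO B e (rep a)) (rep a)" using rep_obj[OF assms] by (intro isomorphicI[of "ActId B (rep a)"]) auto
  from isomorphic_class[OF this] show ?thesis unfolding act_class_def using rep(3)[OF assms] by simp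
qed

lemma act_class_inv:
  assumes "g \<in> carrier G" "a \<in> A"
  shows "act_class (inv\<^bsub>G\<^esub> g) (act_class g a) = a" "act_class g (act_class (inv\<^bsub>G\<^esub> g) a) = a"
  using act_class_comp[of "inv\<^bsub>G\<^esub> g" g a] act_class_comp[of g "inv\<^bsub>G\<^esub> g" a] act_class_one assms by simp_all

lemma act_class_A_one: "g \<in> carrier G \<Longrightarrow> act_class g A_one = A_one"
  using act_class_hom[of g A_one A_one] act_class_in[of g A_one] by simp

lemma pairing_commute: "a \<in> A \<Longrightarrow> b \<in> A \<Longrightarrow> pairing b a = pairing a b"
  unfolding pairing_def using bichar_commute rep by blast

lemma pairing_class:
  assumes "x \<in> Grade B e" "invertible_object B x" "y \<in> Grade B e" "invertible_object B y"
  shows "pairing (iso_class B x) (iso_class B y) = bichar x y"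
  unfolding pairing_def
  using bichar_iso[OF _ _ _ _ rep_class(2)[OF assms(1,2)] rep_class(2)[OF assms(3,4)]] rep rep_class(1) assms by metis

lemma quad_class: "x \<in> Grade B e \<Longrightarrow> invertible_object B x \<Longrightarrow> quad (iso_class B x) = self_braid x"
  unfolding quad_def using self_braid_iso[OF _ _ rep_class(2)] rep rep_class(1) by metis

lemma pairing_mult_right:
  assumes "a \<in> A" "b \<in> A" "c \<in> A" shows "pairing a (b \<bullet> c) = pairing a b * pairing a c"
proof -
  note r = rep[OF assms(1)] rep[OF assms(2)] rep[OF assms(3)]
  have bc: "rep b \<odot> rep c \<in> Grade B e" using grade_tensor[of e e] r by simp
  have "pairing a (b \<bullet> c) = pairing (iso_class B (rep a)) (iso_class B (rep b \<odot> rep c))"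
    using class_mult[of "rep b" "rep c"] r by simp
  also have "\<dots> = bichar (rep a) (rep b \<odot> rep c)" by (rule pairing_class[OF r(1,2) bc invertible_tens[OF r(5,8)]])
  also have "\<dots> = pairing a b * pairing a c" unfolding pairing_def using bichar_tens_right r by simp
  finally show ?thesis .
qed

lemma pairing_mult_left:
  assumes "a \<in> A" "b \<in> A" "c \<in> A" shows "pairing (a \<bullet> b) c = pairing a c * pairing b c"
  using pairing_mult_right[of c a b] pairing_commute assms by simp

lemma pairing_nonzero: assumes "a \<in> A" "b \<in> A" shows "pairing a b \<noteq> 0"
proof
  assume 0: "pairing a b = 0"
  note r = rep[OF assms(1)] rep[OF assms(2)]
  have o [simp]: "rep a \<in> Grade B e" "rep b \<in> Grade B e" using r by auto
  have "isom B (braid (rep b) (rep a) \<cdot> braid (rep a) (rep b))" by simp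
  moreover have "\<not> zero_object B (rep a \<odot> rep b)"
    using simple_not_zero invertible_simple invertible_tens r by blast
  ultimately have "braid (rep b) (rep a) \<cdot> braid (rep a) (rep b) \<noteq> Null B (rep a \<odot> rep b) (rep a \<odot> rep b)"
    using isom_not_null[of "braid (rep b) (rep a) \<cdot> braid (rep a) (rep b)"] by simp
  then show False using bichar[of "rep a" "rep b"] r 0 scale_zero[OF id_in_Hom] unfolding pairing_def by simp
qed

lemma pairing_one: "a \<in> A \<Longrightarrow> pairing a A_one = 1" "a \<in> A \<Longrightarrow> pairing A_one a = 1"
  using pairing_mult_right[of a A_one A_one] pairing_nonzero[of a A_one] pairing_commute[of a A_one] by simp_all

text \<open>Turns the non-degeneracy of the braided category into that of the bicharacter on the
  group \<open>A\<close>.\<close>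

lemma pairing_nondegenerate:
  assumes a: "a \<in> A" and c: "\<And>b. b \<in> A \<Longrightarrow> pairing a b = 1" shows "a = A_one"
proof -
  have "isomorphic B (rep a) (Unit B)"
  proof (rule bichar_nondegenerate)
    fix y assume y: "y \<in> Grade B e" "invertible_object B y"
    show "bichar (rep a) y = 1"
      using pairing_class[OF rep(1,2)[OF a] y] rep(3)[OF a] c[OF rep_class(1)[OF y]] by simp
  qed (use rep a in auto)
  then have "isomorphic B (rep a) (rep A_one)" using rep_one isomorphic_sym isomorphic_trans by blast
  then show ?thesis using A_eqI a by simp
qed

lemma pairing_inv_left: "a \<in> A \<Longrightarrow> b \<in> A \<Longrightarrow> pairing (inv\<^bsub>Inv (neutral_component G B)\<^esub> a) b = inverse (pairing a b)"
  using pairing_mult_left[of a "inv\<^bsub>Inv (neutral_component G B)\<^esub> a" b] pairing_one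
  by (simp add: inverse_unique)

lemma pairing_eqI:
  assumes "a \<in> A" "a' \<in> A" "\<And>b. b \<in> A \<Longrightarrow> pairing a b = pairing a' b" shows "a = a'"
proof -
  let ?i = "inv\<^bsub>Inv (neutral_component G B)\<^esub> a'"
  have "a \<bullet> ?i = A_one"
    by (rule pairing_nondegenerate)
      (use assms pairing_mult_left[of a ?i] pairing_inv_left pairing_nonzero in auto)
  then show ?thesis using assms A.inv_equality[of a ?i] by simp
qed

lemma quad_mult: assumes "a \<in> A" "b \<in> A" shows "quad (a \<bullet> b) = quad a * quad b * pairing a b"
proof -
  note r = rep[OF assms(1)] rep[OF assms(2)]
  have ab: "rep a \<odot> rep b \<in> Grade B e" using grade_tensor[of e e] r by simp
  have "quad (a \<bullet> b) = quad (iso_class B (rep a \<odot> rep b))" using class_mult[of "rep a" "rep b"] r by simp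
  also have "\<dots> = self_braid (rep a \<odot> rep b)" using quad_class ab invertible_tens r by blast
  finally show ?thesis unfolding quad_def pairing_def using self_braid_tens r by simp
qed

lemma pairing_self: "a \<in> A \<Longrightarrow> pairing a a = (quad a)\<^sup>2"
  unfolding pairing_def quad_def using bichar_self rep by blast

lemma quad_nonzero: "a \<in> A \<Longrightarrow> quad a \<noteq> 0"
  using pairing_self[of a] pairing_nonzero[of a a] by auto

lemma quad_act: assumes g: "g \<in> carrier G" and a: "a \<in> A" shows "quad (act_class g a) = quad a"
proof -
  note r = rep(1,2)[OF a]
  note s = act_invertible[OF g r]
  have "quad (act_class g a) = self_braid (ActO B g (rep a))"
    unfolding act_class_def using quad_class[OF act_grade[OF g r(1)] s] .
  also have "\<dots> = quad a" unfolding quad_def by (rule self_braid_act[OF g r s])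
  finally show ?thesis .
qed

text \<open>Polarization: \<open>quad\<close> is preserved by the action and determines
  \<open>pairing\<close> through \<open>quad_mult\<close>.\<close>

lemma pairing_act:
  assumes "g \<in> carrier G" "a \<in> A" "b \<in> A" shows "pairing (act_class g a) (act_class g b) = pairing a b"
proof -
  have "quad (act_class g (a \<bullet> b)) = quad a * quad b * pairing a b"
    using quad_act quad_mult assms by simp
  then have "quad a * quad b * pairing (act_class g a) (act_class g b) = quad a * quad b * pairing a b"
    using quad_mult act_class_hom act_class_in quad_act assms by simp
  then show ?thesis using quad_nonzero assms by simp
qed

section \<open>Components as module categories\<close>

abbreviation "M \<equiv> module_component B"

lemma M_sub: "g \<in> carrier G \<Longrightarrow> full_sub B (M g)"
  by (rule component_full_sub)

lemma tens_grade_left: "g \<in> carrier G \<Longrightarrow> x \<in> Grade B e \<Longrightarrow> m \<in> Grade B g \<Longrightarrow> x \<odot> m \<in> Grade B g"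
  using grade_tensor[of e g x m] by simp

lemma alpha_minus_str:
  assumes g: "g \<in> carrier G" and y [simp]: "y \<in> Grade B e" and w [simp]: "w \<in> Grade B e" and m: "m \<in> Grade B g"
  shows "FunS (alpha_minus (neutral_component G B) (M g) y) w m = inv_arr B (shuffle w y m)"
proof -
  interpret M: full_sub B "M g" by (rule M_sub[OF g])
  have [simp]: "m \<in> Obj B" using m g grade_obj' by blast
  have "y \<odot> (w \<odot> m) \<in> Grade B g" "(y \<odot> w) \<odot> m \<in> Grade B g" "w \<odot> y \<in> Grade B e" "y \<odot> w \<in> Grade B e"
    using tens_grade_left[OF g] tens_grade_left[OF e_carrier] m by simp_all
  then have "inv_arr (M g) (Assoc B y w m) = inv_arr B (Assoc B y w m)"
    "inv_arr (neutral_component G B) (braid w y) = inv_arr B (braid w y)"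
    by (intro M.inv_arr_sub N.inv_arr_sub; simp)+
  then show ?thesis unfolding alpha_minus_def shuffle_def by (simp add: assoc_arr)
qed

lemma alpha_plus_str:
  assumes g: "g \<in> carrier G" and x [simp]: "x \<in> Grade B e" and w [simp]: "w \<in> Grade B e" and m: "m \<in> Grade B g"
  shows "FunS (alpha_plus (neutral_component G B) (M g) x) w m = shuffle x w m"
proof -
  interpret M: full_sub B "M g" by (rule M_sub[OF g])
  have [simp]: "m \<in> Obj B" using m g grade_obj' by blast
  have "x \<odot> (w \<odot> m) \<in> Grade B g" "(x \<odot> w) \<odot> m \<in> Grade B g"
    using tens_grade_left[OF g] tens_grade_left[OF e_carrier] m by simp_all
  then have "inv_arr (M g) (Assoc B x w m) = inv_arr B (Assoc B x w m)" by (intro M.inv_arr_sub; simp)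
  then show ?thesis unfolding alpha_plus_def shuffle_def by (simp add: assoc_arr)
qed

text \<open>Isomorphism of \<open>alpha_minus\<close> for \<open>y\<close> with
  \<open>alpha_plus\<close> for \<open>x\<close> as module functors, spelled out in the ambient
  category with the structure maps written as interchanges.\<close>

definition alpha_iso :: "'g \<Rightarrow> 'o \<Rightarrow> 'o \<Rightarrow> ('o \<Rightarrow> 'm) \<Rightarrow> bool" where
  "alpha_iso g y x \<eta> \<longleftrightarrow>
     (\<forall>m \<in> Grade B g. isom B (\<eta> m) \<and> Dom B (\<eta> m) = y \<odot> m \<and> Cod B (\<eta> m) = x \<odot> m) \<and>
     (\<forall>m \<in> Grade B g. \<forall>n \<in> Grade B g. \<forall>s \<in> Hom B m n. \<eta> n \<cdot> (Id B y \<Odot> s) = (Id B x \<Odot> s) \<cdot> \<eta> m) \<and>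
     (\<forall>w \<in> Grade B e. \<forall>m \<in> Grade B g. shuffle x w m \<cdot> \<eta> (w \<odot> m) = (Id B w \<Odot> \<eta> m) \<cdot> inv_arr B (shuffle w y m))"

lemma alpha_iso_iff:
  assumes g: "g \<in> carrier G" and x: "x \<in> Grade B e" and y: "y \<in> Grade B e"
  shows "module_functors_isomorphic (neutral_component G B) (M g) (M g)
      (alpha_minus (neutral_component G B) (M g) y) (alpha_plus (neutral_component G B) (M g) x) \<longleftrightarrow> (\<exists>\<eta>. alpha_iso g y x \<eta>)"
proof -
  interpret M: full_sub B "M g" by (rule M_sub[OF g])
  have 1: "FunO (alpha_minus (neutral_component G B) (M g) y) = (\<lambda>m. y \<odot> m)" "FunA (alpha_minus (neutral_component G B) (M g) y) = (\<lambda>s. Id B y \<Odot> s)"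
    "FunO (alpha_plus (neutral_component G B) (M g) x) = (\<lambda>m. x \<odot> m)" "FunA (alpha_plus (neutral_component G B) (M g) x) = (\<lambda>s. Id B x \<Odot> s)"
    unfolding alpha_minus_def alpha_plus_def by simp_all
  show ?thesis
    unfolding module_functors_isomorphic_def alpha_iso_def 1
    using tens_grade_left[OF g] x y alpha_minus_str[OF g y] alpha_plus_str[OF g x]
    by (intro ex_cong1 conj_cong ball_cong) (auto simp: M.Iso_sub M.sub_Hom Iso_iff)
qed

text \<open>The module condition for the inverse twists is \<open>twist_tens\<close> with both sides
  inverted. It makes \<open>ActO B g x\<close> the object that the isometry of the component assigns
  to \<open>x\<close>.\<close>

lemma alpha_iso_twist:
  assumes g [simp]: "g \<in> carrier G" and x [simp]: "x \<in> Grade B e"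
  shows "alpha_iso g (ActO B g x) x (\<lambda>m. inv_arr B (twist g x m))"
  unfolding alpha_iso_def
proof (intro conjI ballI)
  have gx [simp]: "ActO B g x \<in> Grade B e" using act_grade by simp
  note tg [simp] = tens_grade_left[OF g]
  fix m assume m [simp]: "m \<in> Grade B g"
  have [simp]: "m \<in> Obj B" using m g grade_obj' by blast
  show "isom B (inv_arr B (twist g x m))" "Dom B (inv_arr B (twist g x m)) = ActO B g x \<odot> m"
    "Cod B (inv_arr B (twist g x m)) = x \<odot> m" by simp_all
  {
    fix n s assume n [simp]: "n \<in> Grade B g" and s: "s \<in> Hom B m n"
    then have s [simp]: "s \<in> Arr B" "Dom B s = m" "Cod B s = n" by (auto simp: Hom_iff)
    have [simp]: "n \<in> Obj B" using n g grade_obj' by blast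
    have "twist g x n \<cdot> (Id B x \<Odot> s) = (Id B (ActO B g x) \<Odot> s) \<cdot> twist g x m"
      using twist_nat[OF g x x m n _ _ _ s, of "Id B x"] by simp
    then have "Id B x \<Odot> s = inv_arr B (twist g x n) \<cdot> ((Id B (ActO B g x) \<Odot> s) \<cdot> twist g x m)"
      by (subst (asm) isom_move_left) simp_all
    then show "inv_arr B (twist g x n) \<cdot> (Id B (ActO B g x) \<Odot> s) = (Id B x \<Odot> s) \<cdot> inv_arr B (twist g x m)"
      by (simp add: assoc_arr)
  }
  fix w assume w [simp]: "w \<in> Grade B e"
  show "shuffle x w m \<cdot> inv_arr B (twist g x (w \<odot> m)) = (Id B w \<Odot> inv_arr B (twist g x m)) \<cdot> inv_arr B (shuffle w (ActO B g x) m)"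
    by (subst twist_tens) (simp_all add: assoc_arr)
qed

end

section \<open>Transport of isomorphisms between the alpha functors along module functors\<close>

context pointed_crossed_category begin

lemma bichar_determines:
  assumes x: "x \<in> Grade B e" "invertible_object B x" and y: "y \<in> Grade B e" "invertible_object B y"
    and eq: "\<And>v. v \<in> Grade B e \<Longrightarrow> invertible_object B v \<Longrightarrow> bichar x v = bichar y v"
  shows "isomorphic B x y"
proof -
  have "iso_class B x = iso_class B y"
  proof (rule pairing_eqI[OF rep_class(1)[OF x] rep_class(1)[OF y]])
    fix b assume b: "b \<in> A"
    show "pairing (iso_class B x) b = pairing (iso_class B y) b"
      using pairing_class[OF x rep(1,2)[OF b]] pairing_class[OF y rep(1,2)[OF b]] eq[OF rep(1,2)[OF b]] rep(3)[OF b] by simp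
  qed
  then show ?thesis using iso_class_eq_iff[OF invertible_obj[OF x(2)] invertible_obj[OF y(2)]] by simp
qed

lemma bichar_act:
  assumes g: "g \<in> carrier G" and x: "x \<in> Grade B e" "invertible_object B x" and y: "y \<in> Grade B e" "invertible_object B y"
  shows "bichar (ActO B g x) (ActO B g y) = bichar x y"
  using pairing_act[OF g rep_class(1)[OF x] rep_class(1)[OF y]]
    pairing_class[OF act_grade[OF g x(1)] act_invertible[OF g x] act_grade[OF g y(1)] act_invertible[OF g y]]
    pairing_class[OF x y] act_class_eq[OF g x] act_class_eq[OF g y] by simp

text \<open>A module functor \<open>F\<close> transports \<open>\<eta>\<close> to a family \<open>\<psi>\<close> on the objects \<open>F m\<close>. Its naturality along the
  twists \<open>v \<otimes> F m \<rightarrow> h\<^sub>*v \<otimes> F m\<close>, which \<open>F\<close> hits by fullness, compares \<open>y\<close> with \<open>h\<^sub>*x\<close>.\<close>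

lemma alpha_iso_transport:
  assumes g [simp]: "g \<in> carrier G" and h [simp]: "h \<in> carrier G"
    and F: "module_functor (neutral_component G B) (M g) (M h) F"
    and full: "\<And>m n. m \<in> Grade B g \<Longrightarrow> n \<in> Grade B g \<Longrightarrow>
      bij_betw (FunA F) (Hom (M g) m n) (Hom (M h) (FunO F m) (FunO F n))"
    and x [simp]: "x \<in> Grade B e" and xi: "invertible_object B x" and y [simp]: "y \<in> Grade B e" and yi: "invertible_object B y"
    and \<eta>: "alpha_iso g y x \<eta>"
  shows "isomorphic B y (ActO B h x)"
proof -
  interpret Mg: full_sub B "M g" by (rule M_sub[OF g])
  interpret Mh: full_sub B "M h" by (rule M_sub[OF h])
  interpret F: module_functor "neutral_component G B" "M g" "M h" F by fact
  interpret FL: linear_functor "M g" "M h" "FunO F" "FunA F" by (rule F.linear_functor)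
  note tg [simp] = tens_grade_left[OF g] and th [simp] = tens_grade_left[OF h]
  have gobj [simp]: "m \<in> Grade B g \<Longrightarrow> m \<in> Obj B" for m using grade_obj' g by blast
  have hobj: "m \<in> Grade B h \<Longrightarrow> m \<in> Obj B" for m using grade_obj' h by blast
  have Fo [simp]: "FunO F m \<in> Grade B h" if "m \<in> Grade B g" for m using FL.functor_obj[of m] that by simp
  have Fo' [simp]: "FunO F m \<in> Obj B" if "m \<in> Grade B g" for m using Fo[OF that] hobj by blast
  have Fa [simp]: "FunA F s \<in> Arr B" "Dom B (FunA F s) = FunO F (Dom B s)" "Cod B (FunA F s) = FunO F (Cod B s)"
    if "s \<in> Arr B" "Dom B s \<in> Grade B g" "Cod B s \<in> Grade B g" for s
  proof -
    have "s \<in> Hom (M g) (Dom B s) (Cod B s)" using that by (simp add: Mg.sub_Hom Hom_iff)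
    from FL.functor_arr[OF this] show "FunA F s \<in> Arr B" "Dom B (FunA F s) = FunO F (Dom B s)" "Cod B (FunA F s) = FunO F (Cod B s)"
      by (simp_all add: Mh.sub_Hom Hom_iff)
  qed
  have Fcomp: "FunA F (t \<cdot> s) = FunA F t \<cdot> FunA F s"
    if "s \<in> Arr B" "t \<in> Arr B" "Dom B t = Cod B s" "Dom B s \<in> Grade B g" "Cod B s \<in> Grade B g" "Cod B t \<in> Grade B g" for s t
    using FL.functor_comp[of s "Dom B s" "Cod B s" t "Cod B t"] that by (simp add: Mg.sub_Hom Hom_iff)
  have Fid [simp]: "FunA F (Id B m) = Id B (FunO F m)" if "m \<in> Grade B g" for m using FL.functor_id[of m] that by simp
  have Fiso [simp]: "isom B (FunA F s)" "inv_arr B (FunA F s) = FunA F (inv_arr B s)"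
    if "isom B s" "Dom B s \<in> Grade B g" "Cod B s \<in> Grade B g" for s
  proof -
    have 1: "FunA F (inv_arr B s) \<cdot> FunA F s = Id B (FunO F (Dom B s))" "FunA F s \<cdot> FunA F (inv_arr B s) = Id B (FunO F (Cod B s))"
      using that by (simp_all flip: Fcomp)
    show "isom B (FunA F s)" "inv_arr B (FunA F s) = FunA F (inv_arr B s)"
      by (rule isomI[OF _ _ 1]; use that in \<open>simp add: Hom_iff\<close>)+
  qed
  define S where "S w m = FunS F w m" for w m
  have S [simp]: "isom B (S w m)" "Dom B (S w m) = FunO F (w \<odot> m)" "Cod B (S w m) = w \<odot> FunO F m"
    if "w \<in> Grade B e" "m \<in> Grade B g" for w m
    using F.str_iso[of w m] that unfolding S_def by (simp_all add: Mh.Iso_sub Iso_iff)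
  have Snat: "S w' n \<cdot> FunA F (k \<Odot> s) = (k \<Odot> FunA F s) \<cdot> S w m"
    if "k \<in> Arr B" "Dom B k = w" "Cod B k = w'" "w \<in> Grade B e" "w' \<in> Grade B e"
      "s \<in> Arr B" "Dom B s = m" "Cod B s = n" "m \<in> Grade B g" "n \<in> Grade B g" for k w w' s m n
    using F.str_natural[of k w w' s m n] that unfolding S_def by (simp add: Mg.sub_Hom N.sub_Hom Hom_iff)
  have Sassoc: "Assoc B a b (FunO F m) \<cdot> S (a \<odot> b) m = (Id B a \<Odot> S b m) \<cdot> (S a (b \<odot> m) \<cdot> FunA F (Assoc B a b m))"
    if [simp]: "a \<in> Grade B e" "b \<in> Grade B e" "m \<in> Grade B g" for a b m
    using F.str_assoc[of a b m] unfolding S_def[symmetric] by (simp add: assoc_arr tens_grade_left[OF e_carrier])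
  \<comment> \<open>\<open>F\<close> intertwines the interchanges of the two components:
    \<open>Sassoc\<close> is used on both sides of the naturality of \<open>S\<close> along the
    braiding.\<close>
  have Sshuffle: "shuffle a b (FunO F m) \<cdot> ((Id B a \<Odot> S b m) \<cdot> S a (b \<odot> m))
      = (Id B b \<Odot> S a m) \<cdot> (S b (a \<odot> m) \<cdot> FunA F (shuffle a b m))"
    if [simp]: "a \<in> Grade B e" "b \<in> Grade B e" "m \<in> Grade B g" for a b m
  proof -
    have [simp]: "a \<odot> b \<in> Grade B e" "b \<odot> a \<in> Grade B e" using tens_grade_left[OF e_carrier] by simp_all
    have [simp]: "(a \<odot> b) \<odot> m \<in> Grade B g" "(b \<odot> a) \<odot> m \<in> Grade B g" by (simp_all)
    have "(Id B a \<Odot> S b m) \<cdot> S a (b \<odot> m) = Assoc B a b (FunO F m) \<cdot> (S (a \<odot> b) m \<cdot> FunA F (inv_arr B (Assoc B a b m)))"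
      using Sassoc[of a b m] Fcomp[of "inv_arr B (Assoc B a b m)" "Assoc B a b m", symmetric]
      by (subst comp_eq_extend[OF Sassoc]) (simp_all add: assoc_arr)
    then have "shuffle a b (FunO F m) \<cdot> ((Id B a \<Odot> S b m) \<cdot> S a (b \<odot> m))
       = Assoc B b a (FunO F m) \<cdot> (((braid a b \<Odot> Id B (FunO F m)) \<cdot> S (a \<odot> b) m) \<cdot> FunA F (inv_arr B (Assoc B a b m)))"
      unfolding shuffle_def by (simp add: assoc_arr)
    also have "\<dots> = (Assoc B b a (FunO F m) \<cdot> S (b \<odot> a) m) \<cdot> (FunA F (braid a b \<Odot> Id B m) \<cdot> FunA F (inv_arr B (Assoc B a b m)))"
    proof -
      have "(braid a b \<Odot> Id B (FunO F m)) \<cdot> S (a \<odot> b) m = S (b \<odot> a) m \<cdot> FunA F (braid a b \<Odot> Id B m)"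
        using Snat[of "braid a b" "a \<odot> b" "b \<odot> a" "Id B m" m m] by simp
      then show ?thesis by (simp only:) (simp add: assoc_arr)
    qed
    also have "\<dots> = (Id B b \<Odot> S a m) \<cdot> (S b (a \<odot> m) \<cdot> FunA F (shuffle a b m))"
      unfolding shuffle_def Sassoc[OF that(2,1,3)] by (simp add: assoc_arr Fcomp)
    finally show ?thesis .
  qed
  have eta [simp]: "isom B (\<eta> m)" "Dom B (\<eta> m) = y \<odot> m" "Cod B (\<eta> m) = x \<odot> m" if "m \<in> Grade B g" for m
    using \<eta> that unfolding alpha_iso_def by auto
  have eta_nat: "\<eta> n \<cdot> (Id B y \<Odot> s) = (Id B x \<Odot> s) \<cdot> \<eta> m"
    if "s \<in> Arr B" "Dom B s = m" "Cod B s = n" "m \<in> Grade B g" "n \<in> Grade B g" for s m n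
    using \<eta> that unfolding alpha_iso_def by (simp add: Hom_iff)
  have eta_shuffle: "shuffle x w m \<cdot> \<eta> (w \<odot> m) = (Id B w \<Odot> \<eta> m) \<cdot> inv_arr B (shuffle w y m)"
    if "w \<in> Grade B e" "m \<in> Grade B g" for w m
    using \<eta> that unfolding alpha_iso_def by simp
  define \<psi> where "\<psi> m = S x m \<cdot> (FunA F (\<eta> m) \<cdot> inv_arr B (S y m))" for m
  have psi [simp]: "isom B (\<psi> m)" "Dom B (\<psi> m) = y \<odot> FunO F m" "Cod B (\<psi> m) = x \<odot> FunO F m" if "m \<in> Grade B g" for m
    unfolding \<psi>_def using that by simp_all
  have psi_nat: "\<psi> n \<cdot> (Id B y \<Odot> FunA F s) = (Id B x \<Odot> FunA F s) \<cdot> \<psi> m"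
    if s [simp]: "s \<in> Arr B" "Dom B s = m" "Cod B s = n" and [simp]: "m \<in> Grade B g" "n \<in> Grade B g" for s m n
  proof -
    have "S y n \<cdot> FunA F (Id B y \<Odot> s) = (Id B y \<Odot> FunA F s) \<cdot> S y m" by (rule Snat) simp_all
    then have 1: "inv_arr B (S y n) \<cdot> (Id B y \<Odot> FunA F s) = FunA F (Id B y \<Odot> s) \<cdot> inv_arr B (S y m)"
      by (subst (asm) isom_move_left) (simp_all add: assoc_arr)
    have "\<psi> n \<cdot> (Id B y \<Odot> FunA F s) = S x n \<cdot> (FunA F (\<eta> n \<cdot> (Id B y \<Odot> s)) \<cdot> inv_arr B (S y m))"
      unfolding \<psi>_def by (simp add: assoc_arr 1 Fcomp)
    also have "\<dots> = (S x n \<cdot> FunA F (Id B x \<Odot> s)) \<cdot> (FunA F (\<eta> m) \<cdot> inv_arr B (S y m))"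
      unfolding eta_nat[OF that] by (simp add: assoc_arr Fcomp)
    also have "\<dots> = (Id B x \<Odot> FunA F s) \<cdot> \<psi> m"
      unfolding \<psi>_def by (subst Snat[of "Id B x" x x s m n]) (simp_all add: assoc_arr)
    finally show ?thesis .
  qed
  \<comment> \<open>The module condition on \<eta>, carried over by \<open>F\<close>; it expresses
    \<psi> at \<open>v \<odot> m\<close> through \<psi> at \<open>m\<close>.\<close>
  have psi_shuffle: "shuffle x v (FunO F m) \<cdot> ((Id B x \<Odot> S v m) \<cdot> \<psi> (v \<odot> m))
      = (Id B v \<Odot> \<psi> m) \<cdot> (inv_arr B (shuffle v y (FunO F m)) \<cdot> (Id B y \<Odot> S v m))"
    if [simp]: "v \<in> Grade B e" "m \<in> Grade B g" for v m
  proof -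
    have 1: "S v (y \<odot> m) \<cdot> FunA F (inv_arr B (shuffle v y m))
        = (Id B v \<Odot> inv_arr B (S y m)) \<cdot> (inv_arr B (shuffle v y (FunO F m)) \<cdot> ((Id B y \<Odot> S v m) \<cdot> S y (v \<odot> m)))"
    proof -
      have "shuffle v y (FunO F m) \<cdot> ((Id B v \<Odot> S y m) \<cdot> (S v (y \<odot> m) \<cdot> FunA F (inv_arr B (shuffle v y m))))
        = (shuffle v y (FunO F m) \<cdot> ((Id B v \<Odot> S y m) \<cdot> S v (y \<odot> m))) \<cdot> FunA F (inv_arr B (shuffle v y m))"
        by (simp add: assoc_arr)
      also have "\<dots> = (Id B y \<Odot> S v m) \<cdot> S y (v \<odot> m)"
        unfolding Sshuffle[OF that(1) y that(2)]
        using Fcomp[of "inv_arr B (shuffle v y m)" "shuffle v y m", symmetric] by (simp add: assoc_arr)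
      finally have "(Id B v \<Odot> S y m) \<cdot> (S v (y \<odot> m) \<cdot> FunA F (inv_arr B (shuffle v y m)))
        = inv_arr B (shuffle v y (FunO F m)) \<cdot> ((Id B y \<Odot> S v m) \<cdot> S y (v \<odot> m))"
        by (subst (asm) isom_move_left) simp_all
      then show ?thesis by (subst (asm) isom_move_left) simp_all
    qed
    have "shuffle x v (FunO F m) \<cdot> ((Id B x \<Odot> S v m) \<cdot> \<psi> (v \<odot> m))
       = (shuffle x v (FunO F m) \<cdot> ((Id B x \<Odot> S v m) \<cdot> S x (v \<odot> m))) \<cdot> (FunA F (\<eta> (v \<odot> m)) \<cdot> inv_arr B (S y (v \<odot> m)))"
      unfolding \<psi>_def by (simp add: assoc_arr)
    also have "\<dots> = (Id B v \<Odot> S x m) \<cdot> (S v (x \<odot> m) \<cdot> (FunA F (shuffle x v m \<cdot> \<eta> (v \<odot> m)) \<cdot> inv_arr B (S y (v \<odot> m))))"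
      unfolding Sshuffle[OF x that] by (simp add: assoc_arr Fcomp)
    also have "\<dots> = (Id B v \<Odot> S x m) \<cdot> ((S v (x \<odot> m) \<cdot> FunA F (Id B v \<Odot> \<eta> m)) \<cdot> (FunA F (inv_arr B (shuffle v y m)) \<cdot> inv_arr B (S y (v \<odot> m))))"
      unfolding eta_shuffle[OF that] by (simp add: assoc_arr Fcomp)
    also have "\<dots> = (Id B v \<Odot> S x m) \<cdot> ((Id B v \<Odot> FunA F (\<eta> m)) \<cdot> ((S v (y \<odot> m) \<cdot> FunA F (inv_arr B (shuffle v y m))) \<cdot> inv_arr B (S y (v \<odot> m))))"
      by (subst Snat[of "Id B v" v v "\<eta> m" "y \<odot> m" "x \<odot> m"]) (simp_all add: assoc_arr)
    also have "\<dots> = ((Id B v \<Odot> S x m) \<cdot> ((Id B v \<Odot> FunA F (\<eta> m)) \<cdot> (Id B v \<Odot> inv_arr B (S y m)))) \<cdot>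
        (inv_arr B (shuffle v y (FunO F m)) \<cdot> (Id B y \<Odot> S v m))"
      unfolding 1 by (simp add: assoc_arr)
    also have "\<dots> = (Id B v \<Odot> \<psi> m) \<cdot> (inv_arr B (shuffle v y (FunO F m)) \<cdot> (Id B y \<Odot> S v m))"
      unfolding \<psi>_def by (simp add: whisker_left)
    finally show ?thesis .
  qed
  \<comment> \<open>Scalars will be compared on objects built from the single non-zero object
    \<open>n\<close>, the image of a simple \<open>m\<close>.\<close>
  obtain m where m: "simple_object B m" "m \<in> Grade B g" using exists_simple[OF g] .
  note mg [simp] = m(2)
  define n where "n = FunO F m"
  have n [simp]: "n \<in> Grade B h" "n \<in> Obj B" unfolding n_def by simp_all
  have nz: "\<not> zero_object B n"
  proof
    assume "zero_object B n"
    then have "FunA F (Id B m) = Null B n n" unfolding n_def using zero_object_iff by simp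
    moreover have "FunA F (Null B m m) = Null B n n"
      unfolding n_def using linear_category.functor_null[OF Mg.linear_category_sub Mh.linear_category_sub F.linear_functor, of m m] by simp
    moreover have "Id B m \<in> Hom (M g) m m" "Null B m m \<in> Hom (M g) m m" by (simp_all add: Mg.sub_Hom Hom_iff)
    ultimately have "Id B m = Null B m m" using full[of m m] unfolding bij_betw_def inj_on_def by simp
    then show False using m not_zero_id by blast
  qed
  have Fm [simp]: "FunO F m = n" by (simp add: n_def)
  have "bichar y (ActO B h v) = bichar x v" if v [simp]: "v \<in> Grade B e" and vi: "invertible_object B v" for v
  proof -
    let ?v = "ActO B h v"
    have hv [simp]: "?v \<in> Grade B e" using act_grade by simp
    have hvi: "invertible_object B ?v" using act_invertible[OF h v vi] .
    define t where "t = twist h v n"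
    have t [simp]: "isom B t" "Dom B t = v \<odot> n" "Cod B t = ?v \<odot> n" unfolding t_def by simp_all
    \<comment> \<open>The twist at \<open>n\<close>, rewritten as an arrow between values of
      \<open>F\<close>. Fullness lifts it to an arrow \<open>k\<close> in degree \<open>g\<close>,
      and \<psi> is natural along images of such arrows.\<close>
    let ?t = "inv_arr B (S ?v m) \<cdot> (t \<cdot> S v m)"
    have "?t \<in> Hom (M h) (FunO F (v \<odot> m)) (FunO F (?v \<odot> m))" by (simp add: Mh.sub_Hom Hom_iff)
    then have "?t \<in> FunA F ` Hom (M g) (v \<odot> m) (?v \<odot> m)"
      using bij_betw_imp_surj_on[OF full[of "v \<odot> m" "?v \<odot> m"]] by simp
    then obtain k where k: "k \<in> Hom (M g) (v \<odot> m) (?v \<odot> m)" "FunA F k = ?t" by (auto simp: image_iff)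
    then have kk [simp]: "k \<in> Arr B" "Dom B k = v \<odot> m" "Cod B k = ?v \<odot> m" by (auto simp: Mg.sub_Hom Hom_iff)
    \<comment> \<open>The arrow \<psi> at \<open>w \<odot> m\<close>, read on
      \<open>w \<odot> n\<close> by means of \<open>psi_shuffle\<close>.\<close>
    define \<Psi> where "\<Psi> w = inv_arr B (shuffle x w n) \<cdot> ((Id B w \<Odot> \<psi> m) \<cdot> inv_arr B (shuffle w y n))" for w
    have Psi [simp]: "isom B (\<Psi> w)" "Dom B (\<Psi> w) = y \<odot> (w \<odot> n)" "Cod B (\<Psi> w) = x \<odot> (w \<odot> n)" if "w \<in> Grade B e" for w
      unfolding \<Psi>_def using that by simp_all
    have PsiS: "(Id B x \<Odot> S w m) \<cdot> \<psi> (w \<odot> m) = \<Psi> w \<cdot> (Id B y \<Odot> S w m)" if [simp]: "w \<in> Grade B e" for w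
      using psi_shuffle[OF that mg] unfolding Fm \<Psi>_def
      by (subst (asm) isom_move_left) (simp_all add: assoc_arr)
    have "\<Psi> ?v \<cdot> (Id B y \<Odot> t) = (Id B x \<Odot> t) \<cdot> \<Psi> v"
    proof -
      have kS: "S ?v m \<cdot> FunA F k = t \<cdot> S v m" unfolding k(2) by simp
      have "(\<Psi> ?v \<cdot> (Id B y \<Odot> t)) \<cdot> (Id B y \<Odot> S v m) = \<Psi> ?v \<cdot> (Id B y \<Odot> (S ?v m \<cdot> FunA F k))"
        unfolding kS by (simp add: assoc_arr whisker_left)
      also have "\<dots> = (\<Psi> ?v \<cdot> (Id B y \<Odot> S ?v m)) \<cdot> (Id B y \<Odot> FunA F k)"
        by (subst whisker_left[symmetric]) (simp_all add: assoc_arr)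
      also have "\<dots> = (Id B x \<Odot> S ?v m) \<cdot> (\<psi> (?v \<odot> m) \<cdot> (Id B y \<Odot> FunA F k))"
        unfolding PsiS[OF hv, symmetric] by (simp add: assoc_arr)
      also have "\<dots> = ((Id B x \<Odot> S ?v m) \<cdot> (Id B x \<Odot> FunA F k)) \<cdot> \<psi> (v \<odot> m)"
        by (subst psi_nat[of k "v \<odot> m" "?v \<odot> m"]) (simp_all add: assoc_arr)
      also have "\<dots> = (Id B x \<Odot> t) \<cdot> ((Id B x \<Odot> S v m) \<cdot> \<psi> (v \<odot> m))"
        by (subst whisker_left) (simp_all add: kS assoc_arr whisker_left[symmetric])
      also have "\<dots> = ((Id B x \<Odot> t) \<cdot> \<Psi> v) \<cdot> (Id B y \<Odot> S v m)"
        unfolding PsiS[OF v] by (simp add: assoc_arr)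
      finally show ?thesis by (subst (asm) isom_cancel_right) simp_all
    qed
    note Psi_t = this
    have xt: "Id B x \<Odot> t = \<Psi> ?v \<cdot> ((Id B y \<Odot> t) \<cdot> inv_arr B (\<Psi> v))"
    proof -
      have "Id B x \<Odot> t = ((Id B x \<Odot> t) \<cdot> \<Psi> v) \<cdot> inv_arr B (\<Psi> v)" by (simp add: assoc_arr)
      then show ?thesis unfolding Psi_t[symmetric] by (simp add: assoc_arr)
    qed
    have tz: "twist h v (z \<odot> n) = shuffle z ?v n \<cdot> ((Id B z \<Odot> t) \<cdot> shuffle v z n)" if "z \<in> Grade B e" for z
      unfolding t_def by (rule twist_tens) (use that in simp_all)
    \<comment> \<open>The twist is also natural along \<open>\<psi> m\<close>. Combined with
      \<open>Psi_t\<close>, this leaves one monodromy on each side: that of \<open>v\<close> with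
      \<open>x\<close> and that of \<open>y\<close> with \<open>?v\<close>.\<close>
    have "twist h v (x \<odot> n) \<cdot> (Id B v \<Odot> \<psi> m) = (ActA B h (Id B v) \<Odot> \<psi> m) \<cdot> twist h v (y \<odot> n)"
      by (rule twist_nat) simp_all
    then have "shuffle x ?v n \<cdot> ((Id B x \<Odot> t) \<cdot> (shuffle v x n \<cdot> (Id B v \<Odot> \<psi> m)))
        = (Id B ?v \<Odot> \<psi> m) \<cdot> (shuffle y ?v n \<cdot> ((Id B y \<Odot> t) \<cdot> shuffle v y n))"
      unfolding tz[OF x] tz[OF y] by (simp add: assoc_arr)
    moreover have "shuffle x ?v n \<cdot> ((Id B x \<Odot> t) \<cdot> (shuffle v x n \<cdot> (Id B v \<Odot> \<psi> m)))
        = (Id B ?v \<Odot> \<psi> m) \<cdot> (bichar v x \<star> (inv_arr B (shuffle ?v y n) \<cdot> ((Id B y \<Odot> t) \<cdot> shuffle v y n)))"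
    proof -
      have "shuffle x ?v n \<cdot> ((Id B x \<Odot> t) \<cdot> (shuffle v x n \<cdot> (Id B v \<Odot> \<psi> m)))
        = (Id B ?v \<Odot> \<psi> m) \<cdot> (inv_arr B (shuffle ?v y n) \<cdot> ((Id B y \<Odot> t) \<cdot> (shuffle v y n \<cdot> ((Id B v \<Odot> inv_arr B (\<psi> m)) \<cdot>
             ((shuffle x v n \<cdot> shuffle v x n) \<cdot> (Id B v \<Odot> \<psi> m))))))"
        unfolding xt \<Psi>_def by (simp add: assoc_arr)
      also have "shuffle x v n \<cdot> shuffle v x n = bichar v x \<star> Id B (v \<odot> (x \<odot> n))"
        by (rule shuffle_shuffle) (use vi xi in simp_all)
      finally show ?thesis by (simp add: scalar_simps whisker_left)
    qed
    ultimately have "bichar v x \<star> (inv_arr B (shuffle ?v y n) \<cdot> ((Id B y \<Odot> t) \<cdot> shuffle v y n))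
        = shuffle y ?v n \<cdot> ((Id B y \<Odot> t) \<cdot> shuffle v y n)"
      using isom_cancel_left[of "Id B ?v \<Odot> \<psi> m"] by simp
    then have "shuffle ?v y n \<cdot> (bichar v x \<star> (inv_arr B (shuffle ?v y n) \<cdot> ((Id B y \<Odot> t) \<cdot> shuffle v y n)))
        = (shuffle ?v y n \<cdot> shuffle y ?v n) \<cdot> ((Id B y \<Odot> t) \<cdot> shuffle v y n)"
      by (simp add: assoc_arr)
    also have "shuffle ?v y n \<cdot> shuffle y ?v n = bichar y ?v \<star> Id B (y \<odot> (?v \<odot> n))"
      by (rule shuffle_shuffle) (use hvi yi in simp_all)
    finally have "bichar v x \<star> ((Id B y \<Odot> t) \<cdot> shuffle v y n) = bichar y ?v \<star> ((Id B y \<Odot> t) \<cdot> shuffle v y n)"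
      by (simp add: scalar_simps)
    moreover have "\<not> zero_object B (v \<odot> (y \<odot> n))"
      using tens_not_zero[OF e_carrier h v th[OF y n(1)]] tens_not_zero[OF e_carrier h y n(1)] nz
        simple_not_zero[OF invertible_simple[OF vi]] simple_not_zero[OF invertible_simple[OF yi]] by blast
    ultimately have "bichar v x = bichar y ?v"
      using isom_scalar_unique[of "(Id B y \<Odot> t) \<cdot> shuffle v y n"] by simp
    then show ?thesis using bichar_commute[OF x v xi vi] by simp
  qed
  note * = this
  have hx: "ActO B h x \<in> Grade B e" "invertible_object B (ActO B h x)" using act_grade act_invertible[OF h x xi] by simp_all
  show ?thesis
  proof (rule bichar_determines[OF y yi hx])
    fix u assume u [simp]: "u \<in> Grade B e" and ui: "invertible_object B u"
    \<comment> \<open>Every invertible \<open>u\<close> is isomorphic to \<open>ActO B h\<close> of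
      an invertible object, so the identity just obtained determines all values of
      \<open>bichar\<close> at \<open>y\<close>.\<close>
    let ?h = "inv\<^bsub>G\<^esub> h"
    let ?u = "ActO B ?h u"
    have hu [simp]: "?u \<in> Grade B e" and hui: "invertible_object B ?u" using act_grade act_invertible[OF _ u ui] by simp_all
    have "isomorphic B (ActO B (h \<otimes>\<^bsub>G\<^esub> ?h) u) (ActO B h ?u)"
      using act_comp_iso[of h ?h u] by (intro isomorphicI[of "ActComp B h ?h u"]) simp_all
    moreover have "isomorphic B (ActO B (h \<otimes>\<^bsub>G\<^esub> ?h) u) u" by (intro isomorphicI[of "ActId B u"]) simp_all
    ultimately have i: "isomorphic B (ActO B h ?u) u" using isomorphic_sym isomorphic_trans by blast
    have hu': "ActO B h ?u \<in> Grade B e" "invertible_object B (ActO B h ?u)" using act_grade act_invertible[OF h hu hui] by simp_all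
    have "bichar y u = bichar y (ActO B h ?u)"
      using bichar_iso[OF y hu'(1) yi hu'(2) isomorphic_refl i] by simp
    also have "\<dots> = bichar (ActO B h x) (ActO B h ?u)"
      using *[OF hu hui] bichar_act[OF h x xi hu hui] by simp
    also have "\<dots> = bichar (ActO B h x) u"
      using bichar_iso[OF hx(1) hu'(1) hx(2) hu'(2) isomorphic_refl i] hx by simp
    finally show "bichar y u = bichar (ActO B h x) u" .
  qed
qed

end

section \<open>Composition of module functors\<close>

lemma module_category_linear: "module_category D M \<Longrightarrow> linear_category M"
  using module_category.finite_semisimple unfolding finite_semisimple_category_def abelian_category_def by blast

lemma linear_functor_comp:
  assumes "linear_functor M N Fo Fa" "linear_functor N K Ho Ha"
  shows "linear_functor M K (\<lambda>x. Ho (Fo x)) (\<lambda>f. Ha (Fa f))"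
proof -
  interpret F: linear_functor M N Fo Fa by fact
  interpret H: linear_functor N K Ho Ha by fact
  show ?thesis
  proof
    show "Ha (Fa (g \<cdot>\<^bsub>M\<^esub> f)) = Ha (Fa g) \<cdot>\<^bsub>K\<^esub> Ha (Fa f)" if "f \<in> Hom M x y" "g \<in> Hom M y z" for f g x y z
      using F.functor_comp[OF that] H.functor_comp[OF F.functor_arr[OF that(1)] F.functor_arr[OF that(2)]] by simp
    show "Ha (Fa (f \<oplus>\<^bsub>M\<^esub> g)) = Ha (Fa f) \<oplus>\<^bsub>K\<^esub> Ha (Fa g)" if "f \<in> Hom M x y" "g \<in> Hom M x y" for f g x y
      using F.functor_plus[OF that] H.functor_plus[OF F.functor_arr[OF that(1)] F.functor_arr[OF that(2)]] by simp
    show "Ha (Fa (a \<star>\<^bsub>M\<^esub> f)) = a \<star>\<^bsub>K\<^esub> Ha (Fa f)" if "f \<in> Hom M x y" for a f x y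
      using F.functor_scale[OF that] H.functor_scale[OF F.functor_arr[OF that]] by simp
  qed (simp_all add: F.functor_obj F.functor_arr F.functor_id H.functor_obj H.functor_arr H.functor_id)
qed

text \<open>A module class collects the modules equivalent to a given one, so equality of classes
  rests on transitivity. The structure of the composite is that of \<open>H\<close> composed with
  the image under \<open>H\<close> of that of \<open>F\<close>.\<close>

lemma module_equivalent_trans:
  assumes D: "monoidal_linear_category D"
    and "module_category D M" "module_category D N" "module_category D K"
    and "module_equivalent D M N" "module_equivalent D N K"
  shows "module_equivalent D M K"
proof -
  interpret D: monoidal_linear_category D by fact
  interpret M: module_category D M by fact
  interpret N: module_category D N by fact
  interpret K: module_category D K by fact
  interpret LM: linear_category M by (rule module_category_linear) fact
  interpret LN: linear_category N by (rule module_category_linear) fact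
  interpret LK: linear_category K by (rule module_category_linear) fact
  obtain F where F: "module_functor D M N F" "equivalence_functor M N (FunO F) (FunA F)"
    using assms(5) unfolding module_equivalent_def by blast
  obtain H where H: "module_functor D N K H" "equivalence_functor N K (FunO H) (FunA H)"
    using assms(6) unfolding module_equivalent_def by blast
  interpret F: module_functor D M N F by fact
  interpret H: module_functor D N K H by fact
  interpret FL: linear_functor M N "FunO F" "FunA F" by (rule F.linear_functor)
  interpret HL: linear_functor N K "FunO H" "FunA H" by (rule H.linear_functor)
  let ?E = "\<lparr>FunO = \<lambda>x. FunO H (FunO F x), FunA = \<lambda>f. FunA H (FunA F f),
     FunS = \<lambda>x m. FunS H x (FunO F m) \<cdot>\<^bsub>K\<^esub> FunA H (FunS F x m)\<rparr>"
  have FS: "FunS F x m \<in> Hom N (FunO F (MActO M x m)) (MActO N x (FunO F m))" "isom N (FunS F x m)"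
    if "x \<in> Obj D" "m \<in> Obj M" for x m
    using F.str_iso[OF that] by (auto simp: Iso_def)
  have HS: "FunS H x m \<in> Hom K (FunO H (MActO N x m)) (MActO K x (FunO H m))" "isom K (FunS H x m)"
    if "x \<in> Obj D" "m \<in> Obj N" for x m
    using H.str_iso[OF that] by (auto simp: Iso_def)
  note HFS = HL.functor_arr[OF FS(1)]
  have "module_functor D M K ?E"
  proof (rule module_functor.intro; unfold modfun.simps)
    show "linear_functor M K (\<lambda>x. FunO H (FunO F x)) (\<lambda>f. FunA H (FunA F f))"
      by (rule linear_functor_comp[OF F.linear_functor H.linear_functor])
    show "FunS H x (FunO F m) \<cdot>\<^bsub>K\<^esub> FunA H (FunS F x m) \<in> Iso K (FunO H (FunO F (MActO M x m))) (MActO K x (FunO H (FunO F m)))"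
      if "x \<in> Obj D" "m \<in> Obj M" for x m
      using HS[of x "FunO F m"] HFS[OF that] LN.functor_isom(1)[OF LK.linear_category_axioms H.linear_functor FS(2)[OF that]]
        FL.functor_obj that by (auto simp: LK.Iso_iff LK.Hom_iff)
    show "(FunS H y (FunO F n) \<cdot>\<^bsub>K\<^esub> FunA H (FunS F y n)) \<cdot>\<^bsub>K\<^esub> FunA H (FunA F (MActA M f s)) =
      MActA K f (FunA H (FunA F s)) \<cdot>\<^bsub>K\<^esub> (FunS H x (FunO F m) \<cdot>\<^bsub>K\<^esub> FunA H (FunS F x m))"
      if f: "f \<in> Hom D x y" and s: "s \<in> Hom M m n" for f x y s m n
    proof -
      have o: "x \<in> Obj D" "y \<in> Obj D" "m \<in> Obj M" "n \<in> Obj M" using D.Hom_obj[OF f] LM.Hom_obj[OF s] by auto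
      note fs = FL.functor_arr[OF M.act_arr[OF f s]] and Fs = FL.functor_arr[OF s]
      note No = FL.functor_obj[OF o(3)] FL.functor_obj[OF o(4)]
      have "(FunS H y (FunO F n) \<cdot>\<^bsub>K\<^esub> FunA H (FunS F y n)) \<cdot>\<^bsub>K\<^esub> FunA H (FunA F (MActA M f s))
         = FunS H y (FunO F n) \<cdot>\<^bsub>K\<^esub> FunA H (FunS F y n \<cdot>\<^bsub>N\<^esub> FunA F (MActA M f s))"
        unfolding HL.functor_comp[OF fs FS(1)[OF o(2,4)]]
        using LK.comp_assoc[OF HL.functor_arr[OF fs] HFS[OF o(2,4)] HS(1)[OF o(2) No(2)]] by simp
      also have "\<dots> = FunS H y (FunO F n) \<cdot>\<^bsub>K\<^esub> (FunA H (MActA N f (FunA F s)) \<cdot>\<^bsub>K\<^esub> FunA H (FunS F x m))"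
        unfolding F.str_natural[OF f s] HL.functor_comp[OF FS(1)[OF o(1,3)] N.act_arr[OF f Fs]] ..
      also have "\<dots> = (FunS H y (FunO F n) \<cdot>\<^bsub>K\<^esub> FunA H (MActA N f (FunA F s))) \<cdot>\<^bsub>K\<^esub> FunA H (FunS F x m)"
        by (rule LK.comp_assoc[OF HFS[OF o(1,3)] HL.functor_arr[OF N.act_arr[OF f Fs]] HS(1)[OF o(2) No(2)]])
      also have "\<dots> = MActA K f (FunA H (FunA F s)) \<cdot>\<^bsub>K\<^esub> (FunS H x (FunO F m) \<cdot>\<^bsub>K\<^esub> FunA H (FunS F x m))"
        unfolding H.str_natural[OF f Fs]
        by (rule LK.comp_assoc[symmetric, OF HFS[OF o(1,3)] HS(1)[OF o(1) No(1)] K.act_arr[OF f HL.functor_arr[OF Fs]]])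
      finally show ?thesis .
    qed
    show "MAssoc K x y (FunO H (FunO F m)) \<cdot>\<^bsub>K\<^esub> (FunS H (x \<odot>\<^bsub>D\<^esub> y) (FunO F m) \<cdot>\<^bsub>K\<^esub> FunA H (FunS F (x \<odot>\<^bsub>D\<^esub> y) m)) =
      MActA K (Id D x) (FunS H y (FunO F m) \<cdot>\<^bsub>K\<^esub> FunA H (FunS F y m)) \<cdot>\<^bsub>K\<^esub>
      (FunS H x (FunO F (MActO M y m)) \<cdot>\<^bsub>K\<^esub> FunA H (FunS F x (MActO M y m))) \<cdot>\<^bsub>K\<^esub> FunA H (FunA F (MAssoc M x y m))"
      if x: "x \<in> Obj D" and y: "y \<in> Obj D" and m: "m \<in> Obj M" for x y m
    proof -
      note xy = D.tens_obj[OF x y] and ym = M.act_obj[OF y m] and Fm = FL.functor_obj[OF m]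
      note yFm = N.act_obj[OF y Fm] and Fym = FL.functor_obj[OF ym] and ix = D.id_in_Hom[OF x]
      note HFm = HL.functor_obj[OF Fm]
      have aM: "MAssoc M x y m \<in> Hom M (MActO M (x \<odot>\<^bsub>D\<^esub> y) m) (MActO M x (MActO M y m))"
        using M.massoc_iso[OF x y m] by (auto simp: Iso_def)
      have aN: "MAssoc N x y (FunO F m) \<in> Hom N (MActO N (x \<odot>\<^bsub>D\<^esub> y) (FunO F m)) (MActO N x (MActO N y (FunO F m)))"
        using N.massoc_iso[OF x y Fm] by (auto simp: Iso_def)
      have aK: "MAssoc K x y (FunO H (FunO F m)) \<in> Hom K (MActO K (x \<odot>\<^bsub>D\<^esub> y) (FunO H (FunO F m))) (MActO K x (MActO K y (FunO H (FunO F m))))"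
        using K.massoc_iso[OF x y HFm] by (auto simp: Iso_def)
      note FA = FL.functor_arr[OF aM]
      note HFA = HL.functor_arr[OF FA] and HA = HL.functor_arr[OF aN]
      note xF = N.act_arr[OF ix FS(1)[OF y m]] and xH = K.act_arr[OF ix HS(1)[OF y Fm]] and xHF = K.act_arr[OF ix HFS[OF y m]]
      note HxF = HL.functor_arr[OF xF]
      have arr: "\<And>f g h. f \<in> Hom K g h \<Longrightarrow> f \<in> Arr K \<and> Dom K f = g \<and> Cod K f = h" by (simp add: LK.Hom_iff)
      note [simp] = arr[OF aK] arr[OF HFA] arr[OF HA] arr[OF xH] arr[OF xHF] arr[OF HxF] arr[OF HS(1)[OF y Fm]]
        arr[OF HS(1)[OF xy Fm]] arr[OF HFS[OF xy m]] arr[OF HS(1)[OF x yFm]] arr[OF HS(1)[OF x Fym]] arr[OF HFS[OF x ym]]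
      have "MAssoc K x y (FunO H (FunO F m)) \<cdot>\<^bsub>K\<^esub> (FunS H (x \<odot>\<^bsub>D\<^esub> y) (FunO F m) \<cdot>\<^bsub>K\<^esub> FunA H (FunS F (x \<odot>\<^bsub>D\<^esub> y) m))
        = (MActA K (Id D x) (FunS H y (FunO F m)) \<cdot>\<^bsub>K\<^esub> FunS H x (MActO N y (FunO F m)) \<cdot>\<^bsub>K\<^esub> FunA H (MAssoc N x y (FunO F m)))
            \<cdot>\<^bsub>K\<^esub> FunA H (FunS F (x \<odot>\<^bsub>D\<^esub> y) m)"
        unfolding H.str_assoc[OF x y Fm, symmetric] by (simp add: LK.assoc_arr)
      also have "\<dots> = MActA K (Id D x) (FunS H y (FunO F m)) \<cdot>\<^bsub>K\<^esub> (FunS H x (MActO N y (FunO F m)) \<cdot>\<^bsub>K\<^esub>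
          FunA H (MAssoc N x y (FunO F m) \<cdot>\<^bsub>N\<^esub> FunS F (x \<odot>\<^bsub>D\<^esub> y) m))"
        unfolding HL.functor_comp[OF FS(1)[OF xy m] aN] by (simp add: LK.assoc_arr)
      also have "FunA H (MAssoc N x y (FunO F m) \<cdot>\<^bsub>N\<^esub> FunS F (x \<odot>\<^bsub>D\<^esub> y) m)
        = FunA H (MActA N (Id D x) (FunS F y m)) \<cdot>\<^bsub>K\<^esub> (FunA H (FunS F x (MActO M y m)) \<cdot>\<^bsub>K\<^esub> FunA H (FunA F (MAssoc M x y m)))"
        unfolding F.str_assoc[OF x y m] HL.functor_comp[OF FA LN.comp_in_Hom[OF FS(1)[OF x ym] xF]] HL.functor_comp[OF FS(1)[OF x ym] xF]
        by (simp add: LK.assoc_arr)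
      also have "MActA K (Id D x) (FunS H y (FunO F m)) \<cdot>\<^bsub>K\<^esub> (FunS H x (MActO N y (FunO F m)) \<cdot>\<^bsub>K\<^esub>
          (FunA H (MActA N (Id D x) (FunS F y m)) \<cdot>\<^bsub>K\<^esub> (FunA H (FunS F x (MActO M y m)) \<cdot>\<^bsub>K\<^esub> FunA H (FunA F (MAssoc M x y m)))))
        = MActA K (Id D x) (FunS H y (FunO F m)) \<cdot>\<^bsub>K\<^esub> ((FunS H x (MActO N y (FunO F m)) \<cdot>\<^bsub>K\<^esub>
          FunA H (MActA N (Id D x) (FunS F y m))) \<cdot>\<^bsub>K\<^esub> (FunA H (FunS F x (MActO M y m)) \<cdot>\<^bsub>K\<^esub> FunA H (FunA F (MAssoc M x y m))))"
        by (simp add: LK.assoc_arr)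
      also have "\<dots> = (MActA K (Id D x) (FunS H y (FunO F m)) \<cdot>\<^bsub>K\<^esub> MActA K (Id D x) (FunA H (FunS F y m))) \<cdot>\<^bsub>K\<^esub>
          (FunS H x (FunO F (MActO M y m)) \<cdot>\<^bsub>K\<^esub> (FunA H (FunS F x (MActO M y m)) \<cdot>\<^bsub>K\<^esub> FunA H (FunA F (MAssoc M x y m))))"
        unfolding H.str_natural[OF ix FS(1)[OF y m]] by (simp add: LK.assoc_arr)
      also have "MActA K (Id D x) (FunS H y (FunO F m)) \<cdot>\<^bsub>K\<^esub> MActA K (Id D x) (FunA H (FunS F y m))
        = MActA K (Id D x) (FunS H y (FunO F m) \<cdot>\<^bsub>K\<^esub> FunA H (FunS F y m))"
        using K.act_comp[OF ix ix HFS[OF y m] HS(1)[OF y Fm]] D.id_comp[OF ix] by simp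
      finally show ?thesis
        using K.act_arr[OF ix LK.comp_in_Hom[OF HFS[OF y m] HS(1)[OF y Fm]]] by (simp add: LK.assoc_arr LK.Hom_iff)
    qed
    show "MUnit K (FunO H (FunO F m)) \<cdot>\<^bsub>K\<^esub> (FunS H (Unit D) (FunO F m) \<cdot>\<^bsub>K\<^esub> FunA H (FunS F (Unit D) m)) = FunA H (FunA F (MUnit M m))"
      if m: "m \<in> Obj M" for m
    proof -
      note Fm = FL.functor_obj[OF m]
      note HFm = HL.functor_obj[OF Fm] and u = D.unit_obj
      have uN: "MUnit N (FunO F m) \<in> Hom N (MActO N (Unit D) (FunO F m)) (FunO F m)"
        using N.munit_iso[OF Fm] by (auto simp: Iso_def)
      have uK: "MUnit K (FunO H (FunO F m)) \<in> Hom K (MActO K (Unit D) (FunO H (FunO F m))) (FunO H (FunO F m))"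
        using K.munit_iso[OF HFm] by (auto simp: Iso_def)
      have "MUnit K (FunO H (FunO F m)) \<cdot>\<^bsub>K\<^esub> (FunS H (Unit D) (FunO F m) \<cdot>\<^bsub>K\<^esub> FunA H (FunS F (Unit D) m))
        = FunA H (MUnit N (FunO F m)) \<cdot>\<^bsub>K\<^esub> FunA H (FunS F (Unit D) m)"
        unfolding H.str_unit[OF Fm, symmetric] by (rule LK.comp_assoc[OF HFS[OF u m] HS(1)[OF u Fm] uK])
      also have "\<dots> = FunA H (FunA F (MUnit M m))"
        unfolding HL.functor_comp[OF FS(1)[OF u m] uN, symmetric] F.str_unit[OF m] ..
      finally show ?thesis .
    qed
  qed
  moreover have "equivalence_functor M K (FunO ?E) (FunA ?E)"
    unfolding equivalence_functor_def modfun.simps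
  proof (intro conjI ballI)
    fix m n assume "m \<in> Obj M" "n \<in> Obj M"
    then show "bij_betw (\<lambda>f. FunA H (FunA F f)) (Hom M m n) (Hom K (FunO H (FunO F m)) (FunO H (FunO F n)))"
      using bij_betw_trans[of "FunA F" "Hom M m n" "Hom N (FunO F m) (FunO F n)" "FunA H"] F(2) H(2) FL.functor_obj
      unfolding equivalence_functor_def comp_def by blast
  next
    fix k assume "k \<in> Obj K"
    then obtain n where n: "n \<in> Obj N" "isomorphic K (FunO H n) k" using H(2) unfolding equivalence_functor_def by blast
    then obtain m where m: "m \<in> Obj M" "isomorphic N (FunO F m) n" using F(2) unfolding equivalence_functor_def by blast
    show "\<exists>m\<in>Obj M. isomorphic K (FunO H (FunO F m)) k"
      using LK.isomorphic_trans[OF LN.functor_isomorphic[OF LK.linear_category_axioms H.linear_functor m(2)] n(2)] m(1) by blast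
  qed
  ultimately show ?thesis unfolding module_equivalent_def by blast
qed

section \<open>The module categories of a graded component\<close>

context pointed_crossed_category begin

context
  fixes g assumes g [simp]: "g \<in> carrier G"
begin

interpretation Mg: full_sub B "M g"
  by (rule M_sub[OF g])

lemma gobj: "x \<in> Grade B g \<Longrightarrow> x \<in> Obj B"
  using grade_obj' g by blast

text \<open>A test object of \<open>B\<close> splits into simple objects: those outside degree
  \<open>g\<close> have no non-zero arrow to the domain of \<open>f\<close>, and the others are
  tested inside the component.\<close>

lemma component_monic:
  assumes "monic (M g) f" shows "monic B f"
  unfolding monic_def
proof (intro conjI allI ballI impI)
  have f: "f \<in> Arr B" "Dom B f \<in> Grade B g" "Cod B f \<in> Grade B g" using assms unfolding monic_def by simp_all
  then show "f \<in> Arr B" by simp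
  fix w s t assume st: "s \<in> Hom B w (Dom B f)" "t \<in> Hom B w (Dom B f)" "f \<cdot> s = f \<cdot> t"
  have w: "w \<in> Obj B" using st Hom_obj by blast
  obtain ws where ws: "\<forall>u\<in>set ws. simple_object B u" "direct_sum B w ws" using decompose w by meson
  obtain i q where "direct_sum_diagram B w ws i q" using direct_sumE ws by blast
  then interpret d: direct_sum_diagram B w ws i q .
  show "s = t"
  proof (rule d.ext_out[OF st(1,2)])
    fix r assume r: "r < length ws"
    let ?u = "ws ! r"
    have si: "s \<cdot> i r \<in> Hom B ?u (Dom B f)" "t \<cdot> i r \<in> Hom B ?u (Dom B f)" using comp_in_Hom[OF d.i_Hom[OF r]] st by blast+
    show "s \<cdot> i r = t \<cdot> i r"
    proof (cases "hom_dim B ?u (Dom B f) = 0")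
      case True
      then show ?thesis using si hom_dim_eq_0_iff[OF d.ys_nth[OF r] gobj[OF f(2)]] by auto
    next
      case False
      then have u: "?u \<in> Grade B g" using grade_of_simple_hom[OF _ g f(2)] ws r by simp
      have "f \<cdot> (s \<cdot> i r) = f \<cdot> (t \<cdot> i r)"
        using st f d.i_Hom[OF r] by (auto simp: Hom_iff simp flip: assoc_arr)
      then show ?thesis using assms si u f unfolding monic_def by (simp add: Mg.sub_Hom)
    qed
  qed
qed

lemma component_epic:
  assumes "epic (M g) f" shows "epic B f"
  unfolding epic_def
proof (intro conjI allI ballI impI)
  have f: "f \<in> Arr B" "Dom B f \<in> Grade B g" "Cod B f \<in> Grade B g" using assms unfolding epic_def by simp_all
  then show "f \<in> Arr B" by simp
  fix w s t assume st: "s \<in> Hom B (Cod B f) w" "t \<in> Hom B (Cod B f) w" "s \<cdot> f = t \<cdot> f"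
  have w: "w \<in> Obj B" using st Hom_obj by blast
  obtain ws where ws: "\<forall>u\<in>set ws. simple_object B u" "direct_sum B w ws" using decompose w by meson
  obtain i q where "direct_sum_diagram B w ws i q" using direct_sumE ws by blast
  then interpret d: direct_sum_diagram B w ws i q .
  show "s = t"
  proof (rule d.ext_in[OF st(1,2)])
    fix r assume r: "r < length ws"
    let ?u = "ws ! r"
    have si: "q r \<cdot> s \<in> Hom B (Cod B f) ?u" "q r \<cdot> t \<in> Hom B (Cod B f) ?u" using comp_in_Hom[OF _ d.p_Hom[OF r]] st by blast+
    show "q r \<cdot> s = q r \<cdot> t"
    proof (cases "hom_dim B (Cod B f) ?u = 0")
      case True
      then show ?thesis using si hom_dim_eq_0_iff[OF gobj[OF f(3)] d.ys_nth[OF r]] by auto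
    next
      case False
      then have u: "?u \<in> Grade B g"
        using grade_of_simple_hom[OF _ g f(3)] ws r hom_dim_commute[OF gobj[OF f(3)] d.ys_nth[OF r]] by simp
      have "(q r \<cdot> s) \<cdot> f = (q r \<cdot> t) \<cdot> f"
        using st f d.p_Hom[OF r] by (auto simp: Hom_iff assoc_arr)
      then show ?thesis using assms si u f unfolding epic_def by (simp add: Mg.sub_Hom)
    qed
  qed
qed

text \<open>A simple summand of the kernel has a non-zero arrow to the domain of \<open>f\<close>,
  because factorizations through \<open>j\<close> are unique; it therefore has the degree of that
  domain.\<close>

lemma kernel_grade:
  assumes j: "is_kernel B j f" and f: "Dom B f \<in> Grade B g" shows "Dom B j \<in> Grade B g"
proof -
  let ?k = "Dom B j"
  have jf: "j \<in> Arr B" "f \<in> Arr B" "Cod B j = Dom B f" "f \<cdot> j = Null B (Dom B j) (Cod B f)"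
    and univ: "\<And>x h. h \<in> Hom B x (Dom B f) \<Longrightarrow> f \<cdot> h = Null B x (Cod B f) \<Longrightarrow> \<exists>!u. u \<in> Hom B x ?k \<and> j \<cdot> u = h"
    using j unfolding is_kernel_def by auto
  have ko: "?k \<in> Obj B" using jf by simp
  obtain ks where ks: "\<forall>u\<in>set ks. simple_object B u" "direct_sum B ?k ks" using decompose ko by meson
  obtain i q where "direct_sum_diagram B ?k ks i q" using direct_sumE ks by blast
  then interpret d: direct_sum_diagram B ?k ks i q .
  have "ks ! r \<in> Grade B g" if r: "r < length ks" for r
  proof -
    let ?u = "ks ! r"
    have u: "simple_object B ?u" "?u \<in> Obj B" using ks r simple_object_obj by auto
    have jH: "j \<in> Hom B ?k (Dom B f)" using jf by (simp add: Hom_iff)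
    have "i r \<noteq> Null B ?u ?k"
    proof
      assume "i r = Null B ?u ?k"
      then have "Id B ?u = Null B ?u ?u" using d.p_i[OF r r] comp_null[OF d.p_Hom[OF r] u(2)] by simp
      then show False using u not_zero_id by blast
    qed
    have "j \<cdot> i r \<noteq> Null B ?u (Dom B f)"
    proof
      assume n: "j \<cdot> i r = Null B ?u (Dom B f)"
      have "\<exists>!v. v \<in> Hom B ?u ?k \<and> j \<cdot> v = Null B ?u (Dom B f)"
      proof (rule univ)
        show "Null B ?u (Dom B f) \<in> Hom B ?u (Dom B f)" by (rule null_in_Hom[OF u(2) dom_cod_obj(1)[OF jf(2)]])
        show "f \<cdot> Null B ?u (Dom B f) = Null B ?u (Cod B f)" by (rule comp_null[OF HomI[OF jf(2) refl refl] u(2)])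
      qed
      moreover have "Null B ?u ?k \<in> Hom B ?u ?k" "j \<cdot> Null B ?u ?k = Null B ?u (Dom B f)"
        by (rule null_in_Hom[OF u(2) ko], rule comp_null[OF jH u(2)])
      ultimately show False using n d.i_Hom[OF r] \<open>i r \<noteq> Null B ?u ?k\<close> by blast
    qed
    then have "hom_dim B ?u (Dom B f) > 0" using hom_dim_pos_iff[OF u(2) dom_cod_obj(1)[OF jf(2)]] comp_in_Hom[OF d.i_Hom[OF r] jH] by blast
    then show ?thesis using grade_of_simple_hom[OF u(1) g f] by simp
  qed
  then have "set ks \<subseteq> Grade B g" by (metis in_set_conv_nth subsetI)
  then show ?thesis using grade_sum[OF g _ ks(2)] by simp
qed

lemma cokernel_grade:
  assumes j: "is_cokernel B j f" and f: "Cod B f \<in> Grade B g" shows "Cod B j \<in> Grade B g"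
proof -
  let ?k = "Cod B j"
  have jf: "j \<in> Arr B" "f \<in> Arr B" "Dom B j = Cod B f" "j \<cdot> f = Null B (Dom B f) (Cod B j)"
    and univ: "\<And>x h. h \<in> Hom B (Cod B f) x \<Longrightarrow> h \<cdot> f = Null B (Dom B f) x \<Longrightarrow> \<exists>!u. u \<in> Hom B ?k x \<and> u \<cdot> j = h"
    using j unfolding is_cokernel_def by auto
  have ko: "?k \<in> Obj B" using jf by simp
  obtain ks where ks: "\<forall>u\<in>set ks. simple_object B u" "direct_sum B ?k ks" using decompose ko by meson
  obtain i q where "direct_sum_diagram B ?k ks i q" using direct_sumE ks by blast
  then interpret d: direct_sum_diagram B ?k ks i q .
  have "ks ! r \<in> Grade B g" if r: "r < length ks" for r
  proof -
    let ?u = "ks ! r"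
    have u: "simple_object B ?u" "?u \<in> Obj B" using ks r simple_object_obj by auto
    have jH: "j \<in> Hom B (Cod B f) ?k" using jf by (simp add: Hom_iff)
    have "q r \<noteq> Null B ?k ?u"
    proof
      assume "q r = Null B ?k ?u"
      then have "Id B ?u = Null B ?u ?u" using d.p_i[OF r r] null_comp[OF d.i_Hom[OF r] u(2)] by simp
      then show False using u not_zero_id by blast
    qed
    have "q r \<cdot> j \<noteq> Null B (Cod B f) ?u"
    proof
      assume n: "q r \<cdot> j = Null B (Cod B f) ?u"
      have "\<exists>!v. v \<in> Hom B ?k ?u \<and> v \<cdot> j = Null B (Cod B f) ?u"
      proof (rule univ)
        show "Null B (Cod B f) ?u \<in> Hom B (Cod B f) ?u" by (rule null_in_Hom[OF dom_cod_obj(2)[OF jf(2)] u(2)])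
        show "Null B (Cod B f) ?u \<cdot> f = Null B (Dom B f) ?u" by (rule null_comp[OF HomI[OF jf(2) refl refl] u(2)])
      qed
      moreover have "Null B ?k ?u \<in> Hom B ?k ?u" "Null B ?k ?u \<cdot> j = Null B (Cod B f) ?u"
        by (rule null_in_Hom[OF ko u(2)], rule null_comp[OF jH u(2)])
      ultimately show False using n d.p_Hom[OF r] \<open>q r \<noteq> Null B ?k ?u\<close> by blast
    qed
    then have "hom_dim B (Cod B f) ?u > 0" using hom_dim_pos_iff[OF dom_cod_obj(2)[OF jf(2)] u(2)] comp_in_Hom[OF jH d.p_Hom[OF r]] by blast
    then have "hom_dim B ?u (Cod B f) > 0" using hom_dim_commute[OF dom_cod_obj(2)[OF jf(2)] u(2)] by simp
    then show ?thesis using grade_of_simple_hom[OF u(1) g f] by simp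
  qed
  then have "set ks \<subseteq> Grade B g" by (metis in_set_conv_nth subsetI)
  then show ?thesis using grade_sum[OF g _ ks(2)] by simp
qed

lemma component_kernel:
  assumes "is_kernel B j f" "f \<in> Arr (M g)" shows "is_kernel (M g) j f"
  using assms kernel_grade[OF assms(1)] unfolding is_kernel_def by (auto simp: Mg.sub_Hom)

lemma component_cokernel:
  assumes "is_cokernel B j f" "f \<in> Arr (M g)" shows "is_cokernel (M g) j f"
  using assms cokernel_grade[OF assms(1)] unfolding is_cokernel_def by (auto simp: Mg.sub_Hom)

lemma component_simple_sub: assumes "simple_object B x" "x \<in> Grade B g" shows "simple_object (M g) x"
  unfolding simple_object_def
proof (intro conjI allI ballI impI)
  show "x \<in> Obj (M g)" using assms by simp
  show "\<not> zero_object (M g) x" using assms simple_not_zero Mg.zero_object_sub by blast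
  fix y f assume f: "f \<in> Hom (M g) y x" "monic (M g) f"
  then have "zero_object B y \<or> isom B f"
    using component_monic assms(1) unfolding simple_object_def by (auto simp: Mg.sub_Hom)
  then show "zero_object (M g) y \<or> isom (M g) f"
    using f(1) by (auto simp: Mg.zero_object_sub Mg.isom_sub Mg.sub_Hom Hom_iff)
qed

text \<open>The inclusion of a simple summand is monic in the component, hence an
  isomorphism.\<close>

lemma component_simple_converse: assumes "simple_object (M g) x" shows "simple_object B x"
proof -
  have x: "x \<in> Grade B g" "\<not> zero_object B x" using assms Mg.zero_object_sub unfolding simple_object_def by auto
  obtain ys where ys: "direct_sum B x ys" "\<And>r. r < length ys \<Longrightarrow> simple_object B (ys ! r)" "\<And>r. r < length ys \<Longrightarrow> ys ! r \<in> Grade B g"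
    using grade_decompose[OF g x(1)] by blast
  have "ys \<noteq> []" using ys(1) x direct_sum_Nil by auto
  then have l: "0 < length ys" by simp
  obtain i q where "direct_sum_diagram B x ys i q" using direct_sumE ys by blast
  then interpret d: direct_sum_diagram B x ys i q .
  have i: "i 0 \<in> Hom B (ys ! 0) x" "q 0 \<in> Hom B x (ys ! 0)" "q 0 \<cdot> i 0 = Id B (ys ! 0)"
    using d.i_Hom[OF l] d.p_Hom[OF l] d.p_i[OF l l] by auto
  have "monic (M g) (i 0)"
    unfolding monic_def
  proof (intro conjI allI ballI impI)
    show "i 0 \<in> Arr (M g)" using i x ys(3)[OF l] by (simp add: Hom_iff)
    fix w s t assume st: "s \<in> Hom (M g) w (Dom (M g) (i 0))" "t \<in> Hom (M g) w (Dom (M g) (i 0))" "i 0 \<cdot>\<^bsub>M g\<^esub> s = i 0 \<cdot>\<^bsub>M g\<^esub> t"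
    then have sH: "s \<in> Hom B w (ys ! 0)" "t \<in> Hom B w (ys ! 0)" using i by (auto simp: Mg.sub_Hom Hom_iff)
    have "q 0 \<cdot> (i 0 \<cdot> s) = q 0 \<cdot> (i 0 \<cdot> t)" using st(3) by simp
    then show "s = t"
      unfolding comp_assoc[OF sH(1) i(1,2)] comp_assoc[OF sH(2) i(1,2)] i(3) id_comp[OF sH(1)] id_comp[OF sH(2)] .
  qed
  moreover have "\<not> zero_object (M g) (ys ! 0)" using ys(2)[OF l] simple_not_zero Mg.zero_object_sub by blast
  moreover have "i 0 \<in> Hom (M g) (ys ! 0) x" using i ys(3)[OF l] x by (simp add: Mg.sub_Hom)
  ultimately have "isom (M g) (i 0)" using assms unfolding simple_object_def by blast
  then have "isomorphic B (ys ! 0) x" using i Mg.isom_sub by (intro isomorphicI[of "i 0"]) (auto simp: Hom_iff)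
  then show ?thesis using simple_iso ys(2)[OF l] by blast
qed

lemma component_semisimple: "finite_semisimple_category (M g)"
  unfolding finite_semisimple_category_def
proof (intro conjI ballI)
  have abB: "\<exists>z. zero_object B z" "\<And>x y. x \<in> Obj B \<Longrightarrow> y \<in> Obj B \<Longrightarrow> \<exists>s. direct_sum B s [x, y]"
    "\<And>f. f \<in> Arr B \<Longrightarrow> (\<exists>j. is_kernel B j f) \<and> (\<exists>q. is_cokernel B q f)"
    "\<And>f. monic B f \<Longrightarrow> \<exists>k. is_kernel B f k" "\<And>f. epic B f \<Longrightarrow> \<exists>k. is_cokernel B f k"
    using abelian unfolding abelian_category_def by auto
  show "abelian_category (M g)"
    unfolding abelian_category_def
  proof (intro conjI ballI allI impI)
    show "linear_category (M g)" by (rule Mg.linear_category_sub)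
    obtain z where "zero_object B z" using abB(1) by blast
    then have "zero_object (M g) z" using zero_in_grade[OF g] by (simp add: Mg.zero_object_sub)
    then show "\<exists>z. zero_object (M g) z" ..
    fix x y assume xy: "x \<in> Obj (M g)" "y \<in> Obj (M g)"
    then obtain s where s: "direct_sum B s [x, y]" using abB(2) gobj by (metis module_component_simps(1))
    then have "s \<in> Grade B g" using grade_sum[OF g _ s] xy by simp
    then have "direct_sum (M g) s [x, y]" using s xy by (simp add: Mg.direct_sum_sub)
    then show "\<exists>s. direct_sum (M g) s [x, y]" ..
  next
    fix f assume f: "f \<in> Arr (M g)"
    then have "f \<in> Arr B" by simp
    then obtain j q where "is_kernel B j f" "is_cokernel B q f" using abB(3) by blast
    then have "is_kernel (M g) j f" "is_cokernel (M g) q f" using component_kernel component_cokernel f by blast+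
    then show "\<exists>j. is_kernel (M g) j f" "\<exists>q. is_cokernel (M g) q f" by blast+
  next
    fix f assume f: "monic (M g) f"
    then have fa: "f \<in> Arr (M g)" unfolding monic_def by blast
    then have fB: "f \<in> Arr B" by simp
    \<comment> \<open>The arrow \<open>c\<close> that has \<open>f\<close> as kernel may leave
      degree \<open>g\<close>. The cokernel \<open>q\<close> of \<open>f\<close> stays in it, and
      \<open>c\<close> factors through \<open>q\<close>, so \<open>f\<close> is a kernel of
      \<open>q\<close> as well.\<close>
    obtain c where c: "is_kernel B f c" using abB(4) component_monic[OF f] by blast
    obtain q where q: "is_cokernel B q f" using abB(3)[OF fB] by blast
    have qa: "q \<in> Arr B" "Dom B q = Cod B f" "q \<cdot> f = Null B (Dom B f) (Cod B q)"
      using q unfolding is_cokernel_def by auto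
    have qu: "\<And>x h. h \<in> Hom B (Cod B f) x \<Longrightarrow> h \<cdot> f = Null B (Dom B f) x \<Longrightarrow> \<exists>u. u \<in> Hom B (Cod B q) x \<and> u \<cdot> q = h"
      using q unfolding is_cokernel_def by blast
    have ca: "c \<in> Arr B" "Cod B f = Dom B c" "c \<cdot> f = Null B (Dom B f) (Cod B c)"
      and cu: "\<And>x h. h \<in> Hom B x (Dom B c) \<Longrightarrow> c \<cdot> h = Null B x (Cod B c) \<Longrightarrow> \<exists>!u. u \<in> Hom B x (Dom B f) \<and> f \<cdot> u = h"
      using c unfolding is_kernel_def by auto
    obtain u where u: "u \<in> Hom B (Cod B q) (Cod B c)" "u \<cdot> q = c" using qu[of c "Cod B c"] ca by (auto simp: Hom_iff)
    have "is_kernel B f q"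
      unfolding is_kernel_def
    proof (intro conjI allI ballI impI)
      fix x h assume h: "h \<in> Hom B x (Dom B q)" "q \<cdot> h = Null B x (Cod B q)"
      have qH: "q \<in> Hom B (Dom B q) (Cod B q)" using qa by (simp add: Hom_iff)
      have "c \<cdot> h = u \<cdot> (q \<cdot> h)" unfolding u(2)[symmetric] using comp_assoc[OF h(1) qH u(1)] by simp
      then have "c \<cdot> h = Null B x (Cod B c)" unfolding h(2) comp_null[OF u(1) Hom_obj(1)[OF h(1)]] .
      then show "\<exists>!u. u \<in> Hom B x (Dom B f) \<and> f \<cdot> u = h" using cu h(1) qa(2) ca(2) by simp
    qed (use fB qa in simp_all)
    moreover have "q \<in> Arr (M g)" using qa fa cokernel_grade[OF q] by simp
    ultimately show "\<exists>k. is_kernel (M g) f k" using component_kernel by blast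
  next
    fix f assume f: "epic (M g) f"
    then have fa: "f \<in> Arr (M g)" unfolding epic_def by blast
    then have fB: "f \<in> Arr B" by simp
    obtain c where c: "is_cokernel B f c" using abB(5) component_epic[OF f] by blast
    obtain q where q: "is_kernel B q f" using abB(3)[OF fB] by blast
    have qa: "q \<in> Arr B" "Cod B q = Dom B f" "f \<cdot> q = Null B (Dom B q) (Cod B f)"
      using q unfolding is_kernel_def by auto
    have qu: "\<And>x h. h \<in> Hom B x (Dom B f) \<Longrightarrow> f \<cdot> h = Null B x (Cod B f) \<Longrightarrow> \<exists>u. u \<in> Hom B x (Dom B q) \<and> q \<cdot> u = h"
      using q unfolding is_kernel_def by blast
    have ca: "c \<in> Arr B" "Dom B f = Cod B c" "f \<cdot> c = Null B (Dom B c) (Cod B f)"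
      and cu: "\<And>x h. h \<in> Hom B (Cod B c) x \<Longrightarrow> h \<cdot> c = Null B (Dom B c) x \<Longrightarrow> \<exists>!u. u \<in> Hom B (Cod B f) x \<and> u \<cdot> f = h"
      using c unfolding is_cokernel_def by auto
    obtain u where u: "u \<in> Hom B (Dom B c) (Dom B q)" "q \<cdot> u = c" using qu[of c "Dom B c"] ca by (auto simp: Hom_iff)
    have "is_cokernel B f q"
      unfolding is_cokernel_def
    proof (intro conjI allI ballI impI)
      fix x h assume h: "h \<in> Hom B (Cod B q) x" "h \<cdot> q = Null B (Dom B q) x"
      have qH: "q \<in> Hom B (Dom B q) (Cod B q)" using qa by (simp add: Hom_iff)
      have "h \<cdot> c = (h \<cdot> q) \<cdot> u" unfolding u(2)[symmetric] using comp_assoc[OF u(1) qH h(1)] by simp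
      then have "h \<cdot> c = Null B (Dom B c) x" unfolding h(2) null_comp[OF u(1) Hom_obj(2)[OF h(1)]] .
      then show "\<exists>!u. u \<in> Hom B (Cod B f) x \<and> u \<cdot> f = h" using cu h(1) qa(2) ca(2) by simp
    qed (use fB qa in simp_all)
    moreover have "q \<in> Arr (M g)" using qa fa kernel_grade[OF q] by simp
    ultimately show "\<exists>k. is_cokernel (M g) f k" using component_cokernel by blast
  qed
  have "Irr (M g) \<subseteq> Irr B"
  proof
    fix Z assume "Z \<in> Irr (M g)"
    then obtain x where x: "simple_object (M g) x" "Z = iso_class (M g) x" unfolding Irr_def by blast
    then have xg: "x \<in> Grade B g" unfolding simple_object_def by simp
    have "iso_class (M g) x = iso_class B x"
      using grade_replete[OF g xg] isomorphic_obj xg unfolding iso_class_def by (auto simp: Mg.isomorphic_sub)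
    then show "Z \<in> Irr B" using x component_simple_converse iso_class_in_Irr by simp
  qed
  then show "finite (Irr (M g))" using finite_Irr finite_subset by blast
  fix x assume x: "x \<in> Obj (M g)"
  then have xg: "x \<in> Grade B g" by simp
  obtain ys where ys: "direct_sum B x ys" "\<And>r. r < length ys \<Longrightarrow> simple_object B (ys ! r)" "\<And>r. r < length ys \<Longrightarrow> ys ! r \<in> Grade B g"
    using grade_decompose[OF g xg] by blast
  have "\<forall>y\<in>set ys. simple_object (M g) y \<and> y \<in> Grade B g"
    using component_simple_sub ys(2,3) by (metis in_set_conv_nth)
  then show "\<exists>ys. (\<forall>y\<in>set ys. simple_object (M g) y) \<and> direct_sum (M g) x ys"
    using ys(1) xg by (intro exI[of _ ys]) (auto simp: Mg.direct_sum_sub)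
  fix y assume y: "y \<in> Obj (M g)"
  then show "\<exists>S\<subseteq>Hom (M g) x y. finite S \<and> lspan (M g) x y S = Hom (M g) x y"
    using finite_spanning[of x y] x gobj by (simp add: Mg.sub_Hom_eq Mg.lspan_sub)
qed

lemma module_component_category: "module_category (neutral_component G B) (M g)"
proof (rule module_category.intro)
  note tg = tens_grade_left[OF g]
  have sub: "f \<in> Hom B x y" if "f \<in> Hom (neutral_component G B) x y" for f x y using that by (simp add: N.sub_Hom)
  have sub': "s \<in> Hom B x y" if "s \<in> Hom (M g) x y" for s x y using that by (simp add: Mg.sub_Hom)
  show "finite_semisimple_category (M g)" by (rule component_semisimple)
  show "MActO (M g) x m \<in> Obj (M g)" if "x \<in> Obj (neutral_component G B)" "m \<in> Obj (M g)" for x m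
    using that tg by simp
  show "MActA (M g) f s \<in> Hom (M g) (MActO (M g) x m) (MActO (M g) y n)"
    if "f \<in> Hom (neutral_component G B) x y" "s \<in> Hom (M g) m n" for f x y s m n
    using that tens_arr[OF sub sub'] tg by (simp add: Mg.sub_Hom N.sub_Hom)
  show "MActA (M g) (Id (neutral_component G B) x) (Id (M g) m) = Id (M g) (MActO (M g) x m)"
    if "x \<in> Obj (neutral_component G B)" "m \<in> Obj (M g)" for x m
    using that gobj by simp
  show "MActA (M g) (f' \<cdot>\<^bsub>neutral_component G B\<^esub> f) (s' \<cdot>\<^bsub>M g\<^esub> s) = MActA (M g) f' s' \<cdot>\<^bsub>M g\<^esub> MActA (M g) f s"
    if "f \<in> Hom (neutral_component G B) x y" "f' \<in> Hom (neutral_component G B) y z" "s \<in> Hom (M g) l m" "s' \<in> Hom (M g) m n"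
    for f x y f' z s l m s' n
    using tens_comp[OF sub[OF that(1)] sub[OF that(2)] sub'[OF that(3)] sub'[OF that(4)]] by simp
  show "MActA (M g) (f \<oplus>\<^bsub>neutral_component G B\<^esub> f') s = MActA (M g) f s \<oplus>\<^bsub>M g\<^esub> MActA (M g) f' s"
    if "f \<in> Hom (neutral_component G B) x y" "f' \<in> Hom (neutral_component G B) x y" "s \<in> Hom (M g) m n" for f x y f' s m n
    using tens_plus_left[OF sub[OF that(1)] sub[OF that(2)] sub'[OF that(3)]] by simp
  show "MActA (M g) f (s \<oplus>\<^bsub>M g\<^esub> s') = MActA (M g) f s \<oplus>\<^bsub>M g\<^esub> MActA (M g) f s'"
    if "f \<in> Hom (neutral_component G B) x y" "s \<in> Hom (M g) m n" "s' \<in> Hom (M g) m n" for f x y s s' m n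
    using tens_plus_right[OF sub[OF that(1)] sub'[OF that(2)] sub'[OF that(3)]] by simp
  show "MActA (M g) (a \<star>\<^bsub>neutral_component G B\<^esub> f) s = a \<star>\<^bsub>M g\<^esub> MActA (M g) f s"
    if "f \<in> Hom (neutral_component G B) x y" "s \<in> Hom (M g) m n" for a f x y s m n
    using tens_scale_left[OF sub[OF that(1)] sub'[OF that(2)]] by simp
  show "MActA (M g) f (a \<star>\<^bsub>M g\<^esub> s) = a \<star>\<^bsub>M g\<^esub> MActA (M g) f s"
    if "f \<in> Hom (neutral_component G B) x y" "s \<in> Hom (M g) m n" for a f x y s m n
    using tens_scale_right[OF sub[OF that(1)] sub'[OF that(2)]] by simp
  show "MAssoc (M g) x y m \<in> Iso (M g) (MActO (M g) (x \<odot>\<^bsub>neutral_component G B\<^esub> y) m) (MActO (M g) x (MActO (M g) y m))"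
    if "x \<in> Obj (neutral_component G B)" "y \<in> Obj (neutral_component G B)" "m \<in> Obj (M g)" for x y m
    using that gobj tg tens_grade_left[OF e_carrier] by (simp add: Mg.Iso_sub Iso_iff)
  show "MUnit (M g) m \<in> Iso (M g) (MActO (M g) (Unit (neutral_component G B)) m) m" if "m \<in> Obj (M g)" for m
    using that gobj tg unit_grade by (simp add: Mg.Iso_sub Iso_iff)
  show "MAssoc (M g) x' y' n \<cdot>\<^bsub>M g\<^esub> MActA (M g) (f \<Odot>\<^bsub>neutral_component G B\<^esub> k) s =
      MActA (M g) f (MActA (M g) k s) \<cdot>\<^bsub>M g\<^esub> MAssoc (M g) x y m"
    if "f \<in> Hom (neutral_component G B) x x'" "k \<in> Hom (neutral_component G B) y y'" "s \<in> Hom (M g) m n" for f x x' k y y' s m n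
    using assoc_natural[OF sub[OF that(1)] sub[OF that(2)] sub'[OF that(3)]] by simp
  show "MUnit (M g) n \<cdot>\<^bsub>M g\<^esub> MActA (M g) (Id (neutral_component G B) (Unit (neutral_component G B))) s = s \<cdot>\<^bsub>M g\<^esub> MUnit (M g) m"
    if "s \<in> Hom (M g) m n" for s m n
    using lunit_natural[OF sub'[OF that]] by simp
  show "MAssoc (M g) x y (MActO (M g) z m) \<cdot>\<^bsub>M g\<^esub> MAssoc (M g) (x \<odot>\<^bsub>neutral_component G B\<^esub> y) z m =
      MActA (M g) (Id (neutral_component G B) x) (MAssoc (M g) y z m) \<cdot>\<^bsub>M g\<^esub> MAssoc (M g) x (y \<odot>\<^bsub>neutral_component G B\<^esub> z) m \<cdot>\<^bsub>M g\<^esub>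
        MActA (M g) (Assoc (neutral_component G B) x y z) (Id (M g) m)"
    if "x \<in> Obj (neutral_component G B)" "y \<in> Obj (neutral_component G B)" "z \<in> Obj (neutral_component G B)" "m \<in> Obj (M g)" for x y z m
    using pentagon[of x y z m] that gobj by simp
  show "MActA (M g) (Id (neutral_component G B) x) (MUnit (M g) m) \<cdot>\<^bsub>M g\<^esub> MAssoc (M g) x (Unit (neutral_component G B)) m =
      MActA (M g) (RUnit (neutral_component G B) x) (Id (M g) m)"
    if "x \<in> Obj (neutral_component G B)" "m \<in> Obj (M g)" for x m
    using triangle[of x m] that gobj by simp
qed

text \<open>For this functor, \<open>alpha_iso_transport\<close> becomes the uniqueness behind the
  definite description in \<open>pic_isometry\<close>.\<close>

lemma identity_module_functor:
  "module_functor (neutral_component G B) (M g) (M g) \<lparr>FunO = \<lambda>x. x, FunA = \<lambda>f. f, FunS = \<lambda>x m. Id B (x \<odot> m)\<rparr>"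
proof (rule module_functor.intro; unfold modfun.simps)
  note tg [simp] = tens_grade_left[OF g]
  note [simp] = gobj
  show "linear_functor (M g) (M g) (\<lambda>x. x) (\<lambda>f. f)" by unfold_locales auto
  show "Id B (x \<odot> m) \<in> Iso (M g) (MActO (M g) x m) (MActO (M g) x m)"
    if "x \<in> Obj (neutral_component G B)" "m \<in> Obj (M g)" for x m
    using that by (simp add: Mg.Iso_sub Iso_iff)
  show "Id B (y \<odot> n) \<cdot>\<^bsub>M g\<^esub> MActA (M g) f s = MActA (M g) f s \<cdot>\<^bsub>M g\<^esub> Id B (x \<odot> m)"
    if "f \<in> Hom (neutral_component G B) x y" "s \<in> Hom (M g) m n" for f x y s m n
    using that by (simp add: N.sub_Hom Mg.sub_Hom Hom_iff)
  show "MAssoc (M g) x y m \<cdot>\<^bsub>M g\<^esub> Id B ((x \<odot>\<^bsub>neutral_component G B\<^esub> y) \<odot> m) =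
      MActA (M g) (Id (neutral_component G B) x) (Id B (y \<odot> m)) \<cdot>\<^bsub>M g\<^esub> Id B (x \<odot> MActO (M g) y m) \<cdot>\<^bsub>M g\<^esub> MAssoc (M g) x y m"
    if "x \<in> Obj (neutral_component G B)" "y \<in> Obj (neutral_component G B)" "m \<in> Obj (M g)" for x y m
    using that by simp
  show "MUnit (M g) m \<cdot>\<^bsub>M g\<^esub> Id B (Unit (neutral_component G B) \<odot> m) = MUnit (M g) m" if "m \<in> Obj (M g)" for m
    using that by simp
qed

text \<open>Existence is the inverse twist, uniqueness the transport along the identity
  functor.\<close>

lemma pic_isometry_component: "pic_isometry (neutral_component G B) (M g) = (\<lambda>a\<in>A. act_class g a)"
  unfolding pic_isometry_def
proof (rule restrict_ext)
  fix a assume a: "a \<in> A"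
  note r = rep[OF a]
  show "(THE b. b \<in> A \<and> (\<exists>x\<in>a. \<exists>y\<in>b. module_functors_isomorphic (neutral_component G B) (M g) (M g)
      (alpha_minus (neutral_component G B) (M g) y) (alpha_plus (neutral_component G B) (M g) x))) = act_class g a"
  proof (rule the_equality, rule conjI)
    show "act_class g a \<in> A" by (rule act_class_in[OF g a])
    have "rep a \<in> a" using r mem_iso_class invertible_obj by blast
    moreover have "ActO B g (rep a) \<in> act_class g a" unfolding act_class_def using mem_iso_class rep_obj[OF a] by simp
    moreover have "module_functors_isomorphic (neutral_component G B) (M g) (M g)
      (alpha_minus (neutral_component G B) (M g) (ActO B g (rep a))) (alpha_plus (neutral_component G B) (M g) (rep a))"
      using alpha_iso_iff[OF g r(1) act_grade[OF g r(1)]] alpha_iso_twist[OF g r(1)] by blast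
    ultimately show "\<exists>x\<in>a. \<exists>y\<in>act_class g a. module_functors_isomorphic (neutral_component G B) (M g) (M g)
      (alpha_minus (neutral_component G B) (M g) y) (alpha_plus (neutral_component G B) (M g) x)" by blast
  next
    fix b assume "b \<in> A \<and> (\<exists>x\<in>a. \<exists>y\<in>b. module_functors_isomorphic (neutral_component G B) (M g) (M g)
      (alpha_minus (neutral_component G B) (M g) y) (alpha_plus (neutral_component G B) (M g) x))"
    then obtain x y where b: "b \<in> A" and x: "x \<in> a" and y: "y \<in> b" and
      i: "module_functors_isomorphic (neutral_component G B) (M g) (M g)
        (alpha_minus (neutral_component G B) (M g) y) (alpha_plus (neutral_component G B) (M g) x)" by blast
    have x': "x \<in> Grade B e" "invertible_object B x" "iso_class B x = a"
      using D.Inv_mem[OF a x] invertible_sub neutral_iso_class by auto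
    have y': "y \<in> Grade B e" "invertible_object B y" "iso_class B y = b"
      using D.Inv_mem[OF b y] invertible_sub neutral_iso_class by auto
    obtain \<eta> where "alpha_iso g y x \<eta>" using i alpha_iso_iff[OF g x'(1) y'(1)] by blast
    then have "isomorphic B y (ActO B g x)"
      using alpha_iso_transport[OF g g identity_module_functor _ x'(1,2) y'(1,2)] by (simp add: bij_betw_def inj_on_def)
    then show "b = act_class g a" using isomorphic_class y'(3) act_class_eq[OF g x'(1,2)] x'(3) by simp
  qed
qed

end

text \<open>Transporting the isomorphism given by the twist in degree \<open>g\<close> along the
  equivalence compares its object with the one assigned in degree \<open>h\<close>.\<close>

lemma module_equivalent_act_class:
  assumes g: "g \<in> carrier G" and h: "h \<in> carrier G" and a: "a \<in> A"
    and eq: "module_equivalent (neutral_component G B) (M g) (M h)"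
  shows "act_class g a = act_class h a"
proof -
  note r = rep[OF a]
  obtain F where F: "module_functor (neutral_component G B) (M g) (M h) F" "equivalence_functor (M g) (M h) (FunO F) (FunA F)"
    using eq unfolding module_equivalent_def by blast
  have "isomorphic B (ActO B g (rep a)) (ActO B h (rep a))"
    by (rule alpha_iso_transport[OF g h F(1) _ r(1,2) act_grade[OF g r(1)] act_invertible[OF g r(1,2)] alpha_iso_twist[OF g r(1)]])
      (use F(2) in \<open>simp add: equivalence_functor_def\<close>)
  then show ?thesis unfolding act_class_def by (rule isomorphic_class)
qed

end

section \<open>Invertible objects in a component\<close>

context closed_fusion_category begin

context
  fixes x y \<iota>
  assumes [simp]: "x \<in> Obj C" "y \<in> Obj C" and iota [simp]: "isom C \<iota>" "Dom C \<iota> = x \<odot> y" "Cod C \<iota> = Unit C"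
begin

text \<open>Undoes tensoring with \<open>x\<close> and then with \<open>y\<close>, naturally in
  \<open>m\<close>; tensoring with \<open>x\<close> is therefore faithful.\<close>

definition untensor :: "'o \<Rightarrow> 'm" where
  "untensor m = RUnit C m \<cdot> ((Id C m \<Odot> \<iota>) \<cdot> Assoc C m x y)"

lemma untensor_iso: "m \<in> Obj C \<Longrightarrow> isom C (untensor m)" "m \<in> Obj C \<Longrightarrow> Dom C (untensor m) = (m \<odot> x) \<odot> y"
  "m \<in> Obj C \<Longrightarrow> Cod C (untensor m) = m"
  unfolding untensor_def by simp_all

lemma untensor_nat:
  assumes s [simp]: "s \<in> Arr C" "Dom C s = m" "Cod C s = n"
  shows "untensor n \<cdot> ((s \<Odot> Id C x) \<Odot> Id C y) = s \<cdot> untensor m"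
proof -
  have [simp]: "m \<in> Obj C" "n \<in> Obj C" using s dom_cod_obj by blast+
  have "untensor n \<cdot> ((s \<Odot> Id C x) \<Odot> Id C y) = RUnit C n \<cdot> ((Id C n \<Odot> \<iota>) \<cdot> (Assoc C n x y \<cdot> ((s \<Odot> Id C x) \<Odot> Id C y)))"
    unfolding untensor_def by (simp add: assoc_arr)
  also have "\<dots> = RUnit C n \<cdot> (((Id C n \<Odot> \<iota>) \<cdot> (s \<Odot> Id C (x \<odot> y))) \<cdot> Assoc C m x y)"
    by (subst assoc_nat[of s "Id C x" "Id C y" m n x x y y]) (simp_all add: assoc_arr)
  also have "\<dots> = (RUnit C n \<cdot> (s \<Odot> Id C (Unit C))) \<cdot> ((Id C m \<Odot> \<iota>) \<cdot> Assoc C m x y)"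
  proof -
    have "(Id C n \<Odot> \<iota>) \<cdot> (s \<Odot> Id C (x \<odot> y)) = (s \<Odot> Id C (Unit C)) \<cdot> (Id C m \<Odot> \<iota>)" by (simp add: tens_comp_arr)
    then show ?thesis by (simp add: assoc_arr)
  qed
  also have "\<dots> = s \<cdot> untensor m"
    unfolding untensor_def by (subst runit_nat[of s m n]) (simp_all add: assoc_arr)
  finally show ?thesis .
qed

lemma tens_right_faithful:
  assumes "s \<in> Hom C m n" "t \<in> Hom C m n" "s \<Odot> Id C x = t \<Odot> Id C x" shows "s = t"
proof -
  have [simp]: "s \<in> Arr C" "t \<in> Arr C" "Dom C s = m" "Cod C s = n" "Dom C t = m" "Cod C t = n" using assms by (auto simp: Hom_iff)
  have m: "m \<in> Obj C" using assms Hom_obj by blast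
  have "s \<cdot> untensor m = t \<cdot> untensor m" using untensor_nat[of s m n] untensor_nat[of t m n] assms(3) by simp
  then show ?thesis using isom_cancel_right[of "untensor m" s t] untensor_iso[OF m] by simp
qed

end

text \<open>For fullness, \<open>h\<close> is tensored with \<open>y\<close> and stripped of both
  factors to give \<open>f\<close>. That \<open>f \<Odot> Id C x\<close> is \<open>h\<close> holds
  after tensoring with \<open>y\<close>, and tensoring with \<open>y\<close> is faithful by the
  second isomorphism \<kappa>.\<close>

lemma tens_invertible_bij:
  assumes x: "invertible_object C x" and m [simp]: "m \<in> Obj C" and n [simp]: "n \<in> Obj C"
  shows "bij_betw (\<lambda>s. s \<Odot> Id C x) (Hom C m n) (Hom C (m \<odot> x) (n \<odot> x))"
proof -
  have [simp]: "x \<in> Obj C" using x invertible_obj by blast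
  obtain y where y [simp]: "y \<in> Obj C" and i: "isomorphic C (x \<odot> y) (Unit C)" "isomorphic C (y \<odot> x) (Unit C)"
    using x unfolding invertible_object_def by blast
  obtain \<iota> where iota: "isom C \<iota>" "Dom C \<iota> = x \<odot> y" "Cod C \<iota> = Unit C" using i(1) isomorphicE by blast
  obtain \<kappa> where kappa: "isom C \<kappa>" "Dom C \<kappa> = y \<odot> x" "Cod C \<kappa> = Unit C" using i(2) isomorphicE by blast
  let ?u = "untensor x y \<iota>"
  note u [simp] = untensor_iso[OF _ y iota, simplified]
  show ?thesis
  proof (rule bij_betw_imageI)
    show "inj_on (\<lambda>s. s \<Odot> Id C x) (Hom C m n)"
      by (rule inj_onI) (rule tens_right_faithful[OF _ y iota]; simp)
    show "(\<lambda>s. s \<Odot> Id C x) ` Hom C m n = Hom C (m \<odot> x) (n \<odot> x)"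
    proof (intro equalityI subsetI)
      fix h assume h: "h \<in> Hom C (m \<odot> x) (n \<odot> x)"
      then have [simp]: "h \<in> Arr C" "Dom C h = m \<odot> x" "Cod C h = n \<odot> x" by (auto simp: Hom_iff)
      define f where "f = ?u n \<cdot> ((h \<Odot> Id C y) \<cdot> inv_arr C (?u m))"
      have f [simp]: "f \<in> Arr C" "Dom C f = m" "Cod C f = n" unfolding f_def by simp_all
      have "?u n \<cdot> ((f \<Odot> Id C x) \<Odot> Id C y) = f \<cdot> ?u m" by (rule untensor_nat[OF _ y iota]) simp_all
      also have "\<dots> = ?u n \<cdot> (h \<Odot> Id C y)" unfolding f_def by (simp add: assoc_arr)
      finally have eq: "(f \<Odot> Id C x) \<Odot> Id C y = h \<Odot> Id C y" by (subst (asm) isom_cancel_left) simp_all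
      have fx: "f \<Odot> Id C x \<in> Hom C (m \<odot> x) (n \<odot> x)" by (simp add: Hom_iff)
      have "f \<Odot> Id C x = h" by (rule tens_right_faithful[OF y _ kappa fx h eq]) simp
      then show "h \<in> (\<lambda>s. s \<Odot> Id C x) ` Hom C m n" by (intro image_eqI[of _ _ f]) (simp_all add: Hom_iff)
    qed (auto simp: Hom_iff)
  qed
qed

end

context pointed_crossed_category begin

text \<open>The neutral component acts from the left, so tensoring with \<open>X\<close> on the
  right is a module functor, with the associator as structure. The pentagon and
  \<open>lunit_tens\<close> are its two axioms, and an inverse of \<open>X\<close> gives essential
  surjectivity.\<close>

lemma right_tensor_module_equivalence:
  assumes k [simp]: "k \<in> carrier G" and g [simp]: "g \<in> carrier G" and X: "X \<in> Grade B g" "invertible_object B X"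
  shows "module_equivalent (neutral_component G B) (M k) (M (k \<otimes>\<^bsub>G\<^esub> g))"
proof -
  have kg [simp]: "k \<otimes>\<^bsub>G\<^esub> g \<in> carrier G" by simp
  interpret Mk: full_sub B "M k" by (rule M_sub[OF k])
  interpret Mkg: full_sub B "M (k \<otimes>\<^bsub>G\<^esub> g)" by (rule M_sub[OF kg])
  have [simp]: "X \<in> Obj B" using X invertible_obj by blast
  interpret R: linear_functor B B "\<lambda>y. y \<odot> X" "\<lambda>f. f \<Odot> Id B X" by (rule tens_right_functor) simp
  have gr [simp]: "m \<odot> X \<in> Grade B (k \<otimes>\<^bsub>G\<^esub> g)" if "m \<in> Grade B k" for m using grade_tensor[OF k g that X(1)] .
  have ob [simp]: "m \<in> Grade B k \<Longrightarrow> m \<in> Obj B" for m using grade_obj' k by blast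
  note tk [simp] = tens_grade_left[OF k] and tkg [simp] = tens_grade_left[OF kg]
  let ?F = "\<lparr>FunO = \<lambda>m. m \<odot> X, FunA = \<lambda>s. s \<Odot> Id B X, FunS = \<lambda>x m. Assoc B x m X\<rparr>"
  have "module_functor (neutral_component G B) (M k) (M (k \<otimes>\<^bsub>G\<^esub> g)) ?F"
  proof (rule module_functor.intro; unfold modfun.simps)
    show "linear_functor (M k) (M (k \<otimes>\<^bsub>G\<^esub> g)) (\<lambda>m. m \<odot> X) (\<lambda>s. s \<Odot> Id B X)"
      by unfold_locales
        (use R.functor_arr R.functor_comp R.functor_plus R.functor_scale in \<open>auto simp: Mk.sub_Hom Mkg.sub_Hom\<close>)
    show "Assoc B x m X \<in> Iso (M (k \<otimes>\<^bsub>G\<^esub> g)) (MActO (M k) x m \<odot> X) (MActO (M (k \<otimes>\<^bsub>G\<^esub> g)) x (m \<odot> X))"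
      if "x \<in> Obj (neutral_component G B)" "m \<in> Obj (M k)" for x m
      using that by (simp add: Mkg.Iso_sub Iso_iff)
    show "Assoc B y n X \<cdot>\<^bsub>M (k \<otimes>\<^bsub>G\<^esub> g)\<^esub> (MActA (M k) f s \<Odot> Id B X) =
        MActA (M (k \<otimes>\<^bsub>G\<^esub> g)) f (s \<Odot> Id B X) \<cdot>\<^bsub>M (k \<otimes>\<^bsub>G\<^esub> g)\<^esub> Assoc B x m X"
      if "f \<in> Hom (neutral_component G B) x y" "s \<in> Hom (M k) m n" for f x y s m n
      using that assoc_natural[of f x y s m n "Id B X" X X] by (simp add: N.sub_Hom Mk.sub_Hom id_in_Hom)
    show "MAssoc (M (k \<otimes>\<^bsub>G\<^esub> g)) x y (m \<odot> X) \<cdot>\<^bsub>M (k \<otimes>\<^bsub>G\<^esub> g)\<^esub> Assoc B (x \<odot>\<^bsub>neutral_component G B\<^esub> y) m X =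
        MActA (M (k \<otimes>\<^bsub>G\<^esub> g)) (Id (neutral_component G B) x) (Assoc B y m X) \<cdot>\<^bsub>M (k \<otimes>\<^bsub>G\<^esub> g)\<^esub>
        Assoc B x (MActO (M k) y m) X \<cdot>\<^bsub>M (k \<otimes>\<^bsub>G\<^esub> g)\<^esub> (MAssoc (M k) x y m \<Odot> Id B X)"
      if "x \<in> Obj (neutral_component G B)" "y \<in> Obj (neutral_component G B)" "m \<in> Obj (M k)" for x y m
      using that pentagon[of x y m X] by simp
    show "MUnit (M (k \<otimes>\<^bsub>G\<^esub> g)) (m \<odot> X) \<cdot>\<^bsub>M (k \<otimes>\<^bsub>G\<^esub> g)\<^esub> Assoc B (Unit (neutral_component G B)) m X = MUnit (M k) m \<Odot> Id B X"
      if "m \<in> Obj (M k)" for m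
      using that lunit_tens[of m X] by simp
  qed
  moreover have "equivalence_functor (M k) (M (k \<otimes>\<^bsub>G\<^esub> g)) (FunO ?F) (FunA ?F)"
    unfolding equivalence_functor_def modfun.simps
  proof (intro conjI ballI)
    fix m n assume "m \<in> Obj (M k)" "n \<in> Obj (M k)"
    then show "bij_betw (\<lambda>s. s \<Odot> Id B X) (Hom (M k) m n) (Hom (M (k \<otimes>\<^bsub>G\<^esub> g)) (m \<odot> X) (n \<odot> X))"
      using tens_invertible_bij[OF X(2), of m n] by (simp add: Mk.sub_Hom_eq Mkg.sub_Hom_eq)
  next
    fix z assume z: "z \<in> Obj (M (k \<otimes>\<^bsub>G\<^esub> g))"
    then have zo: "z \<in> Obj B" using Mkg.sub_obj by blast
    obtain Y where Y: "invertible_object B Y" "isomorphic B (X \<odot> Y) (Unit B)" "isomorphic B (Y \<odot> X) (Unit B)"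
      using invertibleE[OF X(2)] .
    obtain h where h: "h \<in> carrier G" "Y \<in> Grade B h" using simple_homogeneous[OF invertible_simple[OF Y(1)]] .
    have "X \<odot> Y \<in> Grade B (g \<otimes>\<^bsub>G\<^esub> h)" using grade_tensor X h by simp
    then have "Unit B \<in> Grade B (g \<otimes>\<^bsub>G\<^esub> h)" using grade_replete Y h by simp
    then have "g \<otimes>\<^bsub>G\<^esub> h = e" using grade_unique[of "g \<otimes>\<^bsub>G\<^esub> h" e] unit_grade simple_not_zero[OF unit_simple] h by simp
    then have "k \<otimes>\<^bsub>G\<^esub> g \<otimes>\<^bsub>G\<^esub> h = k" using h by (simp add: m_assoc)
    then have "z \<odot> Y \<in> Grade B k" using grade_tensor[OF kg h(1) _ h(2), of z] z by simp
    moreover have "isomorphic B ((z \<odot> Y) \<odot> X) z" using cancel_isomorphic(2)[OF Y(3) invertible_obj[OF Y(1)] _ zo] by simp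
    ultimately show "\<exists>m\<in>Obj (M k). isomorphic (M (k \<otimes>\<^bsub>G\<^esub> g)) (m \<odot> X) z"
      using z by (intro bexI[of _ "z \<odot> Y"]) (simp_all add: Mkg.isomorphic_sub)
  qed
  ultimately show ?thesis unfolding module_equivalent_def by blast
qed

lemma invertible_inverse_grade:
  assumes g: "g \<in> carrier G" and X: "X \<in> Grade B g" "invertible_object B X"
  obtains Y where "Y \<in> Grade B (inv\<^bsub>G\<^esub> g)" "invertible_object B Y"
proof -
  obtain Y where Y: "invertible_object B Y" "isomorphic B (X \<odot> Y) (Unit B)" using invertibleE[OF X(2)] .
  obtain h where h: "h \<in> carrier G" "Y \<in> Grade B h" using simple_homogeneous[OF invertible_simple[OF Y(1)]] .
  have "X \<odot> Y \<in> Grade B (g \<otimes>\<^bsub>G\<^esub> h)" using grade_tensor[OF g h(1) X(1) h(2)] .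
  then have "Unit B \<in> Grade B (g \<otimes>\<^bsub>G\<^esub> h)" using grade_replete[OF _ _ Y(2)] g h by simp
  then have "g \<otimes>\<^bsub>G\<^esub> h = e" using grade_unique[of "g \<otimes>\<^bsub>G\<^esub> h" e] unit_grade simple_not_zero[OF unit_simple] g h by simp
  then have "h = inv\<^bsub>G\<^esub> g" using g h by (metis inv_equality inv_inv inv_closed)
  then show thesis using that h Y by blast
qed

lemma invertible_module_class:
  assumes g: "g \<in> carrier G" and X: "X \<in> Grade B g" "invertible_object B X"
  shows "module_class (neutral_component G B) (M e) = module_class (neutral_component G B) (M g)"
proof -
  obtain Y where Y: "Y \<in> Grade B (inv\<^bsub>G\<^esub> g)" "invertible_object B Y" using invertible_inverse_grade[OF assms] .
  have "module_equivalent (neutral_component G B) (M e) (M g)"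
    using right_tensor_module_equivalence[OF e_carrier g X] g by simp
  moreover have "module_equivalent (neutral_component G B) (M g) (M e)"
    using right_tensor_module_equivalence[OF g inv_closed[OF g] Y] g by simp
  ultimately show ?thesis
    unfolding module_class_def
    using module_equivalent_trans[OF D.monoidal_linear_category_axioms] module_component_category[OF g] module_component_category[OF e_carrier]
    by blast
qed

section \<open>Stabilizers and the image of \<open>g - 1\<close>\<close>

abbreviation A_inv where "A_inv a \<equiv> inv\<^bsub>Inv (neutral_component G B)\<^esub> a"

text \<open>The endomorphism g - 1 of the group \<open>A\<close>, which is written
  multiplicatively.\<close>

definition displacement :: "'g \<Rightarrow> 'o set \<Rightarrow> 'o set" where
  "displacement g a = act_class g a \<bullet> A_inv a"

lemma displacement_in: "g \<in> carrier G \<Longrightarrow> a \<in> A \<Longrightarrow> displacement g a \<in> A"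
  unfolding displacement_def using act_class_in by simp

lemma displacement_mult:
  assumes "g \<in> carrier G" "a \<in> A" "b \<in> A" shows "displacement g (a \<bullet> b) = displacement g a \<bullet> displacement g b"
  unfolding displacement_def
  using assms act_class_hom act_class_in by (simp add: A.inv_mult A.m_ac)

lemma displacement_inv:
  assumes g: "g \<in> carrier G" and a: "a \<in> A" shows "displacement g (A_inv a) = A_inv (displacement g a)"
proof -
  have "displacement g A_one = A_one" unfolding displacement_def using act_class_A_one[OF g] by simp
  then have "displacement g (A_inv a) \<bullet> displacement g a = A_one"
    using displacement_mult[OF g, of "A_inv a" a] a by simp
  then show ?thesis using A.inv_equality displacement_in g a by simp
qed

lemma displacement_eq_one: "g \<in> carrier G \<Longrightarrow> a \<in> A \<Longrightarrow> displacement g a = A_one \<longleftrightarrow> act_class g a = a"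
  unfolding displacement_def using act_class_in[of g a] A.inv_equality[of "act_class g a" "A_inv a"] by auto

lemma displacement_in_Stab:
  assumes g: "g \<in> carrier G" and x: "x \<in> Grade B g" and a: "a \<in> A" shows "displacement g a \<in> Stab x"
proof -
  let ?w = "rep a"
  note r = rep[OF a]
  have xo: "x \<in> Obj B" using x g grade_obj' by blast
  have ga: "act_class g a \<in> A" and ia: "A_inv a \<in> A" using act_class_in[OF g a] a by simp_all
  have "isomorphic B (rep (act_class g a) \<odot> x) (ActO B g ?w \<odot> x)"
    using tens_isomorphic[OF rep_act_class[OF g a] isomorphic_refl[OF xo]] .
  also have "isomorphic B (ActO B g ?w \<odot> x) (?w \<odot> x)"
    using twist_arr[OF g r(1) x] by (intro isomorphic_sym[OF isomorphicI[of "twist g ?w x"]]) simp_all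
  finally (isomorphic_trans) have 1: "isomorphic B (rep (act_class g a) \<odot> x) (?w \<odot> x)" .
  have "isomorphic B (rep (displacement g a) \<odot> x) (rep (A_inv a) \<odot> (rep (act_class g a) \<odot> x))"
    unfolding displacement_def A.m_comm[OF ga ia] by (rule rep_act_assoc[OF ia ga xo])
  also have "isomorphic B (rep (A_inv a) \<odot> (rep (act_class g a) \<odot> x)) (rep (A_inv a) \<odot> (rep a \<odot> x))"
    by (rule rep_act_cong[OF ia 1])
  also (isomorphic_trans) have "isomorphic B (rep (A_inv a) \<odot> (rep a \<odot> x)) (rep A_one \<odot> x)"
    using isomorphic_sym[OF rep_act_assoc[OF ia a xo]] a by simp
  also (isomorphic_trans) have "isomorphic B (rep A_one \<odot> x) x" by (rule rep_one_act[OF xo])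
  finally (isomorphic_trans) show ?thesis unfolding Stab_def using displacement_in[OF g a] by simp
qed

text \<open>Translation by an element \<open>c\<close> with \<chi>(c) \<noteq> 1 multiplies the sum
  by \<chi>(c) without changing it.\<close>

lemma character_sum:
  assumes H: "subgroup H (Inv (neutral_component G B))"
    and mult: "\<And>a b. a \<in> H \<Longrightarrow> b \<in> H \<Longrightarrow> \<chi> (a \<bullet> b) = \<chi> a * (\<chi> b :: 'k)"
  shows "(\<Sum>a\<in>H. \<chi> a) = (if \<forall>a\<in>H. \<chi> a = 1 then of_nat (card H) else 0)"
proof (cases "\<forall>a\<in>H. \<chi> a = 1")
  case True
  then show ?thesis by simp
next
  case False
  then obtain c where c: "c \<in> H" "\<chi> c \<noteq> 1" by blast
  have HA: "a \<in> H \<Longrightarrow> a \<in> A" for a using H subgroup.subset by blast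
  have "bij_betw (\<lambda>a. c \<bullet> a) H H"
    by (rule bij_betw_byWitness[where f' = "\<lambda>a. A_inv c \<bullet> a"])
      (use c H HA in \<open>auto simp: A.m_assoc[symmetric] subgroup.m_closed subgroup.m_inv_closed\<close>)
  then have "(\<Sum>a\<in>H. \<chi> a) = (\<Sum>a\<in>H. \<chi> (c \<bullet> a))" by (rule sum.reindex_bij_betw[symmetric])
  also have "\<dots> = \<chi> c * (\<Sum>a\<in>H. \<chi> a)" using mult c by (simp add: sum_distrib_left)
  finally show ?thesis using c False by auto
qed

definition perp :: "'o set set \<Rightarrow> 'o set set" where
  "perp W = {a \<in> A. \<forall>w\<in>W. pairing w a = 1}"

text \<open>The double sum of \<open>pairing w a\<close> is evaluated in both orders: non-degeneracy
  keeps only the term of \<open>A_one\<close> in one, and the other keeps exactly the elements of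
  \<open>perp W\<close>. The result is an equation in the field, read as one of natural numbers in
  characteristic zero.\<close>

lemma card_perp:
  assumes W: "subgroup W (Inv (neutral_component G B))" shows "card W * card (perp W) = card A"
proof -
  have WA: "a \<in> W \<Longrightarrow> a \<in> A" for a using W subgroup.subset by blast
  have fW: "finite W" by (rule finite_subset[OF _ finite_A]) (use WA in blast)
  have "(\<Sum>w\<in>W. \<Sum>a\<in>A. pairing w a) = (\<Sum>w\<in>W. if w = A_one then of_nat (card A) else 0)"
  proof (rule sum.cong[OF refl])
    fix w assume w: "w \<in> W"
    have "(\<forall>a\<in>A. pairing w a = 1) \<longleftrightarrow> w = A_one" using pairing_nondegenerate[of w] pairing_one WA w by auto
    then show "(\<Sum>a\<in>A. pairing w a) = (if w = A_one then of_nat (card A) else 0)"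
      using character_sum[OF A.subgroup_self, of "pairing w"] pairing_mult_right WA[OF w] by simp
  qed
  also have "\<dots> = of_nat (card A)" using fW subgroup.one_closed[OF W] by simp
  finally have 1: "(\<Sum>w\<in>W. \<Sum>a\<in>A. pairing w a) = of_nat (card A)" .
  have "(\<Sum>w\<in>W. \<Sum>a\<in>A. pairing w a) = (\<Sum>a\<in>A. \<Sum>w\<in>W. pairing w a)" by (rule sum.swap)
  also have "\<dots> = (\<Sum>a\<in>A. if a \<in> perp W then of_nat (card W) else 0)"
  proof (rule sum.cong[OF refl])
    fix a assume a: "a \<in> A"
    show "(\<Sum>w\<in>W. pairing w a) = (if a \<in> perp W then of_nat (card W) else 0)"
      using character_sum[OF W, of "\<lambda>w. pairing w a"] pairing_mult_left[OF WA WA a] a unfolding perp_def by simp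
  qed
  also have "\<dots> = (\<Sum>a\<in>perp W. of_nat (card W))"
    using finite_A by (intro sum.mono_neutral_cong_right) (auto simp: perp_def)
  also have "\<dots> = of_nat (card W * card (perp W))" by simp
  finally have "(of_nat (card W * card (perp W)) :: 'k) = of_nat (card A)" using 1 by simp
  then show ?thesis by (simp only: of_nat_eq_iff)
qed

text \<open>The stabilizer lies between the image of g - 1 and the orthogonal complement of its
  kernel \<open>?W\<close>. Each of these two orders, multiplied by that of \<open>?W\<close>, gives
  the order of \<open>A\<close>, so the inclusions are equalities.\<close>

lemma Stab_eq_displacement:
  assumes g: "g \<in> carrier G" and x: "simple_object B x" "x \<in> Grade B g"
  shows "Stab x = displacement g ` A"
proof -
  let ?W = "{w \<in> A. act_class g w = w}"
  have W: "subgroup ?W (Inv (neutral_component G B))"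
  proof (rule A.subgroupI)
    show "?W \<noteq> {}" using act_class_A_one[OF g] A.one_closed by blast
    fix a b assume a: "a \<in> ?W" and b: "b \<in> ?W"
    show "a \<bullet> b \<in> ?W" using a b act_class_hom[OF g] by simp
    have "displacement g (A_inv a) = A_one" using displacement_inv[OF g, of a] displacement_eq_one[OF g, of a] a by simp
    then show "A_inv a \<in> ?W" using displacement_eq_one[OF g, of "A_inv a"] a by simp
  qed auto
  have sub1: "displacement g ` A \<subseteq> Stab x" using displacement_in_Stab[OF g x(2)] by blast
  have sub2: "Stab x \<subseteq> perp ?W"
  proof
    fix z assume "z \<in> Stab x"
    then have z: "z \<in> A" "isomorphic B (rep z \<odot> x) x" unfolding Stab_def by auto
    have "pairing w z = 1" if w: "w \<in> A" "act_class g w = w" for w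
      unfolding pairing_def
    proof (rule stabilizer_centralizes_fixed[OF g rep(1,2)[OF w(1)] rep(1,2)[OF z(1)] x _ z(2)])
      show "isomorphic B (ActO B g (rep w)) (rep w)" using isomorphic_sym[OF rep_act_class[OF g w(1)]] w(2) by simp
    qed
    then show "z \<in> perp ?W" unfolding perp_def using z by blast
  qed
  \<comment> \<open>Counting along the fibres of g - 1, which are cosets of
    \<open>?W\<close>.\<close>
  have "card A = (\<Sum>a\<in>A. 1)" by simp
  also have "\<dots> = (\<Sum>b\<in>displacement g ` A. \<Sum>a\<in>{a \<in> A. displacement g a = b}. 1)"
    by (rule sum.image_gen[OF finite_A])
  also have "\<dots> = (\<Sum>b\<in>displacement g ` A. card ?W)"
  proof (rule sum.cong[OF refl])
    fix b assume "b \<in> displacement g ` A"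
    then obtain c where c: "c \<in> A" "displacement g c = b" by blast
    have "bij_betw (\<lambda>w. c \<bullet> w) ?W {a \<in> A. displacement g a = b}"
    proof (rule bij_betw_byWitness[where f' = "\<lambda>a. A_inv c \<bullet> a"])
      show "(\<lambda>w. c \<bullet> w) ` ?W \<subseteq> {a \<in> A. displacement g a = b}"
      proof clarify
        fix w assume w: "w \<in> A" "act_class g w = w"
        then have "displacement g w = A_one" using displacement_eq_one[OF g] by blast
        then show "c \<bullet> w \<in> A \<and> displacement g (c \<bullet> w) = b"
          using c w displacement_mult[OF g c(1) w(1)] displacement_in[OF g c(1)] by simp
      qed
      show "(\<lambda>a. A_inv c \<bullet> a) ` {a \<in> A. displacement g a = b} \<subseteq> ?W"
      proof clarify
        fix a assume a: "a \<in> A" "b = displacement g a"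
        have "displacement g (A_inv c \<bullet> a) = A_inv (displacement g c) \<bullet> displacement g a"
          using displacement_mult[OF g, of "A_inv c" a] displacement_inv[OF g c(1)] c a by simp
        also have "\<dots> = A_one" using c a displacement_in[OF g] by simp
        finally show "A_inv c \<bullet> a \<in> A \<and> act_class g (A_inv c \<bullet> a) = A_inv c \<bullet> a"
          using displacement_eq_one[OF g, of "A_inv c \<bullet> a"] c a by simp
      qed
    qed (use c in \<open>auto simp: A.m_assoc[symmetric]\<close>)
    then show "(\<Sum>a\<in>{a \<in> A. displacement g a = b}. 1) = card ?W" using bij_betw_same_card by fastforce
  qed
  finally have "card A = card ?W * card (displacement g ` A)" by simp
  then have "card ?W * card (displacement g ` A) = card ?W * card (perp ?W)" using card_perp[OF W] by (simp only:)
  moreover have "card ?W \<noteq> 0"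
    using finite_subset[OF _ finite_A, of ?W] subgroup.one_closed[OF W] by (auto simp: card_eq_0_iff)
  ultimately have "card (displacement g ` A) = card (perp ?W)" by simp
  moreover have "finite (perp ?W)" unfolding perp_def using finite_A by simp
  ultimately have "displacement g ` A = perp ?W" using sub1 sub2 by (intro card_subset_eq) auto
  then show ?thesis using sub1 sub2 by blast
qed

lemma stab_order_displacement: "g \<in> carrier G \<Longrightarrow> stab_order g = card (displacement g ` A)"
  unfolding stab_order_def using Stab_eq_displacement component_simple by simp

text \<open>At \<open>act_class g b\<close> the displacement of the inverse of \<open>g\<close> is
  the inverse of the displacement of \<open>g\<close> at \<open>b\<close>, so inversion in
  \<open>A\<close> maps one image onto the other.\<close>

lemma stab_order_inv: assumes g: "g \<in> carrier G" shows "stab_order (inv\<^bsub>G\<^esub> g) = stab_order g"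
proof -
  have i: "inv\<^bsub>G\<^esub> g \<in> carrier G" using g by simp
  have *: "displacement (inv\<^bsub>G\<^esub> g) (act_class g b) = A_inv (displacement g b)" if b: "b \<in> A" for b
    unfolding displacement_def using act_class_inv(1)[OF g b] b act_class_in[OF g b] by (simp add: A.inv_mult A.m_comm)
  have "act_class g ` A = A" using act_class_in[OF g] act_class_inv(2)[OF g] act_class_in[OF i] by force
  then have "displacement (inv\<^bsub>G\<^esub> g) ` A = displacement (inv\<^bsub>G\<^esub> g) ` act_class g ` A" by simp
  also have "\<dots> = (\<lambda>b. displacement (inv\<^bsub>G\<^esub> g) (act_class g b)) ` A" by (rule image_image)
  also have "\<dots> = A_inv ` displacement g ` A" using * by (auto simp: image_image)
  finally have "card (displacement (inv\<^bsub>G\<^esub> g) ` A) = card (displacement g ` A)"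
    using card_image[OF inj_on_subset[OF A.inv_inj], of "displacement g ` A"] displacement_in[OF g] by auto
  then show ?thesis using stab_order_displacement g i by simp
qed

text \<open>A stabilizer of order one makes \<open>?x \<odot> y\<close> simple, hence isomorphic to
  the unit, so \<open>y\<close> is a right inverse of \<open>?x\<close>. The crossed braiding
  exhibits \<open>ActO B g y\<close> as a left inverse, and the two inverses agree.\<close>

lemma trivial_action_invertible:
  assumes g: "g \<in> carrier G" and triv: "\<And>a. a \<in> A \<Longrightarrow> act_class g a = a"
  obtains X where "X \<in> Grade B g" "invertible_object B X"
proof -
  let ?x = "component_simple g"
  note X = component_simple[OF g]
  note xo = simple_object_obj[OF X(1)]
  have "displacement g ` A = {A_one}"
    using triv displacement_eq_one[OF g] A.one_closed by (auto simp: image_iff)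
  then have s: "stab_order g = 1" using stab_order_displacement[OF g] by simp
  obtain y where y: "dual_pair B y ?x" using left_dual xo by blast
  have yo: "y \<in> Obj B" using dual_obj y by blast
  have "simple_object B (?x \<odot> y)" using len_eq_1[of "?x \<odot> y"] len_dual[OF g X y] s xo yo by simp
  then have xy: "isomorphic B (?x \<odot> y) (Unit B)"
    using simple_hom_iso[OF unit_simple] simple_unit_hom[OF X(1) y] isomorphic_sym by simp
  have gy: "ActO B g y \<in> Obj B" using g yo by simp
  have "isomorphic B (?x \<odot> y) (ActO B g y \<odot> ?x)"
    using cbraid_arr[OF X(2) g yo] by (intro isomorphicI[of "CBraid B g ?x y"]) simp_all
  then have gyx: "isomorphic B (ActO B g y \<odot> ?x) (Unit B)" using xy isomorphic_sym isomorphic_trans by blast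
  have "isomorphic B (ActO B g y) y" by (rule inverse_unique_iso[OF xo gy yo gyx xy])
  then have "isomorphic B (y \<odot> ?x) (Unit B)"
    using tens_isomorphic[OF isomorphic_sym isomorphic_refl[OF xo]] gyx isomorphic_trans by blast
  then have "invertible_object B ?x" unfolding invertible_object_def using xo yo xy by blast
  then show thesis using that X(2) by blast
qed

end

section \<open>Roots of unity\<close>

lemma primitive_root_powi_eq_iff:
  assumes z: "primitive_root_of_unity n z" and n: "n > 0"
  shows "z powi i = z powi j \<longleftrightarrow> [i = j] (mod int n)"
proof -
  have z0: "z \<noteq> 0" using z n by (auto simp: primitive_root_of_unity_def power_0_left split: if_splits)
  have zn: "z powi int n = 1" using z by (simp add: primitive_root_of_unity_def)
  have *: "z powi k = z ^ nat (k mod int n)" for k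
  proof -
    have "z powi k = z powi (int n * (k div int n) + k mod int n)" by simp
    also have "\<dots> = z powi (k mod int n)" unfolding power_int_add[OF disjI1[OF z0]] power_int_mult zn by simp
    finally show ?thesis using n by (simp add: power_int_nonneg_exp)
  qed
  have "z powi k = 1 \<longleftrightarrow> k mod int n = 0" for k
  proof (cases "k mod int n = 0")
    case False
    then have "0 < nat (k mod int n)" "nat (k mod int n) < n"
      using n pos_mod_sign[of "int n" k] pos_mod_bound[of "int n" k] by linarith+
    then show ?thesis using z False * by (simp add: primitive_root_of_unity_def)
  qed (simp add: *)
  moreover have "z powi i = z powi j \<longleftrightarrow> z powi (i - j) = 1" using z0 by (simp add: power_int_diff)
  ultimately show ?thesis by (simp add: cong_iff_dvd_diff dvd_eq_mod_eq_0)
qed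

text \<open>The powers of \<open>z\<close> are \<open>n\<close> distinct roots of X^n - 1, which has
  at most \<open>n\<close> roots.\<close>

lemma primitive_root_exhausts:
  assumes z: "primitive_root_of_unity n z" and n: "n > 0" and w: "w ^ n = 1"
  obtains j where "j < n" "w = z ^ j"
proof -
  let ?P = "monom 1 n - 1 :: 'a poly"
  have P0: "?P \<noteq> 0"
  proof
    assume "?P = 0"
    then have "coeff ?P n = 0" by simp
    then show False using n by simp
  qed
  have "degree ?P \<le> n" by (intro degree_diff_le) (simp_all add: degree_monom_le)
  then have "card {x. poly ?P x = 0} \<le> n" using card_poly_roots_bound[OF P0] by simp
  then have roots: "card {x. x ^ n = (1::'a)} \<le> n" by (simp add: poly_monom)
  have fin: "finite {x. x ^ n = (1::'a)}" using poly_roots_finite[OF P0] by (simp add: poly_monom)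
  have inj: "inj_on (\<lambda>j. z ^ j) {..<n}"
  proof (rule inj_onI)
    fix i j assume "i \<in> {..<n}" "j \<in> {..<n}" "z ^ i = z ^ j"
    then show "i = j"
      using primitive_root_powi_eq_iff[OF z n, of "int i" "int j"] by (auto simp: cong_def)
  qed
  have sub: "(\<lambda>j. z ^ j) ` {..<n} \<subseteq> {x. x ^ n = 1}"
  proof clarify
    fix j
    have "(z ^ j) ^ n = (z ^ n) ^ j" by (simp add: power_mult[symmetric] mult.commute)
    then show "(z ^ j) ^ n = 1" using z by (simp add: primitive_root_of_unity_def)
  qed
  have "(\<lambda>j. z ^ j) ` {..<n} = {x. x ^ n = 1}"
    using roots card_image[OF inj] by (intro card_seteq[OF fin sub]) simp
  then show thesis using that w by blast
qed

section \<open>Exponents of \<open>\<zeta>\<close>\<close>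

context pointed_crossed_category begin

abbreviation A_pow (infixr \<open>\<up>\<close> 80) where "a \<up> (k::int) \<equiv> a [^]\<^bsub>Inv (neutral_component G B)\<^esub> k"
abbreviation "qform \<equiv> quad_form (neutral_component G B) p \<zeta>"
abbreviation "bform \<equiv> bilin_form (neutral_component G B) p \<zeta>"

lemma p_gt_0: "p > 0" using prime_p prime_gt_0_nat by blast

lemmas zeta_powi_eq_iff = primitive_root_powi_eq_iff[OF root p_gt_0]

lemma zeta_nonzero: "\<zeta> \<noteq> 0"
  using root p_gt_0 by (auto simp: primitive_root_of_unity_def power_0_left split: if_splits)

lemma nat_pow_p: "a \<in> A \<Longrightarrow> a [^]\<^bsub>Inv (neutral_component G B)\<^esub> p = A_one"
  using neutral_elementary unfolding elementary_abelian_group_def by blast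

lemma pairing_nat_pow: "a \<in> A \<Longrightarrow> b \<in> A \<Longrightarrow> pairing (a [^]\<^bsub>Inv (neutral_component G B)\<^esub> (n::nat)) b = pairing a b ^ n"
  by (induction n) (simp_all add: pairing_one pairing_mult_left)

lemma pairing_pow: "a \<in> A \<Longrightarrow> b \<in> A \<Longrightarrow> pairing (a \<up> k) b = pairing a b powi k"
proof (cases "k < 0")
  case True
  assume ab: "a \<in> A" "b \<in> A"
  have "pairing (a \<up> k) b = inverse (pairing a b ^ nat (- k))"
    unfolding int_pow_def2 using True ab by (simp only: if_True pairing_inv_left A.nat_pow_closed pairing_nat_pow)
  then show ?thesis using True by (simp add: power_int_def power_inverse)
next
  case False
  assume ab: "a \<in> A" "b \<in> A"
  show ?thesis unfolding int_pow_def2 using False ab by (simp only: if_False pairing_nat_pow) (simp add: power_int_def)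
qed

lemma quad_one: "quad A_one = 1"
  using quad_mult[of A_one A_one] quad_nonzero[of A_one] pairing_one[of A_one] by simp

lemma quad_nat_pow: "a \<in> A \<Longrightarrow> quad (a [^]\<^bsub>Inv (neutral_component G B)\<^esub> (n::nat)) = quad a ^ (n * n)"
proof (induction n)
  case (Suc n)
  have "quad a ^ (n * n) * quad a * (quad a)\<^sup>2 ^ n = quad a ^ (Suc n * Suc n)"
    unfolding power_mult[symmetric] power_add[symmetric] power_Suc2[symmetric] by (rule arg_cong) simp
  then show ?case using Suc by (simp add: quad_mult pairing_nat_pow pairing_self)
qed (simp add: quad_one)

lemma pairing_power_p: "a \<in> A \<Longrightarrow> b \<in> A \<Longrightarrow> pairing a b ^ p = 1"
  using pairing_nat_pow[of a b p] nat_pow_p[of a] pairing_one by simp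

text \<open>The order of the value divides p^2, because the form is quadratic, and 2p, because its
  square is a value of \<open>pairing\<close>. For odd \<open>p\<close> the greatest common divisor
  of these is \<open>p\<close>.\<close>

lemma quad_power_p: assumes a: "a \<in> A" shows "quad a ^ p = 1"
proof -
  obtain k where k: "p = 2 * k + 1" using odd_p oddE by blast
  have "quad a ^ (p * p) = 1" using quad_nat_pow[OF a, of p] nat_pow_p[OF a] quad_one by simp
  moreover have "quad a ^ (2 * p) = 1" using pairing_power_p[OF a a] pairing_self[OF a] by (simp add: power_mult)
  moreover have "p * p = (2 * p) * k + p" using k by algebra
  ultimately show ?thesis by (simp add: power_add power_mult)
qed

lemma root_exponent_unique:
  assumes w: "w ^ p = 1"
  shows "\<exists>!n. n \<in> {0..<int p} \<and> \<zeta> powi n = w"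
proof -
  obtain j where j: "j < p" "w = \<zeta> ^ j" using primitive_root_exhausts[OF root p_gt_0 w] .
  show ?thesis
  proof (rule ex1I[of _ "int j"])
    show "int j \<in> {0..<int p} \<and> \<zeta> powi int j = w" using j by simp
    fix n assume n: "n \<in> {0..<int p} \<and> \<zeta> powi n = w"
    then have "[n = int j] (mod int p)" using j zeta_powi_eq_iff[of n "int j"] by simp
    then show "n = int j" using n j by (simp add: cong_def)
  qed
qed

text \<open>\<open>quad_form\<close> allows any member of the class; all of them have the same
  self-braiding, so the description amounts to the unique exponent of \<zeta>.\<close>

lemma qform_props:
  assumes a: "a \<in> A" shows "qform a \<in> {0..<int p}" "\<zeta> powi qform a = quad a"
proof -
  have braid: "braid x x = quad a \<star> Id B (x \<odot> x)" "simple_object B (x \<odot> x)" if x: "x \<in> a" for x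
  proof -
    have i: "x \<in> Grade B e" "invertible_object B x" "iso_class B x = a"
      using D.Inv_mem[OF a x] invertible_sub neutral_iso_class by auto
    show "braid x x = quad a \<star> Id B (x \<odot> x)" using self_braid[OF i(1,2)] quad_class[OF i(1,2)] i(3) by simp
    show "simple_object B (x \<odot> x)" using invertible_simple invertible_tens i by blast
  qed
  have ne: "rep a \<in> a" using rep[OF a] mem_iso_class[of "rep a"] invertible_obj by auto
  have "(n \<in> {0..<int p} \<and> (\<exists>x\<in>a. braid x x = (\<zeta> ^ nat n) \<star> Id B (x \<odot> x))) \<longleftrightarrow> n \<in> {0..<int p} \<and> \<zeta> powi n = quad a" for n
    using braid ne scalar_unique by (auto simp: power_int_def split: if_splits) metis
  then have "qform a = (THE n. n \<in> {0..<int p} \<and> \<zeta> powi n = quad a)" unfolding quad_form_def by simp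
  then show "qform a \<in> {0..<int p}" "\<zeta> powi qform a = quad a"
    using theI'[OF root_exponent_unique[OF quad_power_p[OF a]]] by auto
qed

lemma qform_eq_iff: assumes "a \<in> A" "b \<in> A" shows "qform a = qform b \<longleftrightarrow> quad a = quad b"
  using qform_props[OF assms(1)] qform_props[OF assms(2)] zeta_powi_eq_iff[of "qform a" "qform b"]
  by (auto simp: cong_def)

text \<open>The exponent of \<open>pairing a b\<close> has to be halved modulo \<open>p\<close>,
  which is possible in exactly one way because \<open>p\<close> is odd.\<close>

lemma bform_props:
  assumes a: "a \<in> A" and b: "b \<in> A" shows "bform a b \<in> {0..<int p}" "\<zeta> powi (2 * bform a b) = pairing a b"
proof -
  let ?d = "qform (a \<bullet> b) - qform a - qform b"
  have "\<zeta> powi ?d = quad (a \<bullet> b) / quad a / quad b"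
    using qform_props a b zeta_nonzero by (simp add: power_int_diff)
  then have d: "\<zeta> powi ?d = pairing a b" using quad_mult quad_nonzero a b by simp
  have "\<exists>!n. n \<in> {0..<int p} \<and> [2 * n = ?d] (mod int p)"
  proof (rule ex1I[of _ "(?d * modular_inverse (int p) 2) mod int p"])
    let ?n = "(?d * modular_inverse (int p) 2) mod int p"
    have "[2 * ?n = 2 * (?d * modular_inverse (int p) 2)] (mod int p)" by (intro cong_mult) simp_all
    also have "2 * (?d * modular_inverse (int p) 2) = ?d * (2 * modular_inverse (int p) 2)" by simp
    also have "[?d * (2 * modular_inverse (int p) 2) = ?d * 1] (mod int p)"
      by (intro cong_mult cong_refl cong_modular_inverse1) (use odd_p in simp)
    finally show "?n \<in> {0..<int p} \<and> [2 * ?n = ?d] (mod int p)" using p_gt_0 by simp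
    fix n assume n: "n \<in> {0..<int p} \<and> [2 * n = ?d] (mod int p)"
    then have "[2 * n = 2 * ?n] (mod int p)" using \<open>?n \<in> {0..<int p} \<and> [2 * ?n = ?d] (mod int p)\<close> cong_sym cong_trans by blast
    then have "[n = ?n] (mod int p)" using odd_p by (subst (asm) cong_mult_lcancel) (simp_all add: coprime_commute)
    then show "n = ?n" using n p_gt_0 by (simp add: cong_def)
  qed
  from theI'[OF this] have 1: "bform a b \<in> {0..<int p}" "[2 * bform a b = ?d] (mod int p)" unfolding bilin_form_def by auto
  show "bform a b \<in> {0..<int p}" by (rule 1)
  show "\<zeta> powi (2 * bform a b) = pairing a b" unfolding d[symmetric] zeta_powi_eq_iff by (rule 1)
qed

lemma odd_p_coprime: "coprime 2 (int p)" using odd_p by simp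

lemma cong_p_eq: "x \<in> {0..<int p} \<Longrightarrow> y \<in> {0..<int p} \<Longrightarrow> [x = y] (mod int p) \<Longrightarrow> x = y"
  by (simp add: cong_def)

lemma cong_double_iff: "[2 * x = 2 * y] (mod int p) \<longleftrightarrow> [x = y] (mod int p)"
  by (rule cong_mult_lcancel[OF odd_p_coprime])

lemma bform_eq_0_iff: assumes "a \<in> A" "b \<in> A" shows "bform a b = 0 \<longleftrightarrow> pairing a b = 1"
proof
  assume "pairing a b = 1"
  then have "\<zeta> powi (2 * bform a b) = \<zeta> powi (2 * 0)" using bform_props(2)[OF assms] by simp
  then have "[bform a b = 0] (mod int p)" unfolding zeta_powi_eq_iff cong_double_iff .
  then show "bform a b = 0" using bform_props(1)[OF assms] p_gt_0 by (intro cong_p_eq) simp_all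
qed (use bform_props(2)[OF assms] in simp)

lemma bform_self: assumes a: "a \<in> A" shows "bform a a = qform a"
proof -
  have "\<zeta> powi (2 * bform a a) = (\<zeta> powi qform a)\<^sup>2"
    using bform_props(2)[OF a a] pairing_self[OF a] qform_props(2)[OF a] by simp
  then have "\<zeta> powi (2 * bform a a) = \<zeta> powi (2 * qform a)"
    by (simp add: power2_eq_square power_int_add[symmetric] zeta_nonzero)
  then have "[bform a a = qform a] (mod int p)" unfolding zeta_powi_eq_iff cong_double_iff .
  then show ?thesis using bform_props(1)[OF a a] qform_props(1)[OF a] by (rule cong_p_eq[rotated 2])
qed

lemma bform_commute: assumes a: "a \<in> A" and b: "b \<in> A" shows "bform a b = bform b a"
proof -
  have "\<zeta> powi (2 * bform a b) = \<zeta> powi (2 * bform b a)"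
    using bform_props(2)[OF a b] bform_props(2)[OF b a] pairing_commute[OF a b] by simp
  then have "[bform a b = bform b a] (mod int p)" unfolding zeta_powi_eq_iff cong_double_iff .
  then show ?thesis by (rule cong_p_eq[OF bform_props(1)[OF a b] bform_props(1)[OF b a]])
qed

lemma coprime_bform: assumes "a \<in> A" "b \<in> A" "bform a b \<noteq> 0" shows "coprime (bform a b) (int p)"
proof -
  have "\<not> int p dvd bform a b" using bform_props(1)[OF assms(1,2)] assms(3) zdvd_not_zless[of "bform a b" "int p"] by auto
  then have "coprime (int p) (bform a b)" using prime_imp_coprime[of "int p"] prime_p by simp
  then show ?thesis by (simp add: coprime_commute)
qed

lemma pairing_pow_zeta: "a \<in> A \<Longrightarrow> b \<in> A \<Longrightarrow> pairing (a \<up> k) b = \<zeta> powi (2 * (bform a b * k))"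
  using pairing_pow[of a b k] bform_props(2)[of a b] power_int_mult[of \<zeta> "2 * bform a b" k] by (simp add: mult.assoc)

lemma A_pow_cong: assumes a: "a \<in> A" and "[k = l] (mod int p)" shows "a \<up> k = a \<up> l"
proof (rule pairing_eqI)
  fix b assume b: "b \<in> A"
  show "pairing (a \<up> k) b = pairing (a \<up> l) b"
    unfolding pairing_pow_zeta[OF a b] zeta_powi_eq_iff by (intro cong_mult cong_refl assms)
qed (use a in simp_all)

text \<open>Some \<open>b\<close> pairs non-trivially with \<open>a\<close>, and then
  \<open>bform a b\<close> is a unit modulo \<open>p\<close> that can be cancelled.\<close>

lemma A_pow_eq_iff:
  assumes a: "a \<in> A" "a \<noteq> A_one" shows "a \<up> k = a \<up> l \<longleftrightarrow> [k = l] (mod int p)"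
proof
  assume eq: "a \<up> k = a \<up> l"
  obtain b where b: "b \<in> A" "pairing a b \<noteq> 1" using pairing_nondegenerate a by blast
  then have c: "coprime (bform a b) (int p)" using coprime_bform[OF a(1) b(1)] bform_eq_0_iff[OF a(1) b(1)] by simp
  have "\<zeta> powi (2 * (bform a b * k)) = \<zeta> powi (2 * (bform a b * l))"
    using pairing_pow_zeta[OF a(1) b(1), of k] pairing_pow_zeta[OF a(1) b(1), of l] eq by simp
  then have "[bform a b * k = bform a b * l] (mod int p)" unfolding zeta_powi_eq_iff cong_double_iff .
  then show "[k = l] (mod int p)" using cong_mult_lcancel[of "bform a b" "int p" k l] c by (simp add: coprime_commute)
qed (rule A_pow_cong[OF a(1)])

lemma card_powers: assumes a: "a \<in> A" "a \<noteq> A_one" shows "card (range (\<lambda>k. a \<up> k)) = p"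
proof -
  have "range (\<lambda>k. a \<up> k) = (\<lambda>k. a \<up> k) ` {0..<int p}"
  proof (intro equalityI subsetI)
    fix x assume "x \<in> range (\<lambda>k. a \<up> k)"
    then obtain k where "x = a \<up> k" by blast
    then have "x = a \<up> (k mod int p)" using A_pow_cong[OF a(1), of k "k mod int p"] by simp
    then show "x \<in> (\<lambda>k. a \<up> k) ` {0..<int p}" using p_gt_0 by auto
  qed auto
  moreover have "inj_on (\<lambda>k. a \<up> k) {0..<int p}"
    unfolding inj_on_def A_pow_eq_iff[OF a] using cong_p_eq by blast
  ultimately show ?thesis by (simp add: card_image)
qed

lemma bform_pow: assumes "a \<in> A" "b \<in> A" shows "[bform (a \<up> k) b = bform a b * k] (mod int p)"
proof -
  have "\<zeta> powi (2 * bform (a \<up> k) b) = \<zeta> powi (2 * (bform a b * k))"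
    using bform_props(2)[of "a \<up> k" b] pairing_pow_zeta[of a b k] assms by simp
  then show ?thesis unfolding zeta_powi_eq_iff cong_double_iff .
qed

lemma quad_pow: assumes a: "a \<in> A" shows "quad (a \<up> k) = \<zeta> powi (qform a * (k * k))"
proof -
  have inv: "quad (A_inv b) = quad b" if b: "b \<in> A" for b
  proof -
    have "1 = quad b * quad (A_inv b) * inverse ((quad b)\<^sup>2)"
      using quad_mult[of b "A_inv b"] quad_one pairing_inv_left[of b b] pairing_commute[of b "A_inv b"] pairing_self[OF b] b by simp
    then show ?thesis using quad_nonzero[OF b] by (simp add: field_simps power2_eq_square)
  qed
  have "quad (a \<up> k) = quad (a [^]\<^bsub>Inv (neutral_component G B)\<^esub> nat \<bar>k\<bar>)"
    unfolding int_pow_def2 using inv[OF A.int_pow_closed[OF a], of "- k"] by simp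
  also have "\<dots> = quad a powi (k * k)"
    using quad_nat_pow[OF a, of "nat \<bar>k\<bar>"] by (simp add: power_int_def nat_mult_distrib[symmetric])
  also have "\<dots> = \<zeta> powi (qform a * (k * k))" using qform_props(2)[OF a] power_int_mult[of \<zeta> "qform a" "k * k"] by simp
  finally show ?thesis .
qed

section \<open>Reflections\<close>

abbreviation "mirror \<equiv> reflection (neutral_component G B) p \<zeta>"

definition isometry :: "'g \<Rightarrow> 'o set \<Rightarrow> 'o set" where
  "isometry g = (\<lambda>a\<in>A. act_class g a)"

lemma act_class_displacement: "g \<in> carrier G \<Longrightarrow> v \<in> A \<Longrightarrow> act_class g v = v \<bullet> displacement g v"
  unfolding displacement_def using act_class_in[of g v] A.m_lcomm[of v "act_class g v" "A_inv v"] by simp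

lemma displacement_eqI: "g \<in> carrier G \<Longrightarrow> v \<in> A \<Longrightarrow> c \<in> A \<Longrightarrow> act_class g v = v \<bullet> c \<Longrightarrow> displacement g v = c"
  unfolding displacement_def by (simp add: A.m_ac)

text \<open>For a reflection along \<open>a\<close>, the image of g - 1 is the line spanned by
  \<open>a\<close>, which has \<open>p\<close> elements.\<close>

lemma reflection_stab_order:
  assumes g: "g \<in> carrier G" and a: "a \<in> A" "bform a a \<noteq> 0" and eq: "isometry g = mirror a"
  shows "stab_order g = p"
proof -
  let ?i = "modular_inverse (int p) (bform a a)" and ?h = "modular_inverse (int p) 2"
  have a1: "a \<noteq> A_one" using a bform_eq_0_iff[of A_one A_one] pairing_one by auto
  have d: "displacement g v = a \<up> (- 2 * bform v a * ?i)" if v: "v \<in> A" for v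
  proof (rule displacement_eqI[OF g v])
    show "act_class g v = v \<bullet> (a \<up> (- 2 * bform v a * ?i))"
      using fun_cong[OF eq, of v] v unfolding isometry_def reflection_def by (simp del: mult_minus_left)
  qed (use a in simp)
  have "displacement g ` A = range (\<lambda>k. a \<up> k)"
  proof (intro equalityI subsetI)
    fix x assume "x \<in> range (\<lambda>k. a \<up> k)"
    then obtain k where x: "x = a \<up> k" by blast
    \<comment> \<open>The multiple -k/2 of \<open>a\<close>, with \<open>?h\<close> in the role of
      1/2: a reflection negates \<open>a\<close>, so g - 1 sends this vector to k times
      \<open>a\<close>.\<close>
    let ?v = "a \<up> (- (?h * k))"
    have v: "?v \<in> A" using a by simp
    have "[- 2 * bform ?v a * ?i = - 2 * (bform a a * (- (?h * k))) * ?i] (mod int p)"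
      by (intro cong_mult cong_refl bform_pow a)
    also have "- 2 * (bform a a * (- (?h * k))) * ?i = (2 * ?h) * (bform a a * ?i) * k" by simp
    also have "[(2 * ?h) * (bform a a * ?i) * k = 1 * 1 * k] (mod int p)"
      by (intro cong_mult cong_refl cong_modular_inverse1 coprime_bform odd_p_coprime a)
    finally have "displacement g ?v = x" unfolding d[OF v] x using A_pow_cong[OF a(1)] by simp
    then show "x \<in> displacement g ` A" using v by blast
  qed (use d in auto)
  then show ?thesis using stab_order_displacement[OF g] card_powers[OF a(1) a1] by simp
qed

lemma displacement_pow: assumes g: "g \<in> carrier G" and a: "a \<in> A" shows "displacement g (a \<up> k) = displacement g a \<up> k"
proof -
  have "displacement g \<in> hom (Inv (neutral_component G B)) (Inv (neutral_component G B))"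
    using displacement_in[OF g] displacement_mult[OF g] by (intro homI) auto
  then have "group_hom (Inv (neutral_component G B)) (Inv (neutral_component G B)) (displacement g)"
    using A.is_group unfolding group_hom_def group_hom_axioms_def by blast
  from group_hom.hom_int_pow[OF this a] show ?thesis .
qed

text \<open>An image of order \<open>p\<close> is a line spanned by some \<open>c\<close>, so g
  moves every \<open>v\<close> by a multiple j of \<open>c\<close>. Preservation of the form forces
  B(c, c) \<noteq> 0 and determines j.\<close>

lemma stab_order_reflection:
  assumes g: "g \<in> carrier G" and s: "stab_order g = p"
  shows "isometry g \<in> reflections (neutral_component G B) p \<zeta>"
proof -
  have cd: "card (displacement g ` A) = p" using s stab_order_displacement[OF g] by simp
  have "\<not> displacement g ` A \<subseteq> {A_one}"
    using card_mono[of "{A_one}" "displacement g ` A"] cd prime_gt_1_nat[OF prime_p] by auto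
  then obtain w where w: "w \<in> A" and c1: "displacement g w \<noteq> A_one" by blast
  define c where "c = displacement g w"
  have c: "c \<in> A" "c \<noteq> A_one" unfolding c_def using displacement_in[OF g w] c1 by auto
  have "range (\<lambda>k. c \<up> k) \<subseteq> displacement g ` A"
    using displacement_pow[OF g w] w unfolding c_def by (auto intro!: image_eqI[of _ _ "w \<up> _"])
  then have "range (\<lambda>k. c \<up> k) = displacement g ` A"
    using finite_A cd card_powers[OF c] by (intro card_subset_eq) simp_all
  then have ex: "\<exists>j. displacement g v = c \<up> j" if "v \<in> A" for v using that by blast
  \<comment> \<open>For a fixed vector \<open>v\<close>, B(gw, v) = B(gw, gv) = B(w, v), so
    \<open>c\<close>, which is gw - w, is orthogonal to \<open>v\<close>.\<close>
  have fixed: "bform v c = 0" if v: "v \<in> A" "act_class g v = v" for v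
  proof -
    have gw: "act_class g w \<in> A" and iw: "A_inv w \<in> A" using act_class_in[OF g w] w by simp_all
    have "pairing c v = pairing (act_class g w) v * inverse (pairing w v)"
      unfolding c_def displacement_def using pairing_mult_left[OF gw iw v(1)] pairing_inv_left[OF w v(1)] by simp
    also have "\<dots> = 1" using pairing_act[OF g w v(1)] v(2) pairing_nonzero[OF w v(1)] by simp
    finally show ?thesis using bform_eq_0_iff[OF v(1) c(1)] pairing_commute[OF v(1) c(1)] by simp
  qed
  \<comment> \<open>Expansion of Q(v + jc) = Q(v), with Q(c) = B(c, c).\<close>
  have dvd: "int p dvd j * (bform c c * j + 2 * bform v c)" if v: "v \<in> A" and j: "displacement g v = c \<up> j" for v j
  proof -
    have "quad v = quad (v \<bullet> (c \<up> j))" using quad_act[OF g v] act_class_displacement[OF g v] j by simp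
    also have "\<dots> = quad v * \<zeta> powi (qform c * (j * j)) * \<zeta> powi (2 * (bform c v * j))"
      using quad_mult[OF v, of "c \<up> j"] quad_pow[OF c(1), of j] pairing_pow_zeta[OF c(1) v, of j]
        pairing_commute[OF v, of "c \<up> j"] c(1) by simp
    finally have "\<zeta> powi (qform c * (j * j) + 2 * (bform c v * j)) = \<zeta> powi 0"
      using quad_nonzero[OF v] by (simp add: power_int_add zeta_nonzero)
    then have "int p dvd qform c * (j * j) + 2 * (bform c v * j)" unfolding zeta_powi_eq_iff by (simp add: cong_0_iff)
    then show ?thesis unfolding bform_self[OF c(1)] bform_commute[OF c(1) v] by (simp add: algebra_simps)
  qed
  have zero: "bform v c = 0" if v: "v \<in> A" and j: "displacement g v = c \<up> j" and pj: "int p dvd j" for v j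
  proof (rule fixed[OF v])
    have "c \<up> j = A_one" using A_pow_cong[OF c(1), of j 0] pj by (simp add: cong_0_iff)
    then show "act_class g v = v" using j displacement_eq_one[OF g v] by simp
  qed
  have prime: "prime (int p)" using prime_p by simp
  \<comment> \<open>For isotropic \<open>c\<close> the divisibility says that each \<open>v\<close>
    is fixed or orthogonal to \<open>c\<close>. Fixed vectors are orthogonal to \<open>c\<close> as
    well, so \<open>c\<close> would lie in the radical.\<close>
  have cc: "bform c c \<noteq> 0"
  proof
    assume 0: "bform c c = 0"
    have "pairing c v = 1" if v: "v \<in> A" for v
    proof -
      obtain j where j: "displacement g v = c \<up> j" using ex[OF v] by blast
      have "int p dvd j * (2 * bform v c)" using dvd[OF v j] 0 by simp
      then have "int p dvd j \<or> [2 * bform v c = 2 * 0] (mod int p)" using prime_dvd_multD[OF prime] by (auto simp: cong_0_iff)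
      then have "bform v c = 0"
      proof
        assume "[2 * bform v c = 2 * 0] (mod int p)"
        then have "[bform v c = 0] (mod int p)" unfolding cong_double_iff .
        then show "bform v c = 0" using bform_props(1)[OF v c(1)] p_gt_0 by (intro cong_p_eq) simp_all
      qed (rule zero[OF v j])
      then show "pairing c v = 1" using bform_eq_0_iff[OF v c(1)] pairing_commute[OF v c(1)] by simp
    qed
    then show False using pairing_nondegenerate c by blast
  qed
  let ?i = "modular_inverse (int p) (bform c c)"
  have "isometry g = mirror c"
    unfolding isometry_def reflection_def
  proof (rule restrict_ext)
    fix v assume v: "v \<in> A"
    obtain j where j: "displacement g v = c \<up> j" using ex[OF v] by blast
    have "[- 2 * bform v c * ?i = j] (mod int p)"
    proof (cases "int p dvd j")
      case True
      then show ?thesis using zero[OF v j] by (simp add: cong_0_iff cong_sym_eq[of 0])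
    next
      case False
      then have "int p dvd bform c c * j + 2 * bform v c" using prime_dvd_multD[OF prime dvd[OF v j]] by blast
      then have "[- 2 * bform v c = bform c c * j] (mod int p)"
        unfolding cong_iff_dvd_diff by (metis dvd_minus_iff minus_add_distrib mult_minus_left uminus_add_conv_diff add.commute diff_conv_add_uminus)
      then have "[- 2 * bform v c * ?i = bform c c * j * ?i] (mod int p)" by (rule cong_scalar_right)
      also have "bform c c * j * ?i = (bform c c * ?i) * j" by simp
      also have "[(bform c c * ?i) * j = 1 * j] (mod int p)"
        by (intro cong_mult cong_refl cong_modular_inverse1 coprime_bform c cc)
      finally show ?thesis by simp
    qed
    then show "act_class g v = v \<bullet> (c \<up> (- 2 * bform v c * ?i))"
      using A_pow_cong[OF c(1)] act_class_displacement[OF g v] j by simp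
  qed
  then show ?thesis unfolding reflections_def using c cc by blast
qed

end

section \<open>Tensor products of lists of objects\<close>

context closed_fusion_category begin

lemma tensor_list_Cons: "xs \<noteq> [] \<Longrightarrow> tensor_list C (x # xs) = x \<odot> tensor_list C xs"
  by (cases xs) simp_all

lemma tensor_list_obj [simp]: "set xs \<subseteq> Obj C \<Longrightarrow> tensor_list C xs \<in> Obj C"
proof (induction xs)
  case (Cons x xs)
  then show ?case by (cases "xs = []") (simp_all add: tensor_list_Cons)
qed simp

text \<open>Only an isomorphism, because \<open>tensor_list\<close> brackets to the right.\<close>

lemma tensor_list_append:
  "xs \<noteq> [] \<Longrightarrow> ys \<noteq> [] \<Longrightarrow> set xs \<subseteq> Obj C \<Longrightarrow> set ys \<subseteq> Obj C \<Longrightarrow>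
    isomorphic C (tensor_list C (xs @ ys)) (tensor_list C xs \<odot> tensor_list C ys)"
proof (induction xs)
  case (Cons x xs)
  show ?case
  proof (cases "xs = []")
    case True
    then show ?thesis using Cons.prems by (simp add: tensor_list_Cons isomorphic_refl)
  next
    case False
    note o [simp] = tensor_list_obj[of xs] tensor_list_obj[of ys]
    have [simp]: "x \<in> Obj C" using Cons.prems by simp
    have "isomorphic C (x \<odot> tensor_list C (xs @ ys)) (x \<odot> (tensor_list C xs \<odot> tensor_list C ys))"
      using tens_isomorphic[OF isomorphic_refl Cons.IH] False Cons.prems by simp
    also have "isomorphic C (x \<odot> (tensor_list C xs \<odot> tensor_list C ys)) ((x \<odot> tensor_list C xs) \<odot> tensor_list C ys)"
      by (intro isomorphic_sym[OF isomorphicI[of "Assoc C x (tensor_list C xs) (tensor_list C ys)"]]) (use Cons.prems in simp_all)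
    finally (isomorphic_trans) show ?thesis using False by (simp add: tensor_list_Cons)
  qed
qed simp

end

context pointed_crossed_category begin

section \<open>The homomorphism to the orthogonal group\<close>

abbreviation "OG \<equiv> orthogonal_group (neutral_component G B) p \<zeta>"

text \<open>\<open>orthogonal_group\<close> is \<open>BijGroup\<close> with a smaller carrier, so
  its group laws come from the subgroup property.\<close>

lemma orthogonal_subgroup:
  "subgroup {T \<in> auto (Inv (neutral_component G B)). \<forall>a\<in>A. qform (T a) = qform a} (BijGroup A)"
proof -
  note auto = A.subgroup_auto
  interpret Bij: group "BijGroup A" by (rule group_BijGroup)
  have Bij: "T \<in> Bij A" if "T \<in> auto (Inv (neutral_component G B))" for T using that unfolding auto_def by blast
  show ?thesis
  proof (rule subgroup.intro)
    fix S T assume ST: "S \<in> {T \<in> auto (Inv (neutral_component G B)). \<forall>a\<in>A. qform (T a) = qform a}"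
      "T \<in> {T \<in> auto (Inv (neutral_component G B)). \<forall>a\<in>A. qform (T a) = qform a}"
    then have "S \<otimes>\<^bsub>BijGroup A\<^esub> T \<in> auto (Inv (neutral_component G B))" using subgroup.m_closed[OF auto] by blast
    moreover have "S \<otimes>\<^bsub>BijGroup A\<^esub> T = compose A S T" using ST Bij by (simp add: BijGroup_def)
    moreover have "qform (compose A S T a) = qform a" if a: "a \<in> A" for a
      using ST a Bij_imp_funcset[OF Bij, of T] by (auto simp: compose_eq Pi_iff)
    ultimately show "S \<otimes>\<^bsub>BijGroup A\<^esub> T \<in> {T \<in> auto (Inv (neutral_component G B)). \<forall>a\<in>A. qform (T a) = qform a}" by simp
  next
    have "\<one>\<^bsub>BijGroup A\<^esub> = (\<lambda>a\<in>A. a)" by (simp add: BijGroup_def)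
    then show "\<one>\<^bsub>BijGroup A\<^esub> \<in> {T \<in> auto (Inv (neutral_component G B)). \<forall>a\<in>A. qform (T a) = qform a}"
      using subgroup.one_closed[OF auto] by simp
  next
    fix T assume T: "T \<in> {T \<in> auto (Inv (neutral_component G B)). \<forall>a\<in>A. qform (T a) = qform a}"
    then have i: "inv\<^bsub>BijGroup A\<^esub> T \<in> auto (Inv (neutral_component G B))" using subgroup.m_inv_closed[OF auto] by blast
    have TB: "T \<in> Bij A" using T Bij by blast
    have "qform ((inv\<^bsub>BijGroup A\<^esub> T) a) = qform a" if a: "a \<in> A" for a
    proof -
      let ?b = "(inv\<^bsub>BijGroup A\<^esub> T) a"
      have "?b = inv_into A T a" using inv_BijGroup[OF TB] a by simp
      moreover have "T ` A = A" using TB by (simp add: Bij_def bij_betw_def)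
      ultimately have "?b \<in> A" "T ?b = a" using a by (simp_all add: inv_into_into f_inv_into_f)
      then show ?thesis using T by force
    qed
    then show "inv\<^bsub>BijGroup A\<^esub> T \<in> {T \<in> auto (Inv (neutral_component G B)). \<forall>a\<in>A. qform (T a) = qform a}" using i by blast
  qed (use subgroup.subset[OF auto] in blast)
qed

sublocale OG: group OG
  unfolding orthogonal_group_def by (rule subgroup.subgroup_is_group[OF orthogonal_subgroup group_BijGroup])

lemma isometry_Bij: assumes g: "g \<in> carrier G" shows "isometry g \<in> Bij A"
proof -
  have i: "inv\<^bsub>G\<^esub> g \<in> carrier G" using g by simp
  have "bij_betw (act_class g) A A"
    by (rule bij_betw_byWitness[where f' = "act_class (inv\<^bsub>G\<^esub> g)"])
      (use act_class_inv[OF g] act_class_in[OF g] act_class_in[OF i] in auto)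
  then have "bij_betw (isometry g) A A" unfolding isometry_def using bij_betw_restrict_eq by blast
  then show ?thesis unfolding Bij_def isometry_def by simp
qed

lemma isometry_in: assumes g: "g \<in> carrier G" shows "isometry g \<in> carrier OG"
proof -
  have "isometry g \<in> hom (Inv (neutral_component G B)) (Inv (neutral_component G B))"
    unfolding isometry_def using act_class_in[OF g] act_class_hom[OF g] by (intro homI) simp_all
  then show ?thesis
    using isometry_Bij[OF g] act_class_in[OF g] quad_act[OF g] qform_eq_iff
    by (simp add: orthogonal_group_def auto_def) (simp add: isometry_def)
qed

lemma isometry_mult:
  assumes g: "g \<in> carrier G" and h: "h \<in> carrier G"
  shows "isometry (g \<otimes>\<^bsub>G\<^esub> h) = isometry g \<otimes>\<^bsub>OG\<^esub> isometry h"
proof -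
  have "isometry g \<otimes>\<^bsub>OG\<^esub> isometry h = compose A (isometry g) (isometry h)"
    using isometry_Bij g h by (simp add: orthogonal_group_def BijGroup_def)
  also have "\<dots> = isometry (g \<otimes>\<^bsub>G\<^esub> h)"
    unfolding compose_def isometry_def using act_class_comp[OF g h] act_class_in[OF h] by (intro restrict_ext) simp
  finally show ?thesis by simp
qed

lemma isometry_hom: "group_hom G OG isometry"
  using isometry_in isometry_mult OG.is_group is_group
  by (auto simp: group_hom_def group_hom_axioms_def intro!: homI)

lemma isometry_one: "isometry e = \<one>\<^bsub>OG\<^esub>"
  using group_hom.hom_one[OF isometry_hom] .

lemma isometry_inv: "g \<in> carrier G \<Longrightarrow> isometry (inv\<^bsub>G\<^esub> g) = inv\<^bsub>OG\<^esub> (isometry g)"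
  using group_hom.hom_inv[OF isometry_hom] .

text \<open>The quotient of two degrees with the same action acts trivially, so its component
  contains an invertible object. In both directions of the theorem, injectivity is thereby reduced
  to the question in which degrees invertible objects lie.\<close>

lemma isometry_eq_invertible:
  assumes g: "g \<in> carrier G" and h: "h \<in> carrier G" and eq: "\<And>a. a \<in> A \<Longrightarrow> act_class g a = act_class h a"
  obtains X where "X \<in> Grade B (g \<otimes>\<^bsub>G\<^esub> inv\<^bsub>G\<^esub> h)" "invertible_object B X"
proof -
  have ih: "inv\<^bsub>G\<^esub> h \<in> carrier G" using h by simp
  have "act_class (g \<otimes>\<^bsub>G\<^esub> inv\<^bsub>G\<^esub> h) a = a" if a: "a \<in> A" for a
    using act_class_comp[OF g ih a] eq[OF act_class_in[OF ih a]] act_class_inv(2)[OF h a] by simp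
  then show thesis using trivial_action_invertible[of "g \<otimes>\<^bsub>G\<^esub> inv\<^bsub>G\<^esub> h"] g ih that by blast
qed

lemma ratio_eq_one: "g \<in> carrier G \<Longrightarrow> h \<in> carrier G \<Longrightarrow> g \<otimes>\<^bsub>G\<^esub> inv\<^bsub>G\<^esub> h = e \<Longrightarrow> g = h"
  using inv_equality[of g "inv\<^bsub>G\<^esub> h"] by simp

lemma simple_generator_iff:
  assumes "simple_object B x" "g \<in> carrier G" "x \<in> Grade B g" shows "FPdim B x = sqrt (real p) \<longleftrightarrow> stab_order g = p"
  using FPdim_simple[OF assms(2,1,3)] by simp

section \<open>Tensor generation\<close>

abbreviation generators :: "'o set" where
  "generators \<equiv> {x. invertible_object B x} \<union> {x. simple_object B x \<and> FPdim B x = sqrt (real p)}"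

lemma generators_obj: "generators \<subseteq> Obj B"
  using invertible_obj simple_object_obj by blast

text \<open>A single non-zero product in the degree is enough, since translation by \<open>A\<close>
  supplies the simple objects. Non-vanishing must be recorded because zero objects lie in every
  degree.\<close>

definition reached :: "'g \<Rightarrow> bool" where
  "reached g \<longleftrightarrow> g \<in> carrier G \<and> (\<exists>xs. xs \<noteq> [] \<and> set xs \<subseteq> generators \<and> tensor_list B xs \<in> Grade B g \<and> \<not> zero_object B (tensor_list B xs))"

lemma reached_one: "reached e"
  unfolding reached_def
  using invertible_unit unit_grade simple_not_zero[OF unit_simple] by (intro conjI exI[of _ "[Unit B]"]) simp_all

lemma reached_stab_order: assumes g: "g \<in> carrier G" and s: "stab_order g = p" shows "reached g"
proof -
  note x = component_simple[OF g]
  show ?thesis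
    unfolding reached_def
    using g x simple_generator_iff[OF x(1) g x(2)] s simple_not_zero[OF x(1)]
    by (intro conjI exI[of _ "[component_simple g]"]) simp_all
qed

lemma reached_mult: assumes "reached g" "reached h" shows "reached (g \<otimes>\<^bsub>G\<^esub> h)"
proof -
  obtain xs where g: "g \<in> carrier G" and xs: "xs \<noteq> []" "set xs \<subseteq> generators" "tensor_list B xs \<in> Grade B g" "\<not> zero_object B (tensor_list B xs)"
    using assms(1) unfolding reached_def by blast
  obtain ys where h: "h \<in> carrier G" and ys: "ys \<noteq> []" "set ys \<subseteq> generators" "tensor_list B ys \<in> Grade B h" "\<not> zero_object B (tensor_list B ys)"
    using assms(2) unfolding reached_def by blast
  have gh: "g \<otimes>\<^bsub>G\<^esub> h \<in> carrier G" using g h by simp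
  have i: "isomorphic B (tensor_list B (xs @ ys)) (tensor_list B xs \<odot> tensor_list B ys)"
    using tensor_list_append xs ys generators_obj by blast
  have 1: "tensor_list B xs \<odot> tensor_list B ys \<in> Grade B (g \<otimes>\<^bsub>G\<^esub> h)" using grade_tensor[OF g h xs(3) ys(3)] .
  have 2: "\<not> zero_object B (tensor_list B xs \<odot> tensor_list B ys)" using tens_not_zero[OF g h xs(3) ys(3) xs(4) ys(4)] .
  have 3: "tensor_list B (xs @ ys) \<in> Grade B (g \<otimes>\<^bsub>G\<^esub> h)" using grade_replete[OF gh 1 isomorphic_sym[OF i]] .
  moreover have "\<not> zero_object B (tensor_list B (xs @ ys))" using 2 i zero_object_iso by blast
  ultimately show ?thesis
    unfolding reached_def using gh xs ys by (intro conjI exI[of _ "xs @ ys"]) simp_all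
qed

text \<open>Some translate of the product contains the given simple object, and the translating
  invertible object is itself a generator, put in front of the list.\<close>

lemma reached_tensor_generated:
  assumes "\<And>g. g \<in> carrier G \<Longrightarrow> reached g" shows "tensor_generated_by B generators"
  unfolding tensor_generated_by_def
proof (intro allI impI)
  fix y assume y: "simple_object B y"
  obtain g where g: "g \<in> carrier G" "y \<in> Grade B g" using simple_homogeneous[OF y] .
  obtain xs where xs: "xs \<noteq> []" "set xs \<subseteq> generators" "tensor_list B xs \<in> Grade B g" "\<not> zero_object B (tensor_list B xs)"
    using assms[OF g(1)] unfolding reached_def by blast
  let ?W = "tensor_list B xs"
  have W: "?W \<in> Obj B" using grade_obj' g xs by blast
  have "(\<Sum>a\<in>A. hom_dim B y (rep a \<odot> ?W)) \<noteq> 0"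
    using sum_hom_act'[OF g(1) y g(2) xs(3)] stab_order_pos[OF g(1)] len_zero_iff[OF W] xs(4) by simp
  then obtain a where a: "a \<in> A" "hom_dim B y (rep a \<odot> ?W) > 0" using sum.neutral by (metis (no_types, lifting) neq0_conv)
  have "rep a \<odot> ?W = tensor_list B (rep a # xs)" using xs(1) by (simp add: tensor_list_Cons)
  then obtain f where f: "f \<in> Hom B y (tensor_list B (rep a # xs))" "f \<noteq> Null B y (tensor_list B (rep a # xs))"
    using hom_dim_pos_iff[of y "rep a \<odot> ?W"] a(2) simple_object_obj[OF y] W rep_obj[OF a(1)] by (metis tens_obj)
  have "monic B f" by (rule simple_source_monic[OF y f])
  then show "\<exists>xs. xs \<noteq> [] \<and> set xs \<subseteq> generators \<and> (\<exists>f\<in>Hom B y (tensor_list B xs). monic B f)"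
    using f(1) rep(2)[OF a(1)] xs(2) by (intro exI[of _ "rep a # xs"]) auto
qed

text \<open>Injectivity first confines the invertible objects to degree \<open>e\<close>; this in
  turn makes the isometries separate group elements, so that a word in reflections can be read as a
  word in the elements of \<open>G\<close> that act by them.\<close>

lemma reflection_group_imp_fusion:
  assumes "reflection_group_in_Pic p \<zeta> G B"
  shows "carrier (Inv B) = A" "tensor_generated_by B generators"
proof -
  obtain S where inj: "inj_on (\<lambda>g. module_class (neutral_component G B) (M g)) (carrier G)"
    and S: "S \<subseteq> reflections (neutral_component G B) p \<zeta>"
    and img: "isometry ` carrier G = generate OG S"
    using assms pic_isometry_component unfolding reflection_group_in_Pic_def isometry_def by auto
  have neutral: "g = e" if "g \<in> carrier G" "X \<in> Grade B g" "invertible_object B X" for g X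
    using inj_onD[OF inj invertible_module_class[OF that]] that(1) by simp
  show "carrier (Inv B) = A"
  proof (intro equalityI subsetI)
    fix a assume "a \<in> carrier (Inv B)"
    then obtain X where X: "invertible_object B X" "a = iso_class B X" unfolding Inv_def by auto
    obtain g where "g \<in> carrier G" "X \<in> Grade B g" using simple_homogeneous[OF invertible_simple[OF X(1)]] .
    then show "a \<in> A" using neutral X A_mem_iff by blast
  next
    fix a assume "a \<in> A" then show "a \<in> carrier (Inv B)" unfolding A_mem_iff unfolding Inv_def by auto
  qed
  \<comment> \<open>Injectivity was given for module classes; equal isometries put an invertible
    object into the quotient degree, which must then be \<open>e\<close>.\<close>
  have P_inj: "g = h" if gh: "g \<in> carrier G" "h \<in> carrier G" and eq: "isometry g = isometry h" for g h
  proof -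
    have "act_class g a = act_class h a" if "a \<in> A" for a using fun_cong[OF eq, of a] that unfolding isometry_def by simp
    then obtain X where "X \<in> Grade B (g \<otimes>\<^bsub>G\<^esub> inv\<^bsub>G\<^esub> h)" "invertible_object B X" using isometry_eq_invertible[OF gh] by blast
    then have "g \<otimes>\<^bsub>G\<^esub> inv\<^bsub>G\<^esub> h = e" using neutral gh by blast
    then show ?thesis by (rule ratio_eq_one[OF gh])
  qed
  have refl_order: "stab_order g = p" if "g \<in> carrier G" "isometry g \<in> S" for g
    using that S reflection_stab_order unfolding reflections_def by blast
  have "reached g" if T: "T \<in> generate OG S" and g: "g \<in> carrier G" "isometry g = T" for T g
    using T g
  proof (induction arbitrary: g rule: generate.induct)
    case one
    then have "g = e" using P_inj isometry_one by simp
    then show ?case using reached_one by simp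
  next
    case (incl T)
    then show ?case using refl_order reached_stab_order by blast
  next
    case (inv T)
    \<comment> \<open>\<open>generate\<close> also admits inverses of its letters; the corresponding
      degree has the same stabilizer order by \<open>stab_order_inv\<close>.\<close>
    have "T \<in> isometry ` carrier G" unfolding img using inv(1) by (rule generate.incl)
    then obtain h where h: "h \<in> carrier G" "T = isometry h" by blast
    then have "isometry g = isometry (inv\<^bsub>G\<^esub> h)" using inv isometry_inv by simp
    then have "g = inv\<^bsub>G\<^esub> h" using P_inj inv h by simp
    then have "stab_order g = p" using stab_order_inv[OF h(1)] refl_order[OF h(1)] h inv by simp
    then show ?case using reached_stab_order inv by blast
  next
    case (eng T1 T2)
    obtain g1 where g1: "g1 \<in> carrier G" "T1 = isometry g1" using eng(1) unfolding img[symmetric] by blast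
    obtain g2 where g2: "g2 \<in> carrier G" "T2 = isometry g2" using eng(2) unfolding img[symmetric] by blast
    have "g = g1 \<otimes>\<^bsub>G\<^esub> g2" using P_inj eng g1 g2 isometry_mult by simp
    then show ?case using reached_mult eng(3,4) g1 g2 by simp
  qed
  then have "reached g" if "g \<in> carrier G" for g using that img by blast
  then show "tensor_generated_by B generators" by (rule reached_tensor_generated)
qed

text \<open>A generator has degree \<open>e\<close>, if invertible, or a degree of stabilizer order
  \<open>p\<close>, which acts by a reflection. Every simple object embeds into a product of
  generators and therefore has the product of their degrees.\<close>

lemma fusion_imp_reflection_group:
  assumes Inv: "carrier (Inv B) = A" and gen: "tensor_generated_by B generators"
  shows "reflection_group_in_Pic p \<zeta> G B"
proof -
  have neutral: "g = e" if g: "g \<in> carrier G" and X: "X \<in> Grade B g" "invertible_object B X" for g X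
  proof -
    have "iso_class B X \<in> carrier (Inv B)" using X unfolding Inv_def by simp
    then obtain Y where Y: "Y \<in> Grade B e" "invertible_object B Y" "iso_class B X = iso_class B Y" unfolding Inv A_mem_iff by blast
    then have "isomorphic B Y X" using iso_class_eq_iff invertible_obj X(2) by metis
    then have "X \<in> Grade B e" using grade_replete[OF e_carrier Y(1)] by blast
    then show "g = e" using grade_unique[OF g e_carrier X(1)] simple_not_zero[OF invertible_simple[OF X(2)]] by blast
  qed
  have inj: "inj_on (\<lambda>g. module_class (neutral_component G B) (M g)) (carrier G)"
  proof (rule inj_onI)
    fix g h assume gh: "g \<in> carrier G" "h \<in> carrier G"
      and eq: "module_class (neutral_component G B) (M g) = module_class (neutral_component G B) (M h)"
    \<comment> \<open>Reflexivity, obtained by tensoring with the unit on the right.\<close>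
    have "module_equivalent (neutral_component G B) (M h) (M h)"
      using right_tensor_module_equivalence[OF gh(2) e_carrier unit_grade invertible_unit] gh by simp
    then have "M h \<in> module_class (neutral_component G B) (M h)"
      unfolding module_class_def using module_component_category[OF gh(2)] by blast
    then have "M h \<in> module_class (neutral_component G B) (M g)" unfolding eq .
    then have "module_equivalent (neutral_component G B) (M g) (M h)" unfolding module_class_def by blast
    then have "act_class g a = act_class h a" if "a \<in> A" for a using module_equivalent_act_class[OF gh that] by blast
    then obtain X where "X \<in> Grade B (g \<otimes>\<^bsub>G\<^esub> inv\<^bsub>G\<^esub> h)" "invertible_object B X" using isometry_eq_invertible[OF gh] by blast
    then have "g \<otimes>\<^bsub>G\<^esub> inv\<^bsub>G\<^esub> h = e" using neutral gh by blast
    then show "g = h" by (rule ratio_eq_one[OF gh])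
  qed
  define S where "S = {isometry g | g. g \<in> carrier G \<and> stab_order g = p}"
  have S: "S \<subseteq> reflections (neutral_component G B) p \<zeta>" unfolding S_def using stab_order_reflection by blast
  \<comment> \<open>Only some degree of the product is claimed here; that it is the degree of
    \<open>y\<close> follows below from a non-zero arrow.\<close>
  have list: "\<exists>h. h \<in> carrier G \<and> tensor_list B xs \<in> Grade B h \<and> isometry h \<in> generate OG S"
    if "set xs \<subseteq> generators" for xs
    using that
  proof (induction xs)
    case Nil
    show ?case using unit_grade e_carrier isometry_one generate.one[of OG S] by (intro exI[of _ e]) simp
  next
    case (Cons x xs)
    have x: "simple_object B x" using Cons.prems invertible_simple by auto
    obtain h where h: "h \<in> carrier G" "x \<in> Grade B h" using simple_homogeneous[OF x] .
    have hS: "isometry h \<in> generate OG S"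
    proof (cases "invertible_object B x")
      case True
      then have "h = e" using neutral h by blast
      then show ?thesis using isometry_one generate.one by simp
    next
      case False
      then have "stab_order h = p" using Cons.prems simple_generator_iff[OF x h] by simp
      then show ?thesis unfolding S_def using h by (intro generate.incl) blast
    qed
    show ?case
    proof (cases "xs = []")
      case False
      obtain h' where h': "h' \<in> carrier G" "tensor_list B xs \<in> Grade B h'" "isometry h' \<in> generate OG S"
        using Cons by auto
      then show ?thesis
        using h hS generate.eng[of "isometry h" OG S "isometry h'"] grade_tensor[OF h(1) h'(1) h(2) h'(2)] isometry_mult
          tensor_list_Cons[OF False]
        by (intro exI[of _ "h \<otimes>\<^bsub>G\<^esub> h'"]) simp
    qed (use h hS in auto)
  qed
  have "isometry ` carrier G = generate OG S"
  proof (intro equalityI subsetI)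
    fix T assume "T \<in> isometry ` carrier G"
    then obtain g where g: "g \<in> carrier G" "T = isometry g" by blast
    obtain y where y: "simple_object B y" "y \<in> Grade B g" using exists_simple[OF g(1)] .
    note yo = simple_object_obj[OF y(1)]
    obtain xs f where xs: "set xs \<subseteq> generators" and f: "f \<in> Hom B y (tensor_list B xs)" "monic B f"
      using gen y unfolding tensor_generated_by_def by blast
    obtain h where h: "h \<in> carrier G" "tensor_list B xs \<in> Grade B h" "isometry h \<in> generate OG S" using list[OF xs] by blast
    \<comment> \<open>A null arrow does not distinguish \<open>Id B y\<close> from
      \<open>Null B y y\<close>, so a monic arrow out of a non-zero object is not null.\<close>
    have "f \<noteq> Null B y (tensor_list B xs)"
    proof
      assume null: "f = Null B y (tensor_list B xs)"
      have "f \<cdot> Id B y = f" using f(1) by (auto simp: Hom_iff)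
      also have "\<dots> = f \<cdot> Null B y y" unfolding comp_null[OF f(1) yo] by (rule null)
      finally have eq: "f \<cdot> Id B y = f \<cdot> Null B y y" .
      have "Dom B f = y" using f(1) by (simp add: Hom_iff)
      then have "Id B y = Null B y y"
        using f(2) eq id_in_Hom[OF yo] null_in_Hom[OF yo yo] unfolding monic_def by blast
      then show False using simple_not_zero[OF y(1)] zero_object_iff yo by blast
    qed
    then have "hom_dim B y (tensor_list B xs) > 0" using hom_dim_pos_iff[OF yo Hom_obj(2)[OF f(1)]] f(1) by blast
    then have "g = h" using grade_hom[OF g(1) h(1) y(2) h(2)] by blast
    then show "T \<in> generate OG S" using g h by blast
  next
    fix T assume "T \<in> generate OG S"
    then show "T \<in> isometry ` carrier G"
    proof (induction rule: generate.induct)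
      case one
      then show ?case using isometry_one e_carrier by (metis image_eqI)
    next
      case (incl T)
      then show ?case unfolding S_def by blast
    next
      case (inv T)
      then obtain g where "g \<in> carrier G" "T = isometry g" unfolding S_def by blast
      then show ?case using isometry_inv by (metis image_eqI inv_closed)
    next
      case (eng T1 T2)
      then obtain g h where "g \<in> carrier G" "T1 = isometry g" "h \<in> carrier G" "T2 = isometry h" by blast
      then show ?case using isometry_mult by (metis image_eqI m_closed)
    qed
  qed
  moreover have "(\<lambda>g. pic_isometry (neutral_component G B) (M g)) ` carrier G = isometry ` carrier G"
    using pic_isometry_component unfolding isometry_def by auto
  ultimately show ?thesis unfolding reflection_group_in_Pic_def using inj S by auto
qed

end

theorem theorem4p3:
  fixes p :: nat
    and \<zeta> :: "'k::{alg_closed_field, field_char_0}"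
    and G :: "'g monoid"
    and B :: "('g, 'o, 'm, 'k) crossedcat"
  assumes "prime p" and "odd p"
    and "primitive_root_of_unity p \<zeta>"
    and "group G" and "finite (carrier G)"
    and "G_crossed_fusion_category G B"
    and "braided_fusion_category (neutral_component G B)"
    and "nondegenerate (neutral_component G B)"
    and "pointed (neutral_component G B)"
    and "elementary_abelian_group p (Inv (neutral_component G B))"
  shows "reflection_group_in_Pic p \<zeta> G B \<longleftrightarrow> reflection_fusion_category p G B"
proof -
  interpret pointed_crossed_category G B p \<zeta>
    using assms by (intro pointed_crossed_category.intro pointed_crossed_category_axioms.intro)
  show ?thesis
    using reflection_group_imp_fusion fusion_imp_reflection_group assms(6-10)
    unfolding reflection_fusion_category_def by blast
qed

end
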